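(* Let $p$ be a prime and $n$ a positive integer, with $n \geq 2$ when $p = 2$, and let $k$ be a positive integer. Let $G = \mathbb{Z}/p^n\mathbb{Z}$ and let $\Gamma = \mathbb{F}_p[G]^k \rtimes G$, where $G$ acts on $\mathbb{F}_p[G]^k$ by multiplication in each coordinate. Then $$\nu(\Gamma) \geq p^k.$$
   Context: For a finite group $H$ and a field $F$, an $H$-extension of $F$ is a Galois extension $K/F$ with $\mathrm{Gal}(K/F) \simeq H$. Write $\nu(H,F)$ for the number of distinct $H$-extensions of $F$ inside a fixed algebraic (separable) closure of $F$, and $\mathfrak{F}(H)$ for the set of fields $F$ with $\nu(H,F) \geq 1$. The realization multiplicity of $H$ is $\nu(H) = \min_{F \in \mathfrak{F}(H)} \nu(H,F)$. *)

theory Defs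
  imports
    "HOL-Algebra.Algebraic_Closure"
    "HOL-Algebra.Bij"
    "HOL-Algebra.Elementary_Groups"
    "HOL-Algebra.Product_Groups"
    "HOL-Number_Theory.Residues"
    "HOL-Library.Extended_Nat"
begin

section \<open>Galois extensions and realization multiplicity\<close>

text \<open>Field extensions are pairs of subfields \<open>F \<subseteq> K\<close> of an ambient field \<open>L\<close>. As in
  \<^const>\<open>BijGroup\<close>, automorphisms of \<open>K\<close> are extensional functions, so that each one is
  represented by exactly one HOL function.\<close>

definition Gal :: "('a, 'b) ring_scheme \<Rightarrow> 'a set \<Rightarrow> 'a set \<Rightarrow> ('a \<Rightarrow> 'a) monoid" where
  "Gal L K F = BijGroup K \<lparr>carrier :=
     {\<sigma> \<in> Bij K. \<sigma> \<in> ring_hom (L\<lparr>carrier := K\<rparr>) (L\<lparr>carrier := K\<rparr>) \<and> (\<forall>x\<in>F. \<sigma> x = x)}\<rparr>"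

text \<open>\<open>K/F\<close> is Galois if it is algebraic and \<open>F\<close> is the fixed field of the group of all
  \<open>F\<close>-automorphisms of \<open>K\<close>.\<close>

definition galois_extension :: "('a, 'b) ring_scheme \<Rightarrow> 'a set \<Rightarrow> 'a set \<Rightarrow> bool" where
  "galois_extension L K F \<longleftrightarrow>
     subfield F L \<and> subfield K L \<and> F \<subseteq> K \<and>
     (\<forall>x\<in>K. (ring.algebraic L over F) x) \<and>
     {x \<in> K. \<forall>\<sigma> \<in> carrier (Gal L K F). \<sigma> x = x} = F"

definition group_extensions ::
    "('h, 'm) monoid_scheme \<Rightarrow> ('a, 'b) ring_scheme \<Rightarrow> 'a set \<Rightarrow> 'a set set" where
  "group_extensions H L F = {K. galois_extension L K F \<and> Gal L K F \<cong> H}"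

definition ecard :: "'a set \<Rightarrow> enat" where
  "ecard A = (if finite A then enat (card A) else \<infinity>)"

text \<open>\<open>\<nu>(H, F)\<close>: the fixed algebraic closure is the library's \<^const>\<open>field.alg_closure\<close>, in which
  \<open>F\<close> sits as the image of \<^const>\<open>ring.indexed_const\<close>.\<close>

definition realization_count :: "('h, 'm) monoid_scheme \<Rightarrow> 'a ring \<Rightarrow> enat" where
  "realization_count H F =
     ecard (group_extensions H (field.alg_closure F) (ring.indexed_const F ` carrier F))"

definition realizing_fields :: "('h, 'm) monoid_scheme \<Rightarrow> 'a ring set" where
  "realizing_fields H = {F. field F \<and> realization_count H F \<ge> 1}"

text \<open>\<open>\<nu>(H)\<close>, taken over the fields whose carrier is a subset of the type \<open>'a\<close>: HOL has no
  collection of all fields, so a statement about \<open>\<nu>(H)\<close> has to be made for every type \<open>'a\<close>.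
  The infimum of a nonempty set of \<^typ>\<open>enat\<close> is its minimum. It is \<open>\<infinity>\<close> if \<open>H\<close> is not
  realizable over any field living on \<open>'a\<close>, so that such a type does not affect lower bounds
  on \<open>\<nu>(H)\<close>.\<close>

definition realization_multiplicity :: "'a itself \<Rightarrow> ('h, 'm) monoid_scheme \<Rightarrow> enat" where
  "realization_multiplicity _ H =
     (INF F \<in> (realizing_fields H :: 'a ring set). realization_count H F)"


section \<open>The semidirect product \<open>\<Gamma>\<close>\<close>

text \<open>The group ring \<open>R[G]\<close> of a finite group \<open>G\<close>; the function \<open>a\<close> stands for the formal
  sum of all \<open>a g \<cdot> g\<close>.\<close>

definition group_ring ::
    "('r, 's) ring_scheme \<Rightarrow> ('g, 'm) monoid_scheme \<Rightarrow> ('g \<Rightarrow> 'r) ring" where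
  "group_ring R G =
     \<lparr>carrier = carrier G \<rightarrow>\<^sub>E carrier R,
      monoid.mult = (\<lambda>a b. \<lambda>g\<in>carrier G.
        \<Oplus>\<^bsub>R\<^esub>h\<in>carrier G. a h \<otimes>\<^bsub>R\<^esub> b (inv\<^bsub>G\<^esub> h \<otimes>\<^bsub>G\<^esub> g)),
      one = (\<lambda>g\<in>carrier G. if g = \<one>\<^bsub>G\<^esub> then \<one>\<^bsub>R\<^esub> else \<zero>\<^bsub>R\<^esub>),
      zero = (\<lambda>g\<in>carrier G. \<zero>\<^bsub>R\<^esub>),
      add = (\<lambda>a b. \<lambda>g\<in>carrier G. a g \<oplus>\<^bsub>R\<^esub> b g)\<rparr>"

definition group_ring_of ::
    "('r, 's) ring_scheme \<Rightarrow> ('g, 'm) monoid_scheme \<Rightarrow> 'g \<Rightarrow> ('g \<Rightarrow> 'r)" where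
  "group_ring_of R G g = (\<lambda>h\<in>carrier G. if h = g then \<one>\<^bsub>R\<^esub> else \<zero>\<^bsub>R\<^esub>)"

definition semidirect_product ::
    "('n, 'a) monoid_scheme \<Rightarrow> ('h, 'b) monoid_scheme \<Rightarrow> ('h \<Rightarrow> 'n \<Rightarrow> 'n) \<Rightarrow> ('n \<times> 'h) monoid" where
  "semidirect_product N H \<phi> =
     \<lparr>carrier = carrier N \<times> carrier H,
      monoid.mult = (\<lambda>(a, g) (b, h). (a \<otimes>\<^bsub>N\<^esub> \<phi> g b, g \<otimes>\<^bsub>H\<^esub> h)),
      one = (\<one>\<^bsub>N\<^esub>, \<one>\<^bsub>H\<^esub>)\<rparr>"

definition free_semidirect ::
    "('r, 's) ring_scheme \<Rightarrow> ('g, 'm) monoid_scheme \<Rightarrow> nat \<Rightarrow> ((nat \<Rightarrow> 'g \<Rightarrow> 'r) \<times> 'g) monoid" where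
  "free_semidirect R G k =
     semidirect_product
       (product_group {..<k} (\<lambda>_. add_monoid (group_ring R G)))
       G
       (\<lambda>g v. \<lambda>i\<in>{..<k}. group_ring_of R G g \<otimes>\<^bsub>group_ring R G\<^esub> v i)"

end

theory Submission
  imports Defs
begin

text \<open>Let \<open>M\<close> be one \<open>\<Gamma>\<close>-extension of \<open>F\<close> and \<open>E \<subseteq> M\<close> its cyclic subextension of degree \<open>p\<^sup>n\<close>,
  and write \<open>V\<close> for the free module on which \<open>G\<close> acts.  Suppose that a character \<open>\<psi>\<close> of the absolute
  Galois group of \<open>E\<close> with values in \<open>\<int>/p\<close> is \<open>G\<close>-invariant but does not factor through
  \<open>Gal(M/E) = V\<close>.  Induction turns \<open>\<psi>\<close> into a cocycle with values in the group ring, and adding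
  \<open>c\<^sub>i\<close> times this cocycle to the \<open>i\<close>-th coordinate of the surjection onto \<open>\<Gamma>\<close>, for
  \<open>c \<in> (\<int>/p)\<^sup>k\<close>, gives \<open>p\<^sup>k\<close> surjections with distinct kernels.

  To find \<open>\<psi>\<close>, adjoin a primitive \<open>p\<close>-th root of unity \<open>\<zeta>\<close>, of degree prime to \<open>p\<close>, and use Kummer
  theory, or Artin-Schreier theory in characteristic \<open>p\<close>.  If there were no \<open>\<psi>\<close>, the cohomological
  triviality of the dual of \<open>V\<close> would force every character of \<open>E\<close> to factor through \<open>V\<close>.  But
  \<open>\<zeta>\<close> is the norm of some \<open>\<delta>\<close> from \<open>E(\<zeta>)\<close> to its subfield of index \<open>p\<close>; here the case
  \<open>p\<^sup>n = 2\<close> has to be excluded.  By Hilbert 90, \<open>\<delta>\<^sup>p = \<tau>(b)/b\<close> with \<open>\<tau>\<close> of order \<open>p\<close>.  If the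
  projection of \<open>b\<close> to the cyclotomic eigenspace became a \<open>p\<close>-th power in \<open>M(\<zeta>)\<close>, taking norms
  would give \<open>\<zeta>\<^sup>d = 1\<close> with \<open>d\<close> prime to \<open>p\<close>.\<close>

section \<open>The semidirect product\<close>

text \<open>That \<open>\<zeta>\<close> is a norm is no general fact. It follows from the assumption
  that no \<open>\<psi>\<close> exists, which makes \<open>\<zeta>\<close> itself a
  \<open>p\<close>-th power in \<open>M(\<zeta>)\<close>; the computation leaves a factor
  \<open>\<zeta>\<close> raised to \<open>j p^(n-1) (0 + ... + (p-1))\<close>. This factor is 1
  unless \<open>p^n = 2\<close>, when it can be -1. In characteristic \<open>p\<close> the norm is a
  trace, which takes the value 1 anyway.

  The absolute Galois group never appears: one root \<open>\<beta>\<close> is adjoined to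
  \<open>M(\<zeta>)\<close>, and \<open>\<psi>\<close> is read off from the action on
  \<open>\<beta>\<close>. Since conjugation also moves \<open>\<zeta>\<close>, \<open>\<psi>\<close>
  is invariant when the group acts on the class of \<open>b = \<pi> \<beta>\<close> not trivially
  but through the cyclotomic character \<open>w\<close>. This is why eigenspaces enter.

  That \<open>w\<close> has its values in \<open>1, ..., p-1\<close> is used three times: the
  elements of the \<open>p\<close>-group \<open>\<Gamma>\<close> lift to automorphisms fixing
  \<open>\<zeta>\<close>; the exponent \<open>d\<close> of the overview is prime to
  \<open>p\<close>; and the fibres over which the cocycle is summed have sizes prime to
  \<open>p\<close>.\<close>

locale gamma_params =
  fixes p q k :: nat
  assumes p_gt_1: "1 < p" and q_gt_1: "1 < q"
begin

definition V :: "(nat \<Rightarrow> int \<Rightarrow> int) monoid" where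
  "V = product_group {..<k} (\<lambda>_. add_monoid (group_ring (residue_ring (int p)) (integer_mod_group q)))"

text \<open>Multiplication by the group element \<open>g\<close> in every coordinate of the group
  ring. Letting \<open>g\<close> be any integer, reduced only in the index, allows negative shifts
  without normalising them.\<close>

definition shift :: "int \<Rightarrow> (nat \<Rightarrow> int \<Rightarrow> int) \<Rightarrow> nat \<Rightarrow> int \<Rightarrow> int" where
  "shift g v = (\<lambda>i\<in>{..<k}. \<lambda>x\<in>{0..<int q}. v i ((x - g) mod int q))"

abbreviation \<Gamma> where
  "\<Gamma> \<equiv> free_semidirect (residue_ring (int p)) (integer_mod_group q) k"

lemma carrier_V: "carrier V = {..<k} \<rightarrow>\<^sub>E ({0..<int q} \<rightarrow>\<^sub>E {0..<int p})"
proof -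
  have "{0..int p - 1} = {0..<int p}" by auto
  then show ?thesis
    using q_gt_1 by (simp add: V_def group_ring_def carrier_integer_mod_group residue_ring_def)
qed

lemma one_V: "\<one>\<^bsub>V\<^esub> = (\<lambda>i\<in>{..<k}. \<lambda>x\<in>{0..<int q}. 0)"
  using q_gt_1 by (simp add: V_def group_ring_def carrier_integer_mod_group residue_ring_def)

lemma mult_V: "a \<otimes>\<^bsub>V\<^esub> b = (\<lambda>i\<in>{..<k}. \<lambda>x\<in>{0..<int q}. (a i x + b i x) mod int p)"
  using q_gt_1 by (simp add: V_def group_ring_def carrier_integer_mod_group residue_ring_def)

lemma in_V_iff:
  "v \<in> carrier V \<longleftrightarrow> v \<in> extensional {..<k} \<and>
     (\<forall>i<k. v i \<in> extensional {0..<int q} \<and> (\<forall>x. 0 \<le> x \<longrightarrow> x < int q \<longrightarrow> 0 \<le> v i x \<and> v i x < int p))"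
  unfolding carrier_V by (auto simp: PiE_iff)

lemma V_eqI:
  assumes "a \<in> carrier V" "b \<in> carrier V"
    and "\<And>i x. i < k \<Longrightarrow> 0 \<le> x \<Longrightarrow> x < int q \<Longrightarrow> a i x = b i x"
  shows "a = b"
proof (rule extensionalityI[of _ "{..<k}"])
  fix i assume "i \<in> {..<k}"
  then show "a i = b i"
    using assms by (intro extensionalityI[of _ "{0..<int q}"]) (auto simp: in_V_iff)
qed (use assms in \<open>auto simp: in_V_iff\<close>)

lemma V_entry: "v \<in> carrier V \<Longrightarrow> i < k \<Longrightarrow> 0 \<le> x \<Longrightarrow> x < int q \<Longrightarrow> 0 \<le> v i x \<and> v i x < int p"
  by (simp add: in_V_iff)

lemma V_memI:
  "(\<And>i x. i < k \<Longrightarrow> 0 \<le> x \<Longrightarrow> x < int q \<Longrightarrow> 0 \<le> f i x \<and> f i x < int p) \<Longrightarrow>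
   (\<lambda>i\<in>{..<k}. \<lambda>x\<in>{0..<int q}. f i x) \<in> carrier V"
  by (auto simp: in_V_iff)

lemma V_entry_mod: "v \<in> carrier V \<Longrightarrow> i < k \<Longrightarrow> 0 \<le> x \<Longrightarrow> x < int q \<Longrightarrow> v i x mod int p = v i x"
  using V_entry by simp

lemma V_mult_entry: "i < k \<Longrightarrow> 0 \<le> x \<Longrightarrow> x < int q \<Longrightarrow> (a \<otimes>\<^bsub>V\<^esub> b) i x = (a i x + b i x) mod int p"
  by (simp add: mult_V)

lemma V_one_entry: "i < k \<Longrightarrow> 0 \<le> x \<Longrightarrow> x < int q \<Longrightarrow> \<one>\<^bsub>V\<^esub> i x = 0"
  by (simp add: one_V)

lemma V_mult_closed: "a \<otimes>\<^bsub>V\<^esub> b \<in> carrier V"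
  unfolding mult_V using p_gt_1 by (intro V_memI) auto

lemma V_one_closed: "\<one>\<^bsub>V\<^esub> \<in> carrier V"
  unfolding one_V using p_gt_1 by (intro V_memI) auto

lemma comm_group_V: "comm_group V"
proof (rule comm_groupI)
  show "\<exists>b\<in>carrier V. b \<otimes>\<^bsub>V\<^esub> a = \<one>\<^bsub>V\<^esub>" if "a \<in> carrier V" for a
  proof
    show m: "(\<lambda>i\<in>{..<k}. \<lambda>x\<in>{0..<int q}. (- a i x) mod int p) \<in> carrier V"
      using p_gt_1 by (intro V_memI) auto
    show "(\<lambda>i\<in>{..<k}. \<lambda>x\<in>{0..<int q}. (- a i x) mod int p) \<otimes>\<^bsub>V\<^esub> a = \<one>\<^bsub>V\<^esub>"
      by (intro V_eqI V_mult_closed V_one_closed) (auto simp: V_mult_entry V_one_entry mod_simps)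
  qed
  show "x \<otimes>\<^bsub>V\<^esub> y \<otimes>\<^bsub>V\<^esub> z = x \<otimes>\<^bsub>V\<^esub> (y \<otimes>\<^bsub>V\<^esub> z)" for x y z
    by (intro V_eqI V_mult_closed) (auto simp: V_mult_entry mod_simps add_ac)
  show "x \<otimes>\<^bsub>V\<^esub> y = y \<otimes>\<^bsub>V\<^esub> x" for x y
    by (intro V_eqI V_mult_closed) (auto simp: V_mult_entry add_ac)
  show "\<one>\<^bsub>V\<^esub> \<otimes>\<^bsub>V\<^esub> x = x" if "x \<in> carrier V" for x
    using that by (intro V_eqI V_mult_closed) (auto simp: V_mult_entry V_one_entry V_entry_mod)
qed (auto intro: V_one_closed V_mult_closed)

sublocale V: comm_group V by (rule comm_group_V)

lemma shift_closed: "v \<in> carrier V \<Longrightarrow> shift g v \<in> carrier V"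
  unfolding shift_def using q_gt_1 by (intro V_memI V_entry) auto

lemma shift_entry: "i < k \<Longrightarrow> 0 \<le> x \<Longrightarrow> x < int q \<Longrightarrow> shift g v i x = v i ((x - g) mod int q)"
  by (simp add: shift_def)

lemma shift_mult:
  assumes "a \<in> carrier V" "b \<in> carrier V"
  shows "shift g (a \<otimes>\<^bsub>V\<^esub> b) = shift g a \<otimes>\<^bsub>V\<^esub> shift g b"
  using assms q_gt_1 by (intro V_eqI V_mult_closed shift_closed) (auto simp: V_mult_entry shift_entry)

lemma shift_shift: "v \<in> carrier V \<Longrightarrow> shift g (shift h v) = shift (g + h) v"
  using q_gt_1 by (intro V_eqI shift_closed) (auto simp: shift_entry mod_simps algebra_simps)

lemma shift_mod: "shift (g mod int q) v = shift g v"
  unfolding shift_def by (auto simp: mod_simps intro!: restrict_ext)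

lemma shift_0: "v \<in> carrier V \<Longrightarrow> shift 0 v = v"
  by (intro V_eqI shift_closed) (auto simp: shift_entry)

lemma shift_one: "shift g \<one>\<^bsub>V\<^esub> = \<one>\<^bsub>V\<^esub>"
  using q_gt_1 by (intro V_eqI shift_closed) (auto simp: shift_entry V_one_entry)

text \<open>Convolution with the indicator function of \<open>g\<close> leaves the single summand
  \<open>h = g\<close>; so the action in \<open>free_semidirect\<close> is
  \<open>shift\<close>.\<close>

lemma group_ring_of_mult:
  assumes "v \<in> {0..<int q} \<rightarrow>\<^sub>E {0..<int p}" "g \<in> {0..<int q}"
  shows "group_ring_of (residue_ring (int p)) (integer_mod_group q) g
           \<otimes>\<^bsub>group_ring (residue_ring (int p)) (integer_mod_group q)\<^esub> v
         = (\<lambda>x\<in>{0..<int q}. v ((x - g) mod int q))"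
proof -
  interpret R: residues "int p" "residue_ring (int p)"
    by unfold_locales (use p_gt_1 in auto)
  have G: "carrier (integer_mod_group q) = {0..<int q}"
    using q_gt_1 by (simp add: carrier_integer_mod_group)
  have RR: "carrier (residue_ring (int p)) = {0..<int p}"
    by (auto simp: residue_ring_def)
  let ?d = "group_ring_of (residue_ring (int p)) (integer_mod_group q) g"
  have "(\<Oplus>\<^bsub>residue_ring (int p)\<^esub>h\<in>{0..<int q}. ?d h \<otimes>\<^bsub>residue_ring (int p)\<^esub>
          v (inv\<^bsub>integer_mod_group q\<^esub> h \<otimes>\<^bsub>integer_mod_group q\<^esub> x)) = v ((x - g) mod int q)"
    if "x \<in> {0..<int q}" for x
  proof -
    have vv: "v ((x - h) mod int q) \<in> carrier (residue_ring (int p))" for h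
      using assms(1) q_gt_1 by (auto simp: RR PiE_iff)
    have "(\<Oplus>\<^bsub>residue_ring (int p)\<^esub>h\<in>{0..<int q}. ?d h \<otimes>\<^bsub>residue_ring (int p)\<^esub>
            v (inv\<^bsub>integer_mod_group q\<^esub> h \<otimes>\<^bsub>integer_mod_group q\<^esub> x)) =
          (\<Oplus>\<^bsub>residue_ring (int p)\<^esub>h\<in>{0..<int q}.
           (if g = h then v ((x - h) mod int q) else \<zero>\<^bsub>residue_ring (int p)\<^esub>))"
      using vv by (intro R.finsum_cong') (auto simp: G mod_simps group_ring_of_def)
    also have "\<dots> = v ((x - g) mod int q)"
      using assms(2) vv by (intro R.finsum_singleton) auto
    finally show ?thesis .
  qed
  then show ?thesis
    by (auto simp: group_ring_def G intro!: restrict_ext)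
qed

lemma carrier_\<Gamma>: "carrier \<Gamma> = carrier V \<times> {0..<int q}"
  using q_gt_1
  by (simp add: free_semidirect_def semidirect_product_def V_def carrier_integer_mod_group)

lemma one_\<Gamma>: "\<one>\<^bsub>\<Gamma>\<^esub> = (\<one>\<^bsub>V\<^esub>, 0)"
  by (simp add: free_semidirect_def semidirect_product_def V_def)

lemma mult_\<Gamma>:
  assumes "b \<in> carrier V" "g \<in> {0..<int q}"
  shows "(a, g) \<otimes>\<^bsub>\<Gamma>\<^esub> (b, h) = (a \<otimes>\<^bsub>V\<^esub> shift g b, (g + h) mod int q)"
proof -
  have "b i \<in> {0..<int q} \<rightarrow>\<^sub>E {0..<int p}" if "i < k" for i
    using assms(1) that by (auto simp: carrier_V)
  then have "group_ring_of (residue_ring (int p)) (integer_mod_group q) g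
           \<otimes>\<^bsub>group_ring (residue_ring (int p)) (integer_mod_group q)\<^esub> b i = shift g b i" if "i < k" for i
    using assms(2) that by (simp add: group_ring_of_mult shift_def)
  then show ?thesis
    by (auto simp: free_semidirect_def semidirect_product_def V_def intro!: restrict_ext)
qed

lemma mult_\<Gamma>':
  assumes "snd y \<in> {0..<int q}" "fst z \<in> carrier V"
  shows "y \<otimes>\<^bsub>\<Gamma>\<^esub> z = (fst y \<otimes>\<^bsub>V\<^esub> shift (snd y) (fst z), (snd y + snd z) mod int q)"
  using mult_\<Gamma>[OF assms(2,1), of "fst y" "snd z"] by simp

lemma group_\<Gamma>: "group \<Gamma>"
proof (rule groupI)
  show "\<exists>y\<in>carrier \<Gamma>. y \<otimes>\<^bsub>\<Gamma>\<^esub> x = \<one>\<^bsub>\<Gamma>\<^esub>" if "x \<in> carrier \<Gamma>" for x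
  proof -
    define v g where "v = fst x" and "g = snd x"
    have x: "x = (v, g)" "v \<in> carrier V" "g \<in> {0..<int q}"
      using that unfolding carrier_\<Gamma> v_def g_def by auto
    let ?y = "(inv\<^bsub>V\<^esub> (shift (- g) v), (- g) mod int q)"
    have "?y \<otimes>\<^bsub>\<Gamma>\<^esub> x = \<one>\<^bsub>\<Gamma>\<^esub>"
      using x q_gt_1 by (simp add: mult_\<Gamma> one_\<Gamma> shift_mod V.l_inv shift_closed mod_simps)
    moreover have "?y \<in> carrier \<Gamma>"
      using x q_gt_1 by (simp add: carrier_\<Gamma> shift_closed)
    ultimately show ?thesis by blast
  qed
qed (use q_gt_1 in \<open>auto simp: carrier_\<Gamma> mult_\<Gamma> one_\<Gamma> shift_closed V_mult_closed shift_one shift_0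
      shift_mult shift_mod shift_shift V.m_assoc mod_simps add_ac\<close>)

lemma finite_\<Gamma>: "finite (carrier \<Gamma>)"
  unfolding carrier_\<Gamma> carrier_V by (auto intro!: finite_PiE)

lemma card_\<Gamma>: "card (carrier \<Gamma>) = p ^ (q * k) * q"
  by (simp add: carrier_\<Gamma> carrier_V card_PiE power_mult card_cartesian_product)


text \<open>Shapiro's lemma made explicit: inducing the character \<open>\<psi>\<close> from \<open>B\<close> yields a cocycle
  \<open>f\<close> with values in the group ring, and \<open>\<rho>\<close> is twisted by its multiples.  Invariance of \<open>\<psi>\<close>
  makes \<open>f\<close> on \<open>B\<close> a multiple of one fixed vector with nonzero entries.\<close>

lemma twisted_surjections:
  fixes A :: "('b, 'c) monoid_scheme" (structure) and w \<psi> :: "'b \<Rightarrow> int"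
  assumes p: "prime p" and "group A" and fin: "finite (carrier A)"
    and \<rho>: "\<rho> \<in> hom A \<Gamma>" and \<rho>_onto: "\<rho> ` carrier A = carrier \<Gamma>"
    and w_range: "\<And>a. a \<in> carrier A \<Longrightarrow> 0 < w a \<and> w a < int p"
    and w_mult: "\<And>a b. a \<in> carrier A \<Longrightarrow> b \<in> carrier A \<Longrightarrow> w (a \<otimes> b) = w a * w b mod int p"
    and B: "B = {a \<in> carrier A. snd (\<rho> a) = 0 \<and> w a = 1}"
    and \<psi>_mult: "\<And>a b. a \<in> B \<Longrightarrow> b \<in> B \<Longrightarrow> [\<psi> (a \<otimes> b) = \<psi> a + \<psi> b] (mod int p)"
    and \<psi>_inv: "\<And>a b. a \<in> carrier A \<Longrightarrow> b \<in> B \<Longrightarrow> [\<psi> (inv a \<otimes> b \<otimes> a) = \<psi> b] (mod int p)"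
    and b0: "b0 \<in> B" "\<rho> b0 = \<one>\<^bsub>\<Gamma>\<^esub>" "\<not> [\<psi> b0 = 0] (mod int p)"
    and B_onto: "\<And>v. v \<in> carrier V \<Longrightarrow> \<exists>b\<in>B. \<rho> b = (v, 0)"
  shows "\<exists>\<rho>'. (\<forall>c \<in> {..<k} \<rightarrow>\<^sub>E {0..<int p}.
             \<rho>' c \<in> hom A \<Gamma> \<and> \<rho>' c ` carrier A = carrier \<Gamma>) \<and>
           inj_on (\<lambda>c. kernel A \<Gamma> (\<rho>' c)) ({..<k} \<rightarrow>\<^sub>E {0..<int p})"
proof -
  interpret A: group A by fact
  interpret \<Gamma>: group \<Gamma> by (rule group_\<Gamma>)
  have \<rho>_closed: "\<rho> a \<in> carrier \<Gamma>" if "a \<in> carrier A" for a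
    using \<rho> that by (auto simp: hom_def)
  then have \<rho>V: "fst (\<rho> a) \<in> carrier V" and \<rho>G: "0 \<le> snd (\<rho> a)" "snd (\<rho> a) < int q"
    if "a \<in> carrier A" for a
    using that by (fastforce simp: carrier_\<Gamma>)+
  have \<rho>_mult: "\<rho> (a \<otimes> b) = \<rho> a \<otimes>\<^bsub>\<Gamma>\<^esub> \<rho> b" if "a \<in> carrier A" "b \<in> carrier A" for a b
    using \<rho> that by (auto simp: hom_def)
  have \<rho>V_mult: "fst (\<rho> (a \<otimes> b)) = fst (\<rho> a) \<otimes>\<^bsub>V\<^esub> shift (snd (\<rho> a)) (fst (\<rho> b))"
    and \<rho>G_mult: "snd (\<rho> (a \<otimes> b)) = (snd (\<rho> a) + snd (\<rho> b)) mod int q"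
    if "a \<in> carrier A" "b \<in> carrier A" for a b
    using that \<rho>G \<rho>V by (auto simp: \<rho>_mult mult_\<Gamma>')
  \<comment> \<open>\<open>B\<close> is the kernel of \<open>Q\<close>, seen as a homomorphism to
    \<open>\<int>/q\<close> times the units mod \<open>p\<close>. Two elements lie in the same coset
    of \<open>B\<close> exactly when their \<open>Q\<close> agree.\<close>
  define Q where "Q a = (snd (\<rho> a), w a)" for a
  have Q_mult: "Q (a \<otimes> b) = Q (a' \<otimes> b')"
    if "Q a = Q a'" "Q b = Q b'" "a \<in> carrier A" "b \<in> carrier A" "a' \<in> carrier A" "b' \<in> carrier A"
    for a b a' b'
    using that by (auto simp: Q_def \<rho>G_mult w_mult)
  have Q_one: "Q \<one> = (0, 1)"
  proof -
    have "\<rho> \<one> = \<one>\<^bsub>\<Gamma>\<^esub>" using \<rho> hom_one A.is_group \<Gamma>.is_group by blast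
    then have 1: "snd (\<rho> \<one>) = 0" by (simp add: one_\<Gamma>)
    have "w \<one> = w \<one> * w \<one> mod int p" using w_mult[of \<one> \<one>] by simp
    then have "[w \<one> * 1 = w \<one> * w \<one>] (mod int p)"
      unfolding cong_def by (metis mod_mod_trivial mult.right_neutral)
    moreover have "coprime (w \<one>) (int p)"
      using w_range[of \<one>] p zdvd_not_zless
      by (metis A.one_closed coprime_commute prime_imp_coprime prime_nat_int_transfer)
    ultimately have "[1 = w \<one>] (mod int p)" using cong_mult_lcancel by blast
    then have "w \<one> = 1" using w_range[of \<one>] p_gt_1 by (simp add: cong_def)
    with 1 show ?thesis by (simp add: Q_def)
  qed
  have B_iff: "a \<in> B \<longleftrightarrow> a \<in> carrier A \<and> Q a = Q \<one>" for a
    unfolding Q_one B by (auto simp: Q_def)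
  have QB: "inv a \<otimes> b \<in> B" if "Q a = Q b" "a \<in> carrier A" "b \<in> carrier A" for a b
    using Q_mult[of "inv a" "inv a" b a] that by (simp add: B_iff)
  have Q_cancel: "Q a = Q b" if "Q (c \<otimes> a) = Q (c \<otimes> b)" "a \<in> carrier A" "b \<in> carrier A" "c \<in> carrier A" for a b c
    using Q_mult[OF refl that(1), of "inv c"] that by (simp add: A.m_assoc[symmetric])
  \<comment> \<open>The choice depends on \<open>Q x\<close> alone, so \<open>r\<close> is constant
    on cosets of \<open>B\<close> and idempotent.\<close>
  define r where "r x = (SOME y. y \<in> carrier A \<and> Q y = Q x)" for x
  have r: "r x \<in> carrier A" "Q (r x) = Q x" if "x \<in> carrier A" for x
    using someI[of "\<lambda>y. y \<in> carrier A \<and> Q y = Q x" x] that by (auto simp: r_def)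
  have r_cong: "r x = r y" if "Q x = Q y" for x y
    using that by (simp add: r_def)
  \<comment> \<open>\<open>B\<close> also demands \<open>w = 1\<close>, so several cosets may lie
    over one \<open>x\<close>. Summing over all of them makes the cocycle a function of
    \<open>x\<close> alone, with values in the group ring.\<close>
  define T where "T x = {t \<in> r ` carrier A. snd (\<rho> t) = x}" for x
  have T_carrier: "t \<in> carrier A" and T_r: "r t = t" and T_snd: "snd (\<rho> t) = x" if tT: "t \<in> T x" for t x
  proof -
    obtain a where a: "a \<in> carrier A" "t = r a" "snd (\<rho> t) = x" using tT by (auto simp: T_def)
    show "t \<in> carrier A" "r t = t" "snd (\<rho> t) = x" using a r r_cong[OF r(2)[OF a(1)]] by simp_all
  qed
  have T_I: "r a \<in> T (snd (\<rho> a))" if "a \<in> carrier A" for a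
    using r[OF that] that by (auto simp: T_def Q_def)
  \<comment> \<open>The usual formula for inducing from \<open>B\<close>:
    \<open>r (inv a \<otimes> t)\<close> represents the coset of \<open>inv a \<otimes> t\<close>,
    which puts the argument of \<open>\<psi>\<close> into \<open>B\<close>.\<close>
  define f where "f a x = (\<Sum>t\<in>T x. \<psi> (inv t \<otimes> a \<otimes> r (inv a \<otimes> t)))" for a x
  have arg_B: "inv t \<otimes> a \<otimes> r (inv a \<otimes> t) \<in> B" if "t \<in> carrier A" "a \<in> carrier A" for a t
  proof -
    have "Q (a \<otimes> r (inv a \<otimes> t)) = Q (a \<otimes> (inv a \<otimes> t))"
      using that r by (intro Q_mult) auto
    also have "a \<otimes> (inv a \<otimes> t) = t" using that by (simp add: A.m_assoc[symmetric])
    finally show ?thesis using that r QB[of t "a \<otimes> r (inv a \<otimes> t)"] by (simp add: A.m_assoc)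
  qed
  have f_mult: "[f (a \<otimes> b) x = f a x + f b ((x - snd (\<rho> a)) mod int q)] (mod int p)"
    if a: "a \<in> carrier A" and b: "b \<in> carrier A" and x: "0 \<le> x" "x < int q" for a b x
  proof -
    let ?u = "\<lambda>t. r (inv a \<otimes> t)"
    have "[f (a \<otimes> b) x = (\<Sum>t\<in>T x. \<psi> (inv t \<otimes> a \<otimes> ?u t) + \<psi> (inv (?u t) \<otimes> b \<otimes> r (inv b \<otimes> ?u t)))] (mod int p)"
      unfolding f_def
    proof (rule cong_sum)
      fix t assume t: "t \<in> T x"
      note tc = T_carrier[OF t]
      have uc: "?u t \<in> carrier A" and uq: "Q (?u t) = Q (inv a \<otimes> t)" using r tc a by auto
      have "Q (inv b \<otimes> ?u t) = Q (inv b \<otimes> (inv a \<otimes> t))"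
        using a b tc uc uq by (intro Q_mult) auto
      also have "inv b \<otimes> (inv a \<otimes> t) = inv (a \<otimes> b) \<otimes> t"
        using a b tc by (simp add: A.inv_mult_group A.m_assoc)
      finally have "r (inv b \<otimes> ?u t) = r (inv (a \<otimes> b) \<otimes> t)" by (rule r_cong)
      \<comment> \<open>Inserting \<open>?u t\<close> and its inverse splits the argument for
        \<open>a \<otimes> b\<close> into those for \<open>a\<close> and for
        \<open>b\<close>.\<close>
      moreover have "inv t \<otimes> (a \<otimes> b) \<otimes> z = (inv t \<otimes> a \<otimes> ?u t) \<otimes> (inv (?u t) \<otimes> b \<otimes> z)" if "z \<in> carrier A" for z
      proof -
        have "(inv t \<otimes> a \<otimes> ?u t) \<otimes> (inv (?u t) \<otimes> b \<otimes> z) = inv t \<otimes> a \<otimes> (?u t \<otimes> inv (?u t)) \<otimes> b \<otimes> z"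
          using a b tc uc that by (simp only: A.m_assoc A.m_closed A.inv_closed)
        then show ?thesis using a b tc uc that by (simp add: A.m_assoc)
      qed
      ultimately show "[\<psi> (inv t \<otimes> (a \<otimes> b) \<otimes> r (inv (a \<otimes> b) \<otimes> t)) =
           \<psi> (inv t \<otimes> a \<otimes> ?u t) + \<psi> (inv (?u t) \<otimes> b \<otimes> r (inv b \<otimes> ?u t))] (mod int p)"
        using \<psi>_mult[OF arg_B[OF tc a] arg_B[OF uc b]] r tc a b uc by simp
    qed
    also have "(\<Sum>t\<in>T x. \<psi> (inv t \<otimes> a \<otimes> ?u t) + \<psi> (inv (?u t) \<otimes> b \<otimes> r (inv b \<otimes> ?u t))) =
        f a x + (\<Sum>t\<in>T x. \<psi> (inv (?u t) \<otimes> b \<otimes> r (inv b \<otimes> ?u t)))"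
      by (simp add: f_def sum.distrib)
    \<comment> \<open>Left translation by \<open>inv a\<close> permutes the cosets and moves those
      over \<open>x\<close> to those over \<open>x - snd (\<rho> a)\<close>; this change of index is
      the \<open>shift\<close> of the semidirect product.\<close>
    also have "(\<Sum>t\<in>T x. \<psi> (inv (?u t) \<otimes> b \<otimes> r (inv b \<otimes> ?u t))) = f b ((x - snd (\<rho> a)) mod int q)"
      unfolding f_def
    proof (rule sum.reindex_bij_witness[where i = "\<lambda>u. r (a \<otimes> u)" and j = ?u])
      fix t assume t: "t \<in> T x"
      note tc = T_carrier[OF t]
      have "Q (a \<otimes> ?u t) = Q (a \<otimes> (inv a \<otimes> t))" using r tc a by (intro Q_mult) auto
      also have "a \<otimes> (inv a \<otimes> t) = t" using tc a by (simp add: A.m_assoc[symmetric])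
      finally show "r (a \<otimes> ?u t) = t"
        using r_cong T_r[OF t] by metis
      have "snd (\<rho> (a \<otimes> (inv a \<otimes> t))) = x" using T_snd[OF t] tc a by (simp add: A.m_assoc[symmetric])
      then have "(snd (\<rho> a) + snd (\<rho> (inv a \<otimes> t))) mod int q = x" using tc a by (simp add: \<rho>G_mult[of a])
      then have "(x - snd (\<rho> a)) mod int q = snd (\<rho> (inv a \<otimes> t)) mod int q"
        by (metis add_diff_cancel_left' mod_diff_left_eq)
      also have "\<dots> = snd (\<rho> (inv a \<otimes> t))" using \<rho>G tc a by simp
      finally show "?u t \<in> T ((x - snd (\<rho> a)) mod int q)" using T_I[of "inv a \<otimes> t"] tc a by simp
    next
      fix u assume u: "u \<in> T ((x - snd (\<rho> a)) mod int q)"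
      note uc = T_carrier[OF u]
      have "Q (inv a \<otimes> r (a \<otimes> u)) = Q (inv a \<otimes> (a \<otimes> u))" using r uc a by (intro Q_mult) auto
      also have "inv a \<otimes> (a \<otimes> u) = u" using uc a by (simp add: A.m_assoc[symmetric])
      finally show "?u (r (a \<otimes> u)) = u"
        using r_cong T_r[OF u] by metis
      have "snd (\<rho> (a \<otimes> u)) = x" using \<rho>G_mult[OF a uc] T_snd[OF u] x by (simp add: mod_simps)
      then show "r (a \<otimes> u) \<in> T x" using T_I[of "a \<otimes> u"] uc a by simp
    qed simp
    finally show ?thesis .
  qed
  define m where "m x = int (card (T x))" for x
  have finT: "finite (T x)" for x using fin by (auto simp: T_def)
  \<comment> \<open>Elements of \<open>B\<close> fix every coset, so each summand is
    \<open>\<psi>\<close> of a conjugate of \<open>b\<close>.\<close>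
  have f_B: "[f b x = m x * \<psi> b] (mod int p)" if b: "b \<in> B" for b x
  proof -
    have bc: "b \<in> carrier A" "Q b = Q \<one>" using b by (auto simp: B_iff)
    have "[f b x = (\<Sum>t\<in>T x. \<psi> b)] (mod int p)"
      unfolding f_def
    proof (rule cong_sum)
      fix t assume t: "t \<in> T x"
      note tc = T_carrier[OF t]
      have "Q (inv b) = Q \<one>" using Q_mult[of "inv b" "inv b" b \<one>] bc by simp
      then have "Q (inv b \<otimes> t) = Q t" using Q_mult[of "inv b" \<one> t t] bc tc by simp
      then have "r (inv b \<otimes> t) = t" using r_cong T_r[OF t] by metis
      then show "[\<psi> (inv t \<otimes> b \<otimes> r (inv b \<otimes> t)) = \<psi> b] (mod int p)" using \<psi>_inv[OF tc b] by simp
    qed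
    then show ?thesis by (simp add: m_def)
  qed
  \<comment> \<open>Positive because \<open>\<rho>\<close> is onto, less than \<open>p\<close>
    because \<open>w\<close> is injective on a fibre; hence \<open>m x\<close> is invertible mod
    \<open>p\<close>.\<close>
  have m_range: "0 < m x \<and> m x < int p" if "0 \<le> x" "x < int q" for x
  proof -
    have "(\<one>\<^bsub>V\<^esub>, x) \<in> carrier \<Gamma>" using that by (simp add: carrier_\<Gamma>)
    then obtain a where "a \<in> carrier A" "\<rho> a = (\<one>\<^bsub>V\<^esub>, x)" using \<rho>_onto by (metis imageE)
    then have "T x \<noteq> {}" using T_I[of a] by auto
    moreover have "card (T x) \<le> card {0<..<int p}"
    proof (rule card_inj_on_le[where f = w])
      show "inj_on w (T x)"
      proof (rule inj_onI)
        fix t u assume tu: "t \<in> T x" "u \<in> T x" "w t = w u"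
        then have "Q t = Q u" using T_snd by (simp add: Q_def)
        then show "t = u" using r_cong T_r tu by metis
      qed
    qed (use w_range T_carrier in auto)
    ultimately show ?thesis using finT p_gt_1 by (simp add: m_def card_gt_0_iff)
  qed
  \<comment> \<open>\<open>f_mult\<close> is the cocycle identity that the first component of
    \<open>\<rho>\<close> satisfies, so any multiple of \<open>f\<close> may be added there.\<close>
  define \<rho>' where "\<rho>' c a = ((\<lambda>i\<in>{..<k}. \<lambda>x\<in>{0..<int q}. (fst (\<rho> a) i x + c i * f a x) mod int p), snd (\<rho> a))"
    for c :: "nat \<Rightarrow> int" and a
  have \<rho>'V: "fst (\<rho>' c a) \<in> carrier V" for c a
    unfolding \<rho>'_def fst_conv using p_gt_1 by (intro V_memI) auto
  have \<rho>'_closed: "\<rho>' c a \<in> carrier \<Gamma>" if "a \<in> carrier A" for c a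
    using \<rho>'V[of c a] \<rho>G[OF that] unfolding carrier_\<Gamma> by (auto simp: mem_Times_iff \<rho>'_def)
  have \<rho>'_hom: "\<rho>' c \<in> hom A \<Gamma>" for c
  proof (rule homI)
    fix a b assume a: "a \<in> carrier A" and b: "b \<in> carrier A"
    show "\<rho>' c (a \<otimes> b) = \<rho>' c a \<otimes>\<^bsub>\<Gamma>\<^esub> \<rho>' c b"
    proof (rule prod_eqI)
      have sG: "snd (\<rho>' c a) \<in> {0..<int q}" using \<rho>G[OF a] by (simp add: \<rho>'_def)
      have eq: "\<rho>' c a \<otimes>\<^bsub>\<Gamma>\<^esub> \<rho>' c b = (fst (\<rho>' c a) \<otimes>\<^bsub>V\<^esub> shift (snd (\<rho> a)) (fst (\<rho>' c b)), (snd (\<rho> a) + snd (\<rho> b)) mod int q)"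
        using mult_\<Gamma>'[OF sG \<rho>'V, of c b] by (simp add: \<rho>'_def)
      show "snd (\<rho>' c (a \<otimes> b)) = snd (\<rho>' c a \<otimes>\<^bsub>\<Gamma>\<^esub> \<rho>' c b)"
        unfolding eq using \<rho>G_mult[OF a b] by (simp add: \<rho>'_def)
      show "fst (\<rho>' c (a \<otimes> b)) = fst (\<rho>' c a \<otimes>\<^bsub>\<Gamma>\<^esub> \<rho>' c b)"
        unfolding eq fst_conv
      proof (rule V_eqI)
        fix i x assume i: "i < k" and x: "0 \<le> x" "x < int q"
        let ?y = "(x - snd (\<rho> a)) mod int q"
        have y: "0 \<le> ?y" "?y < int q" using q_gt_1 by auto
        have "fst (\<rho> (a \<otimes> b)) i x = (fst (\<rho> a) i x + fst (\<rho> b) i ?y) mod int p"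
          using \<rho>V_mult[OF a b] i x by (simp add: V_mult_entry shift_entry)
        then have "fst (\<rho>' c (a \<otimes> b)) i x = (fst (\<rho> a) i x + fst (\<rho> b) i ?y + c i * f (a \<otimes> b) x) mod int p"
          using i x by (simp add: \<rho>'_def mod_simps)
        also have "\<dots> = (fst (\<rho> a) i x + fst (\<rho> b) i ?y + c i * (f a x + f b ?y)) mod int p"
          using cong_add[OF cong_refl cong_scalar_left[OF f_mult[OF a b x]], of "fst (\<rho> a) i x + fst (\<rho> b) i ?y" "c i"]
          by (simp add: cong_def)
        also have "\<dots> = ((fst (\<rho> a) i x + c i * f a x) mod int p + (fst (\<rho> b) i ?y + c i * f b ?y) mod int p) mod int p"
          by (subst mod_add_eq) (simp add: algebra_simps)
        also have "\<dots> = (fst (\<rho>' c a) i x + fst (\<rho>' c b) i ?y) mod int p"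
          using i x y by (simp add: \<rho>'_def)
        also have "\<dots> = (fst (\<rho>' c a) \<otimes>\<^bsub>V\<^esub> shift (snd (\<rho> a)) (fst (\<rho>' c b))) i x"
          using i x by (simp add: V_mult_entry shift_entry)
        finally show "fst (\<rho>' c (a \<otimes> b)) i x = (fst (\<rho>' c a) \<otimes>\<^bsub>V\<^esub> shift (snd (\<rho> a)) (fst (\<rho>' c b))) i x" .
      qed (auto intro: \<rho>'V V_mult_closed)
    qed
  qed (rule \<rho>'_closed)
  have b0c: "b0 \<in> carrier A" using b0 by (simp add: B)
  have B_sub: "b \<otimes> b' \<in> B" if "b \<in> B" "b' \<in> B" for b b'
    using that Q_mult[of b \<one> b' \<one>] by (auto simp: B_iff)
  have pow_b0: "b0 [^] (e::nat) \<in> B \<and> [\<psi> (b0 [^] e) = int e * \<psi> b0] (mod int p) \<and> \<rho> (b0 [^] e) = \<one>\<^bsub>\<Gamma>\<^esub>" for e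
  proof (induction e)
    case 0
    have "\<one> \<in> B" by (simp add: B_iff)
    then have "[\<psi> \<one> + 0 = \<psi> \<one> + \<psi> \<one>] (mod int p)" using \<psi>_mult[of \<one> \<one>] by simp
    then have "[0 = \<psi> \<one>] (mod int p)" using cong_add_lcancel by blast
    moreover have "\<rho> \<one> = \<one>\<^bsub>\<Gamma>\<^esub>" using \<rho> hom_one A.is_group \<Gamma>.is_group by blast
    ultimately show ?case using \<open>\<one> \<in> B\<close> by (simp add: cong_sym)
  next
    case (Suc e)
    have "[\<psi> (b0 [^] e \<otimes> b0) = \<psi> (b0 [^] e) + \<psi> b0] (mod int p)" using \<psi>_mult Suc b0 by blast
    also have "[\<psi> (b0 [^] e) + \<psi> b0 = int e * \<psi> b0 + \<psi> b0] (mod int p)"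
      using Suc by (intro cong_add) auto
    finally show ?case using Suc b0 B_sub b0c by (auto simp: \<rho>_mult algebra_simps)
  qed
  have cop: "coprime (\<psi> b0) (int p)"
    using b0(3) p unfolding cong_0_iff
    by (metis coprime_commute prime_imp_coprime prime_nat_int_transfer)
  \<comment> \<open>Powers of \<open>b0\<close> change \<open>\<psi>\<close> by arbitrary residues
    and leave \<open>\<rho>\<close> alone, so on \<open>B\<close> the values of
    \<open>\<rho>\<close> and \<open>\<psi>\<close> can be prescribed independently.\<close>
  have adjust: "\<exists>b\<in>B. \<rho> b = (v, 0) \<and> [\<psi> b = y] (mod int p)" if v: "v \<in> carrier V" for v y
  proof -
    obtain b where b: "b \<in> B" "\<rho> b = (v, 0)" using B_onto v by blast
    obtain s where s: "[\<psi> b0 * s = y - \<psi> b] (mod int p)"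
      using cong_solve_coprime_int[OF cop] by (metis cong_scalar_right mult.assoc mult_1)
    define e where "e = nat (s mod int p)"
    have e: "int e = s mod int p" using p_gt_1 by (simp add: e_def)
    have "[\<psi> (b \<otimes> b0 [^] e) = \<psi> b + \<psi> (b0 [^] e)] (mod int p)" using \<psi>_mult pow_b0 b by blast
    also have "[\<psi> b + \<psi> (b0 [^] e) = \<psi> b + int e * \<psi> b0] (mod int p)" using pow_b0 by (intro cong_add) auto
    also have "[\<psi> b + int e * \<psi> b0 = \<psi> b + (y - \<psi> b)] (mod int p)"
    proof (intro cong_add cong_refl)
      show "[int e * \<psi> b0 = y - \<psi> b] (mod int p)"
        using s by (simp add: e cong_def mod_simps mult.commute)
    qed
    finally have "[\<psi> (b \<otimes> b0 [^] e) = y] (mod int p)" by simp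
    moreover have "\<rho> (b \<otimes> b0 [^] e) = (v, 0)"
    proof -
      have "b \<in> carrier A" using b by (simp add: B)
      then show ?thesis using b pow_b0[of e] b0c \<rho>_closed[of b] by (simp add: \<rho>_mult)
    qed
    ultimately show ?thesis using B_sub b pow_b0 by blast
  qed
  have \<rho>'_B: "\<rho>' c b = ((\<lambda>i\<in>{..<k}. \<lambda>x\<in>{0..<int q}. (v i x + c i * (m x * \<psi> b)) mod int p), 0)"
    if "b \<in> B" "\<rho> b = (v, 0)" for c b v
  proof -
    have "(v i x + c i * f b x) mod int p = (v i x + c i * (m x * \<psi> b)) mod int p" for i x
      using cong_add[OF cong_refl cong_scalar_left[OF f_B[OF that(1)]], of "v i x" "c i" x] by (simp add: cong_def)
    then show ?thesis using that by (simp add: \<rho>'_def)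
  qed
  have onto: "\<rho>' c ` carrier A = carrier \<Gamma>" for c
  proof
    show "\<rho>' c ` carrier A \<subseteq> carrier \<Gamma>" using \<rho>'_closed by auto
    \<comment> \<open>An element over \<open>v\<close> on which \<open>\<psi>\<close> vanishes is
      not affected by the twist.\<close>
    have BV: "\<exists>b\<in>carrier A. \<rho>' c b = (v, 0)" if v: "v \<in> carrier V" for v
    proof -
      obtain b where b: "b \<in> B" "\<rho> b = (v, 0)" "[\<psi> b = 0] (mod int p)" using adjust[OF v] by blast
      have *: "(v i x + c i * (m x * \<psi> b)) mod int p = v i x" if "i < k" "0 \<le> x" "x < int q" for i x
      proof -
        have "int p dvd c i * (m x * \<psi> b)" using b(3) by (simp add: cong_0_iff)
        then show ?thesis using V_entry_mod[OF v that] by (metis add.right_neutral dvd_imp_mod_0 mod_add_right_eq)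
      qed
      have "(\<lambda>i\<in>{..<k}. \<lambda>x\<in>{0..<int q}. (v i x + c i * (m x * \<psi> b)) mod int p) = v"
        using v p_gt_1 * V_entry[OF v] by (intro V_eqI V_memI) auto
      then have "\<rho>' c b = (v, 0)" using \<rho>'_B[OF b(1,2)] by simp
      then show ?thesis using b by (auto simp: B)
    qed
    show "carrier \<Gamma> \<subseteq> \<rho>' c ` carrier A"
    proof
      fix y assume y: "y \<in> carrier \<Gamma>"
      then have "(\<one>\<^bsub>V\<^esub>, snd y) \<in> carrier \<Gamma>" unfolding carrier_\<Gamma> by auto
      then obtain a where a: "a \<in> carrier A" "\<rho> a = (\<one>\<^bsub>V\<^esub>, snd y)" using \<rho>_onto by (metis imageE)
      have ga: "snd (\<rho>' c a) = snd y" using a by (simp add: \<rho>'_def)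
      define v where "v = fst y \<otimes>\<^bsub>V\<^esub> inv\<^bsub>V\<^esub> (fst (\<rho>' c a))"
      have yV: "fst y \<in> carrier V" "0 \<le> snd y" "snd y < int q" using y unfolding carrier_\<Gamma> by auto
      then obtain b where b: "b \<in> carrier A" "\<rho>' c b = (v, 0)" using BV[of v] \<rho>'V by (auto simp: v_def)
      have "\<rho>' c (b \<otimes> a) = (v, 0) \<otimes>\<^bsub>\<Gamma>\<^esub> \<rho>' c a" using \<rho>'_hom[of c] a b by (simp add: hom_def)
      also have "\<dots> = (v \<otimes>\<^bsub>V\<^esub> fst (\<rho>' c a), snd y)"
        using mult_\<Gamma>'[of "(v, 0)" "\<rho>' c a"] \<rho>'V[of c a] yV ga q_gt_1 by (simp add: shift_0)
      also have "\<dots> = y" using yV \<rho>'V[of c a] by (simp add: v_def V.m_assoc)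
      finally show "y \<in> \<rho>' c ` carrier A" using a b by force
    qed
  qed
  have "inj_on (\<lambda>c. kernel A \<Gamma> (\<rho>' c)) ({..<k} \<rightarrow>\<^sub>E {0..<int p})"
  proof (rule inj_onI, rule ccontr)
    fix c c' assume c: "c \<in> {..<k} \<rightarrow>\<^sub>E {0..<int p}" "c' \<in> {..<k} \<rightarrow>\<^sub>E {0..<int p}"
      and ker: "kernel A \<Gamma> (\<rho>' c) = kernel A \<Gamma> (\<rho>' c')" and "c \<noteq> c'"
    then obtain i where i: "i < k" "c i \<noteq> c' i" by (metis PiE_ext lessThan_iff)
    \<comment> \<open>If \<open>\<rho> b = (v, 0)\<close> and \<open>\<psi> b\<close> is 1 mod
      \<open>p\<close>, this \<open>v\<close> cancels the twist by \<open>c\<close>: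
      \<open>b\<close> lies in the kernel of \<open>\<rho>' c\<close>, but \<open>\<rho>' c'\<close>
      maps it to the vector with entries \<open>(c' i - c i) m x\<close>.\<close>
    define v where "v = (\<lambda>i\<in>{..<k}. \<lambda>x\<in>{0..<int q}. (- (c i * m x)) mod int p)"
    have v: "v \<in> carrier V" unfolding v_def using p_gt_1 by (intro V_memI) auto
    obtain b where b: "b \<in> B" "\<rho> b = (v, 0)" "[\<psi> b = 1] (mod int p)" using adjust[OF v] by blast
    have bc: "b \<in> carrier A" using b by (simp add: B)
    have val: "(v i x + d i * (m x * \<psi> b)) mod int p = ((d i - c i) * m x) mod int p"
      if "i < k" "0 \<le> x" "x < int q" for i x and d :: "nat \<Rightarrow> int"
    proof -
      have "[v i x + d i * (m x * \<psi> b) = - (c i * m x) + d i * (m x * 1)] (mod int p)"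
        using that b(3) by (intro cong_add cong_scalar_left) (auto simp: v_def)
      then show ?thesis by (simp add: cong_def algebra_simps)
    qed
    have "\<rho>' c b = \<one>\<^bsub>\<Gamma>\<^esub>"
      unfolding \<rho>'_B[OF b(1,2)] one_\<Gamma> one_V using val[of _ _ c] by (auto intro!: restrict_ext)
    then have "\<rho>' c' b = \<one>\<^bsub>\<Gamma>\<^esub>" using ker bc by (auto simp: kernel_def)
    then have "fst (\<rho>' c' b) i 0 = 0" using i q_gt_1 by (simp add: one_\<Gamma> one_V)
    then have "((c' i - c i) * m 0) mod int p = 0"
      unfolding \<rho>'_B[OF b(1,2)] using val[of i 0 c'] i q_gt_1 by simp
    then have "int p dvd (c' i - c i) \<or> int p dvd m 0"
      using p by (metis mod_0_imp_dvd prime_dvd_mult_iff prime_nat_int_transfer)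
    moreover have "\<not> int p dvd m 0" using m_range[of 0] q_gt_1 zdvd_not_zless by auto
    moreover have "\<not> int p dvd (c' i - c i)"
    proof -
      have "c i \<in> {0..<int p}" "c' i \<in> {0..<int p}"
        using PiE_mem[OF c(1), of i] PiE_mem[OF c(2), of i] i(1) by simp_all
      then have "\<bar>c' i - c i\<bar> < int p" "c' i - c i \<noteq> 0" using i by auto
      then show ?thesis using dvd_imp_le_int[of "c' i - c i" "int p"] by linarith
    qed
    ultimately show False by blast
  qed
  then show ?thesis using \<rho>'_hom onto by (intro exI[of _ \<rho>']) simp
qed

end

section \<open>Finite products and cyclic norms in a commutative group\<close>

primrec (in monoid) nat_prod :: "(nat \<Rightarrow> 'a) \<Rightarrow> nat \<Rightarrow> 'a" where
  "nat_prod f 0 = \<one>"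
| "nat_prod f (Suc m) = nat_prod f m \<otimes> f m"

context comm_group begin

lemma nat_prod_closed: "(\<And>i. i < m \<Longrightarrow> f i \<in> carrier G) \<Longrightarrow> nat_prod f m \<in> carrier G"
  by (induction m) auto

lemma nat_prod_cong: "(\<And>i. i < m \<Longrightarrow> f i = g i) \<Longrightarrow> nat_prod f m = nat_prod g m"
  by (induction m) auto

lemma nat_prod_mult:
  assumes "\<And>i. f i \<in> carrier G" "\<And>i. g i \<in> carrier G"
  shows "nat_prod (\<lambda>i. f i \<otimes> g i) m = nat_prod f m \<otimes> nat_prod g m"
  using assms by (induction m) (auto simp: nat_prod_closed m_ac)

lemma nat_prod_Suc_shift:
  assumes "\<And>i. f i \<in> carrier G"
  shows "nat_prod f (Suc m) = f 0 \<otimes> nat_prod (\<lambda>i. f (Suc i)) m"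
proof (induction m)
  case (Suc m)
  have "nat_prod f (Suc (Suc m)) = nat_prod f (Suc m) \<otimes> f (Suc m)" by simp
  also have "\<dots> = f 0 \<otimes> nat_prod (\<lambda>i. f (Suc i)) m \<otimes> f (Suc m)" using Suc by simp
  finally show ?case using assms by (simp add: nat_prod_closed m_ac)
qed (use assms in simp)

lemma nat_prod_hom:
  assumes "h \<in> hom G G" "\<And>i. f i \<in> carrier G"
  shows "h (nat_prod f m) = nat_prod (\<lambda>i. h (f i)) m"
  using assms by (induction m) (auto simp: nat_prod_closed hom_mult hom_one[OF assms(1)])

lemma nat_prod_const: "x \<in> carrier G \<Longrightarrow> nat_prod (\<lambda>_. x) m = x [^] m"
  by (induction m) auto

lemma nat_prod_pow: "x \<in> carrier G \<Longrightarrow> nat_prod (\<lambda>i. x [^] (e i :: nat)) m = x [^] (\<Sum>i<m. e i)"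
  by (induction m) (auto simp: nat_pow_mult)

lemma nat_prod_add:
  assumes "\<And>i. f i \<in> carrier G"
  shows "nat_prod f (a + b) = nat_prod f a \<otimes> nat_prod (\<lambda>i. f (a + i)) b"
  using assms by (induction b) (auto simp: nat_prod_closed m_ac)

lemma nat_prod_mult_index:
  assumes "\<And>i. f i \<in> carrier G"
  shows "nat_prod f (a * b) = nat_prod (\<lambda>j. nat_prod (\<lambda>i. f (a * j + i)) a) b"
proof (induction b)
  case (Suc b)
  have "nat_prod f (a * Suc b) = nat_prod f (a * b + a)" by (simp add: algebra_simps)
  then show ?case using assms Suc by (simp add: nat_prod_add)
qed simp

lemma hom_funpow: "h \<in> hom G G \<Longrightarrow> h ^^ i \<in> hom G G"
  by (induction i) (auto simp: hom_def Pi_iff)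

lemma hom_finprod':
  assumes "h \<in> hom G G" "finite A" "\<And>i. i \<in> A \<Longrightarrow> f i \<in> carrier G"
  shows "h (finprod G f A) = finprod G (\<lambda>i. h (f i)) A"
  using assms(2,3)
proof (induction A rule: finite_induct)
  case (insert a A)
  then show ?case using assms(1) by (simp add: Pi_iff hom_mult hom_in_carrier)
qed (simp add: hom_one[OF assms(1)])

lemma nat_pow_hom:
  assumes "h \<in> hom G G" "x \<in> carrier G"
  shows "h (x [^] (i::nat)) = h x [^] i"
  using assms by (induction i) (auto simp: hom_mult hom_one[OF assms(1)])

lemma hom_inv':
  assumes "h \<in> hom G G" "x \<in> carrier G"
  shows "h (inv x) = inv (h x)"
  using assms(2) group_hom.hom_inv[OF group_hom.intro[OF group_axioms group_axioms] ] assms(1)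
  by (simp add: group_hom_axioms_def)

text \<open>The norm for the cyclic group generated by \<open>t\<close>. It is a trace when the
  group is the additive group of a field.\<close>

definition norm_prod :: "('a \<Rightarrow> 'a) \<Rightarrow> nat \<Rightarrow> 'a \<Rightarrow> 'a" where
  "norm_prod t m x = nat_prod (\<lambda>i. (t ^^ i) x) m"

lemma norm_prod_closed: "t \<in> hom G G \<Longrightarrow> x \<in> carrier G \<Longrightarrow> norm_prod t m x \<in> carrier G"
  unfolding norm_prod_def by (intro nat_prod_closed hom_in_carrier[OF hom_funpow])

lemma norm_prod_mult:
  assumes "t \<in> hom G G" "x \<in> carrier G" "y \<in> carrier G"
  shows "norm_prod t m (x \<otimes> y) = norm_prod t m x \<otimes> norm_prod t m y"
proof -
  have "nat_prod (\<lambda>i. (t ^^ i) x \<otimes> (t ^^ i) y) m = nat_prod (\<lambda>i. (t ^^ i) x) m \<otimes> nat_prod (\<lambda>i. (t ^^ i) y) m"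
    using assms by (intro nat_prod_mult hom_in_carrier[OF hom_funpow])
  then show ?thesis using assms by (simp add: norm_prod_def hom_mult[OF hom_funpow])
qed

lemma norm_prod_hom: "t \<in> hom G G \<Longrightarrow> norm_prod t m \<in> hom G G"
  by (rule homI) (auto simp: norm_prod_closed norm_prod_mult)

lemma funpow_comm:
  assumes "h \<in> hom G G" "t \<in> hom G G" "\<And>x. x \<in> carrier G \<Longrightarrow> h (t x) = t (h x)" "x \<in> carrier G"
  shows "h ((t ^^ i) x) = (t ^^ i) (h x)"
  using assms(4) by (induction i) (auto simp: assms hom_in_carrier[OF hom_funpow])

lemma norm_prod_comm:
  assumes "h \<in> hom G G" "t \<in> hom G G" "\<And>x. x \<in> carrier G \<Longrightarrow> h (t x) = t (h x)" "x \<in> carrier G"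
  shows "h (norm_prod t m x) = norm_prod t m (h x)"
  unfolding norm_prod_def using assms
  by (subst nat_prod_hom) (auto simp: hom_in_carrier[OF hom_funpow] funpow_comm)

text \<open>Applying \<open>t\<close> moves the factors by one place, and the last one,
  \<open>(t ^^ m) x\<close>, is again \<open>x\<close>.\<close>

lemma norm_prod_invariant:
  assumes "t \<in> hom G G" "x \<in> carrier G" "(t ^^ m) x = x"
  shows "norm_prod t m (t x) = norm_prod t m x"
proof -
  have c: "(t ^^ i) x \<in> carrier G" for i using assms by (simp add: hom_in_carrier[OF hom_funpow])
  have "x \<otimes> norm_prod t m (t x) = nat_prod (\<lambda>i. (t ^^ i) x) (Suc m)"
    using nat_prod_Suc_shift[of "\<lambda>i. (t ^^ i) x" m] c by (simp add: norm_prod_def funpow_swap1)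
  also have "\<dots> = x \<otimes> norm_prod t m x"
    using assms c by (simp add: norm_prod_def m_comm nat_prod_closed)
  finally show ?thesis
    using assms by (simp add: norm_prod_closed hom_in_carrier)
qed

end

section \<open>The free module as a sum of translates of its entries at 0\<close>

context gamma_params begin

text \<open>The component of \<open>v\<close> supported on the positions in \<open>P\<close>. For
  single positions these components are permuted simply transitively by \<open>shift\<close>; both
  lemmas on cohomology below rest on this.\<close>

definition part :: "(int \<Rightarrow> bool) \<Rightarrow> (nat \<Rightarrow> int \<Rightarrow> int) \<Rightarrow> nat \<Rightarrow> int \<Rightarrow> int" where
  "part P v = (\<lambda>i\<in>{..<k}. \<lambda>x\<in>{0..<int q}. if P x then v i x else 0)"

lemma part_closed: "v \<in> carrier V \<Longrightarrow> part P v \<in> carrier V"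
  unfolding part_def using p_gt_1 V_entry by (intro V_memI) auto

lemma part_entry: "i < k \<Longrightarrow> 0 \<le> x \<Longrightarrow> x < int q \<Longrightarrow> part P v i x = (if P x then v i x else 0)"
  by (simp add: part_def)

lemma part_mult: "v \<in> carrier V \<Longrightarrow> u \<in> carrier V \<Longrightarrow> part P (v \<otimes>\<^bsub>V\<^esub> u) = part P v \<otimes>\<^bsub>V\<^esub> part P u"
  by (intro V_eqI part_closed V_mult_closed) (auto simp: part_entry V_mult_entry)

lemma part_all: "v \<in> carrier V \<Longrightarrow> (\<And>x. 0 \<le> x \<Longrightarrow> x < int q \<Longrightarrow> P x) \<Longrightarrow> part P v = v"
  by (intro V_eqI part_closed) (auto simp: part_entry)

lemma part_none: "v \<in> carrier V \<Longrightarrow> (\<And>x. 0 \<le> x \<Longrightarrow> x < int q \<Longrightarrow> \<not> P x) \<Longrightarrow> part P v = \<one>\<^bsub>V\<^esub>"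
  by (intro V_eqI part_closed V_one_closed) (auto simp: part_entry V_one_entry)

lemma part_disjoint:
  assumes "v \<in> carrier V" "\<And>x. 0 \<le> x \<Longrightarrow> x < int q \<Longrightarrow> \<not> (P x \<and> Q x)"
  shows "part P v \<otimes>\<^bsub>V\<^esub> part Q v = part (\<lambda>x. P x \<or> Q x) v"
  using assms(1) assms(2)
  by (intro V_eqI part_closed V_mult_closed) (auto simp: part_entry V_mult_entry V_entry_mod)

lemma part_shift:
  assumes "v \<in> carrier V"
  shows "part P (shift g v) = shift g (part (\<lambda>x. P ((x + g) mod int q)) v)"
proof (rule V_eqI)
  fix i x assume "i < k" "0 \<le> x" "x < int q"
  then show "part P (shift g v) i x = shift g (part (\<lambda>x. P ((x + g) mod int q)) v) i x"
    using q_gt_1 by (simp add: part_entry shift_entry mod_simps)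
qed (auto intro: part_closed shift_closed assms)

text \<open>The two lemmas say that the dual of the free module \<open>V\<close> has trivial cohomology in degrees
  -1 and 0.\<close>

lemma hom_norm_one_imp_coboundary:
  assumes "comm_group M" and ch: "ch \<in> hom V M"
    and norm1: "\<And>v. v \<in> carrier V \<Longrightarrow> monoid.nat_prod M (\<lambda>j. ch (shift (- int j) v)) q = \<one>\<^bsub>M\<^esub>"
  shows "\<exists>\<mu> \<in> hom V M. (\<forall>v\<in>carrier V. \<mu> v = \<mu> (shift (-1) v) \<otimes>\<^bsub>M\<^esub> ch v) \<and>
           (\<forall>h\<in>hom M M. (\<forall>v\<in>carrier V. h (ch v) = \<one>\<^bsub>M\<^esub>) \<longrightarrow> (\<forall>v\<in>carrier V. h (\<mu> v) = \<one>\<^bsub>M\<^esub>))"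
proof -
  interpret M: comm_group M by fact
  have lc: "ch v \<in> carrier M" if "v \<in> carrier V" for v using ch that by (rule hom_in_carrier)
  have lm: "ch (v \<otimes>\<^bsub>V\<^esub> u) = ch v \<otimes>\<^bsub>M\<^esub> ch u" if "v \<in> carrier V" "u \<in> carrier V" for v u
    using ch that by (rule hom_mult)
  have l1: "ch \<one>\<^bsub>V\<^esub> = \<one>\<^bsub>M\<^esub>" using hom_one[OF ch V.is_group M.is_group] .
  \<comment> \<open>For \<open>v\<close> supported at \<open>x\<close> the coboundary equation is a
    recursion from \<open>x - 1\<close> to \<open>x\<close>. Starting with
    \<open>\<mu> v = ch v\<close> at 0, it gives the product of the
    \<open>ch (shift (- int j) v)\<close> over \<open>j \<le> x\<close>; here the factors are sorted
    by \<open>j\<close>. Passing from 0 back to \<open>q - 1\<close> is consistent because the norm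
    of \<open>ch\<close> is trivial.\<close>
  define f where "f j v = ch (shift (- int j) (part (\<lambda>x. int j \<le> x) v))" for j v
  have fc: "f j v \<in> carrier M" if "v \<in> carrier V" for j v
    using that by (simp add: f_def lc shift_closed part_closed)
  have fm: "f j (v \<otimes>\<^bsub>V\<^esub> u) = f j v \<otimes>\<^bsub>M\<^esub> f j u" if "v \<in> carrier V" "u \<in> carrier V" for j v u
    using that by (simp add: f_def lm shift_closed part_closed part_mult shift_mult)
  define \<mu> where "\<mu> v = M.nat_prod (\<lambda>j. f j v) q" for v
  have "\<mu> \<in> hom V M"
    by (rule homI) (auto simp: \<mu>_def fc fm M.nat_prod_closed M.nat_prod_mult)
  moreover have "\<mu> v = \<mu> (shift (-1) v) \<otimes>\<^bsub>M\<^esub> ch v" if v: "v \<in> carrier V" for v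
  proof -
    let ?e = "part (\<lambda>x. x = 0) v"
    have e: "?e \<in> carrier V" using v by (rule part_closed)
    define h where "h j = ch (shift (- int j) ?e)" for j
    have hc: "h j \<in> carrier M" for j using e by (simp add: h_def lc shift_closed)
    have step: "f j (shift (-1) v) = f (Suc j) v \<otimes>\<^bsub>M\<^esub> h (Suc j)" if "j < q" for j
    proof -
      have "part (\<lambda>x. int j \<le> x) (shift (-1) v) = shift (-1) (part (\<lambda>x. int j \<le> (x - 1) mod int q) v)"
        using part_shift[OF v, of _ "-1"] by simp
      also have "part (\<lambda>x. int j \<le> (x - 1) mod int q) v = part (\<lambda>x. int (Suc j) \<le> x \<or> x = 0) v"
      proof (intro V_eqI part_closed v)
        fix i x assume x: "0 \<le> x" "x < int q" and i: "i < k"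
        have "(int j \<le> (x - 1) mod int q) \<longleftrightarrow> (int (Suc j) \<le> x \<or> x = 0)"
        proof (cases "x = 0")
          case True
          then show ?thesis using that q_gt_1 by (simp add: zmod_minus1)
        next
          case False
          then show ?thesis using x by auto
        qed
        then show "part (\<lambda>x. int j \<le> (x - 1) mod int q) v i x = part (\<lambda>x. int (Suc j) \<le> x \<or> x = 0) v i x"
          using x i by (simp add: part_entry)
      qed
      also have "\<dots> = part (\<lambda>x. int (Suc j) \<le> x) v \<otimes>\<^bsub>V\<^esub> ?e"
        using v by (subst part_disjoint) auto
      finally have "part (\<lambda>x. int j \<le> x) (shift (-1) v) =
          shift (-1) (part (\<lambda>x. int (Suc j) \<le> x) v) \<otimes>\<^bsub>V\<^esub> shift (-1) ?e"
        using v e by (simp add: shift_mult part_closed)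
      then show ?thesis
        using v e by (simp add: minus_diff_commute f_def h_def lm shift_mult shift_closed part_closed shift_shift)
    qed
    have "M.nat_prod (\<lambda>j. h (Suc j)) q = \<one>\<^bsub>M\<^esub>"
    proof -
      have "h q = h 0" using e shift_mod[of "- int q" ?e] shift_mod[of 0 ?e] by (simp add: h_def)
      moreover have "h 0 \<otimes>\<^bsub>M\<^esub> M.nat_prod (\<lambda>j. h (Suc j)) q = M.nat_prod h q \<otimes>\<^bsub>M\<^esub> h q"
        using M.nat_prod_Suc_shift[of h q] hc by simp
      moreover have "M.nat_prod h q = \<one>\<^bsub>M\<^esub>" using norm1[OF e] by (simp add: h_def[abs_def])
      ultimately show ?thesis using hc by (simp add: M.nat_prod_closed)
    qed
    moreover have "\<mu> (shift (-1) v) = M.nat_prod (\<lambda>j. f (Suc j) v \<otimes>\<^bsub>M\<^esub> h (Suc j)) q"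
      unfolding \<mu>_def by (intro M.nat_prod_cong step)
    ultimately have "\<mu> (shift (-1) v) = M.nat_prod (\<lambda>j. f (Suc j) v) q"
      using fc[OF v] hc by (simp add: M.nat_prod_mult M.nat_prod_closed)
    then have "f 0 v \<otimes>\<^bsub>M\<^esub> \<mu> (shift (-1) v) = M.nat_prod (\<lambda>j. f j v) (Suc q)"
      using M.nat_prod_Suc_shift[of "\<lambda>j. f j v" q] fc[OF v] by simp
    moreover have "f 0 v = ch v" using v by (simp add: f_def part_all shift_0)
    moreover have "f q v = \<one>\<^bsub>M\<^esub>" using v by (simp add: f_def part_none shift_one l1)
    ultimately have "ch v \<otimes>\<^bsub>M\<^esub> \<mu> (shift (-1) v) = \<mu> v"
      using fc[OF v] by (simp add: \<mu>_def M.nat_prod_closed)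
    then show ?thesis
      using lc[OF v] \<open>\<mu> \<in> hom V M\<close> shift_closed[OF v] M.m_comm hom_in_carrier by metis
  qed
  \<comment> \<open>All values of \<open>\<mu>\<close> are products of values of \<open>ch\<close>.
    With \<open>h = \<pi>\<close> this will keep \<open>\<mu>\<close> inside the powers of
    \<open>\<zeta>\<close>.\<close>
  moreover have "h (\<mu> v) = \<one>\<^bsub>M\<^esub>"
    if "h \<in> hom M M" "\<forall>v\<in>carrier V. h (ch v) = \<one>\<^bsub>M\<^esub>" "v \<in> carrier V" for h v
  proof -
    have "h (f j v) = \<one>\<^bsub>M\<^esub>" for j
      using that by (simp add: f_def shift_closed part_closed)
    then show ?thesis
      using that fc[OF that(3)] by (simp add: \<mu>_def M.nat_prod_hom M.nat_prod_const)
  qed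
  ultimately show ?thesis by blast
qed

lemma invariant_hom_imp_norm:
  assumes "comm_group M" and ch: "ch \<in> hom V M"
    and invariant: "\<And>v. v \<in> carrier V \<Longrightarrow> ch (shift (-1) v) = ch v"
  shows "\<exists>\<mu> \<in> hom V M. (\<forall>v\<in>carrier V. monoid.nat_prod M (\<lambda>j. \<mu> (shift (- int j) v)) q = ch v) \<and>
           \<mu> ` carrier V \<subseteq> ch ` carrier V"
proof -
  interpret M: comm_group M by fact
  have lc: "ch v \<in> carrier M" if "v \<in> carrier V" for v using ch that by (rule hom_in_carrier)
  have lm: "ch (v \<otimes>\<^bsub>V\<^esub> u) = ch v \<otimes>\<^bsub>M\<^esub> ch u" if "v \<in> carrier V" "u \<in> carrier V" for v u
    using ch that by (rule hom_mult)
  have l1: "ch \<one>\<^bsub>V\<^esub> = \<one>\<^bsub>M\<^esub>" using hom_one[OF ch V.is_group M.is_group] .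
  have inv_j: "ch (shift (- int j) v) = ch v" if "v \<in> carrier V" for j v
  proof (induction j)
    case (Suc j)
    have "shift (- int (Suc j)) v = shift (-1) (shift (- int j) v)"
      using that by (simp add: shift_shift)
    then show ?case using Suc invariant[of "shift (- int j) v"] that by (simp add: shift_closed)
  qed (use that in \<open>simp add: shift_0\<close>)
  \<comment> \<open>Only the entries at 0 are kept; by invariance of \<open>ch\<close> the
    translates of this restriction account for the other positions.\<close>
  define \<mu> where "\<mu> v = ch (part (\<lambda>x. x = 0) v)" for v
  have "\<mu> \<in> hom V M"
    by (rule homI) (auto simp: \<mu>_def lc lm part_closed part_mult)
  moreover have "M.nat_prod (\<lambda>j. \<mu> (shift (- int j) v)) q = ch v" if v: "v \<in> carrier V" for v
  proof -
    have "M.nat_prod (\<lambda>j. \<mu> (shift (- int j) v)) m = ch (part (\<lambda>x. x < int m) v)" if "m \<le> q" for m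
      using that
    proof (induction m)
      case 0
      then show ?case using v by (simp add: part_none l1)
    next
      case (Suc m)
      have "part (\<lambda>x. x = 0) (shift (- int m) v) = shift (- int m) (part (\<lambda>x. (x - int m) mod int q = 0) v)"
        using part_shift[OF v, of _ "- int m"] by simp
      also have "part (\<lambda>x. (x - int m) mod int q = 0) v = part (\<lambda>x. x = int m) v"
      proof (intro V_eqI part_closed v)
        fix i x assume x: "0 \<le> x" "x < int q" and i: "i < k"
        have "(x - int m) mod int q = 0 \<longleftrightarrow> x mod int q = int m mod int q"
          by (metis mod_eq_dvd_iff mod_0_imp_dvd dvd_imp_mod_0)
        then have "(x - int m) mod int q = 0 \<longleftrightarrow> x = int m" using x Suc.prems by simp
        then show "part (\<lambda>x. (x - int m) mod int q = 0) v i x = part (\<lambda>x. x = int m) v i x"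
          using x i by (simp add: part_entry)
      qed
      finally have "\<mu> (shift (- int m) v) = ch (part (\<lambda>x. x = int m) v)"
        using v inv_j by (simp add: \<mu>_def part_closed)
      moreover have "part (\<lambda>x. x < int m) v \<otimes>\<^bsub>V\<^esub> part (\<lambda>x. x = int m) v = part (\<lambda>x. x < int (Suc m)) v"
      proof -
        have "(x < int m \<or> x = int m) \<longleftrightarrow> x < int (Suc m)" for x by auto
        then show ?thesis using v by (subst part_disjoint) auto
      qed
      ultimately show ?case
        using Suc v lm[of "part (\<lambda>x. x < int m) v" "part (\<lambda>x. x = int m) v"] by (simp add: part_closed)
    qed
    then show ?thesis using v by (simp add: part_all)
  qed
  moreover have "\<mu> ` carrier V \<subseteq> ch ` carrier V" by (auto simp: \<mu>_def part_closed)
  ultimately show ?thesis by blast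
qed

end

section \<open>Invariant classes not coming from the free module\<close>

text \<open>An abstraction of Kummer and Artin-Schreier theory.  \<open>M\<close> is the multiplicative or additive
  group of a field, \<open>\<pi>\<close> is the \<open>p\<close>-th power map or the Artin-Schreier map, \<open>V\<close> acts through
  \<open>\<alpha>\<close>, a generator of the cyclic quotient acts through \<open>s\<close>, and \<open>D\<close> is the Galois group of
  the extension generated by the kernel of \<open>\<pi>\<close>.\<close>

locale kummer_data = gamma_params p q k + comm_group M
  for p q k :: nat and M :: "('x, 'm) monoid_scheme" (structure) +
  fixes n :: nat
    and \<alpha> :: "(nat \<Rightarrow> int \<Rightarrow> int) \<Rightarrow> 'x \<Rightarrow> 'x" and s :: "'x \<Rightarrow> 'x"
    and D :: "('d, 'e) monoid_scheme" and \<delta> :: "'d \<Rightarrow> 'x \<Rightarrow> 'x" and w :: "'d \<Rightarrow> nat"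
    and \<pi> :: "'x \<Rightarrow> 'x" and \<zeta> :: 'x and K :: "'x set"
  assumes prime_p: "prime p" and q_eq: "q = p ^ n"
    and \<alpha>_hom: "\<And>v. v \<in> carrier V \<Longrightarrow> \<alpha> v \<in> hom M M"
    and \<alpha>_mult: "\<And>v u x. v \<in> carrier V \<Longrightarrow> u \<in> carrier V \<Longrightarrow> x \<in> carrier M \<Longrightarrow>
                   \<alpha> (v \<otimes>\<^bsub>V\<^esub> u) x = \<alpha> v (\<alpha> u x)"
    and s_hom: "s \<in> hom M M" and s_order: "\<And>x. x \<in> carrier M \<Longrightarrow> (s ^^ q) x = x"
    and s_\<alpha>: "\<And>v x. v \<in> carrier V \<Longrightarrow> x \<in> carrier M \<Longrightarrow> s (\<alpha> v x) = \<alpha> (shift 1 v) (s x)"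
    and D_group: "group D" and D_finite: "finite (carrier D)" and D_small: "card (carrier D) < p"
    and \<delta>_hom: "\<And>d. d \<in> carrier D \<Longrightarrow> \<delta> d \<in> hom M M"
    and \<delta>_mult: "\<And>d e x. d \<in> carrier D \<Longrightarrow> e \<in> carrier D \<Longrightarrow> x \<in> carrier M \<Longrightarrow>
                   \<delta> (d \<otimes>\<^bsub>D\<^esub> e) x = \<delta> d (\<delta> e x)"
    and \<delta>_\<alpha>: "\<And>d v x. d \<in> carrier D \<Longrightarrow> v \<in> carrier V \<Longrightarrow> x \<in> carrier M \<Longrightarrow> \<delta> d (\<alpha> v x) = \<alpha> v (\<delta> d x)"
    and \<delta>_s: "\<And>d x. d \<in> carrier D \<Longrightarrow> x \<in> carrier M \<Longrightarrow> \<delta> d (s x) = s (\<delta> d x)"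
    and w_range: "\<And>d. d \<in> carrier D \<Longrightarrow> 0 < w d \<and> w d < p"
    and w_mult: "\<And>d e. d \<in> carrier D \<Longrightarrow> e \<in> carrier D \<Longrightarrow> [w (d \<otimes>\<^bsub>D\<^esub> e) = w d * w e] (mod p)"
    and \<pi>_hom: "\<pi> \<in> hom M M"
    and \<pi>_\<alpha>: "\<And>v x. v \<in> carrier V \<Longrightarrow> x \<in> carrier M \<Longrightarrow> \<pi> (\<alpha> v x) = \<alpha> v (\<pi> x)"
    and \<pi>_s: "\<And>x. x \<in> carrier M \<Longrightarrow> \<pi> (s x) = s (\<pi> x)"
    and \<pi>_\<delta>: "\<And>d x. d \<in> carrier D \<Longrightarrow> x \<in> carrier M \<Longrightarrow> \<pi> (\<delta> d x) = \<delta> d (\<pi> x)"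
    and \<zeta>_closed: "\<zeta> \<in> carrier M" and \<zeta>_not_one: "\<zeta> \<noteq> \<one>" and \<zeta>_pow: "\<zeta> [^] p = \<one>"
    and \<alpha>_\<zeta>: "\<And>v. v \<in> carrier V \<Longrightarrow> \<alpha> v \<zeta> = \<zeta>" and s_\<zeta>: "s \<zeta> = \<zeta>"
    and \<delta>_\<zeta>: "\<And>d. d \<in> carrier D \<Longrightarrow> \<delta> d \<zeta> = \<zeta> [^] w d"
    and \<pi>_kernel: "\<And>x. x \<in> carrier M \<Longrightarrow> \<pi> x = \<one> \<longleftrightarrow> (\<exists>j::nat. x = \<zeta> [^] j)"
    and K_def: "K = {x \<in> carrier M. \<forall>v\<in>carrier V. \<alpha> v x = x}"
    and K_pow: "\<And>x. x \<in> K \<Longrightarrow> \<exists>y\<in>K. x [^] p = \<pi> y"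
    and hilbert90_V: "\<And>ch. ch \<in> hom V M \<Longrightarrow> (\<And>v. v \<in> carrier V \<Longrightarrow> \<pi> (ch v) = \<one>) \<Longrightarrow>
                        \<exists>\<gamma>\<in>carrier M. \<forall>v\<in>carrier V. \<alpha> v \<gamma> = ch v \<otimes> \<gamma>"
    and hilbert90_K: "\<And>x. x \<in> K \<Longrightarrow> norm_prod (s ^^ (p ^ (n - 1))) p x = \<one> \<Longrightarrow>
                        \<exists>b\<in>K. (s ^^ (p ^ (n - 1))) b = x \<otimes> b"
    and \<zeta>_norm: "(\<exists>y\<in>K. norm_prod (s ^^ (p ^ (n - 1))) p y = \<zeta>) \<or>
                   ((\<forall>x\<in>carrier M. \<pi> x = x [^] p) \<and> (odd p \<or> n \<ge> 2))"
    and n_pos: "n \<ge> 1"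
begin

lemma mult_inv_cancel [simp]:
  assumes "x \<in> carrier M" "y \<in> carrier M"
  shows "x \<otimes> (inv x \<otimes> y) = y" "inv x \<otimes> (x \<otimes> y) = y"
  using assms by (simp_all add: m_assoc[symmetric])

lemma K_closed: "x \<in> K \<Longrightarrow> x \<in> carrier M" by (simp add: K_def)

lemma \<alpha>_closed [simp]: "v \<in> carrier V \<Longrightarrow> x \<in> carrier M \<Longrightarrow> \<alpha> v x \<in> carrier M"
  using \<alpha>_hom hom_in_carrier by metis
lemma s_closed [simp]: "x \<in> carrier M \<Longrightarrow> s x \<in> carrier M"
  using s_hom hom_in_carrier by metis
lemma \<pi>_closed [simp]: "x \<in> carrier M \<Longrightarrow> \<pi> x \<in> carrier M"
  using \<pi>_hom hom_in_carrier by metis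
lemma \<delta>_closed [simp]: "d \<in> carrier D \<Longrightarrow> x \<in> carrier M \<Longrightarrow> \<delta> d x \<in> carrier M"
  using \<delta>_hom hom_in_carrier by metis
declare \<zeta>_closed [simp]

lemma K_hom:
  assumes "h \<in> hom M M" "\<And>v x. v \<in> carrier V \<Longrightarrow> x \<in> carrier M \<Longrightarrow> h (\<alpha> v x) = \<alpha> v (h x)" "x \<in> K"
  shows "h x \<in> K"
  using assms hom_in_carrier[OF assms(1)] by (auto simp: K_def) metis

lemma K_s: assumes "x \<in> K" shows "s x \<in> K"
proof -
  have "\<alpha> v (s x) = s x" if "v \<in> carrier V" for v
  proof -
    have "\<alpha> v (s x) = s (\<alpha> (shift (-1) v) x)"
      using that assms s_\<alpha>[of "shift (-1) v" x] by (simp add: shift_closed shift_shift shift_0 K_def)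
    then show ?thesis using that assms by (simp add: K_def shift_closed)
  qed
  then show ?thesis using assms by (simp add: K_def)
qed

lemma K_mult: "x \<in> K \<Longrightarrow> y \<in> K \<Longrightarrow> x \<otimes> y \<in> K"
  using hom_mult[OF \<alpha>_hom] by (auto simp: K_def)
lemma K_one: "\<one> \<in> K"
  using hom_one[OF \<alpha>_hom] by (auto simp: K_def)
lemma K_inv: "x \<in> K \<Longrightarrow> inv x \<in> K"
  using hom_inv'[OF \<alpha>_hom] by (auto simp: K_def)
lemma K_nat_pow: "x \<in> K \<Longrightarrow> x [^] (i::nat) \<in> K"
  by (induction i) (auto simp: K_one K_mult)
lemma K_\<zeta>: "\<zeta> \<in> K" by (simp add: K_def \<alpha>_\<zeta>)
lemma K_\<pi>: "x \<in> K \<Longrightarrow> \<pi> x \<in> K" by (rule K_hom[OF \<pi>_hom \<pi>_\<alpha>])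
lemma K_\<delta>: "d \<in> carrier D \<Longrightarrow> x \<in> K \<Longrightarrow> \<delta> d x \<in> K" by (rule K_hom[OF \<delta>_hom \<delta>_\<alpha>])
lemma \<pi>_mult: "x \<in> carrier M \<Longrightarrow> y \<in> carrier M \<Longrightarrow> \<pi> (x \<otimes> y) = \<pi> x \<otimes> \<pi> y"
  by (rule hom_mult[OF \<pi>_hom])

text \<open>The elements of \<open>K\<close> whose class modulo \<open>\<pi> K\<close> lies in the
  eigenspace of \<open>D\<close> for the character \<open>w\<close>. For the Kummer character of
  \<open>b\<close> this is what gives invariance under conjugation by \<open>D\<close>.\<close>

definition eigen :: "'x set" where
  "eigen = {b \<in> K. \<forall>d\<in>carrier D. \<exists>c\<in>K. \<delta> d b = b [^] w d \<otimes> \<pi> c}"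

lemma eigen_K: "b \<in> eigen \<Longrightarrow> b \<in> K" by (simp add: eigen_def)

lemma eigen_mult:
  assumes "a \<in> eigen" "b \<in> eigen" shows "a \<otimes> b \<in> eigen"
proof -
  note ab = K_closed[OF eigen_K[OF assms(1)]] K_closed[OF eigen_K[OF assms(2)]]
  have "\<exists>c\<in>K. \<delta> d (a \<otimes> b) = (a \<otimes> b) [^] w d \<otimes> \<pi> c" if d: "d \<in> carrier D" for d
  proof -
    obtain c c' where c: "c \<in> K" "\<delta> d a = a [^] w d \<otimes> \<pi> c" "c' \<in> K" "\<delta> d b = b [^] w d \<otimes> \<pi> c'"
      using assms d by (auto simp: eigen_def) blast
    then have "\<delta> d (a \<otimes> b) = (a \<otimes> b) [^] w d \<otimes> \<pi> (c \<otimes> c')"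
      using ab d K_closed by (simp add: hom_mult[OF \<delta>_hom] \<pi>_mult nat_pow_distrib m_ac)
    then show ?thesis using K_mult c by blast
  qed
  then show ?thesis using assms K_mult by (simp add: eigen_def)
qed

lemma eigen_one: "\<one> \<in> eigen"
  using K_one hom_one[OF \<delta>_hom] hom_one[OF \<pi>_hom] by (auto simp: eigen_def intro!: bexI[of _ \<one>])

lemma eigen_nat_pow: "b \<in> eigen \<Longrightarrow> b [^] (i::nat) \<in> eigen"
  by (induction i) (auto simp: eigen_one eigen_mult)

lemma eigen_nat_prod: "(\<And>i. f i \<in> eigen) \<Longrightarrow> nat_prod f m \<in> eigen"
  by (induction m) (auto simp: eigen_one eigen_mult)

lemma eigen_s:
  assumes "b \<in> eigen" shows "s b \<in> eigen"
proof -
  note b = K_closed[OF eigen_K[OF assms]]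
  have "\<exists>c\<in>K. \<delta> d (s b) = s b [^] w d \<otimes> \<pi> c" if d: "d \<in> carrier D" for d
  proof -
    obtain c where c: "c \<in> K" "\<delta> d b = b [^] w d \<otimes> \<pi> c" using assms d by (auto simp: eigen_def)
    then have "\<delta> d (s b) = s b [^] w d \<otimes> \<pi> (s c)"
      using b d K_closed by (simp add: \<delta>_s hom_mult[OF s_hom] \<pi>_s nat_pow_hom[OF s_hom])
    then show ?thesis using K_s c by blast
  qed
  then show ?thesis using assms K_s by (simp add: eigen_def)
qed

lemma eigen_s_pow: "b \<in> eigen \<Longrightarrow> (s ^^ i) b \<in> eigen"
  by (induction i) (auto simp: eigen_s)

text \<open>The Kummer character of \<open>\<pi> \<beta>\<close>, or its Artin-Schreier character in
  the additive case.\<close>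

definition char_of :: "'x \<Rightarrow> (nat \<Rightarrow> int \<Rightarrow> int) \<Rightarrow> 'x" where
  "char_of \<beta> v = \<alpha> v \<beta> \<otimes> inv \<beta>"

lemma kernel_fixed:
  assumes "x \<in> carrier M" "\<pi> x = \<one>" "h \<in> hom M M" "h \<zeta> = \<zeta>"
  shows "h x = x"
  using assms \<pi>_kernel nat_pow_hom[OF assms(3)] by auto

text \<open>Multiplicativity holds because the values, being powers of \<open>\<zeta>\<close>, are
  fixed by \<open>V\<close>.\<close>

lemma char_of:
  assumes \<beta>: "\<beta> \<in> carrier M" "\<pi> \<beta> \<in> K"
  shows "char_of \<beta> \<in> hom V M" and "\<And>v. v \<in> carrier V \<Longrightarrow> \<pi> (char_of \<beta> v) = \<one>"
    and "\<And>v. v \<in> carrier V \<Longrightarrow> \<alpha> v \<beta> = char_of \<beta> v \<otimes> \<beta>"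
proof -
  show 1: "\<pi> (char_of \<beta> v) = \<one>" if "v \<in> carrier V" for v
    using that \<beta> by (simp add: char_of_def \<pi>_mult hom_inv'[OF \<pi>_hom] \<pi>_\<alpha> K_def)
  show 2: "\<alpha> v \<beta> = char_of \<beta> v \<otimes> \<beta>" if "v \<in> carrier V" for v
    using that \<beta> by (simp add: char_of_def m_assoc)
  have c: "char_of \<beta> v \<in> carrier M" if "v \<in> carrier V" for v
    using that \<beta> by (simp add: char_of_def)
  show "char_of \<beta> \<in> hom V M"
  proof (rule homI)
    fix v u assume v: "v \<in> carrier V" and u: "u \<in> carrier V"
    have "\<alpha> (v \<otimes>\<^bsub>V\<^esub> u) \<beta> = \<alpha> v (char_of \<beta> u \<otimes> \<beta>)" using \<alpha>_mult[OF v u \<beta>(1)] 2[OF u] by simp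
    also have "\<dots> = char_of \<beta> u \<otimes> (char_of \<beta> v \<otimes> \<beta>)"
      using v u \<beta> c 2[OF v] kernel_fixed[OF c[OF u] 1[OF u] \<alpha>_hom[OF v] \<alpha>_\<zeta>[OF v]]
      by (simp add: hom_mult[OF \<alpha>_hom])
    finally show "char_of \<beta> (v \<otimes>\<^bsub>V\<^esub> u) = char_of \<beta> v \<otimes> char_of \<beta> u"
      using v u \<beta> c by (simp add: char_of_def[of \<beta> "v \<otimes>\<^bsub>V\<^esub> u"] m_ac)
  qed (rule c)
qed

lemma \<alpha>_s_pow:
  assumes "v \<in> carrier V" "x \<in> carrier M"
  shows "\<alpha> v ((s ^^ j) x) = (s ^^ j) (\<alpha> (shift (- int j) v) x)"
  using assms(1)
proof (induction j arbitrary: v)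
  case 0
  then show ?case by (simp add: shift_0)
next
  case (Suc j)
  have sx: "(s ^^ j) x \<in> carrier M" using assms by (simp add: hom_in_carrier[OF hom_funpow[OF s_hom]])
  have "\<alpha> v ((s ^^ Suc j) x) = s (\<alpha> (shift (-1) v) ((s ^^ j) x))"
    using Suc.prems sx s_\<alpha>[of "shift (-1) v" "(s ^^ j) x"] by (simp add: shift_closed shift_shift shift_0)
  also have "\<dots> = (s ^^ Suc j) (\<alpha> (shift (- int (Suc j)) v) x)"
    using Suc by (simp add: shift_closed shift_shift minus_diff_commute)
  finally show ?case .
qed

text \<open>Moving \<open>\<alpha> v\<close> past \<open>s ^^ j\<close> turns \<open>v\<close> into
  \<open>shift (- int j) v\<close>, and \<open>s\<close> fixes the values of \<open>ch\<close>. So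
  the character of a norm is the norm of the character.\<close>

lemma \<alpha>_norm_prod:
  assumes x: "x \<in> carrier M" and ch: "ch \<in> hom V M" "\<And>v. v \<in> carrier V \<Longrightarrow> \<pi> (ch v) = \<one>"
    "\<And>v. v \<in> carrier V \<Longrightarrow> \<alpha> v x = ch v \<otimes> x" and v: "v \<in> carrier V"
  shows "\<alpha> v (norm_prod s m x) = nat_prod (\<lambda>j. ch (shift (- int j) v)) m \<otimes> norm_prod s m x"
proof -
  have sx: "(s ^^ j) x \<in> carrier M" for j using x by (simp add: hom_in_carrier[OF hom_funpow[OF s_hom]])
  have cc: "ch u \<in> carrier M" if "u \<in> carrier V" for u using hom_in_carrier[OF ch(1) that] .
  have s_fix: "(s ^^ j) \<zeta> = \<zeta>" for j by (induction j) (auto simp: s_\<zeta>)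
  have "\<alpha> v ((s ^^ j) x) = ch (shift (- int j) v) \<otimes> (s ^^ j) x" for j
  proof -
    let ?u = "shift (- int j) v"
    have u: "?u \<in> carrier V" using v by (rule shift_closed)
    have "\<alpha> v ((s ^^ j) x) = (s ^^ j) (ch ?u \<otimes> x)" using \<alpha>_s_pow[OF v x] ch(3)[OF u] by simp
    also have "\<dots> = (s ^^ j) (ch ?u) \<otimes> (s ^^ j) x" using cc[OF u] x by (simp add: hom_mult[OF hom_funpow[OF s_hom]])
    also have "(s ^^ j) (ch ?u) = ch ?u"
      by (rule kernel_fixed[OF cc[OF u] ch(2)[OF u] hom_funpow[OF s_hom] s_fix])
    finally show ?thesis .
  qed
  then show ?thesis
    unfolding norm_prod_def using v sx cc by (simp add: nat_prod_hom[OF \<alpha>_hom] nat_prod_mult shift_closed)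
qed

lemma same_char_imp_K:
  assumes "x \<in> carrier M" "y \<in> carrier M" "\<And>v. v \<in> carrier V \<Longrightarrow> ch v \<in> carrier M"
    "\<And>v. v \<in> carrier V \<Longrightarrow> \<alpha> v x = ch v \<otimes> x" "\<And>v. v \<in> carrier V \<Longrightarrow> \<alpha> v y = ch v \<otimes> y"
  shows "x \<otimes> inv y \<in> K"
proof -
  have "\<alpha> v (x \<otimes> inv y) = x \<otimes> inv y" if "v \<in> carrier V" for v
  proof -
    have "\<alpha> v (x \<otimes> inv y) = (ch v \<otimes> x) \<otimes> inv (ch v \<otimes> y)"
      using assms that by (simp add: hom_mult[OF \<alpha>_hom] hom_inv'[OF \<alpha>_hom])
    also have "\<dots> = (ch v \<otimes> inv (ch v)) \<otimes> (x \<otimes> inv y)"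
      using assms that by (simp add: inv_mult m_ac del: r_inv)
    finally show ?thesis using assms that by simp
  qed
  then show ?thesis using assms by (simp add: K_def)
qed

text \<open>\<open>D\<close> commutes with \<open>V\<close> and raises \<open>\<zeta>\<close> to the
  power \<open>w d\<close>, so \<open>\<delta> d \<beta>\<close> and \<open>\<beta> [^] w d\<close>
  have the same character and differ by an element of \<open>K\<close>. Classes that die in
  \<open>M\<close> thus satisfy the eigenspace condition automatically.\<close>

lemma \<pi>_image_eigen:
  assumes \<beta>: "\<beta> \<in> carrier M" "\<pi> \<beta> \<in> K"
  shows "\<pi> \<beta> \<in> eigen"
proof -
  have "\<exists>c\<in>K. \<delta> d (\<pi> \<beta>) = \<pi> \<beta> [^] w d \<otimes> \<pi> c" if d: "d \<in> carrier D" for d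
  proof -
    let ?c = "\<delta> d \<beta> \<otimes> inv (\<beta> [^] w d)"
    have "?c \<in> K"
    proof (rule same_char_imp_K[where ch = "\<lambda>v. char_of \<beta> v [^] w d"])
      fix v assume v: "v \<in> carrier V"
      have c: "char_of \<beta> v \<in> carrier M" using v \<beta> by (simp add: char_of_def)
      then show "char_of \<beta> v [^] w d \<in> carrier M" by simp
      obtain j :: nat where j: "char_of \<beta> v = \<zeta> [^] j" using \<pi>_kernel[OF c] char_of(2)[OF \<beta> v] by auto
      have "\<delta> d (char_of \<beta> v) = char_of \<beta> v [^] w d"
        using d by (simp add: j nat_pow_hom[OF \<delta>_hom] \<delta>_\<zeta> nat_pow_pow mult.commute)
      then show "\<alpha> v (\<delta> d \<beta>) = char_of \<beta> v [^] w d \<otimes> \<delta> d \<beta>"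
        using \<delta>_\<alpha>[OF d v \<beta>(1)] char_of(3)[OF \<beta> v] c \<beta> d by (simp add: hom_mult[OF \<delta>_hom])
      show "\<alpha> v (\<beta> [^] w d) = char_of \<beta> v [^] w d \<otimes> \<beta> [^] w d"
        using v c \<beta> char_of(3)[OF \<beta> v] by (simp add: nat_pow_hom[OF \<alpha>_hom] nat_pow_distrib)
    qed (use \<beta> d in auto)
    moreover have "\<pi> \<beta> [^] w d \<otimes> \<pi> ?c = \<delta> d (\<pi> \<beta>)"
    proof -
      have "\<pi> \<beta> [^] w d \<otimes> \<pi> ?c = \<pi> (\<beta> [^] w d \<otimes> ?c)" using \<beta> d by (simp add: \<pi>_mult nat_pow_hom[OF \<pi>_hom])
      also have "\<beta> [^] w d \<otimes> ?c = \<delta> d \<beta>" using \<beta> d by (simp add: m_lcomm)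
      finally show ?thesis using \<beta> d by (simp add: \<pi>_\<delta>)
    qed
    ultimately show ?thesis by metis
  qed
  then show ?thesis using \<beta> by (simp add: eigen_def)
qed

section \<open>Consequences of the absence of an invariant class\<close>

context
  assumes no_solution: "\<And>b c. b \<in> eigen \<Longrightarrow> c \<in> K \<Longrightarrow> s b = b \<otimes> \<pi> c \<Longrightarrow> b \<in> \<pi> ` carrier M"
begin

text \<open>Here \<open>\<beta>\<close> lies in \<open>M\<close> but perhaps not in
  \<open>K\<close>. Its character has trivial norm, hence is the coboundary of some
  \<open>\<mu>\<close>, which Hilbert 90 realises as the character of some \<open>\<gamma>\<close>.
  Replacing \<open>b\<close> by \<open>b \<otimes> \<pi> \<gamma>\<close> turns
  \<open>\<beta>\<close> into \<open>\<beta> \<otimes> s \<gamma> \<otimes> inv \<gamma>\<close>,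
  which lies in \<open>K\<close>, so \<open>no_solution\<close> applies.\<close>

lemma almost_invariant_imp_image:
  assumes b: "b \<in> eigen" and \<beta>: "\<beta> \<in> carrier M" and sb: "s b = b \<otimes> \<pi> \<beta>"
  shows "b \<in> \<pi> ` carrier M"
proof -
  have bK: "b \<in> K" and bc: "b \<in> carrier M" using b eigen_K K_closed by auto
  have \<pi>\<beta>: "\<pi> \<beta> = inv b \<otimes> s b" using bc \<beta> sb by (simp add: m_assoc[symmetric])
  then have "\<pi> \<beta> \<in> K" using K_mult K_inv K_s bK by simp
  note ch = char_of[OF \<beta> this]
  have "norm_prod s q (\<pi> \<beta>) = inv (norm_prod s q b) \<otimes> norm_prod s q (s b)"
    using bc by (simp add: \<pi>\<beta> norm_prod_mult[OF s_hom] hom_inv'[OF norm_prod_hom[OF s_hom]])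
  also have "\<dots> = \<one>"
    using norm_prod_invariant[OF s_hom bc s_order[OF bc]] norm_prod_closed[OF s_hom bc] by simp
  finally have "\<pi> (norm_prod s q \<beta>) = \<one>"
    using norm_prod_comm[OF \<pi>_hom s_hom \<pi>_s \<beta>] by simp
  \<comment> \<open>The norm of \<open>\<beta>\<close> is in the kernel of \<open>\<pi>\<close>,
    hence a power of \<open>\<zeta>\<close> and fixed by \<open>V\<close>; this is what trivialises
    the norm of its character.\<close>
  then have fixed: "\<alpha> v (norm_prod s q \<beta>) = norm_prod s q \<beta>" if "v \<in> carrier V" for v
    by (rule kernel_fixed[OF norm_prod_closed[OF s_hom \<beta>] _ \<alpha>_hom[OF that] \<alpha>_\<zeta>[OF that]])
  have norm1: "nat_prod (\<lambda>j. char_of \<beta> (shift (- int j) v)) q = \<one>" if "v \<in> carrier V" for v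
  proof -
    have "nat_prod (\<lambda>j. char_of \<beta> (shift (- int j) v)) q \<in> carrier M"
      by (intro nat_prod_closed hom_in_carrier[OF ch(1)] shift_closed that)
    moreover have "norm_prod s q \<beta> = nat_prod (\<lambda>j. char_of \<beta> (shift (- int j) v)) q \<otimes> norm_prod s q \<beta>"
      using \<alpha>_norm_prod[OF \<beta> ch that, of q] fixed[OF that] by simp
    ultimately show ?thesis using norm_prod_closed[OF s_hom \<beta>, of q] by (simp add: l_cancel_one')
  qed
  obtain \<mu> where \<mu>: "\<mu> \<in> hom V M" "\<And>v. v \<in> carrier V \<Longrightarrow> \<mu> v = \<mu> (shift (-1) v) \<otimes> char_of \<beta> v"
    and \<mu>1: "\<And>v. v \<in> carrier V \<Longrightarrow> \<pi> (\<mu> v) = \<one>"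
    using hom_norm_one_imp_coboundary[OF comm_group_axioms ch(1) norm1] \<pi>_hom ch(2) by blast
  obtain \<gamma> where \<gamma>: "\<gamma> \<in> carrier M" "\<And>v. v \<in> carrier V \<Longrightarrow> \<alpha> v \<gamma> = \<mu> v \<otimes> \<gamma>"
    using hilbert90_V[OF \<mu>(1) \<mu>1] by blast
  have \<mu>c: "\<mu> v \<in> carrier M" if "v \<in> carrier V" for v using hom_in_carrier[OF \<mu>(1) that] .
  have \<pi>\<gamma>: "\<pi> \<gamma> \<in> K"
    using \<gamma> \<mu>1 \<mu>c by (auto simp: K_def \<pi>_\<alpha>[symmetric] \<pi>_mult)
  have s\<gamma>: "\<alpha> v (s \<gamma>) = \<mu> (shift (-1) v) \<otimes> s \<gamma>" if v: "v \<in> carrier V" for v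
  proof -
    have sv: "shift (-1) v \<in> carrier V" using v by (rule shift_closed)
    have "\<alpha> v (s \<gamma>) = s (\<mu> (shift (-1) v) \<otimes> \<gamma>)" using \<alpha>_s_pow[OF v \<gamma>(1), of 1] \<gamma>(2)[OF sv] by simp
    then show ?thesis
      using \<mu>c[OF sv] \<gamma> kernel_fixed[OF \<mu>c[OF sv] \<mu>1[OF sv] s_hom s_\<zeta>] by (simp add: hom_mult[OF s_hom])
  qed
  have "\<beta> \<otimes> s \<gamma> \<otimes> inv \<gamma> \<in> K"
  proof (rule same_char_imp_K[of _ _ \<mu>])
    fix v assume v: "v \<in> carrier V"
    have c: "char_of \<beta> v \<in> carrier M" "\<mu> (shift (-1) v) \<in> carrier M"
      using hom_in_carrier[OF ch(1) v] \<mu>c shift_closed[OF v] by auto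
    show "\<alpha> v (\<beta> \<otimes> s \<gamma>) = \<mu> v \<otimes> (\<beta> \<otimes> s \<gamma>)"
      using v \<beta> \<gamma>(1) c ch(3)[OF v] s\<gamma>[OF v] by (simp add: hom_mult[OF \<alpha>_hom] \<mu>(2)[OF v] m_ac)
  qed (use \<beta> \<gamma> \<mu>c in auto)
  moreover have "s (b \<otimes> \<pi> \<gamma>) = (b \<otimes> \<pi> \<gamma>) \<otimes> \<pi> (\<beta> \<otimes> s \<gamma> \<otimes> inv \<gamma>)"
  proof -
    have "(b \<otimes> \<pi> \<gamma>) \<otimes> \<pi> (\<beta> \<otimes> s \<gamma> \<otimes> inv \<gamma>) = b \<otimes> \<pi> (\<gamma> \<otimes> (\<beta> \<otimes> s \<gamma> \<otimes> inv \<gamma>))"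
      using bc \<beta> \<gamma>(1) by (simp add: \<pi>_mult m_assoc)
    also have "\<gamma> \<otimes> (\<beta> \<otimes> s \<gamma> \<otimes> inv \<gamma>) = \<beta> \<otimes> s \<gamma>"
      using \<beta> \<gamma>(1) by (simp add: m_comm[of _ "inv \<gamma>"] m_assoc[symmetric])
    finally show ?thesis
      using bc \<beta> \<gamma>(1) sb by (simp add: hom_mult[OF s_hom] \<pi>_mult \<pi>_s m_assoc)
  qed
  ultimately have "b \<otimes> \<pi> \<gamma> \<in> \<pi> ` carrier M"
    using no_solution eigen_mult[OF b \<pi>_image_eigen[OF \<gamma>(1) \<pi>\<gamma>]] by blast
  then obtain y where y: "y \<in> carrier M" "b \<otimes> \<pi> \<gamma> = \<pi> y" by auto
  then have "b = \<pi> (y \<otimes> inv \<gamma>)"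
    using bc \<gamma>(1) by (simp add: \<pi>_mult hom_inv'[OF \<pi>_hom] inv_solve_right)
  then show ?thesis using y \<gamma>(1) by blast
qed

text \<open>The powers of \<open>t\<close> applied to \<open>b\<close> with binomial exponents triangularise the action of \<open>t\<close>
  modulo \<open>p\<close>-th powers.\<close>

lemma periodic_imp_image:
  assumes "b \<in> eigen" "\<beta> \<in> carrier M" "(s ^^ (p ^ m)) b = b \<otimes> \<pi> \<beta>"
  shows "b \<in> \<pi> ` carrier M"
  using assms
proof (induction m arbitrary: b \<beta>)
  case 0
  then show ?case using almost_invariant_imp_image by simp
next
  case (Suc m)
  define t where "t = s ^^ (p ^ m)"
  have t: "t \<in> hom M M" unfolding t_def by (rule hom_funpow[OF s_hom])
  have tp: "(t ^^ p) b = b \<otimes> \<pi> \<beta>"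
    using Suc.prems(3) by (simp add: t_def funpow_mult mult.commute)
  have t_eigen: "(t ^^ i) b \<in> eigen" for i
    using eigen_s_pow[OF Suc.prems(1)] by (simp add: t_def funpow_mult)
  then have tc: "(t ^^ i) b \<in> carrier M" for i using eigen_K K_closed by blast
  \<comment> \<open>By Pascal's rule \<open>t\<close> multiplies \<open>e (Suc r)\<close> by the
    inverse of \<open>t (e r)\<close>, up to a boundary term from \<open>i = p\<close>. So the
    \<open>e r\<close> can be shown to lie in the image one after another.\<close>
  define e where "e r = nat_prod (\<lambda>i. (t ^^ i) b [^] (i choose r)) p" for r
  have e_eigen: "e r \<in> eigen" for r
    unfolding e_def by (intro eigen_nat_prod eigen_nat_pow t_eigen)
  then have ec: "e r \<in> carrier M" for r using eigen_K K_closed by blast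
  have t_comm: "\<pi> (t x) = t (\<pi> x)" if "x \<in> carrier M" for x
    unfolding t_def using that by (intro funpow_comm \<pi>_hom s_hom \<pi>_s)
  have te: "t (e r) = nat_prod (\<lambda>i. (t ^^ Suc i) b [^] (i choose r)) p" for r
    unfolding e_def using tc by (simp add: nat_prod_hom[OF t] nat_pow_hom[OF t])
  have e_shift: "b [^] (0 choose r) \<otimes> nat_prod (\<lambda>i. (t ^^ Suc i) b [^] (Suc i choose r)) p =
      e r \<otimes> (b \<otimes> \<pi> \<beta>) [^] (p choose r)" for r
    using nat_prod_Suc_shift[of "\<lambda>i. (t ^^ i) b [^] (i choose r)" p] tc tp by (simp add: e_def del: funpow.simps(2))
  have in_image: "x \<in> \<pi> ` carrier M" if "x \<in> eigen" "y \<in> \<pi> ` carrier M" "t x = x \<otimes> y" for x y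
    using Suc.IH[of x] that by (auto simp: t_def)
  have "e r \<in> \<pi> ` carrier M" if "r < p" for r
    using that
  proof (induction r)
    case 0
    have "b \<otimes> t (e 0) = e 0 \<otimes> (b \<otimes> \<pi> \<beta>)"
      using e_shift[of 0] te[of 0] tc[of 0] Suc.prems(2) by (simp del: funpow.simps(2))
    also have "\<dots> = b \<otimes> (e 0 \<otimes> \<pi> \<beta>)" using ec tc[of 0] Suc.prems(2) by (simp add: m_ac)
    finally have "t (e 0) = e 0 \<otimes> \<pi> \<beta>"
      using ec tc[of 0] Suc.prems(2) hom_in_carrier[OF t] by simp
    then show ?case using in_image[OF e_eigen] Suc.prems(2) by blast
  next
    case (Suc r)
    obtain y where y: "y \<in> carrier M" "e r = \<pi> y" using Suc by auto
    \<comment> \<open>The boundary term at \<open>i = p\<close> has this binomial coefficient as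
      exponent; being a \<open>p\<close>-th power of an element of \<open>K\<close>, it lies in
      \<open>\<pi> K\<close>.\<close>
    have "p dvd (p choose Suc r)" using dvd_choose_prime[of "Suc r" p] prime_p Suc.prems by simp
    then obtain l where l: "p choose Suc r = p * l" by auto
    have "b \<otimes> \<pi> \<beta> \<in> K" using tp t_eigen eigen_K by metis
    then obtain z where z: "z \<in> K" "((b \<otimes> \<pi> \<beta>) [^] l) [^] p = \<pi> z" using K_pow K_nat_pow by meson
    have bb: "b \<otimes> \<pi> \<beta> \<in> carrier M" using tp tc by metis
    have "t (e (Suc r)) \<otimes> t (e r) = nat_prod (\<lambda>i. (t ^^ Suc i) b [^] (Suc i choose Suc r)) p"
      unfolding te using tc
      by (subst nat_prod_mult[symmetric]) (auto simp del: funpow.simps(2) simp: nat_pow_mult add.commute)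
    also have "\<dots> = e (Suc r) \<otimes> \<pi> z"
    proof -
      have "nat_prod (\<lambda>i. (t ^^ Suc i) b [^] (Suc i choose Suc r)) p \<in> carrier M"
        using tc by (intro nat_prod_closed) (simp del: funpow.simps(2))
      then show ?thesis
        using e_shift[of "Suc r"] z bb tc[of 0]
        by (simp add: l nat_pow_pow mult.commute del: funpow.simps(2) binomial_Suc_Suc)
    qed
    finally have "t (e (Suc r)) = e (Suc r) \<otimes> (\<pi> z \<otimes> inv (t (e r)))"
      using ec hom_in_carrier[OF t] K_closed[OF z(1)] by (simp add: inv_solve_right m_assoc[symmetric])
    also have "\<pi> z \<otimes> inv (t (e r)) = \<pi> (z \<otimes> inv (t y))"
      using y K_closed[OF z(1)] hom_in_carrier[OF t y(1)]
      by (simp add: \<pi>_mult hom_inv'[OF \<pi>_hom] t_comm)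
    finally show ?case
      using in_image[OF e_eigen] y K_closed[OF z(1)] hom_in_carrier[OF t y(1)] by blast
  qed
  \<comment> \<open>The exponents \<open>i choose (p - 1)\<close> with \<open>i < p - 1\<close>
    vanish, so the last element of the chain is a conjugate of \<open>b\<close> itself.\<close>
  moreover have "e (p - 1) = (t ^^ (p - 1)) b"
  proof -
    obtain p' where p': "p = Suc p'" using p_gt_1 by (cases p) auto
    have "nat_prod (\<lambda>i. (t ^^ i) b [^] (i choose p')) p' = nat_prod (\<lambda>i. \<one>) p'"
      by (intro nat_prod_cong) (simp add: binomial_eq_0)
    then show ?thesis using tc by (simp add: e_def p' nat_prod_const)
  qed
  ultimately obtain y where y: "y \<in> carrier M" "(t ^^ (p - 1)) b = \<pi> y"
    using p_gt_1 by (metis diff_less imageE less_numeral_extra(1) order_less_trans zero_less_one)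
  have "b \<otimes> \<pi> \<beta> = t ((t ^^ (p - 1)) b)"
    using tp p_gt_1 by (cases p) auto
  also have "\<dots> = \<pi> (t y)" using y t_comm by simp
  finally have "b = \<pi> (t y \<otimes> inv \<beta>)"
    using tc[of 0] Suc.prems(2) hom_in_carrier[OF t y(1)]
    by (simp add: \<pi>_mult hom_inv'[OF \<pi>_hom] inv_solve_right)
  then show ?case using Suc.prems(2) hom_in_carrier[OF t y(1)] by blast
qed

text \<open>As \<open>s ^^ (p ^ n)\<close> is the identity, the periodicity asked for holds with
  \<open>\<beta> = \<one>\<close>.\<close>

lemma eigen_imp_image: "b \<in> eigen \<Longrightarrow> b \<in> \<pi> ` carrier M"
  using periodic_imp_image[of b \<one> n] s_order[of b] eigen_K K_closed hom_one[OF \<pi>_hom]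
  by (simp add: q_eq)

text \<open>If \<open>p\<close>-th roots are adjoined and \<open>\<zeta> = \<beta>\<^sup>p\<close>, the character of \<open>\<beta>\<close> is invariant, hence a
  norm, and \<open>\<beta>\<close> is the norm of some \<open>\<gamma>\<close> up to \<open>c \<in> K\<close>; the hypothesis on \<open>p\<close> and \<open>n\<close> makes
  \<open>c\<^sup>p\<close> the norm of \<open>c\<close> to the subfield of index \<open>p\<close>.\<close>

lemma \<zeta>_is_norm: "\<exists>y\<in>K. norm_prod (s ^^ (p ^ (n - 1))) p y = \<zeta>"
proof (rule ccontr)
  assume neg: "\<not> ?thesis"
  then have \<pi>_pow: "\<pi> x = x [^] p" if "x \<in> carrier M" for x using \<zeta>_norm that by blast
  from neg have pn: "odd p \<or> n \<ge> 2" using \<zeta>_norm by blast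
  have "\<zeta> \<in> eigen"
    using K_\<zeta> K_one \<delta>_\<zeta> hom_one[OF \<pi>_hom] by (auto simp: eigen_def intro!: bexI[of _ \<one>])
  then obtain \<beta> where \<beta>: "\<beta> \<in> carrier M" "\<pi> \<beta> = \<zeta>" using eigen_imp_image by (metis imageE)
  then have \<pi>\<beta>: "\<pi> \<beta> \<in> K" using K_\<zeta> by simp
  note ch = char_of[OF \<beta>(1) \<pi>\<beta>]
  have chc: "char_of \<beta> v \<in> carrier M" if "v \<in> carrier V" for v using hom_in_carrier[OF ch(1) that] .
  have "\<pi> (s \<beta> \<otimes> inv \<beta>) = \<one>" using \<beta> by (simp add: \<pi>_mult hom_inv'[OF \<pi>_hom] \<pi>_s s_\<zeta>)
  then obtain j :: nat where "s \<beta> \<otimes> inv \<beta> = \<zeta> [^] j" using \<pi>_kernel[of "s \<beta> \<otimes> inv \<beta>"] \<beta> by auto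
  then have s\<beta>: "s \<beta> = \<zeta> [^] j \<otimes> \<beta>" using \<beta> by (metis inv_solve_right s_closed \<zeta>_closed nat_pow_closed)
  \<comment> \<open>\<open>s\<close> multiplies \<open>\<beta>\<close> by a power of
    \<open>\<zeta>\<close>, which \<open>V\<close> fixes, so \<open>\<beta>\<close> and
    \<open>s \<beta>\<close> have the same character.\<close>
  have "char_of \<beta> (shift (-1) v) = char_of \<beta> v" if v: "v \<in> carrier V" for v
  proof -
    have sv: "shift (-1) v \<in> carrier V" using v by (rule shift_closed)
    have "\<alpha> v (s \<beta>) = s (char_of \<beta> (shift (-1) v) \<otimes> \<beta>)"
      using \<alpha>_s_pow[OF v \<beta>(1), of 1] ch(3)[OF sv] by simp
    also have "\<dots> = char_of \<beta> (shift (-1) v) \<otimes> s \<beta>"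
      using kernel_fixed[OF chc[OF sv] ch(2)[OF sv] s_hom s_\<zeta>] chc[OF sv] \<beta> by (simp add: hom_mult[OF s_hom])
    finally have "char_of \<beta> (shift (-1) v) \<otimes> s \<beta> = char_of \<beta> v \<otimes> s \<beta>"
      using v \<beta> chc[OF v] ch(3)[OF v] by (simp add: s\<beta> hom_mult[OF \<alpha>_hom] nat_pow_hom[OF \<alpha>_hom] \<alpha>_\<zeta> m_lcomm)
    then show ?thesis using chc v sv \<beta> by simp
  qed
  then obtain \<mu> where \<mu>: "\<mu> \<in> hom V M"
      "\<And>v. v \<in> carrier V \<Longrightarrow> nat_prod (\<lambda>j. \<mu> (shift (- int j) v)) q = char_of \<beta> v"
    and sub: "\<mu> ` carrier V \<subseteq> char_of \<beta> ` carrier V"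
    using invariant_hom_imp_norm[OF comm_group_axioms ch(1)] by blast
  have \<mu>1: "\<pi> (\<mu> v) = \<one>" if "v \<in> carrier V" for v using sub that ch(2) by auto
  obtain \<gamma> where \<gamma>: "\<gamma> \<in> carrier M" "\<And>v. v \<in> carrier V \<Longrightarrow> \<alpha> v \<gamma> = \<mu> v \<otimes> \<gamma>"
    using hilbert90_V[OF \<mu>(1) \<mu>1] by blast
  define N where "N = norm_prod s q \<gamma>"
  have Nc: "N \<in> carrier M" unfolding N_def by (rule norm_prod_closed[OF s_hom \<gamma>(1)])
  define c where "c = \<beta> \<otimes> inv N"
  have cK: "c \<in> K" unfolding c_def
  proof (rule same_char_imp_K[of _ _ "char_of \<beta>"])
    show "\<alpha> v N = char_of \<beta> v \<otimes> N" if "v \<in> carrier V" for v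
      unfolding N_def using \<alpha>_norm_prod[OF \<gamma>(1) \<mu>(1) \<mu>1 \<gamma>(2) that] \<mu>(2)[OF that] by simp
  qed (use \<beta> Nc chc ch in auto)
  then have cc: "c \<in> carrier M" by (rule K_closed)
  have sN: "s N = N"
    using norm_prod_comm[OF s_hom s_hom refl \<gamma>(1)] norm_prod_invariant[OF s_hom \<gamma>(1) s_order[OF \<gamma>(1)]]
    by (simp add: N_def)
  have sc: "s c = \<zeta> [^] j \<otimes> c"
    unfolding c_def using \<beta> Nc s\<beta> sN by (simp add: hom_mult[OF s_hom] hom_inv'[OF s_hom] m_assoc)
  have s_\<zeta>_pow: "s (\<zeta> [^] (i::nat)) = \<zeta> [^] i" for i by (simp add: nat_pow_hom[OF s_hom] s_\<zeta>)
  have s_pow_c: "(s ^^ i) c = \<zeta> [^] (i * j) \<otimes> c" for i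
  proof (induction i)
    case (Suc i)
    then show ?case
      using cc by (simp add: hom_mult[OF s_hom] s_\<zeta>_pow sc nat_pow_mult m_assoc[symmetric] add.commute)
  qed (use cc in simp)
  define m where "m = p ^ (n - 1)"
  let ?t = "s ^^ m"
  have t: "?t \<in> hom M M" by (rule hom_funpow[OF s_hom])
  \<comment> \<open>\<open>s\<close> multiplies \<open>c\<close> by \<open>\<zeta>^j\<close>, so the
    factors of the norm are \<open>\<zeta>^(m i j) c\<close> for \<open>i < p\<close>.\<close>
  have norm_c: "norm_prod ?t p c = c [^] p"
  proof -
    have "norm_prod ?t p c = nat_prod (\<lambda>i. \<zeta> [^] (m * i * j) \<otimes> c) p"
      by (simp add: norm_prod_def funpow_mult s_pow_c mult.commute)
    also have "\<dots> = \<zeta> [^] (\<Sum>i<p. m * i * j) \<otimes> c [^] p"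
      using cc by (simp add: nat_prod_mult nat_prod_pow nat_prod_const)
    also have "p dvd (\<Sum>i<p. m * i * j)"
    proof -
      have "(\<Sum>i<p. m * i * j) = m * j * (\<Sum>i<p. i)" by (subst sum_distrib_left) (simp add: mult_ac)
      \<comment> \<open>Either \<open>n \<ge> 2\<close> and \<open>p\<close> divides
        \<open>m\<close>, or \<open>p\<close> is odd and divides \<open>p (p-1) / 2\<close>; this
        fails exactly for \<open>p^n = 2\<close>.\<close>
      moreover have "p dvd m * (\<Sum>i<p. i)"
      proof (cases "n \<ge> 2")
        case True
        then show ?thesis by (simp add: m_def dvd_power)
      next
        case False
        then have "odd p" using pn by simp
        moreover have "(\<Sum>i<p. i) = p * (p - 1) div 2"
          using gauss_sum_nat[of "p - 1"] p_gt_1 by (simp add: lessThan_Suc_atMost[symmetric] atLeast0AtMost mult.commute)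
        ultimately have "(\<Sum>i<p. i) = p * ((p - 1) div 2)" by (simp add: div_mult_swap)
        then show ?thesis by simp
      qed
      ultimately show ?thesis by (simp add: mult.assoc mult.left_commute)
    qed
    then obtain l where l: "(\<Sum>i<p. m * i * j) = p * l" by auto
    also have "\<zeta> [^] (p * l) \<otimes> c [^] p = c [^] p"
      using cc \<zeta>_pow by (simp add: nat_pow_pow[symmetric])
    finally show ?thesis by simp
  qed
  \<comment> \<open>The part of the norm of \<open>\<gamma>\<close> taken over the first
    \<open>m\<close> powers of \<open>s\<close>; its norm under \<open>s ^^ m\<close> is the full
    norm \<open>N\<close>. \<open>R\<close> itself need not lie in \<open>K\<close>, but
    \<open>\<pi> R\<close> does, since \<open>V\<close> multiplies \<open>R\<close> by elements of
    the kernel of \<open>\<pi>\<close>.\<close>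
  define R where "R = norm_prod s m \<gamma>"
  have Rc: "R \<in> carrier M" unfolding R_def by (rule norm_prod_closed[OF s_hom \<gamma>(1)])
  have norm_R: "norm_prod ?t p R = N"
  proof -
    have sg: "(s ^^ i) \<gamma> \<in> carrier M" for i using \<gamma> by (simp add: hom_in_carrier[OF hom_funpow[OF s_hom]])
    have "q = m * p" using n_pos by (simp add: m_def q_eq power_eq_if)
    then have "N = nat_prod (\<lambda>j. nat_prod (\<lambda>i. (s ^^ (m * j + i)) \<gamma>) m) p"
      using nat_prod_mult_index[of "\<lambda>i. (s ^^ i) \<gamma>" m p] sg by (simp add: N_def norm_prod_def)
    also have "\<dots> = norm_prod ?t p R"
      unfolding norm_prod_def R_def
      by (intro nat_prod_cong) (simp add: funpow_mult nat_prod_hom[OF hom_funpow[OF s_hom]] sg funpow_add mult.commute)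
    finally show ?thesis by simp
  qed
  have "\<pi> R \<in> K"
  proof -
    have "\<alpha> v (\<pi> R) = \<pi> R" if v: "v \<in> carrier V" for v
    proof -
      let ?z = "nat_prod (\<lambda>j. \<mu> (shift (- int j) v)) m"
      have zc: "?z \<in> carrier M" using hom_in_carrier[OF \<mu>(1)] v by (intro nat_prod_closed) (auto simp: shift_closed)
      have "\<pi> ?z = nat_prod (\<lambda>j. \<one>) m"
        using v \<mu>1 hom_in_carrier[OF \<mu>(1)] by (simp add: nat_prod_hom[OF \<pi>_hom] shift_closed)
      then have "\<pi> ?z = \<one>" by (simp add: nat_prod_const)
      moreover have "\<alpha> v R = ?z \<otimes> R" unfolding R_def using \<alpha>_norm_prod[OF \<gamma>(1) \<mu>(1) \<mu>1 \<gamma>(2) v] by simp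
      ultimately show ?thesis using zc Rc v by (simp add: \<pi>_\<alpha>[symmetric] \<pi>_mult)
    qed
    then show ?thesis using Rc by (simp add: K_def)
  qed
  \<comment> \<open>Here \<open>\<pi>\<close> is the \<open>p\<close>-th power map, so the norm
    \<open>c [^] p\<close> of \<open>c\<close> is \<open>\<pi> c\<close>.\<close>
  moreover have "norm_prod ?t p (\<pi> R \<otimes> c) = \<zeta>"
  proof -
    have "norm_prod ?t p (\<pi> R \<otimes> c) = \<pi> N \<otimes> \<pi> c"
      using Rc cc norm_R norm_c \<pi>_pow[OF cc] norm_prod_comm[OF \<pi>_hom t _ Rc, of p]
        funpow_comm[OF \<pi>_hom s_hom \<pi>_s]
      by (simp add: norm_prod_mult[OF t])
    also have "\<dots> = \<pi> (N \<otimes> c)" using Nc cc by (simp add: \<pi>_mult)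
    also have "N \<otimes> c = \<beta>" unfolding c_def using Nc \<beta> by (simp add: m_comm[of \<beta> "inv N"])
    finally show ?thesis using \<beta> by simp
  qed
  ultimately show False using neg K_mult cK unfolding m_def by blast
qed

lemma inverse_mod_p: "d \<in> carrier D \<Longrightarrow> \<exists>u::nat. [w d * u = 1] (mod p)"
proof -
  assume "d \<in> carrier D"
  then have "\<not> p dvd w d" using w_range[of d] by (auto dest: dvd_imp_le)
  then have "coprime (w d) p" using prime_p by (metis coprime_commute prime_imp_coprime)
  then show ?thesis by (metis One_nat_def cong_solve_coprime_nat)
qed

definition w' :: "'d \<Rightarrow> nat" where "w' d = (SOME u. [w d * u = 1] (mod p))"

lemma w': "d \<in> carrier D \<Longrightarrow> [w d * w' d = 1] (mod p)"
  unfolding w'_def by (rule someI_ex[OF inverse_mod_p])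

text \<open>The operator of the group ring of \<open>D\<close> that sums the
  \<open>w(d)^-1 d\<close>, without division by the order of \<open>D\<close>. It therefore raises
  \<open>\<zeta>\<close> to the power \<open>card (carrier D)\<close>, a number prime to
  \<open>p\<close>.\<close>

definition proj :: "'x \<Rightarrow> 'x" where "proj x = (\<Otimes>d\<in>carrier D. \<delta> d x [^] w' d)"

lemma proj_hom: "proj \<in> hom M M"
proof (rule homI)
  fix x y assume x: "x \<in> carrier M" and y: "y \<in> carrier M"
  have "proj (x \<otimes> y) = (\<Otimes>d\<in>carrier D. \<delta> d x [^] w' d \<otimes> \<delta> d y [^] w' d)"
    unfolding proj_def using x y by (intro finprod_cong') (auto simp: hom_mult[OF \<delta>_hom] nat_pow_distrib)
  also have "\<dots> = proj x \<otimes> proj y"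
    unfolding proj_def using x y by (intro finprod_multf) auto
  finally show "proj (x \<otimes> y) = proj x \<otimes> proj y" .
qed (auto simp: proj_def)

lemma proj_comm:
  assumes "h \<in> hom M M" "\<And>d x. d \<in> carrier D \<Longrightarrow> x \<in> carrier M \<Longrightarrow> h (\<delta> d x) = \<delta> d (h x)" "x \<in> carrier M"
  shows "h (proj x) = proj (h x)"
  unfolding proj_def using assms D_finite
  by (subst hom_finprod') (auto simp: nat_pow_hom[OF assms(1)] hom_in_carrier[OF assms(1)] intro!: finprod_cong')

lemma K_proj: "x \<in> K \<Longrightarrow> proj x \<in> K"
  using K_hom[OF proj_hom] proj_comm[OF \<alpha>_hom] \<delta>_\<alpha> by metis

text \<open>The \<open>p\<close>-th powers of elements of \<open>K\<close> lie in
  \<open>\<pi> K\<close>, so modulo \<open>\<pi> K\<close> exponents may be reduced mod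
  \<open>p\<close>.\<close>

lemma pow_mod_p: "[a = b] (mod p) \<Longrightarrow> x \<in> K \<Longrightarrow> \<exists>c\<in>K. x [^] a = x [^] b \<otimes> \<pi> c"
proof -
  assume ab: "[a = b] (mod p)" and x: "x \<in> K"
  note xc = K_closed[OF x]
  obtain y where y: "y \<in> K" "x [^] p = \<pi> y" using K_pow x by blast
  then have yc: "y \<in> carrier M" by (simp add: K_closed)
  have "x [^] a = x [^] (a mod p) \<otimes> \<pi> (y [^] (a div p))" for a
  proof -
    have "x [^] a = x [^] (a mod p) \<otimes> (x [^] p) [^] (a div p)"
      using xc by (simp add: nat_pow_pow nat_pow_mult)
    then show ?thesis using y yc by (simp add: nat_pow_hom[OF \<pi>_hom])
  qed
  from this[of a] this[of b] have "x [^] a = x [^] b \<otimes> \<pi> (inv (y [^] (b div p)) \<otimes> y [^] (a div p))"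
    using ab xc yc by (simp add: cong_def \<pi>_mult hom_inv'[OF \<pi>_hom] m_assoc)
  then show ?thesis using K_mult K_inv K_nat_pow y by blast
qed

text \<open>Translating the product by \<open>d\<close> replaces the exponent at \<open>e\<close> by
  the inverse of \<open>w\<close> at the quotient of \<open>e\<close> by \<open>d\<close>, which is
  \<open>w' e * w d\<close> mod \<open>p\<close>. Changing exponents mod \<open>p\<close> costs only
  factors in \<open>\<pi> K\<close>.\<close>

lemma eigen_proj:
  assumes x: "x \<in> K" shows "proj x \<in> eigen"
proof -
  interpret D: group D by (rule D_group)
  note xc = K_closed[OF x]
  have "\<exists>c\<in>K. \<delta> d (proj x) = proj x [^] w d \<otimes> \<pi> c" if d: "d \<in> carrier D" for d
  proof -
    have "\<delta> d (proj x) = (\<Otimes>e\<in>carrier D. \<delta> (d \<otimes>\<^bsub>D\<^esub> e) x [^] w' e)"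
      unfolding proj_def using d xc D_finite
      by (subst hom_finprod'[OF \<delta>_hom]) (auto simp: nat_pow_hom[OF \<delta>_hom] \<delta>_mult intro!: finprod_cong')
    also have "\<dots> = (\<Otimes>e\<in>carrier D. \<delta> e x [^] w' (inv\<^bsub>D\<^esub> d \<otimes>\<^bsub>D\<^esub> e))"
    proof -
      have bij: "(\<lambda>e. d \<otimes>\<^bsub>D\<^esub> e) ` carrier D = carrier D"
        using d D.surj_const_mult by blast
      have "(\<Otimes>e\<in>(\<lambda>e. d \<otimes>\<^bsub>D\<^esub> e) ` carrier D. \<delta> e x [^] w' (inv\<^bsub>D\<^esub> d \<otimes>\<^bsub>D\<^esub> e)) =
            (\<Otimes>e\<in>carrier D. \<delta> (d \<otimes>\<^bsub>D\<^esub> e) x [^] w' (inv\<^bsub>D\<^esub> d \<otimes>\<^bsub>D\<^esub> (d \<otimes>\<^bsub>D\<^esub> e)))"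
        using d xc by (intro finprod_reindex) (auto simp: inj_on_def)
      also have "\<dots> = (\<Otimes>e\<in>carrier D. \<delta> (d \<otimes>\<^bsub>D\<^esub> e) x [^] w' e)"
        using d xc by (intro finprod_cong') (auto simp: D.m_assoc[symmetric])
      finally show ?thesis unfolding bij by simp
    qed
    finally have 1: "\<delta> d (proj x) = (\<Otimes>e\<in>carrier D. \<delta> e x [^] w' (inv\<^bsub>D\<^esub> d \<otimes>\<^bsub>D\<^esub> e))" .
    have "\<exists>c\<in>K. \<delta> e x [^] w' (inv\<^bsub>D\<^esub> d \<otimes>\<^bsub>D\<^esub> e) = \<delta> e x [^] (w' e * w d) \<otimes> \<pi> c" if e: "e \<in> carrier D" for e
    proof (rule pow_mod_p[OF _ K_\<delta>[OF e x]])
      let ?f = "inv\<^bsub>D\<^esub> d \<otimes>\<^bsub>D\<^esub> e"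
      have f: "?f \<in> carrier D" using d e by simp
      have "e = d \<otimes>\<^bsub>D\<^esub> ?f" using d e by (simp add: D.m_assoc[symmetric])
      then have we: "[w e = w d * w ?f] (mod p)" using w_mult[OF d f] by simp
      have "[w' ?f * (w e * w' e) = w' ?f * 1] (mod p)" using w'[OF e] by (intro cong_scalar_left)
      moreover have "[w' ?f * (w e * w' e) = w' ?f * ((w d * w ?f) * w' e)] (mod p)"
        using we by (intro cong_scalar_left cong_scalar_right)
      moreover have "w' ?f * ((w d * w ?f) * w' e) = (w ?f * w' ?f) * (w' e * w d)" by (simp add: mult_ac)
      moreover have "[(w ?f * w' ?f) * (w' e * w d) = 1 * (w' e * w d)] (mod p)"
        using w'[OF f] by (intro cong_scalar_right)
      ultimately show "[w' ?f = w' e * w d] (mod p)" by (metis cong_sym cong_trans mult_1 mult.right_neutral)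
    qed
    then obtain c where c: "\<And>e. e \<in> carrier D \<Longrightarrow> c e \<in> K"
        "\<And>e. e \<in> carrier D \<Longrightarrow> \<delta> e x [^] w' (inv\<^bsub>D\<^esub> d \<otimes>\<^bsub>D\<^esub> e) = \<delta> e x [^] (w' e * w d) \<otimes> \<pi> (c e)"
      by metis
    have cc: "c e \<in> carrier M" if "e \<in> carrier D" for e using c that K_closed by blast
    have "\<delta> d (proj x) = (\<Otimes>e\<in>carrier D. (\<delta> e x [^] w' e) [^] w d \<otimes> \<pi> (c e))"
      unfolding 1 using c cc xc by (intro finprod_cong') (auto simp: nat_pow_pow)
    also have "\<dots> = (\<Otimes>e\<in>carrier D. (\<delta> e x [^] w' e) [^] w d) \<otimes> (\<Otimes>e\<in>carrier D. \<pi> (c e))"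
      using xc cc by (intro finprod_multf) auto
    also have "(\<Otimes>e\<in>carrier D. (\<delta> e x [^] w' e) [^] w d) = proj x [^] w d"
    proof -
      have "(\<lambda>y. y [^] w d) \<in> hom M M" by (rule homI) (auto simp: nat_pow_distrib)
      then show ?thesis unfolding proj_def using hom_finprod'[of "\<lambda>y. y [^] w d" "carrier D"] D_finite xc by simp
    qed
    also have "(\<Otimes>e\<in>carrier D. \<pi> (c e)) = \<pi> (\<Otimes>e\<in>carrier D. c e)"
      using hom_finprod'[OF \<pi>_hom D_finite] cc by simp
    finally have "\<delta> d (proj x) = proj x [^] w d \<otimes> \<pi> (\<Otimes>e\<in>carrier D. c e)" .
    moreover have "(\<Otimes>e\<in>A. c e) \<in> K" if "A \<subseteq> carrier D" for A
      using finite_subset[OF that D_finite] that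
    proof (induction A rule: finite_induct)
      case (insert a A)
      then show ?case using cc c(1) by (subst finprod_insert) (auto intro!: K_mult)
    qed (simp add: K_one)
    ultimately show ?thesis by blast
  qed
  then show ?thesis using K_proj[OF x] by (simp add: eigen_def)
qed

lemma contradiction: False
proof -
  define m where "m = p ^ (n - 1)"
  let ?t = "s ^^ m"
  have t: "?t \<in> hom M M" by (rule hom_funpow[OF s_hom])
  have tt: "(?t ^^ p) x = x" if "x \<in> carrier M" for x
  proof -
    have "q = m * p" using n_pos by (simp add: m_def q_eq power_eq_if)
    then show ?thesis using s_order[OF that] by (simp add: funpow_mult)
  qed
  have \<pi>t: "\<pi> (?t x) = ?t (\<pi> x)" if "x \<in> carrier M" for x
    using that by (intro funpow_comm \<pi>_hom s_hom \<pi>_s)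
  obtain y where y: "y \<in> K" "norm_prod ?t p y = \<zeta>" using \<zeta>_is_norm unfolding m_def by blast
  have yc: "y \<in> carrier M" using y by (simp add: K_closed)
  \<comment> \<open>Here \<open>y\<close> is the element called \<open>\<delta>\<close> in the
    overview; as \<open>\<pi> \<zeta>\<close> is trivial, Hilbert 90 applies to
    \<open>\<pi> y\<close>.\<close>
  have "norm_prod ?t p (\<pi> y) = \<pi> \<zeta>" using norm_prod_comm[OF \<pi>_hom t \<pi>t yc, of p] y(2) by metis
  also have "\<pi> \<zeta> = \<one>" using \<pi>_kernel[of \<zeta>] nat_pow_eone[of \<zeta>] by (metis \<zeta>_closed)
  finally obtain b where b: "b \<in> K" "?t b = \<pi> y \<otimes> b" 
    using hilbert90_K[OF K_\<pi>[OF y(1)]] unfolding m_def by blast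
  have bc: "b \<in> carrier M" using b by (simp add: K_closed)
  note pc = hom_in_carrier[OF proj_hom]
  have pt: "proj (?t x) = ?t (proj x)" if "x \<in> carrier M" for x
    using that proj_comm[OF s_hom] \<delta>_s by (intro funpow_comm proj_hom s_hom) auto
  have p\<pi>: "proj (\<pi> x) = \<pi> (proj x)" if "x \<in> carrier M" for x
    using that proj_comm[OF \<pi>_hom] \<pi>_\<delta> by auto
  obtain \<beta> where \<beta>: "\<beta> \<in> carrier M" "proj b = \<pi> \<beta>" using eigen_imp_image[OF eigen_proj[OF b(1)]] by auto
  have "\<pi> (?t \<beta>) = ?t (proj b)" using \<beta> \<pi>t by simp
  also have "\<dots> = \<pi> (proj y) \<otimes> \<pi> \<beta>"
    using pt[OF bc] b(2) bc yc \<beta> p\<pi> by (simp add: hom_mult[OF proj_hom])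
  also have "\<dots> = \<pi> (proj y \<otimes> \<beta>)" using pc[OF yc] \<beta> by (simp add: \<pi>_mult)
  \<comment> \<open>\<open>?t \<beta>\<close> and \<open>proj y \<otimes> \<beta>\<close> have the
    same image under \<open>\<pi>\<close>, so they differ by a power of \<open>\<zeta>\<close>. Its
    norm is trivial, and those of \<open>\<beta>\<close> and \<open>?t \<beta>\<close> agree; what
    is left is the norm of \<open>proj y\<close>, that is, \<open>proj \<zeta>\<close>.\<close>
  finally have "\<pi> (?t \<beta> \<otimes> inv (proj y \<otimes> \<beta>)) = \<one>"
    using pc[OF yc] \<beta> hom_in_carrier[OF t \<beta>(1)] by (simp add: \<pi>_mult hom_inv'[OF \<pi>_hom] del: inv_mult_group)
  then obtain j :: nat where "?t \<beta> \<otimes> inv (proj y \<otimes> \<beta>) = \<zeta> [^] j"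
    using \<pi>_kernel pc[OF yc] \<beta> hom_in_carrier[OF t \<beta>(1)] by (metis inv_closed m_closed)
  then have "?t \<beta> = \<zeta> [^] j \<otimes> (proj y \<otimes> \<beta>)"
    using pc[OF yc] \<beta> hom_in_carrier[OF t \<beta>(1)] by (metis inv_solve_right m_closed \<zeta>_closed nat_pow_closed)
  then have "norm_prod ?t p (?t \<beta>) = norm_prod ?t p (\<zeta> [^] j) \<otimes> (norm_prod ?t p (proj y) \<otimes> norm_prod ?t p \<beta>)"
    using pc[OF yc] \<beta> by (simp add: norm_prod_mult[OF t])
  moreover have "norm_prod ?t p (?t \<beta>) = norm_prod ?t p \<beta>"
    using \<beta> tt by (intro norm_prod_invariant t)
  moreover have "norm_prod ?t p (\<zeta> [^] j) = \<one>"
  proof -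
    have "(s ^^ i) (\<zeta> [^] j) = \<zeta> [^] j" for i by (induction i) (auto simp: nat_pow_hom[OF s_hom] s_\<zeta>)
    then have "norm_prod ?t p (\<zeta> [^] j) = (\<zeta> [^] j) [^] p" by (simp add: norm_prod_def funpow_mult nat_prod_const)
    also have "\<dots> = (\<zeta> [^] p) [^] j" by (simp add: nat_pow_pow mult.commute)
    finally show ?thesis by (simp add: \<zeta>_pow)
  qed
  ultimately have "norm_prod ?t p (proj y) = \<one>"
    using norm_prod_closed[OF t \<beta>(1)] norm_prod_closed[OF t pc[OF yc]] by simp
  then have "proj \<zeta> = \<one>" using norm_prod_comm[OF proj_hom t pt yc, of p] y(2) by metis
  moreover have "proj \<zeta> = \<zeta> [^] card (carrier D)"
  proof -
    have "\<delta> d \<zeta> [^] w' d = \<zeta>" if "d \<in> carrier D" for d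
    proof -
      have "\<delta> d \<zeta> [^] w' d = \<zeta> [^] (w d * w' d)" using that by (simp add: \<delta>_\<zeta> nat_pow_pow)
      also have "\<dots> = \<zeta> [^] (w d * w' d mod p + p * (w d * w' d div p))" by simp
      also have "\<dots> = \<zeta> [^] (w d * w' d mod p) \<otimes> (\<zeta> [^] p) [^] (w d * w' d div p)"
        by (simp add: nat_pow_mult nat_pow_pow)
      also have "\<dots> = \<zeta>" using w'[OF that] p_gt_1 by (simp add: cong_def \<zeta>_pow)
      finally show ?thesis .
    qed
    then have "proj \<zeta> = (\<Otimes>d\<in>carrier D. \<zeta>)" unfolding proj_def by (intro finprod_cong') auto
    then show ?thesis by (simp add: finprod_const)
  qed
  ultimately have "\<zeta> [^] card (carrier D) = \<one>" by simp
  moreover have "coprime (card (carrier D)) p"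
  proof -
    have "card (carrier D) > 0" using D_finite group.subgroup_self[OF D_group] subgroup.one_closed by (fastforce simp: card_gt_0_iff)
    then have "\<not> p dvd card (carrier D)" using D_small by (auto dest: dvd_imp_le)
    then show ?thesis using prime_p by (metis coprime_commute prime_imp_coprime)
  qed
  then obtain u v where "card (carrier D) * u = p * v + 1"
    using coprime_bezout_strong[of "card (carrier D)" p] p_gt_1 by auto
  then have "\<zeta> [^] (card (carrier D) * u) = \<zeta>" by (simp add: nat_pow_mult[symmetric] nat_pow_pow[symmetric] \<zeta>_pow)
  ultimately show False using \<zeta>_not_one by (simp add: nat_pow_pow[symmetric])
qed

end

text \<open>The contradiction refutes \<open>no_solution\<close>; this is its negation with
  \<open>eigen\<close> written out.\<close>

theorem exists_invariant_non_image:
  "\<exists>b\<in>K. b \<notin> \<pi> ` carrier M \<and> (\<exists>c\<in>K. s b = b \<otimes> \<pi> c) \<and>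
     (\<forall>d\<in>carrier D. \<exists>c\<in>K. \<delta> d b = b [^] w d \<otimes> \<pi> c)"
proof -
  have "\<exists>b c. b \<in> eigen \<and> c \<in> K \<and> s b = b \<otimes> \<pi> c \<and> b \<notin> \<pi> ` carrier M"
    using contradiction by blast
  then show ?thesis unfolding eigen_def by blast
qed

end

section \<open>Galois theory in an algebraic closure\<close>

context field begin

lemma carrier_Gal:
  "carrier (Gal R K F) = {\<tau> \<in> Bij K. \<tau> \<in> ring_hom (R\<lparr>carrier := K\<rparr>) (R\<lparr>carrier := K\<rparr>) \<and> (\<forall>x\<in>F. \<tau> x = x)}"
  by (simp add: Gal_def)

lemma one_Gal: "\<one>\<^bsub>Gal R K F\<^esub> = (\<lambda>x\<in>K. x)"
  by (simp add: Gal_def BijGroup_def)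

lemma mult_Gal:
  "a \<in> carrier (Gal R K F) \<Longrightarrow> b \<in> carrier (Gal R K F) \<Longrightarrow> a \<otimes>\<^bsub>Gal R K F\<^esub> b = compose K a b"
  by (simp add: Gal_def BijGroup_def)

lemma GalD:
  assumes "\<tau> \<in> carrier (Gal R K F)"
  shows "\<And>x. x \<in> K \<Longrightarrow> \<tau> x \<in> K" "\<And>x y. x \<in> K \<Longrightarrow> y \<in> K \<Longrightarrow> \<tau> (x \<oplus> y) = \<tau> x \<oplus> \<tau> y"
    "\<And>x y. x \<in> K \<Longrightarrow> y \<in> K \<Longrightarrow> \<tau> (x \<otimes> y) = \<tau> x \<otimes> \<tau> y" "\<tau> \<one> = \<one>" "\<And>x. x \<in> F \<Longrightarrow> \<tau> x = x"
    "\<tau> \<in> extensional K" "inj_on \<tau> K" "\<tau> ` K = K"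
  using assms by (auto simp: carrier_Gal ring_hom_def Bij_def bij_betw_def)

lemma GalI:
  assumes "\<tau> \<in> extensional K" "bij_betw \<tau> K K"
    "\<And>x y. x \<in> K \<Longrightarrow> y \<in> K \<Longrightarrow> \<tau> (x \<oplus> y) = \<tau> x \<oplus> \<tau> y"
    "\<And>x y. x \<in> K \<Longrightarrow> y \<in> K \<Longrightarrow> \<tau> (x \<otimes> y) = \<tau> x \<otimes> \<tau> y" "\<tau> \<one> = \<one>" "\<And>x. x \<in> F \<Longrightarrow> \<tau> x = x"
  shows "\<tau> \<in> carrier (Gal R K F)"
  using assms bij_betwE[OF assms(2)] by (auto simp: carrier_Gal ring_hom_def Bij_def)

lemma mult_Gal_apply:
  "a \<in> carrier (Gal R K F) \<Longrightarrow> b \<in> carrier (Gal R K F) \<Longrightarrow> x \<in> K \<Longrightarrow> (a \<otimes>\<^bsub>Gal R K F\<^esub> b) x = a (b x)"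
  by (simp add: mult_Gal compose_def)

lemma Gal_eqI:
  assumes "a \<in> carrier (Gal R K F)" "b \<in> carrier (Gal R K F')" "\<And>x. x \<in> K \<Longrightarrow> a x = b x"
  shows "a = b"
  using GalD(6)[OF assms(1)] GalD(6)[OF assms(2)] assms(3) by (rule extensionalityI)

lemma subfieldD:
  assumes "subfield K R"
  shows "K \<subseteq> carrier R" "\<zero> \<in> K" "\<one> \<in> K" "\<And>x. x \<in> K \<Longrightarrow> \<ominus> x \<in> K"
    "\<And>x y. x \<in> K \<Longrightarrow> y \<in> K \<Longrightarrow> x \<oplus> y \<in> K" "\<And>x y. x \<in> K \<Longrightarrow> y \<in> K \<Longrightarrow> x \<otimes> y \<in> K"
    "\<And>x. x \<in> K \<Longrightarrow> x \<noteq> \<zero> \<Longrightarrow> inv x \<in> K" "\<And>x. x \<in> K \<Longrightarrow> x \<in> carrier R"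
  using subfieldE[OF assms] subringE[OF subfieldE(1)[OF assms]] subfield_m_inv(1)[OF assms] by auto

lemma group_Gal:
  assumes K: "subfield K R" and F: "F \<subseteq> K"
  shows "group (Gal R K F)"
proof (rule groupI)
  note sK = subfieldD[OF K]
  fix a b assume a: "a \<in> carrier (Gal R K F)" and b: "b \<in> carrier (Gal R K F)"
  show "a \<otimes>\<^bsub>Gal R K F\<^esub> b \<in> carrier (Gal R K F)"
  proof (rule GalI)
    have "bij_betw a K K" "bij_betw b K K" using GalD[OF a] GalD[OF b] by (auto simp: bij_betw_def)
    then show "bij_betw (a \<otimes>\<^bsub>Gal R K F\<^esub> b) K K"
      unfolding mult_Gal[OF a b] by (blast intro: bij_betw_compose)
  qed (use a b sK F GalD[OF a] GalD[OF b] in \<open>auto simp: mult_Gal compose_def\<close>)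
next
  note sK = subfieldD[OF K]
  show "\<one>\<^bsub>Gal R K F\<^esub> \<in> carrier (Gal R K F)"
    using sK F by (intro GalI) (auto simp: one_Gal bij_betw_def inj_on_def)
next
  fix a b c assume abc: "a \<in> carrier (Gal R K F)" "b \<in> carrier (Gal R K F)" "c \<in> carrier (Gal R K F)"
  then have Bij: "a \<in> Bij K" "b \<in> Bij K" "c \<in> Bij K" by (auto simp: carrier_Gal)
  have "monoid.mult (Gal R K F) = monoid.mult (BijGroup K)" by (simp add: Gal_def)
  then show "a \<otimes>\<^bsub>Gal R K F\<^esub> b \<otimes>\<^bsub>Gal R K F\<^esub> c = a \<otimes>\<^bsub>Gal R K F\<^esub> (b \<otimes>\<^bsub>Gal R K F\<^esub> c)"
    using group.is_monoid[OF group_BijGroup[of K]] Bij monoid.m_assoc[of "BijGroup K" a b c]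
    by (simp add: BijGroup_def)
next
  fix a assume a: "a \<in> carrier (Gal R K F)"
  then have "a \<in> Bij K" by (auto simp: carrier_Gal)
  have "monoid.mult (Gal R K F) = monoid.mult (BijGroup K)" "one (Gal R K F) = one (BijGroup K)" by (auto simp: Gal_def)
  then show "\<one>\<^bsub>Gal R K F\<^esub> \<otimes>\<^bsub>Gal R K F\<^esub> a = a"
    using group.is_monoid[OF group_BijGroup[of K]] \<open>a \<in> Bij K\<close> monoid.l_one[of "BijGroup K" a]
    by (simp add: BijGroup_def)
next
  note sK = subfieldD[OF K]
  fix a assume a: "a \<in> carrier (Gal R K F)"
  note A = GalD[OF a]
  define b where "b = restrict (inv_into K a) K"
  have ba: "b (a x) = x" if "x \<in> K" for x using that A by (simp add: b_def)
  have ab: "a (b x) = x" if "x \<in> K" for x using that A f_inv_into_f[of x a K] by (simp add: b_def)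
  have bK: "b x \<in> K" if "x \<in> K" for x using that A inv_into_into[of x a K] by (simp add: b_def)
  have b: "b \<in> carrier (Gal R K F)"
  proof (rule GalI)
    show "b \<in> extensional K" by (simp add: b_def)
    show "bij_betw b K K" using ba ab bK A(1) by (intro bij_betwI[where g = a]) auto
    show "b (x \<oplus> y) = b x \<oplus> b y" if "x \<in> K" "y \<in> K" for x y
      using that sK(5) A(2)[of "b x" "b y"] ba[of "b x \<oplus> b y"] ab bK by metis
    show "b (x \<otimes> y) = b x \<otimes> b y" if "x \<in> K" "y \<in> K" for x y
      using that sK(6) A(3)[of "b x" "b y"] ba[of "b x \<otimes> b y"] ab bK by metis
    show "b \<one> = \<one>" using ba[OF sK(3)] A(4) by simp
    show "b x = x" if "x \<in> F" for x using that F ba[of x] A(5)[OF that] by auto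
  qed
  have "b \<otimes>\<^bsub>Gal R K F\<^esub> a = \<one>\<^bsub>Gal R K F\<^esub>"
    using ba by (auto simp: mult_Gal[OF b a] one_Gal compose_def intro!: restrict_ext)
  then show "\<exists>b\<in>carrier (Gal R K F). b \<otimes>\<^bsub>Gal R K F\<^esub> a = \<one>\<^bsub>Gal R K F\<^esub>" using b by blast
qed

lemma Gal_zero: 
  assumes "subfield K R" "\<tau> \<in> carrier (Gal R K F)" shows "\<tau> \<zero> = \<zero>"
proof -
  note sK = subfieldD[OF assms(1)]
  have "\<tau> \<zero> \<oplus> \<tau> \<zero> = \<tau> \<zero>" using GalD(2)[OF assms(2) sK(2) sK(2)] by simp
  moreover have "\<tau> \<zero> \<in> carrier R" using GalD(1)[OF assms(2) sK(2)] sK by auto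
  ultimately show ?thesis using add.l_cancel_one' by metis
qed

lemma Gal_minus:
  assumes "subfield K R" "\<tau> \<in> carrier (Gal R K F)" "x \<in> K" shows "\<tau> (\<ominus> x) = \<ominus> \<tau> x"
proof -
  note sK = subfieldD[OF assms(1)]
  have "\<tau> (\<ominus> x) \<oplus> \<tau> x = \<zero>"
    using GalD(2)[OF assms(2), of "\<ominus> x" x] Gal_zero[OF assms(1,2)] assms sK by (simp add: l_neg)
  then show ?thesis using GalD(1)[OF assms(2)] assms(3) sK minus_equality by metis
qed

lemma Gal_nonzero:
  assumes "subfield K R" "\<tau> \<in> carrier (Gal R K F)" "x \<in> K" "x \<noteq> \<zero>" shows "\<tau> x \<noteq> \<zero>"
  using GalD(7)[OF assms(2)] Gal_zero[OF assms(1,2)] assms(3,4) subfieldD(2)[OF assms(1)]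
  by (metis inj_onD)

lemma Gal_inverse:
  assumes "subfield K R" "\<tau> \<in> carrier (Gal R K F)" "x \<in> K" "x \<noteq> \<zero>" shows "\<tau> (inv x) = inv (\<tau> x)"
proof -
  note sK = subfieldD[OF assms(1)]
  have "\<tau> x \<otimes> \<tau> (inv x) = \<one>"
    using GalD(3)[OF assms(2), of x "inv x"] GalD(4)[OF assms(2)] assms sK field_Units by simp
  then show ?thesis using comm_inv_char[of "\<tau> x" "\<tau> (inv x)"] GalD(1)[OF assms(2)] assms sK by auto
qed

lemma subfield_finsum:
  assumes "subfield K R" "\<And>i. i \<in> A \<Longrightarrow> f i \<in> K" "finite A"
  shows "finsum R f A \<in> K"
  using assms(3,2)
proof (induction A rule: finite_induct)
  case (insert a A)
  then show ?case using subfieldD[OF assms(1)] by (subst finsum_insert) auto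
qed (use subfieldD[OF assms(1)] in auto)

lemma Gal_finsum:
  assumes "subfield K R" "\<tau> \<in> carrier (Gal R K F)" "finite A" "\<And>i. i \<in> A \<Longrightarrow> f i \<in> K"
  shows "\<tau> (finsum R f A) = (\<Oplus>i\<in>A. \<tau> (f i))"
  using assms(3,4)
proof (induction A rule: finite_induct)
  case (insert a A)
  note sK = subfieldD[OF assms(1)] and G = GalD[OF assms(2)]
  have "\<tau> (finsum R f (insert a A)) = \<tau> (f a \<oplus> finsum R f A)"
    using insert sK by (subst finsum_insert) auto
  also have "\<dots> = \<tau> (f a) \<oplus> (\<Oplus>i\<in>A. \<tau> (f i))"
    using insert G(2)[of "f a" "finsum R f A"] subfield_finsum[OF assms(1), of A f] by simp
  also have "\<dots> = (\<Oplus>i\<in>insert a A. \<tau> (f i))"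
    using insert sK G(1) by (subst finsum_insert) auto
  finally show ?case .
qed (simp add: Gal_zero[OF assms(1,2)])

text \<open>Dedekind's argument: taking the relation at \<open>y \<otimes> x\<close> and subtracting
  \<open>g y\<close> times the relation at \<open>x\<close> eliminates \<open>g\<close> and
  multiplies the coefficient of \<open>h\<close> by \<open>h y \<ominus> g y\<close>, which is
  nonzero for a suitable \<open>y\<close>.\<close>

lemma characters_independent:
  assumes K: "K \<subseteq> carrier R" "\<one> \<in> K" "\<And>x y. x \<in> K \<Longrightarrow> y \<in> K \<Longrightarrow> x \<otimes> y \<in> K"
    and "finite H"
    and "\<And>h x. h \<in> H \<Longrightarrow> x \<in> K \<Longrightarrow> h x \<in> carrier R"
    and "\<And>h x y. h \<in> H \<Longrightarrow> x \<in> K \<Longrightarrow> y \<in> K \<Longrightarrow> h (x \<otimes> y) = h x \<otimes> h y"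
    and "\<And>h. h \<in> H \<Longrightarrow> h \<one> = \<one>"
    and "\<And>h h'. h \<in> H \<Longrightarrow> h' \<in> H \<Longrightarrow> h \<noteq> h' \<Longrightarrow> \<exists>x\<in>K. h x \<noteq> h' x"
    and "\<And>h. h \<in> H \<Longrightarrow> c h \<in> carrier R"
    and "\<And>x. x \<in> K \<Longrightarrow> (\<Oplus>h\<in>H. c h \<otimes> h x) = \<zero>"
    and "h \<in> H"
  shows "c h = \<zero>"
  using assms(4-)
proof (induction H arbitrary: c h rule: finite_induct)
  case (insert g H)
  note H = insert.prems(1-5) and sum0 = insert.prems(6)
  have cH: "c h = \<zero>" if h: "h \<in> H" for h
  proof -
    obtain y where y: "y \<in> K" "h y \<noteq> g y" using H(4)[of h g] h insert.hyps by auto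
    have yc: "h' y \<in> carrier R" if "h' \<in> insert g H" for h' using H(1) y that by blast
    have "c h \<otimes> (h y \<ominus> g y) = \<zero>"
    proof (rule insert.IH[of "\<lambda>h. c h \<otimes> (h y \<ominus> g y)"])
      fix x assume x: "x \<in> K"
      have xc: "h' x \<in> carrier R" if "h' \<in> insert g H" for h' using H(1) x that by blast
      have summand: "c h' \<otimes> h' (y \<otimes> x) \<oplus> \<ominus> (g y) \<otimes> (c h' \<otimes> h' x) = (c h' \<otimes> (h' y \<ominus> g y)) \<otimes> h' x"
        if "h' \<in> insert g H" for h'
      proof -
        have "c h' \<in> carrier R" "h' y \<in> carrier R" "h' x \<in> carrier R" "g y \<in> carrier R"
          using H(5) yc xc that by auto
        then show ?thesis using H(2)[OF that y(1) x] by (simp, algebra)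
      qed
      have "(\<Oplus>h'\<in>insert g H. (c h' \<otimes> (h' y \<ominus> g y)) \<otimes> h' x)
          = (\<Oplus>h'\<in>insert g H. c h' \<otimes> h' (y \<otimes> x) \<oplus> \<ominus> (g y) \<otimes> (c h' \<otimes> h' x))"
        using H yc xc x y K by (intro finsum_cong' refl) (auto simp: summand)
      also have "\<dots> = (\<Oplus>h'\<in>insert g H. c h' \<otimes> h' (y \<otimes> x)) \<oplus> (\<Oplus>h'\<in>insert g H. \<ominus> (g y) \<otimes> (c h' \<otimes> h' x))"
        using H(1,5) yc xc x y K by (intro finsum_addf) (auto simp: K(3))
      also have "(\<Oplus>h'\<in>insert g H. \<ominus> (g y) \<otimes> (c h' \<otimes> h' x)) = \<ominus> (g y) \<otimes> (\<Oplus>h'\<in>insert g H. c h' \<otimes> h' x)"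
        using insert.hyps H(5) yc xc by (intro finsum_rdistr[symmetric]) auto
      finally have "(\<Oplus>h'\<in>insert g H. (c h' \<otimes> (h' y \<ominus> g y)) \<otimes> h' x) = \<zero>"
        using sum0[OF x] sum0[of "y \<otimes> x"] K(3) x y yc by simp
      moreover have "(\<Oplus>h'\<in>insert g H. (c h' \<otimes> (h' y \<ominus> g y)) \<otimes> h' x)
          = (c g \<otimes> (g y \<ominus> g y)) \<otimes> g x \<oplus> (\<Oplus>h'\<in>H. (c h' \<otimes> (h' y \<ominus> g y)) \<otimes> h' x)"
        using insert.hyps H(5) yc xc by (intro finsum_insert) auto
      moreover have "(c g \<otimes> (g y \<ominus> g y)) \<otimes> g x = \<zero>"
        using H(5)[of g] yc[of g] xc[of g] by (simp add: minus_eq r_neg)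
      moreover have "(\<Oplus>h'\<in>H. (c h' \<otimes> (h' y \<ominus> g y)) \<otimes> h' x) \<in> carrier R"
        using H(5) yc xc by (intro finsum_closed) auto
      ultimately show "(\<Oplus>h'\<in>H. (c h' \<otimes> (h' y \<ominus> g y)) \<otimes> h' x) = \<zero>" by simp
    qed (use H yc h in auto)
    moreover have "h y \<ominus> g y \<noteq> \<zero>" using y yc h by (simp add: r_right_minus_eq)
    moreover have "c h \<in> carrier R" "h y \<ominus> g y \<in> carrier R" using H(5) yc h by auto
    ultimately show ?thesis using integral by blast
  qed
  have "(\<Oplus>h'\<in>insert g H. c h' \<otimes> h' \<one>) = c g \<otimes> g \<one> \<oplus> (\<Oplus>h'\<in>H. c h' \<otimes> h' \<one>)"
    using insert.hyps H(1,5) K(2) by (intro finsum_insert) auto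
  moreover have "(\<Oplus>h'\<in>H. c h' \<otimes> h' \<one>) = \<zero>"
    using cH H(1)[OF insertI2 K(2)] by (intro add.finprod_one_eqI) simp
  ultimately have "c g = \<zero>" using sum0[OF K(2)] H(3)[of g] H(5)[of g] by simp
  then show ?case using cH insert.prems(7) by blast
qed simp

definition fixed :: "'a set \<Rightarrow> ('a \<Rightarrow> 'a) set \<Rightarrow> 'a set" where
  "fixed K P = {x \<in> K. \<forall>a\<in>P. a x = x}"

lemma fixedD: "x \<in> fixed K P \<Longrightarrow> x \<in> K" "x \<in> fixed K P \<Longrightarrow> a \<in> P \<Longrightarrow> a x = x"
  by (auto simp: fixed_def)

lemma subfield_fixed:
  assumes K: "subfield K R" and P: "P \<subseteq> carrier (Gal R K F)"
  shows "subfield (fixed K P) R"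
proof -
  note sK = subfieldD[OF K]
  have P': "a \<in> carrier (Gal R K F)" if "a \<in> P" for a using P that by blast
  show ?thesis
  proof (rule subfieldI'[OF subringI])
    fix x assume "x \<in> fixed K P - {\<zero>}"
    then have x: "x \<in> K" "x \<noteq> \<zero>" "\<And>a. a \<in> P \<Longrightarrow> a x = x" by (auto simp: fixed_def)
    have "a (inv x) = inv x" if "a \<in> P" for a
      using Gal_inverse[OF K P'[OF that] x(1,2)] x(3)[OF that] by simp
    then show "inv x \<in> fixed K P" using sK(7) x by (simp add: fixed_def)
  next
    fix x assume x: "x \<in> fixed K P"
    have "a (\<ominus> x) = \<ominus> x" if "a \<in> P" for a
      using Gal_minus[OF K P'[OF that] fixedD(1)[OF x]] fixedD(2)[OF x that] by simp
    then show "\<ominus> x \<in> fixed K P" using sK(4) x by (simp add: fixed_def)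
  next
    fix x y assume xy: "x \<in> fixed K P" "y \<in> fixed K P"
    have "a (x \<otimes> y) = x \<otimes> y" "a (x \<oplus> y) = x \<oplus> y" if "a \<in> P" for a
      using GalD(2,3)[OF P'[OF that] xy[THEN fixedD(1)]] xy[THEN fixedD(2), OF that] by simp_all
    then show "x \<otimes> y \<in> fixed K P" "x \<oplus> y \<in> fixed K P" using sK(5,6) xy by (simp_all add: fixed_def)
  next
    show "\<one> \<in> fixed K P" using sK(3) GalD(4)[OF P'] by (auto simp: fixed_def)
  qed (use sK(1) in \<open>auto simp: fixed_def\<close>)
qed

text \<open>Artin's theorem without counting degrees. The sum of the \<open>a x\<close> over
  \<open>a \<in> P\<close> is fixed by \<open>P\<close>, hence by \<open>s\<close>. If
  \<open>s\<close> were not in \<open>P\<close>, then \<open>P\<close> and its translate by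
  \<open>s\<close> would be disjoint, and this invariance would be a linear relation between
  distinct characters with coefficients 1 and -1.\<close>

lemma embedding_in_fixed_group:
  assumes K: "subfield K R" and F: "F \<subseteq> K" and P: "subgroup P (Gal R K F)" and fin: "finite P"
    and s: "\<And>x. x \<in> K \<Longrightarrow> s x \<in> carrier R" "\<And>x y. x \<in> K \<Longrightarrow> y \<in> K \<Longrightarrow> s (x \<oplus> y) = s x \<oplus> s y"
      "\<And>x y. x \<in> K \<Longrightarrow> y \<in> K \<Longrightarrow> s (x \<otimes> y) = s x \<otimes> s y" "s \<one> = \<one>" "s \<in> extensional K"
      "\<And>x. x \<in> fixed K P \<Longrightarrow> s x = x"
  shows "s \<in> P"
proof (rule ccontr)
  assume nP: "s \<notin> P"
  interpret G: group "Gal R K F" by (rule group_Gal[OF K F])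
  interpret P: subgroup P "Gal R K F" by fact
  note sK = subfieldD[OF K]
  have PG: "a \<in> carrier (Gal R K F)" if "a \<in> P" for a using P.subset that by blast
  have s0: "s \<zero> = \<zero>"
  proof -
    have "s \<zero> \<oplus> s \<zero> = s \<zero>" using s(2)[OF sK(2) sK(2)] by simp
    then show ?thesis using s(1)[OF sK(2)] add.l_cancel_one' by metis
  qed
  have s_inj: "x = y" if "x \<in> K" "y \<in> K" "s x = s y" for x y
  proof (rule ccontr)
    assume "x \<noteq> y"
    let ?z = "x \<oplus> \<ominus> y"
    have z: "?z \<in> K" using that sK by blast
    have "?z \<noteq> \<zero>" using \<open>x \<noteq> y\<close> that(1,2) sK(8) minus_eq r_right_minus_eq by metis
    then have "?z \<otimes> inv ?z = \<one>" "inv ?z \<in> K" using z sK(7,8) field_Units by auto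
    then have "s ?z \<otimes> s (inv ?z) = \<one>" using s(3)[OF z] s(4) by metis
    moreover have "s ?z = \<zero>"
    proof -
      have "s y \<oplus> s (\<ominus> y) = \<zero>" using s(2)[of y "\<ominus> y"] that(2) sK(4,8) s0 by (simp add: r_neg)
      then show ?thesis using s(2)[of x "\<ominus> y"] that sK(4) by simp
    qed
    ultimately show False using s(1)[OF \<open>inv ?z \<in> K\<close>] by simp
  qed
  let ?sP = "(\<lambda>a. compose K s a) ` P"
  have disj: "P \<inter> ?sP = {}"
  proof -
    have "s \<in> P" if a: "a \<in> P" "compose K s a \<in> P" for a
    proof -
      let ?b = "compose K s a \<otimes>\<^bsub>Gal R K F\<^esub> inv\<^bsub>Gal R K F\<^esub> a"
      have bP: "?b \<in> P" using a by blast
      have "s = ?b"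
      proof (rule extensionalityI[OF s(5) GalD(6)[OF PG[OF bP]]])
        fix x assume x: "x \<in> K"
        let ?y = "(inv\<^bsub>Gal R K F\<^esub> a) x"
        have y: "?y \<in> K" using GalD(1)[OF G.inv_closed[OF PG[OF a(1)]] x] .
        have "a ?y = (a \<otimes>\<^bsub>Gal R K F\<^esub> inv\<^bsub>Gal R K F\<^esub> a) x"
          using mult_Gal_apply[OF PG[OF a(1)] G.inv_closed[OF PG[OF a(1)]] x] by simp
        also have "\<dots> = x" using G.r_inv[OF PG[OF a(1)]] x by (simp add: one_Gal)
        finally have "a ?y = x" .
        then show "s x = ?b x"
          using mult_Gal_apply[OF PG[OF a(2)] G.inv_closed[OF PG[OF a(1)]] x] y by (simp add: compose_def)
      qed
      then show ?thesis using bP by simp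
    qed
    then show ?thesis using nP by auto
  qed
  have inj: "inj_on (\<lambda>a. compose K s a) P"
  proof (rule inj_onI)
    fix a b assume a: "a \<in> P" and b: "b \<in> P" and eq: "compose K s a = compose K s b"
    show "a = b"
    proof (rule Gal_eqI[OF PG[OF a] PG[OF b]])
      fix x assume x: "x \<in> K"
      then have "s (a x) = s (b x)" using fun_cong[OF eq, of x] by (simp add: compose_def)
      then show "a x = b x" using s_inj GalD(1)[OF PG[OF a] x] GalD(1)[OF PG[OF b] x] by blast
    qed
  qed
  define c where "c a = (if a \<in> P then \<one> else \<ominus> \<one>)" for a :: "'a \<Rightarrow> 'a"
  have "c (\<one>\<^bsub>Gal R K F\<^esub>) = \<zero>"
  proof (rule characters_independent[where H = "P \<union> ?sP" and K = K and c = c])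
    fix x assume x: "x \<in> K"
    define e where "e a = a x" for a :: "'a \<Rightarrow> 'a"
    let ?t = "\<Oplus>a\<in>P. e a"
    have eK: "e a \<in> K" if "a \<in> P" for a using GalD(1)[OF PG[OF that] x] by (simp add: e_def)
    have e_mult: "e (a \<otimes>\<^bsub>Gal R K F\<^esub> b) = a (e b)" if "a \<in> P" "b \<in> P" for a b
      using mult_Gal_apply[OF PG[OF that(1)] PG[OF that(2)] x] by (simp add: e_def)
    have e_comp: "e (compose K s a) = s (e a)" for a
      using x by (simp add: e_def compose_def)
    have eP: "e a \<in> carrier R" if "a \<in> P" for a using eK[OF that] sK(8) by blast
    have es: "s (e a) \<in> carrier R" if "a \<in> P" for a using s(1)[OF eK[OF that]] .
    have c_closed: "c a \<in> carrier R" for a by (simp add: c_def)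
    have t_fixed: "?t \<in> fixed K P"
    proof -
      have "b ?t = ?t" if b: "b \<in> P" for b
      proof -
        have "b ?t = (\<Oplus>a\<in>P. b (e a))" using eK by (intro Gal_finsum[OF K PG[OF b] fin]) auto
        also have "\<dots> = (\<Oplus>a\<in>P. e (b \<otimes>\<^bsub>Gal R K F\<^esub> a))"
          using eP b by (intro finsum_cong') (auto simp: e_mult)
        also have "\<dots> = (\<Oplus>a\<in>(\<lambda>a. b \<otimes>\<^bsub>Gal R K F\<^esub> a) ` P. e a)"
          using eP PG b by (intro finsum_reindex[symmetric]) (auto simp: inj_on_def)
        also have "(\<lambda>a. b \<otimes>\<^bsub>Gal R K F\<^esub> a) ` P = P"
        proof
          show "P \<subseteq> (\<lambda>a. b \<otimes>\<^bsub>Gal R K F\<^esub> a) ` P"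
          proof
            fix a assume a: "a \<in> P"
            have "a = b \<otimes>\<^bsub>Gal R K F\<^esub> (inv\<^bsub>Gal R K F\<^esub> b \<otimes>\<^bsub>Gal R K F\<^esub> a)"
              using PG[OF a] PG[OF b] by (simp add: G.m_assoc[symmetric])
            then show "a \<in> (\<lambda>a. b \<otimes>\<^bsub>Gal R K F\<^esub> a) ` P" using a b by blast
          qed
        qed (use b in auto)
        finally show ?thesis .
      qed
      moreover have "?t \<in> K" using eK by (intro subfield_finsum[OF K _ fin]) auto
      ultimately show ?thesis by (simp add: fixed_def)
    qed
    have s_sum: "s (finsum R e A) = (\<Oplus>a\<in>A. s (e a))" if "A \<subseteq> P" for A
      using finite_subset[OF that fin] that
    proof (induction A rule: finite_induct)
      case (insert a A)
      then have "s (finsum R e (insert a A)) = s (e a \<oplus> finsum R e A)"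
        using eP by (subst finsum_insert) auto
      also have "\<dots> = s (e a) \<oplus> s (finsum R e A)"
        using insert eK by (intro s(2) subfield_finsum[OF K]) auto
      also have "\<dots> = (\<Oplus>a\<in>insert a A. s (e a))"
        using insert es by (subst finsum_insert) auto
      finally show ?case .
    qed (simp add: s0)
    have "(\<Oplus>h\<in>P \<union> ?sP. c h \<otimes> e h) = (\<Oplus>h\<in>P. c h \<otimes> e h) \<oplus> (\<Oplus>h\<in>?sP. c h \<otimes> e h)"
      using fin disj eP es c_closed by (intro finsum_Un_disjoint) (auto simp: e_comp)
    also have "(\<Oplus>h\<in>P. c h \<otimes> e h) = ?t"
      using eP by (intro finsum_cong') (auto simp: c_def)
    also have "(\<Oplus>h\<in>?sP. c h \<otimes> e h) = (\<Oplus>a\<in>P. c (compose K s a) \<otimes> e (compose K s a))"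
      using es c_closed by (intro finsum_reindex inj) (auto simp: e_comp)
    also have "\<dots> = (\<Oplus>a\<in>P. \<ominus> \<one> \<otimes> s (e a))"
    proof (rule finsum_cong')
      show "(\<lambda>a. \<ominus> \<one> \<otimes> s (e a)) \<in> P \<rightarrow> carrier R" using es by auto
      show "c (compose K s a) \<otimes> e (compose K s a) = \<ominus> \<one> \<otimes> s (e a)" if "a \<in> P" for a
        using that disj by (auto simp: c_def e_comp)
    qed simp
    also have "\<dots> = \<ominus> \<one> \<otimes> (\<Oplus>a\<in>P. s (e a))"
      using es fin by (intro finsum_rdistr[symmetric]) auto
    also have "(\<Oplus>a\<in>P. s (e a)) = s ?t" using s_sum[of P] by simp
    also have "s ?t = ?t" by (rule s(6)[OF t_fixed])
    finally have "(\<Oplus>h\<in>P \<union> ?sP. c h \<otimes> e h) = \<zero>"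
      using fixedD(1)[OF t_fixed] sK(8) by (simp add: l_minus r_neg)
    then show "(\<Oplus>h\<in>P \<union> ?sP. c h \<otimes> h x) = \<zero>" by (simp add: e_def)
  next
    fix h h' assume h: "h \<in> P \<union> ?sP" "h' \<in> P \<union> ?sP" "h \<noteq> h'"
    have "h \<in> extensional K" if "h \<in> P \<union> ?sP" for h using that GalD(6)[OF PG] by auto
    then show "\<exists>x\<in>K. h x \<noteq> h' x" using h extensionalityI[of h K h'] by blast
  next
    fix h assume h: "h \<in> P \<union> ?sP"
    show "c h \<in> carrier R" by (simp add: c_def)
    from h consider "h \<in> P" | a where "a \<in> P" "h = compose K s a" by blast
    then have "h \<one> = \<one> \<and> (\<forall>x\<in>K. h x \<in> carrier R) \<and> (\<forall>x\<in>K. \<forall>y\<in>K. h (x \<otimes> y) = h x \<otimes> h y)"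
    proof cases
      case 1
      then show ?thesis using GalD(1,3,4)[OF PG[OF 1]] sK(8) by blast
    next
      case 2
      then show ?thesis
        using GalD(1,3,4)[OF PG[OF 2(1)]] sK(3,6) s(1,3,4) by (simp add: compose_def)
    qed
    then show "h \<one> = \<one>" "\<And>x. x \<in> K \<Longrightarrow> h x \<in> carrier R"
        "\<And>x y. x \<in> K \<Longrightarrow> y \<in> K \<Longrightarrow> h (x \<otimes> y) = h x \<otimes> h y" by blast+
  qed (use sK fin in auto)
  then show False by (simp add: c_def)
qed

lemma fixed_group_complete:
  assumes K: "subfield K R" and F: "F \<subseteq> K" and P: "subgroup P (Gal R K F)" and fin: "finite P"
    and s: "s \<in> carrier (Gal R K F)" "\<And>x. x \<in> fixed K P \<Longrightarrow> s x = x"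
  shows "s \<in> P"
  using GalD[OF s(1)] subfieldD(8)[OF K] s(2)
  by (intro embedding_in_fixed_group[OF K F P fin]) auto

lemma restrict_Gal:
  assumes E: "E \<subseteq> K" "F \<subseteq> E" "subfield E R" and a: "a \<in> carrier (Gal R K F)" and img: "a ` E = E"
  shows "restrict a E \<in> carrier (Gal R E F)"
proof (rule GalI)
  note A = GalD[OF a]
  show "bij_betw (restrict a E) E E"
    using A(7) E(1) img by (auto simp: bij_betw_def inj_on_def subset_iff)
qed (use GalD[OF a] E subfieldD[OF E(3)] in \<open>auto simp: subset_iff\<close>)

text \<open>Conjugation preserves the kernel of \<open>h\<close>, so its fixed field is stable and
  restriction to it is defined. By Artin's theorem, applied to \<open>K\<close> and to the fixed
  field, restriction has exactly this kernel and is onto. The first isomorphism theorem, used twice,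
  then identifies the Galois group with \<open>Q\<close>.\<close>

lemma galois_extension_of_surjection:
  assumes gal: "galois_extension R K F" and fin: "finite (carrier (Gal R K F))"
    and Q: "group Q" and h: "h \<in> hom (Gal R K F) Q" "h ` carrier (Gal R K F) = carrier Q"
  shows "fixed K (kernel (Gal R K F) Q h) \<in> group_extensions Q R F"
proof -
  have K: "subfield K R" and F: "subfield F R" "F \<subseteq> K" and fixF: "fixed K (carrier (Gal R K F)) = F"
    and alg: "\<And>x. x \<in> K \<Longrightarrow> (algebraic over F) x"
    using gal by (auto simp: galois_extension_def fixed_def)
  interpret G: group "Gal R K F" by (rule group_Gal[OF K F(2)])
  interpret h: group_hom "Gal R K F" Q h using Q h(1) by (simp add: group_hom_def group_hom_axioms_def G.is_group)
  let ?W = "kernel (Gal R K F) Q h"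
  let ?E = "fixed K ?W"
  have W: "subgroup ?W (Gal R K F)" by (rule h.subgroup_kernel)
  have WG: "?W \<subseteq> carrier (Gal R K F)" by (auto simp: kernel_def)
  have E: "subfield ?E R" by (rule subfield_fixed[OF K WG])
  have EK: "?E \<subseteq> K" by (auto simp: fixed_def)
  have FE: "F \<subseteq> ?E" using F(2) WG GalD(5) by (force simp: fixed_def)
  have aE: "a x \<in> ?E" if a: "a \<in> carrier (Gal R K F)" and x: "x \<in> ?E" for a x
  proof -
    have xK: "x \<in> K" using x EK by blast
    have "b (a x) = a x" if b: "b \<in> ?W" for b
    proof -
      have bG: "b \<in> carrier (Gal R K F)" using b WG by blast
      let ?c = "inv\<^bsub>Gal R K F\<^esub> a \<otimes>\<^bsub>Gal R K F\<^esub> b \<otimes>\<^bsub>Gal R K F\<^esub> a"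
      have "?c \<in> ?W" using a b bG by (simp add: kernel_def)
      then have "?c x = x" by (rule fixedD(2)[OF x])
      then have "(a \<otimes>\<^bsub>Gal R K F\<^esub> ?c) x = a x" using a bG xK by (simp add: mult_Gal_apply)
      moreover have "a \<otimes>\<^bsub>Gal R K F\<^esub> ?c = b \<otimes>\<^bsub>Gal R K F\<^esub> a" using a bG by (simp add: G.m_assoc[symmetric])
      ultimately show ?thesis using a bG xK by (simp add: mult_Gal_apply)
    qed
    then show ?thesis using GalD(1)[OF a xK] by (simp add: fixed_def)
  qed
  have img: "a ` ?E = ?E" if a: "a \<in> carrier (Gal R K F)" for a
  proof
    show "a ` ?E \<subseteq> ?E" using aE[OF a] by auto
    show "?E \<subseteq> a ` ?E"
    proof
      fix x assume x: "x \<in> ?E"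
      have "a ((inv\<^bsub>Gal R K F\<^esub> a) x) = (a \<otimes>\<^bsub>Gal R K F\<^esub> inv\<^bsub>Gal R K F\<^esub> a) x"
        using a x EK by (subst mult_Gal_apply) auto
      also have "\<dots> = x" using a x EK by (auto simp: one_Gal)
      finally show "x \<in> a ` ?E" using aE[OF G.inv_closed[OF a] x] by (metis imageI)
    qed
  qed
  define r where "r a = restrict a ?E" for a :: "'a \<Rightarrow> 'a"
  have rG: "r a \<in> carrier (Gal R ?E F)" if "a \<in> carrier (Gal R K F)" for a
    unfolding r_def by (rule restrict_Gal[OF EK FE E that img[OF that]])
  interpret GE: group "Gal R ?E F" by (rule group_Gal[OF E FE])
  have r_hom: "r \<in> hom (Gal R K F) (Gal R ?E F)"
  proof (rule homI)
    fix a b assume a: "a \<in> carrier (Gal R K F)" and b: "b \<in> carrier (Gal R K F)"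
    show "r (a \<otimes>\<^bsub>Gal R K F\<^esub> b) = r a \<otimes>\<^bsub>Gal R ?E F\<^esub> r b"
    proof (rule Gal_eqI[OF rG[OF G.m_closed[OF a b]] GE.m_closed[OF rG[OF a] rG[OF b]]])
      fix x assume x: "x \<in> ?E"
      then have xK: "x \<in> K" using EK by blast
      show "r (a \<otimes>\<^bsub>Gal R K F\<^esub> b) x = (r a \<otimes>\<^bsub>Gal R ?E F\<^esub> r b) x"
        using x aE[OF b x] mult_Gal_apply[OF rG[OF a] rG[OF b] x] mult_Gal_apply[OF a b xK] by (simp add: r_def)
    qed
  qed (rule rG)
  interpret r: group_hom "Gal R K F" "Gal R ?E F" r
    using r_hom by (simp add: group_hom_def group_hom_axioms_def G.is_group GE.is_group)
  have fixE: "fixed ?E (r ` carrier (Gal R K F)) = F"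
  proof
    show "fixed ?E (r ` carrier (Gal R K F)) \<subseteq> F"
    proof
      fix x assume x: "x \<in> fixed ?E (r ` carrier (Gal R K F))"
      then have "x \<in> ?E" "\<And>a. a \<in> carrier (Gal R K F) \<Longrightarrow> a x = x" by (auto simp: fixed_def r_def)
      then have "x \<in> fixed K (carrier (Gal R K F))" using EK by (auto simp: fixed_def)
      then show "x \<in> F" using fixF by simp
    qed
    show "F \<subseteq> fixed ?E (r ` carrier (Gal R K F))"
      using FE GalD(5) by (force simp: fixed_def r_def)
  qed
  have onto: "r ` carrier (Gal R K F) = carrier (Gal R ?E F)"
  proof
    show "carrier (Gal R ?E F) \<subseteq> r ` carrier (Gal R K F)"
    proof
      fix s assume s: "s \<in> carrier (Gal R ?E F)"
      show "s \<in> r ` carrier (Gal R K F)"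
        using fin r.img_is_subgroup fixE GalD(5)[OF s]
        by (intro fixed_group_complete[OF E FE _ _ s]) auto
    qed
  qed (use rG in auto)
  have "kernel (Gal R K F) (Gal R ?E F) r = ?W"
  proof
    show "kernel (Gal R K F) (Gal R ?E F) r \<subseteq> ?W"
    proof
      fix a assume "a \<in> kernel (Gal R K F) (Gal R ?E F) r"
      then have a: "a \<in> carrier (Gal R K F)" and ra: "r a = (\<lambda>x\<in>?E. x)" by (auto simp: kernel_def one_Gal)
      have "a x = x" if "x \<in> ?E" for x using fun_cong[OF ra, of x] that by (simp add: r_def)
      then show "a \<in> ?W" using finite_subset[OF WG fin] by (intro fixed_group_complete[OF K F(2) W _ a])
    qed
    show "?W \<subseteq> kernel (Gal R K F) (Gal R ?E F) r"
    proof
      fix a assume a: "a \<in> ?W"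
      then have "r a = (\<lambda>x\<in>?E. x)" unfolding r_def by (intro restrict_ext) (simp add: fixed_def)
      then show "a \<in> kernel (Gal R K F) (Gal R ?E F) r" using a WG by (auto simp: kernel_def one_Gal)
    qed
  qed
  then have "Gal R K F Mod ?W \<cong> Gal R ?E F" using r.FactGroup_iso[OF onto] by simp
  moreover have "Gal R K F Mod ?W \<cong> Q" by (rule h.FactGroup_iso[OF h(2)])
  moreover have "group (Gal R K F Mod ?W)" using h.normal_kernel by (rule normal.factorgroup_is_group)
  ultimately have iso: "Gal R ?E F \<cong> Q" by (meson group.iso_sym iso_trans)
  have "fixed ?E (carrier (Gal R ?E F)) = F" using fixE onto by simp
  then have "galois_extension R ?E F"
    using E F FE EK alg by (auto simp: galois_extension_def fixed_def)
  then show ?thesis using iso by (simp add: group_extensions_def)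
qed

text \<open>A finite subgroup is recovered from its fixed field, so distinct kernels lead to
  distinct extensions.\<close>

lemma fixed_kernel_inj:
  assumes K: "subfield K R" and F: "F \<subseteq> K" and fin: "finite (carrier (Gal R K F))" and Q: "group Q"
    and h: "h \<in> hom (Gal R K F) Q" "h' \<in> hom (Gal R K F) Q"
    and eq: "fixed K (kernel (Gal R K F) Q h) = fixed K (kernel (Gal R K F) Q h')"
  shows "kernel (Gal R K F) Q h = kernel (Gal R K F) Q h'"
proof -
  interpret G: group "Gal R K F" by (rule group_Gal[OF K F])
  have sub: "kernel (Gal R K F) Q g \<subseteq> kernel (Gal R K F) Q g'"
    if g: "g \<in> hom (Gal R K F) Q" "g' \<in> hom (Gal R K F) Q"
      and eq: "fixed K (kernel (Gal R K F) Q g) = fixed K (kernel (Gal R K F) Q g')" for g g'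
  proof
    interpret g': group_hom "Gal R K F" Q g' using Q g(2) by (simp add: group_hom_def group_hom_axioms_def G.is_group)
    have fk: "finite (kernel (Gal R K F) Q g')" using fin by (simp add: kernel_def)
    fix a assume a: "a \<in> kernel (Gal R K F) Q g"
    then have "a x = x" if "x \<in> fixed K (kernel (Gal R K F) Q g')" for x
      using that unfolding eq[symmetric] by (simp add: fixed_def)
    then show "a \<in> kernel (Gal R K F) Q g'"
      using a by (intro fixed_group_complete[OF K F g'.subgroup_kernel fk]) (auto simp: kernel_def)
  qed
  show ?thesis using sub[OF h eq] sub[OF h(2,1) eq[symmetric]] by blast
qed

end

section \<open>Embeddings of subfields and roots of polynomials\<close>

context field begin

abbreviation embeddings :: "'a set \<Rightarrow> ('a \<Rightarrow> 'a) set" where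
  "embeddings E \<equiv> ring_hom (R\<lparr>carrier := E\<rparr>) R"

lemma embeddingsD:
  assumes "h \<in> embeddings E"
  shows "\<And>x. x \<in> E \<Longrightarrow> h x \<in> carrier R" "\<And>x y. x \<in> E \<Longrightarrow> y \<in> E \<Longrightarrow> h (x \<oplus> y) = h x \<oplus> h y"
    "\<And>x y. x \<in> E \<Longrightarrow> y \<in> E \<Longrightarrow> h (x \<otimes> y) = h x \<otimes> h y" "h \<one> = \<one>"
  using assms by (auto simp: ring_hom_def)

lemma embedding_ring_hom:
  assumes "subfield E R" "h \<in> embeddings E"
  shows "ring_hom_ring (R\<lparr>carrier := E\<rparr>) R h"
  using assms subring_is_ring[OF subfieldE(1)[OF assms(1)]] ring_axioms by (intro ring_hom_ringI2) auto

lemma embedding_zero_minus: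
  assumes "subfield E R" "h \<in> embeddings E"
  shows "h \<zero> = \<zero>" "\<And>x. x \<in> E \<Longrightarrow> h (\<ominus> x) = \<ominus> h x"
proof -
  note sE = subfieldD[OF assms(1)] and e = embeddingsD[OF assms(2)]
  have "h \<zero> \<oplus> h \<zero> = h \<zero>" using e(2)[OF sE(2) sE(2)] by simp
  then show h0: "h \<zero> = \<zero>" using e(1)[OF sE(2)] add.l_cancel_one' by metis
  fix x assume x: "x \<in> E"
  have "h (\<ominus> x) \<oplus> h x = \<zero>" using e(2)[of "\<ominus> x" x] x sE(4,8) h0 by (simp add: l_neg)
  then show "h (\<ominus> x) = \<ominus> h x" using e(1) x sE(4) minus_equality by metis
qed

lemma embedding_inj:
  assumes "subfield E R" "h \<in> embeddings E"
  shows "inj_on h E"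
proof -
  have "field (R\<lparr>carrier := E\<rparr>)" using subfield_iff(2)[OF assms(1)] .
  then show ?thesis using non_trivial_field_hom_is_inj[OF assms(2) _ field_axioms] by simp
qed

lemma eval_map_hom:
  assumes E: "subfield E R" and h: "h \<in> embeddings E" and y: "y \<in> carrier R"
  shows "(\<lambda>p. eval (map h p) y) \<in> ring_hom (E[X]) R"
proof -
  interpret h: ring_hom_ring "R\<lparr>carrier := E\<rparr>" R h by (rule embedding_ring_hom[OF E h])
  note sE = subfieldD[OF E] and sr = subfieldE(1)[OF E]
  have pE: "set p \<subseteq> E" if "p \<in> carrier (E[X])" for p
    using that polynomial_incl by (auto simp: univ_poly_carrier[symmetric])
  have pc: "set (map h p) \<subseteq> carrier R" if "p \<in> carrier (E[X])" for p
    using pE[OF that] embeddingsD(1)[OF h] by auto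
  have add: "univ_poly (R\<lparr>carrier := E\<rparr>) = univ_poly R" by (rule univ_poly_consistent[OF sr])
  have pa: "h.R.poly_add = poly_add"
    using arg_cong[OF fun_cong[OF add, of E], of add] by (simp add: univ_poly_add)
  have pm: "h.R.poly_mult = poly_mult"
    using arg_cong[OF fun_cong[OF add, of E], of monoid.mult] by (simp add: univ_poly_mult)
  show ?thesis
  proof (rule ring_hom_memI)
    fix p q assume p: "p \<in> carrier (E[X])" and q: "q \<in> carrier (E[X])"
    show "eval (map h p) y \<in> carrier R" using eval_in_carrier[OF pc[OF p] y] .
    have in_c: "set (poly_add p q) \<subseteq> E" "set (poly_mult p q) \<subseteq> E"
      using pE[OF p] pE[OF q] poly_add_in_carrier
        h.R.poly_add_in_carrier[of p q] h.R.poly_mult_in_carrier[of p q] by (simp_all add: pa pm)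
    then have in_c': "set (map h (poly_add p q)) \<subseteq> carrier R" "set (map h (poly_mult p q)) \<subseteq> carrier R"
      using embeddingsD(1)[OF h] by auto
    have "eval (map h (poly_add p q)) y = eval (normalize (map h (poly_add p q))) y"
      using eval_normalize[OF in_c'(1) y] by simp
    also have "normalize (map h (poly_add p q)) = poly_add (map h p) (map h q)"
      using h.poly_add_hom'[of p q] pE[OF p] pE[OF q] by (simp add: pa)
    finally show "eval (map h (p \<oplus>\<^bsub>E[X]\<^esub> q)) y = eval (map h p) y \<oplus> eval (map h q) y"
      using eval_poly_add[OF pc[OF p] pc[OF q] y] by (simp add: univ_poly_add)
    have "eval (map h (poly_mult p q)) y = eval (normalize (map h (poly_mult p q))) y"
      using eval_normalize[OF in_c'(2) y] by simp
    also have "normalize (map h (poly_mult p q)) = poly_mult (map h p) (map h q)"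
      using h.poly_mult_hom'[of p q] pE[OF p] pE[OF q] by (simp add: pm)
    finally show "eval (map h (p \<otimes>\<^bsub>E[X]\<^esub> q)) y = eval (map h p) y \<otimes> eval (map h q) y"
      using eval_poly_mult[OF pc[OF p] pc[OF q] y] by (simp add: univ_poly_mult)
  next
    show "eval (map h \<one>\<^bsub>E[X]\<^esub>) y = \<one>" using y embeddingsD(4)[OF h] by (simp add: univ_poly_one)
  qed
qed

text \<open>Evaluating at \<open>y\<close> after applying \<open>h\<close> to the coefficients kills
  \<open>Irr E x\<close> and all its multiples, so the result depends only on the value at
  \<open>x\<close>. Every element of the simple extension is such a value.\<close>

lemma embedding_extends:
  assumes E: "subfield E R" and h: "h \<in> embeddings E" and x: "x \<in> carrier R" "(algebraic over E) x"
    and y: "y \<in> carrier R" "eval (map h (Irr E x)) y = \<zero>"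
  shows "\<exists>g \<in> embeddings (simple_extension E x). (\<forall>z\<in>E. g z = h z) \<and> g x = y"
proof -
  note sE = subfieldD[OF E] and sr = subfieldE(1)[OF E]
  interpret UP: domain "E[X]" by (rule univ_poly_is_domain[OF sr])
  define \<Phi> where "\<Phi> p = eval (map h p) y" for p
  have \<Phi>: "\<Phi> \<in> ring_hom (E[X]) R" using eval_map_hom[OF E h y(1)] by (simp add: \<Phi>_def[abs_def])
  have ev: "(\<lambda>p. eval p x) \<in> ring_hom (E[X]) R" using eval_is_hom[OF sr x(1)] .
  have \<Phi>c: "\<Phi> p \<in> carrier R" and evc: "eval p x \<in> carrier R" if "p \<in> carrier (E[X])" for p
    using ring_hom_closed[OF \<Phi> that] ring_hom_closed[OF ev that] by auto
  have Irr: "Irr E x \<in> carrier (E[X])" "\<Phi> (Irr E x) = \<zero>" using IrrE(1)[OF E x] y(2) by (auto simp: \<Phi>_def)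
  have zero: "\<Phi> p = \<zero>" if p: "p \<in> carrier (E[X])" "eval p x = \<zero>" for p
  proof -
    have "Irr E x divides\<^bsub>E[X]\<^esub> p"
      using Irr_minimal[OF E x p] pdivides_iff_shell[OF E Irr(1) p(1)] by simp
    then obtain r where "r \<in> carrier (E[X])" "p = Irr E x \<otimes>\<^bsub>E[X]\<^esub> r" by (auto simp: factor_def)
    then show ?thesis using ring_hom_mult[OF \<Phi> Irr(1)] Irr(2) \<Phi>c by simp
  qed
  have wd: "\<Phi> p = \<Phi> q" if pq: "p \<in> carrier (E[X])" "q \<in> carrier (E[X])" "eval p x = eval q x" for p q
  proof -
    let ?d = "p \<ominus>\<^bsub>E[X]\<^esub> q"
    have d: "?d \<in> carrier (E[X])" using pq by simp
    have p: "p = ?d \<oplus>\<^bsub>E[X]\<^esub> q" using pq(1,2) by algebra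
    have "eval p x = eval ?d x \<oplus> eval q x" using ring_hom_add[OF ev d pq(2)] p by simp
    then have "eval ?d x = \<zero>" using pq(3) evc[OF d] evc[OF pq(2)] add.l_cancel_one by (metis add.m_comm add.r_cancel_one')
    then have "\<Phi> ?d = \<zero>" using zero[OF d] by simp
    then show ?thesis using ring_hom_add[OF \<Phi> d pq(2)] p \<Phi>c[OF pq(2)] by simp
  qed
  define rep where "rep z = (SOME p. p \<in> carrier (E[X]) \<and> eval p x = z)" for z
  have S: "simple_extension E x = (\<lambda>p. eval p x) ` carrier (E[X])"
    by (rule simple_extension_as_eval_img[OF sE(1) x(1)])
  have rep: "rep z \<in> carrier (E[X])" "eval (rep z) x = z" if "z \<in> simple_extension E x" for z
  proof -
    have "\<exists>p. p \<in> carrier (E[X]) \<and> eval p x = z" using that S by auto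
    from someI_ex[OF this] show "rep z \<in> carrier (E[X])" "eval (rep z) x = z" by (auto simp: rep_def)
  qed
  define g where "g z = \<Phi> (rep z)" for z
  have g_eval: "g (eval p x) = \<Phi> p" if p: "p \<in> carrier (E[X])" for p
  proof -
    have "eval p x \<in> simple_extension E x" using S p by auto
    then show ?thesis unfolding g_def using rep wd p by blast
  qed
  have "g \<in> embeddings (simple_extension E x)"
  proof (rule ring_hom_memI)
    fix a b assume "a \<in> carrier (R\<lparr>carrier := simple_extension E x\<rparr>)" "b \<in> carrier (R\<lparr>carrier := simple_extension E x\<rparr>)"
    then obtain p q where p: "p \<in> carrier (E[X])" "a = eval p x" and q: "q \<in> carrier (E[X])" "b = eval q x"
      using S by auto
    show "g a \<in> carrier R" using p g_eval \<Phi>c by simp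
    have "a \<otimes> b = eval (p \<otimes>\<^bsub>E[X]\<^esub> q) x" using ring_hom_mult[OF ev p(1) q(1)] p q by simp
    then show "g (a \<otimes>\<^bsub>R\<lparr>carrier := simple_extension E x\<rparr>\<^esub> b) = g a \<otimes> g b"
      using g_eval[OF UP.m_closed[OF p(1) q(1)]] g_eval[OF p(1)] g_eval[OF q(1)] ring_hom_mult[OF \<Phi> p(1) q(1)] p q
      by simp
    have "a \<oplus> b = eval (p \<oplus>\<^bsub>E[X]\<^esub> q) x" using ring_hom_add[OF ev p(1) q(1)] p q by simp
    then show "g (a \<oplus>\<^bsub>R\<lparr>carrier := simple_extension E x\<rparr>\<^esub> b) = g a \<oplus> g b"
      using g_eval[OF UP.a_closed[OF p(1) q(1)]] g_eval[OF p(1)] g_eval[OF q(1)] ring_hom_add[OF \<Phi> p(1) q(1)] p q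
      by simp
  next
    have "eval \<one>\<^bsub>E[X]\<^esub> x = \<one>" using ring_hom_one[OF ev] .
    then show "g \<one>\<^bsub>R\<lparr>carrier := simple_extension E x\<rparr>\<^esub> = \<one>"
      using g_eval[OF UP.one_closed] ring_hom_one[OF \<Phi>] by simp
  qed
  moreover have "g z = h z" if z: "z \<in> E" for z
  proof (cases "z = \<zero>")
    case True
    then show ?thesis using g_eval[OF UP.zero_closed] embedding_zero_minus(1)[OF E h]
      by (simp add: univ_poly_zero \<Phi>_def)
  next
    case False
    then have "[z] \<in> carrier (E[X])" using z by (simp add: univ_poly_carrier[symmetric] polynomial_def)
    moreover have "eval [z] x = z" "eval (map h [z]) y = h z"
      using sE(8)[OF z] x y embeddingsD(1)[OF h z] by simp_all
    ultimately show ?thesis using g_eval[of "[z]"] by (simp add: \<Phi>_def)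
  qed
  moreover have "g x = y"
  proof -
    have "eval X x = x" using eval_var[OF x(1)] .
    moreover have "eval (map h X) y = y"
      using y embedding_zero_minus(1)[OF E h] embeddingsD(4)[OF h] by (simp add: var_def)
    ultimately show ?thesis using g_eval[OF var_closed(1)[OF sr]] by (simp add: \<Phi>_def)
  qed
  ultimately show ?thesis by blast
qed

lemma card_roots_le_degree:
  assumes "p \<in> carrier (poly_ring R)" "p \<noteq> []" "S \<subseteq> {z \<in> carrier R. eval p z = \<zero>}"
  shows "finite S" "card S \<le> degree p"
proof -
  have S: "S \<subseteq> set_mset (roots p)"
    using assms roots_mem_iff_is_root[OF assms(1)] by (auto simp: is_root_def)
  then show "finite S" by (rule finite_subset) simp
  have "card S \<le> card (set_mset (roots p))" using S by (rule card_mono[rotated]) simp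
  also have "\<dots> \<le> size (roots p)" by (metis mset_set_set_mset_msubset size_mset_mono size_mset_set finite_set_mset)
  also have "\<dots> \<le> degree p" by (rule size_roots_le_degree[OF assms(1)])
  finally show "card S \<le> degree p" .
qed

lemma subfield_poly_carrier: "subfield E R \<Longrightarrow> p \<in> carrier (E[X]) \<Longrightarrow> p \<in> carrier (poly_ring R)"
  using carrier_polynomial_shell[OF subfieldE(1)] .

lemma embedding_root:
  assumes E: "subfield E R" and h: "h \<in> embeddings E" and F: "F \<subseteq> E" "\<And>z. z \<in> F \<Longrightarrow> h z = z"
    and p: "p \<in> carrier (F[X])" and x: "x \<in> E"
  shows "h (eval p x) = eval p (h x)"
proof -
  interpret h: ring_hom_ring "R\<lparr>carrier := E\<rparr>" R h by (rule embedding_ring_hom[OF E h])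
  have pF: "set p \<subseteq> F" using p polynomial_incl by (auto simp: univ_poly_carrier[symmetric])
  then have "map h p = p" using F(2) by (intro map_idI) auto
  then show ?thesis using h.eval_hom'[of x p] x pF F(1) eval_consistent[OF subfieldE(1)[OF E]] by auto
qed

text \<open>A simple extension lies in every subring that contains its generators. With this lemma
  and the next, equality of embeddings and containment of their images need be checked on generators
  only.\<close>

lemma subring_equalizer:
  assumes E: "subfield E R" and g: "g \<in> embeddings E" "h \<in> embeddings E"
  shows "subring {z \<in> E. g z = h z} R"
  using subfieldD[OF E] embeddingsD[OF g(1)] embeddingsD[OF g(2)]
    embedding_zero_minus[OF E g(1)] embedding_zero_minus[OF E g(2)]
  by (intro subringI) auto

lemma subring_preimage:
  assumes E: "subfield E R" and g: "g \<in> embeddings E" and S: "subfield S R"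
  shows "subring {z \<in> E. g z \<in> S} R"
  using subfieldD[OF E] embeddingsD[OF g] embedding_zero_minus[OF E g] subfieldD[OF S]
  by (intro subringI) auto

end

section \<open>Adjoining one element to a finite Galois extension\<close>

context algebraic_closure begin

lemma exists_root_closed:
  assumes "p \<in> carrier (poly_ring L)" "degree p \<ge> 1"
  shows "\<exists>z\<in>carrier L. eval p z = \<zero>"
proof -
  have "size (roots p) = degree p" using roots_over_carrier[OF assms(1)] by (simp add: splitted_def)
  then obtain z where "z \<in># roots p" using assms(2) by (metis multiset_nonemptyE not_one_le_zero size_empty)
  then show ?thesis using roots_mem_iff_is_root[OF assms(1)] by (auto simp: is_root_def)
qed

text \<open>For surjectivity: an element \<open>z\<close> is a root of a polynomial over
  \<open>K\<close>, and the injective map \<open>g\<close> permutes the finitely many roots of this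
  polynomial in \<open>E\<close>.\<close>

lemma embedding_is_automorphism:
  assumes E: "subfield E L" "K \<subseteq> E" and g: "g \<in> embeddings E" "\<And>z. z \<in> K \<Longrightarrow> g z = z"
    and img: "\<And>z. z \<in> E \<Longrightarrow> g z \<in> E"
  shows "restrict g E \<in> carrier (Gal L E K)"
proof (rule GalI)
  note sE = subfieldD[OF E(1)]
  have inj: "inj_on g E" by (rule embedding_inj[OF E(1) g(1)])
  have "E \<subseteq> g ` E"
  proof
    fix z assume z: "z \<in> E"
    obtain f where f: "f \<in> carrier (K[X])" "f \<noteq> []" "eval f z = \<zero>"
      using algebraicE[OF subfieldE(1)[OF subfield_axioms] sE(8)[OF z] algebraic_extension[OF sE(8)[OF z]]] .
    let ?S = "{y \<in> E. eval f y = \<zero>}"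
    have fin: "finite ?S"
      using card_roots_le_degree(1)[OF subfield_poly_carrier[OF subfield_axioms f(1)] f(2), of ?S] sE(8) by auto
    have "g ` ?S \<subseteq> ?S"
    proof
      fix u assume "u \<in> g ` ?S"
      then obtain y where y: "y \<in> E" "eval f y = \<zero>" "u = g y" by auto
      then have "eval f (g y) = \<zero>"
        using embedding_root[OF E(1) g(1) E(2) g(2) f(1) y(1)] embedding_zero_minus(1)[OF E(1) g(1)] by simp
      then show "u \<in> ?S" using y img by simp
    qed
    moreover have "card (g ` ?S) = card ?S" using inj by (intro card_image) (auto simp: inj_on_def)
    ultimately have "g ` ?S = ?S" using fin by (intro card_subset_eq) auto
    then show "z \<in> g ` E" using z f(3) by auto
  qed
  then show "bij_betw (restrict g E) E E" using inj img by (auto simp: bij_betw_def)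
qed (use embeddingsD[OF g(1)] subfieldD[OF E(1)] E(2) g(2) in auto)

lemma Gal_embedding:
  assumes "subfield E L" "a \<in> carrier (Gal L E F)"
  shows "a \<in> embeddings E"
  using GalD[OF assms(2)] subfieldD(8)[OF assms(1)] by (intro ring_hom_memI) auto

text \<open>Normality of \<open>M\<close>, obtained from Artin's theorem: an embedding that fixes
  the fixed field of a finite group belongs to this group.\<close>

lemma embedding_restricts:
  assumes M: "galois_extension L M K" "finite (carrier (Gal L M K))"
    and E: "M \<subseteq> E" and g: "g \<in> embeddings E" "\<And>z. z \<in> K \<Longrightarrow> g z = z"
  shows "restrict g M \<in> carrier (Gal L M K)"
proof -
  have M': "subfield M L" "K \<subseteq> M" and fixM: "fixed M (carrier (Gal L M K)) = K"
    using M by (auto simp: galois_extension_def fixed_def)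
  interpret G: group "Gal L M K" by (rule group_Gal[OF M'])
  note sM = subfieldD[OF M'(1)] and e = embeddingsD[OF g(1)]
  show ?thesis
    using e E sM M' g(2) fixM
    by (intro embedding_in_fixed_group[OF M' G.subgroup_self M(2)]) (auto simp: subset_iff)
qed

text \<open>The set \<open>S\<close> stands for separability: \<open>f\<close> has as many roots as
  its degree, so its factor \<open>Irr M x\<close> has too. The hypothesis \<open>conj\<close>
  stands for normality; it concerns only embeddings that restrict to the Galois group of
  \<open>M\<close>, whose action on \<open>x\<close> can be computed from their action on the
  coefficients.\<close>

lemma adjoin_galois:
  assumes M: "galois_extension L M K" "finite (carrier (Gal L M K))" and x: "x \<in> carrier L"
    and E_def: "E = simple_extension M x"
    and f: "f \<in> carrier (M[X])" "f \<noteq> []" "eval f x = \<zero>"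
    and S: "S \<subseteq> {z \<in> carrier L. eval f z = \<zero>}" "card S \<ge> degree f"
    and conj: "\<forall>g\<in>embeddings E. restrict g M \<in> carrier (Gal L M K) \<longrightarrow> g x \<in> E"
  shows "galois_extension L E K" "finite (carrier (Gal L E K))" "subfield E L" "M \<subseteq> E" "x \<in> E"
    "(\<lambda>a. restrict a M) \<in> hom (Gal L E K) (Gal L M K)"
    "(\<lambda>a. restrict a M) ` carrier (Gal L E K) = carrier (Gal L M K)"
    "\<And>a b. a \<in> carrier (Gal L E K) \<Longrightarrow> b \<in> carrier (Gal L E K) \<Longrightarrow>
        restrict a M = restrict b M \<Longrightarrow> a x = b x \<Longrightarrow> a = b"
    "x \<notin> M \<Longrightarrow> \<exists>a\<in>carrier (Gal L E K). restrict a M = (\<lambda>z\<in>M. z) \<and> a x \<noteq> x"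
proof -
  have M': "subfield M L" "K \<subseteq> M" and fixM: "fixed M (carrier (Gal L M K)) = K"
    using M by (auto simp: galois_extension_def fixed_def)
  note sM = subfieldD[OF M'(1)]
  have algM: "(algebraic over M) z" if "z \<in> carrier L" for z
    using algebraic_mono[OF M'(2) algebraic_extension[OF that]] .
  show E: "subfield E L"
    unfolding E_def using simple_extension_is_subfield[OF M'(1) x] algM[OF x] by simp
  note sE = subfieldD[OF E]
  show ME: "M \<subseteq> E" unfolding E_def by (rule simple_extension_incl[OF sM(1) x])
  show xE: "x \<in> E" unfolding E_def by (rule simple_extension_mem[OF subfieldE(1)[OF M'(1)] x])
  have KE: "K \<subseteq> E" using ME M'(2) by blast
  interpret GM: group "Gal L M K" by (rule group_Gal[OF M'])
  interpret GE: group "Gal L E K" by (rule group_Gal[OF E KE])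
  have E_ind: "E \<subseteq> S" if "subring S L" "M \<subseteq> S" "x \<in> S" for S
    unfolding E_def using simple_extension_subring_incl[OF that] .
  have eqE: "g z = h z" if gh: "g \<in> embeddings E" "h \<in> embeddings E" "\<And>z. z \<in> M \<Longrightarrow> g z = h z" "g x = h x"
    and z: "z \<in> E" for g h z
    using E_ind[OF subring_equalizer[OF E gh(1,2)]] gh(3,4) ME xE z by blast
  have auto: "restrict g E \<in> carrier (Gal L E K)"
    if g: "g \<in> embeddings E" and gM: "\<And>z. z \<in> M \<Longrightarrow> g z = a z" and a: "a \<in> carrier (Gal L M K)" for g a
  proof -
    have "restrict g M = a" using gM GalD(6)[OF a] by (intro extensionalityI[of _ M]) auto
    then have gx: "g x \<in> E" using conj g a by simp
    have "g z \<in> E" if "z \<in> M" for z using gM[OF that] GalD(1)[OF a that] ME by auto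
    then have "M \<subseteq> {z \<in> E. g z \<in> E}" using ME by auto
    then have "E \<subseteq> {z \<in> E. g z \<in> E}" using E_ind[OF subring_preimage[OF E g E]] gx xE by simp
    then have "g z \<in> E" if "z \<in> E" for z using that by auto
    moreover have "g z = z" if "z \<in> K" for z using gM[of z] GalD(5)[OF a that] that M'(2) by auto
    ultimately show ?thesis using embedding_is_automorphism[OF E KE g] by blast
  qed
  have id_M: "(\<lambda>z. z) \<in> embeddings M" using sM by (intro ring_hom_memI) auto
  let ?I = "Irr M x"
  have I: "?I \<in> carrier (M[X])" "pirreducible M ?I" "eval ?I x = \<zero>"
    using IrrE[OF M'(1) x algM[OF x]] by auto
  have dI: "degree ?I \<ge> 1" by (rule pirreducible_degree[OF M'(1) I(1,2)])
  then have Inz: "?I \<noteq> []" by auto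
  have IL: "?I \<in> carrier (poly_ring L)" by (rule subfield_poly_carrier[OF M'(1) I(1)])
  define C where "C = {z \<in> carrier L. eval ?I z = \<zero>}"
  have C_card: "card C \<ge> degree ?I" "finite C"
  proof -
    show fC: "finite C" using card_roots_le_degree(1)[OF IL Inz, of C] by (simp add: C_def)
    have "?I divides\<^bsub>M[X]\<^esub> f"
      using Irr_minimal[OF M'(1) x algM[OF x] f(1,3)] pdivides_iff_shell[OF M'(1) I(1) f(1)] by simp
    then obtain r where r: "r \<in> carrier (M[X])" "f = poly_mult ?I r" by (auto simp: factor_def univ_poly_mult)
    have rnz: "r \<noteq> []" using r f(2) poly_mult_zero(2)[of ?I] I(1) by (metis polynomial_in_carrier sM(1) univ_poly_carrier polynomial_incl subset_trans)
    have deg: "degree f = degree ?I + degree r"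
      using poly_mult_degree_eq[OF subfieldE(1)[OF M'(1)], of ?I r] I(1) r Inz rnz by (simp add: univ_poly_carrier)
    let ?T = "{z \<in> carrier L. eval r z = \<zero>}"
    have rL: "r \<in> carrier (poly_ring L)" by (rule subfield_poly_carrier[OF M'(1) r(1)])
    \<comment> \<open>Roots of \<open>f\<close> are roots of \<open>?I\<close> or of the cofactor
      \<open>r\<close>, and \<open>r\<close> has at most \<open>degree r\<close> of them.\<close>
    have "S \<subseteq> C \<union> ?T"
    proof
      fix z assume "z \<in> S"
      then have z: "z \<in> carrier L" "eval f z = \<zero>" using S(1) by auto
      have "set ?I \<subseteq> carrier L" "set r \<subseteq> carrier L"
        using IL rL polynomial_incl by (auto simp: univ_poly_carrier[symmetric])
      then have "eval ?I z \<otimes> eval r z = \<zero>" "eval ?I z \<in> carrier L" "eval r z \<in> carrier L"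
        using z r(2) eval_poly_mult[of ?I r z] eval_in_carrier by auto
      then have "eval ?I z = \<zero> \<or> eval r z = \<zero>" using integral by blast
      then show "z \<in> C \<union> ?T" using z by (auto simp: C_def)
    qed
    moreover have "finite ?T" "card ?T \<le> degree r" using card_roots_le_degree[OF rL rnz, of ?T] by auto
    ultimately have "card S \<le> card C + degree r"
      using card_mono[of "C \<union> ?T" S] card_Un_le[of C ?T] fC by fastforce
    then show "card C \<ge> degree ?I" using S(2) deg by simp
  qed
  have conj_auto: "\<exists>a\<in>carrier (Gal L E K). (\<forall>w\<in>M. a w = w) \<and> a x = z" if "z \<in> C" for z
  proof -
    have "eval (map (\<lambda>z. z) ?I) z = \<zero>" "z \<in> carrier L" using that by (auto simp: C_def)
    then obtain g where g: "g \<in> embeddings E" "\<And>w. w \<in> M \<Longrightarrow> g w = w" "g x = z"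
      using embedding_extends[OF M'(1) id_M x algM[OF x]] unfolding E_def by blast
    have "restrict g E \<in> carrier (Gal L E K)"
      using auto[OF g(1) _ GM.one_closed] g(2) by (simp add: one_Gal)
    then show ?thesis using g(2,3) ME xE by (intro bexI[of _ "restrict g E"]) auto
  qed
  show hom: "(\<lambda>a. restrict a M) \<in> hom (Gal L E K) (Gal L M K)"
  proof (rule homI)
    fix a assume a: "a \<in> carrier (Gal L E K)"
    show aM: "restrict a M \<in> carrier (Gal L M K)"
      by (rule embedding_restricts[OF M ME Gal_embedding[OF E a] GalD(5)[OF a]])
  next
    fix a b assume a: "a \<in> carrier (Gal L E K)" and b: "b \<in> carrier (Gal L E K)"
    have aM: "restrict a M \<in> carrier (Gal L M K)" if "a \<in> carrier (Gal L E K)" for a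
      by (rule embedding_restricts[OF M ME Gal_embedding[OF E that] GalD(5)[OF that]])
    show "restrict (a \<otimes>\<^bsub>Gal L E K\<^esub> b) M = restrict a M \<otimes>\<^bsub>Gal L M K\<^esub> restrict b M"
    proof (rule Gal_eqI[OF aM[OF GE.m_closed[OF a b]] GM.m_closed[OF aM[OF a] aM[OF b]]])
      fix z assume z: "z \<in> M"
      have "b z \<in> M" using GalD(1)[OF aM[OF b] z] z by simp
      then show "restrict (a \<otimes>\<^bsub>Gal L E K\<^esub> b) M z = (restrict a M \<otimes>\<^bsub>Gal L M K\<^esub> restrict b M) z"
        using z ME mult_Gal_apply[OF a b, of z] mult_Gal_apply[OF aM[OF a] aM[OF b] z] by auto
    qed
  qed
  have resM: "restrict a M \<in> carrier (Gal L M K)" if "a \<in> carrier (Gal L E K)" for a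
    using hom_in_carrier[OF hom that] .
  \<comment> \<open>The image of \<open>?I\<close> under \<open>a\<close> has a root in the
    algebraically closed field; sending \<open>x\<close> there extends \<open>a\<close>.\<close>
  have extend: "\<exists>a'\<in>carrier (Gal L E K). restrict a' M = a" if a: "a \<in> carrier (Gal L M K)" for a
  proof -
    have aemb: "a \<in> embeddings M" by (rule Gal_embedding[OF M'(1) a])
    have "field (L\<lparr>carrier := M\<rparr>)" using subfield_iff(2)[OF M'(1)] .
    moreover have "?I \<in> carrier (poly_ring (L\<lparr>carrier := M\<rparr>))"
      using I(1) univ_poly_consistent[OF subfieldE(1)[OF M'(1)]] by simp
    ultimately have "map a ?I \<in> carrier (poly_ring L)"
      using polynomial_hom[OF aemb _ field_axioms] by simp
    then obtain y where y: "y \<in> carrier L" "eval (map a ?I) y = \<zero>"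
      using exists_root_closed[of "map a ?I"] dI by auto
    then obtain g where g: "g \<in> embeddings E" "\<And>w. w \<in> M \<Longrightarrow> g w = a w"
      using embedding_extends[OF M'(1) aemb x algM[OF x]] unfolding E_def by blast
    have "restrict g E \<in> carrier (Gal L E K)" by (rule auto[OF g a])
    moreover have "restrict (restrict g E) M = a"
      using g(2) GalD(6)[OF a] ME by (intro extensionalityI[of _ M]) auto
    ultimately show ?thesis by blast
  qed
  then show "(\<lambda>a. restrict a M) ` carrier (Gal L E K) = carrier (Gal L M K)" using resM by (auto simp: image_iff)
  show inj: "a = b"
    if ab: "a \<in> carrier (Gal L E K)" "b \<in> carrier (Gal L E K)" "restrict a M = restrict b M" "a x = b x" for a b
  proof (rule Gal_eqI[OF ab(1,2)])
    fix z assume z: "z \<in> E"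
    have "a w = b w" if "w \<in> M" for w using fun_cong[OF ab(3), of w] that by simp
    then show "a z = b z" by (rule eqE[OF Gal_embedding[OF E ab(1)] Gal_embedding[OF E ab(2)] _ ab(4) z])
  qed
  show "finite (carrier (Gal L E K))"
  proof -
    obtain f where f: "f \<in> carrier (K[X])" "f \<noteq> []" "eval f x = \<zero>"
      using algebraicE[OF subfieldE(1)[OF subfield_axioms] x algebraic_extension[OF x]] .
    let ?S = "{y \<in> carrier L. eval f y = \<zero>}"
    have fin: "finite ?S"
      using card_roots_le_degree(1)[OF subfield_poly_carrier[OF subfield_axioms f(1)] f(2), of ?S] by auto
    have "(\<lambda>a. (restrict a M, a x)) ` carrier (Gal L E K) \<subseteq> carrier (Gal L M K) \<times> ?S"
    proof
      fix u assume "u \<in> (\<lambda>a. (restrict a M, a x)) ` carrier (Gal L E K)"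
      then obtain a where a: "a \<in> carrier (Gal L E K)" "u = (restrict a M, a x)" by auto
      note ae = Gal_embedding[OF E a(1)]
      have "eval f (a x) = \<zero>"
        using embedding_root[OF E ae KE GalD(5)[OF a(1)] f(1) xE] f(3) embedding_zero_minus(1)[OF E ae] by simp
      then show "u \<in> carrier (Gal L M K) \<times> ?S" using a resM embeddingsD(1)[OF ae xE] by simp
    qed
    then have "finite ((\<lambda>a. (restrict a M, a x)) ` carrier (Gal L E K))"
      using finite_subset fin M(2) by blast
    moreover have "inj_on (\<lambda>a. (restrict a M, a x)) (carrier (Gal L E K))"
      by (rule inj_onI) (simp add: inj)
    ultimately show ?thesis by (rule finite_imageD)
  qed
  show "\<exists>a\<in>carrier (Gal L E K). restrict a M = (\<lambda>z\<in>M. z) \<and> a x \<noteq> x" if "x \<notin> M"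
  proof -
    have "degree ?I \<noteq> 1"
    proof
      assume "degree ?I = 1"
      then obtain u v where uv: "?I = [u, v]" by (cases ?I; cases "tl ?I") auto
      have uvM: "u \<in> M" "v \<in> M" "u \<noteq> \<zero>"
        using I(1) uv by (auto simp: univ_poly_carrier[symmetric] polynomial_def)
      have c: "u \<in> carrier L" "v \<in> carrier L" using uvM sM(8) by auto
      have "u \<otimes> x \<oplus> v = \<zero>" using I(3) uv c x by simp
      then have "u \<otimes> x = \<ominus> v" using c x minus_equality[of "u \<otimes> x" v] by simp
      then have "x = inv u \<otimes> (\<ominus> v)"
        using c x uvM(3) field_Units by (metis (no_types, lifting) DiffI Units_inv_closed Units_l_inv empty_iff insert_iff l_one m_assoc)
      then show False using that uvM sM by simp
    qed
    then have "card C \<ge> 2" using C_card dI by linarith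
    then have "\<not> C \<subseteq> {x}" using card_mono[of "{x}" C] by auto
    then obtain z where z: "z \<in> C" "z \<noteq> x" by auto
    obtain a where a: "a \<in> carrier (Gal L E K)" "\<And>w. w \<in> M \<Longrightarrow> a w = w" "a x = z" using conj_auto[OF z(1)] by blast
    then have "restrict a M = (\<lambda>z\<in>M. z)" by (intro restrict_ext) simp
    then show ?thesis using a z by blast
  qed
  have "fixed E (carrier (Gal L E K)) \<subseteq> K"
  proof
    fix y assume y: "y \<in> fixed E (carrier (Gal L E K))"
    have yE: "y \<in> E" and ya: "\<And>a. a \<in> carrier (Gal L E K) \<Longrightarrow> a y = y" using fixedD[OF y] by auto
    have yc: "y \<in> carrier L" using sE(8)[OF yE] .
    interpret UP: domain "M[X]" by (rule univ_poly_is_domain[OF subfieldE(1)[OF M'(1)]])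
    have yM: "y \<in> M"
    proof -
      obtain u where u: "u \<in> carrier (M[X])" "eval u x = y"
        using yE simple_extension_as_eval_img[OF sM(1) x] by (auto simp: E_def)
      define v where "v = pmod u ?I"
      have v: "v \<in> carrier (M[X])" unfolding v_def using long_division_closed(2)[OF M'(1) u(1) I(1)] .
      have dv: "v = [] \<or> degree v < degree ?I" unfolding v_def by (rule pmod_degree[OF M'(1) u(1) I(1) Inz])
      note ev = eval_is_hom[OF subfieldE(1)[OF M'(1)]]
      have "eval u x = eval (?I \<otimes>\<^bsub>M[X]\<^esub> (pdiv u ?I)) x \<oplus> eval v x"
        using pdiv_pmod[OF M'(1) u(1) I(1)] ring_hom_add[OF ev[OF x], of "?I \<otimes>\<^bsub>M[X]\<^esub> (pdiv u ?I)" v]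
          long_division_closed(1)[OF M'(1) u(1) I(1)] I(1) v unfolding v_def by simp
      also have "eval (?I \<otimes>\<^bsub>M[X]\<^esub> (pdiv u ?I)) x = \<zero>"
        using ring_hom_mult[OF ev[OF x] I(1) long_division_closed(1)[OF M'(1) u(1) I(1)]] I(3)
          ring_hom_closed[OF ev[OF x] long_division_closed(1)[OF M'(1) u(1) I(1)]] by simp
      finally have vy: "eval v x = y" using u(2) ring_hom_closed[OF ev[OF x] v] by simp
      have v_conj: "eval v z = y" if z: "z \<in> C" for z
      proof -
        obtain a where a: "a \<in> carrier (Gal L E K)" "\<And>w. w \<in> M \<Longrightarrow> a w = w" "a x = z" using conj_auto[OF z] by blast
        have "a (eval v x) = eval v (a x)"
          by (rule embedding_root[OF E Gal_embedding[OF E a(1)] ME a(2) v xE])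
        then show ?thesis using vy ya[OF a(1)] a(3) by simp
      qed
      have vL: "set v \<subseteq> carrier L" using subfield_poly_carrier[OF M'(1) v] polynomial_incl by (auto simp: univ_poly_carrier[symmetric])
      \<comment> \<open>\<open>v\<close> takes the value \<open>y\<close> at every conjugate of
        \<open>x\<close>. There are at least \<open>degree ?I\<close> conjugates and
        \<open>v\<close> has smaller degree, so \<open>v\<close> minus the constant \<open>y\<close>
        is zero, and \<open>y\<close> is the constant coefficient of \<open>v\<close>.\<close>
      define t where "t = poly_add v [\<ominus> y]"
      have tL: "t \<in> carrier (poly_ring L)"
        unfolding t_def using vL yc poly_add_is_polynomial[OF carrier_is_subring, of v "[\<ominus> y]"] by (simp add: univ_poly_carrier)
      have "degree t < degree ?I"
      proof -
        have "degree t \<le> max (degree v) (degree [\<ominus> y])" unfolding t_def by (rule poly_add_degree)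
        then show ?thesis using dv dI by auto
      qed
      moreover have "C \<subseteq> {z \<in> carrier L. eval t z = \<zero>}"
      proof
        fix z assume z: "z \<in> C"
        then have zc: "z \<in> carrier L" by (simp add: C_def)
        have "eval t z = eval v z \<oplus> eval [\<ominus> y] z" unfolding t_def using vL yc zc by (intro eval_poly_add) auto
        then show "z \<in> {z \<in> carrier L. eval t z = \<zero>}" using v_conj[OF z] zc yc by (simp add: r_neg)
      qed
      ultimately have "t = []" using card_roots_le_degree(2)[OF tL, of C] C_card(1) by linarith
      then have coeffs: "coeff v i \<oplus> coeff [\<ominus> y] i = \<zero>" for i
        using poly_add_coeff[OF vL, of "[\<ominus> y]"] yc unfolding t_def[symmetric] by (metis coeff.simps(1) empty_set insert_subset a_inv_closed list.simps(15) empty_subsetI)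
      have "coeff v 0 = y" using coeffs[of 0] yc coeff_in_carrier[OF vL, of 0] minus_equality[of "coeff v 0" "\<ominus> y"] by simp
      moreover have "coeff v 0 \<in> M"
      proof (cases "v = []")
        case False
        then have "coeff v 0 \<in> set v" using coeff_img_restrict[of v] by (metis imageI length_greater_0_conv lessThan_iff)
        then show ?thesis using v polynomial_incl by (auto simp: univ_poly_carrier[symmetric])
      qed (simp add: sM(2))
      ultimately show ?thesis by simp
    qed
    have "a y = y" if "a \<in> carrier (Gal L M K)" for a
      using extend[OF that] ya yM by (metis restrict_apply')
    then have "y \<in> fixed M (carrier (Gal L M K))" using yM by (simp add: fixed_def)
    then show "y \<in> K" using fixM by simp
  qed
  moreover have "K \<subseteq> fixed E (carrier (Gal L E K))" using KE GalD(5) by (force simp: fixed_def)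
  ultimately have "fixed E (carrier (Gal L E K)) = K" by blast
  then show "galois_extension L E K"
    using E KE algebraic_extension sE(8) subfield_axioms by (auto simp: galois_extension_def fixed_def)
qed

end

section \<open>Twisting the given extension\<close>

text \<open>The common setting of Kummer theory, with \<open>U\<close> the multiplicative group, and of Artin-Schreier
  theory, with \<open>U\<close> the additive group.\<close>

locale kummer_group = algebraic_closure L K for L (structure) and K +
  fixes U :: "('a, 'u) monoid_scheme" and p :: nat and \<pi> :: "'a \<Rightarrow> 'a" and \<zeta> :: 'a
  assumes prime_p: "prime p" and comm_group_U: "comm_group U" and U_sub: "carrier U \<subseteq> carrier L"
    and subgroup_U: "\<And>E. subfield E L \<Longrightarrow> subgroup (E \<inter> carrier U) U"
    and embedding_U: "\<And>E h x. subfield E L \<Longrightarrow> h \<in> embeddings E \<Longrightarrow> x \<in> E \<Longrightarrow> x \<in> carrier U \<Longrightarrow> h x \<in> carrier U"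
    and embedding_mult: "\<And>E h x y. subfield E L \<Longrightarrow> h \<in> embeddings E \<Longrightarrow> x \<in> E \<Longrightarrow> y \<in> E \<Longrightarrow>
          h (x \<otimes>\<^bsub>U\<^esub> y) = h x \<otimes>\<^bsub>U\<^esub> h y"
    and embedding_\<pi>: "\<And>E h x. subfield E L \<Longrightarrow> h \<in> embeddings E \<Longrightarrow> x \<in> E \<Longrightarrow> h (\<pi> x) = \<pi> (h x)"
    and \<pi>_hom: "\<pi> \<in> hom U U" and \<pi>_sub: "\<And>E x. subfield E L \<Longrightarrow> x \<in> E \<Longrightarrow> \<pi> x \<in> E"
    and \<zeta>_U: "\<zeta> \<in> carrier U" and \<zeta>_not_one: "\<zeta> \<noteq> \<one>\<^bsub>U\<^esub>" and \<zeta>_pow: "\<zeta> [^]\<^bsub>U\<^esub> p = \<one>\<^bsub>U\<^esub>"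
    and \<pi>_kernel: "\<And>x. x \<in> carrier U \<Longrightarrow> \<pi> x = \<one>\<^bsub>U\<^esub> \<longleftrightarrow> (\<exists>j::nat. x = \<zeta> [^]\<^bsub>U\<^esub> j)"
    and \<pi>_poly: "\<And>E b. subfield E L \<Longrightarrow> b \<in> E \<Longrightarrow> b \<in> carrier U \<Longrightarrow>
          \<exists>f\<in>carrier (E[X]). degree f = p \<and> (\<forall>z\<in>carrier L. eval f z = \<zero> \<longleftrightarrow> z \<in> carrier U \<and> \<pi> z = b)"
    and pow_\<pi>: "\<And>E x. subfield E L \<Longrightarrow> x \<in> E \<Longrightarrow> x \<in> carrier U \<Longrightarrow>
          \<exists>y\<in>E \<inter> carrier U. x [^]\<^bsub>U\<^esub> p = \<pi> y"
    and hilbert90: "\<And>M F P ch. subfield M L \<Longrightarrow> F \<subseteq> M \<Longrightarrow> subgroup P (Gal L M F) \<Longrightarrow> finite P \<Longrightarrow>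
          (\<And>a. a \<in> P \<Longrightarrow> ch a \<in> fixed M P \<inter> carrier U) \<Longrightarrow>
          (\<And>a b. a \<in> P \<Longrightarrow> b \<in> P \<Longrightarrow> ch (a \<otimes>\<^bsub>Gal L M F\<^esub> b) = ch a \<otimes>\<^bsub>U\<^esub> ch b) \<Longrightarrow>
          \<exists>\<gamma>\<in>M \<inter> carrier U. \<forall>a\<in>P. a \<gamma> = ch a \<otimes>\<^bsub>U\<^esub> \<gamma>"
    and hilbert90_cyclic: "\<And>E F t x. subfield E L \<Longrightarrow> t \<in> carrier (Gal L E F) \<Longrightarrow>
          (\<And>x. x \<in> E \<Longrightarrow> (t ^^ p) x = x) \<Longrightarrow> \<exists>x\<in>E. t x \<noteq> x \<Longrightarrow> x \<in> E \<Longrightarrow> x \<in> carrier U \<Longrightarrow>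
          comm_group.norm_prod U t p x = \<one>\<^bsub>U\<^esub> \<Longrightarrow> \<exists>b\<in>E \<inter> carrier U. t b = x \<otimes>\<^bsub>U\<^esub> b"
    and \<zeta>_norm: "(\<forall>E F t. subfield E L \<longrightarrow> t \<in> carrier (Gal L E F) \<longrightarrow>
          (\<forall>x\<in>E. (t ^^ p) x = x) \<longrightarrow> (\<exists>x\<in>E. t x \<noteq> x) \<longrightarrow>
          (\<exists>y\<in>E \<inter> carrier U. comm_group.norm_prod U t p y = \<zeta>)) \<or>
        (\<forall>x\<in>carrier U. \<pi> x = x [^]\<^bsub>U\<^esub> p)"
begin

sublocale U: comm_group U by (rule comm_group_U)

lemma U_carrier: "x \<in> carrier U \<Longrightarrow> x \<in> carrier L" using U_sub by blast

lemma \<pi>_U: "x \<in> carrier U \<Longrightarrow> \<pi> x \<in> carrier U" using hom_in_carrier[OF \<pi>_hom] .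

lemma U_closed:
  assumes "subfield E L"
  shows "\<And>x y. x \<in> E \<Longrightarrow> y \<in> E \<Longrightarrow> x \<in> carrier U \<Longrightarrow> y \<in> carrier U \<Longrightarrow> x \<otimes>\<^bsub>U\<^esub> y \<in> E"
    "\<one>\<^bsub>U\<^esub> \<in> E" "\<And>x. x \<in> E \<Longrightarrow> x \<in> carrier U \<Longrightarrow> inv\<^bsub>U\<^esub> x \<in> E"
    "\<And>x i. x \<in> E \<Longrightarrow> x \<in> carrier U \<Longrightarrow> x [^]\<^bsub>U\<^esub> (i::nat) \<in> E"
proof -
  interpret S: subgroup "E \<inter> carrier U" U by (rule subgroup_U[OF assms])
  show 1: "x \<otimes>\<^bsub>U\<^esub> y \<in> E" if "x \<in> E" "y \<in> E" "x \<in> carrier U" "y \<in> carrier U" for x y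
    using S.m_closed[of x y] that by auto
  show 2: "\<one>\<^bsub>U\<^esub> \<in> E" using S.one_closed by auto
  show "inv\<^bsub>U\<^esub> x \<in> E" if "x \<in> E" "x \<in> carrier U" for x using S.m_inv_closed[of x] that by auto
  show "x [^]\<^bsub>U\<^esub> (i::nat) \<in> E" if "x \<in> E" "x \<in> carrier U" for x i
    using that 1 2 by (induction i) auto
qed

lemma embedding_one:
  assumes "subfield E L" "h \<in> embeddings E"
  shows "h \<one>\<^bsub>U\<^esub> = \<one>\<^bsub>U\<^esub>"
proof -
  have 1: "\<one>\<^bsub>U\<^esub> \<in> E" by (rule U_closed(2)[OF assms(1)])
  have "h \<one>\<^bsub>U\<^esub> \<otimes>\<^bsub>U\<^esub> h \<one>\<^bsub>U\<^esub> = h \<one>\<^bsub>U\<^esub>" using embedding_mult[OF assms 1 1] by simp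
  then show ?thesis using embedding_U[OF assms 1 U.one_closed] by simp
qed

lemma embedding_pow:
  assumes "subfield E L" "h \<in> embeddings E" "x \<in> E" "x \<in> carrier U"
  shows "h (x [^]\<^bsub>U\<^esub> (i::nat)) = h x [^]\<^bsub>U\<^esub> i"
  using embedding_one[OF assms(1,2)] embedding_mult[OF assms(1,2)] U_closed(4)[OF assms(1,3,4)] assms(3)
  by (induction i) auto

lemma \<zeta>_pow_eq_iff: "\<zeta> [^]\<^bsub>U\<^esub> (i::nat) = \<zeta> [^]\<^bsub>U\<^esub> (j::nat) \<longleftrightarrow> [i = j] (mod p)"
proof -
  have red: "\<zeta> [^]\<^bsub>U\<^esub> (i::nat) = \<zeta> [^]\<^bsub>U\<^esub> (i mod p)" for i
  proof -
    have "\<zeta> [^]\<^bsub>U\<^esub> i = \<zeta> [^]\<^bsub>U\<^esub> (i mod p + p * (i div p))" by simp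
    also have "\<dots> = \<zeta> [^]\<^bsub>U\<^esub> (i mod p) \<otimes>\<^bsub>U\<^esub> (\<zeta> [^]\<^bsub>U\<^esub> p) [^]\<^bsub>U\<^esub> (i div p)"
      using \<zeta>_U by (simp only: U.nat_pow_mult U.nat_pow_pow)
    finally show ?thesis using \<zeta>_U \<zeta>_pow by simp
  qed
  have "i mod p = j mod p" if eq: "\<zeta> [^]\<^bsub>U\<^esub> i = \<zeta> [^]\<^bsub>U\<^esub> j" and "j \<le> i" for i j :: nat
  proof (rule ccontr)
    assume ne: "i mod p \<noteq> j mod p"
    have "\<zeta> [^]\<^bsub>U\<^esub> j \<otimes>\<^bsub>U\<^esub> \<zeta> [^]\<^bsub>U\<^esub> (i - j) = \<zeta> [^]\<^bsub>U\<^esub> j"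
      using \<zeta>_U \<open>j \<le> i\<close> eq by (simp add: U.nat_pow_mult)
    then have one: "\<zeta> [^]\<^bsub>U\<^esub> (i - j) = \<one>\<^bsub>U\<^esub>" using \<zeta>_U by simp
    have "\<not> p dvd i - j" using ne \<open>j \<le> i\<close> by (metis mod_eq_dvd_iff_nat)
    then have "coprime (i - j) p" using prime_p by (metis coprime_commute prime_imp_coprime)
    then obtain u v where "(i - j) * u = p * v + 1"
      using coprime_bezout_strong[of "i - j" p] prime_p prime_gt_1_nat by auto
    then have "\<zeta> [^]\<^bsub>U\<^esub> ((i - j) * u) = (\<zeta> [^]\<^bsub>U\<^esub> p) [^]\<^bsub>U\<^esub> v \<otimes>\<^bsub>U\<^esub> \<zeta>"
      using \<zeta>_U by (simp add: U.nat_pow_pow)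
    then show False using \<zeta>_U \<zeta>_not_one one \<zeta>_pow by (simp add: U.nat_pow_pow[symmetric])
  qed
  then have "i mod p = j mod p" if "\<zeta> [^]\<^bsub>U\<^esub> i = \<zeta> [^]\<^bsub>U\<^esub> j" for i j :: nat
    using that by (metis nat_le_linear)
  then show ?thesis using red unfolding cong_def by metis
qed

lemma same_\<pi>:
  assumes "x \<in> carrier U" "y \<in> carrier U" "\<pi> x = \<pi> y"
  shows "\<exists>j<p. x = \<zeta> [^]\<^bsub>U\<^esub> (j::nat) \<otimes>\<^bsub>U\<^esub> y"
proof -
  have "\<pi> (x \<otimes>\<^bsub>U\<^esub> inv\<^bsub>U\<^esub> y) = \<one>\<^bsub>U\<^esub>"
    using assms hom_mult[OF \<pi>_hom] U.hom_inv'[OF \<pi>_hom] \<pi>_U by simp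
  then obtain j :: nat where j: "x \<otimes>\<^bsub>U\<^esub> inv\<^bsub>U\<^esub> y = \<zeta> [^]\<^bsub>U\<^esub> j" using \<pi>_kernel assms by auto
  have "\<zeta> [^]\<^bsub>U\<^esub> j = \<zeta> [^]\<^bsub>U\<^esub> (j mod p)" by (simp add: \<zeta>_pow_eq_iff)
  moreover have "x = \<zeta> [^]\<^bsub>U\<^esub> j \<otimes>\<^bsub>U\<^esub> y" using j assms \<zeta>_U by (metis U.inv_solve_right U.nat_pow_closed)
  ultimately show ?thesis using prime_gt_0_nat[OF prime_p] by (intro exI[of _ "j mod p"]) simp
qed

end

text \<open>\<open>M\<close> is the given \<open>\<Gamma>\<close>-extension with \<open>\<zeta>\<close> adjoined, and \<open>w\<close> is the cyclotomic character.\<close>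

locale kummer_extension = kummer_group L K U p \<pi> \<zeta> + gamma_params p q k
  for L (structure) and K and U :: "('a, 'u) monoid_scheme" and p \<pi> \<zeta> q k +
  fixes n :: nat and M :: "'a set" and \<rho> :: "('a \<Rightarrow> 'a) \<Rightarrow> (nat \<Rightarrow> int \<Rightarrow> int) \<times> int" and w :: "('a \<Rightarrow> 'a) \<Rightarrow> nat"
  assumes q_eq: "q = p ^ n" and n_pos: "n \<ge> 1" and p2: "p = 2 \<Longrightarrow> n \<ge> 2"
    and gal_M: "galois_extension L M K" and fin_M: "finite (carrier (Gal L M K))"
    and \<rho>_hom: "\<rho> \<in> hom (Gal L M K) \<Gamma>" and \<rho>_onto: "\<rho> ` carrier (Gal L M K) = carrier \<Gamma>"
    and \<zeta>_M: "\<zeta> \<in> M"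
    and w_range: "\<And>a. a \<in> carrier (Gal L M K) \<Longrightarrow> 0 < w a \<and> w a < p"
    and w_\<zeta>: "\<And>a. a \<in> carrier (Gal L M K) \<Longrightarrow> a \<zeta> = \<zeta> [^]\<^bsub>U\<^esub> w a"
    and \<rho>_w_inj: "\<And>a b. a \<in> carrier (Gal L M K) \<Longrightarrow> b \<in> carrier (Gal L M K) \<Longrightarrow>
           \<rho> a = \<rho> b \<Longrightarrow> w a = w b \<Longrightarrow> a = b"
begin

abbreviation A where "A \<equiv> Gal L M K"

lemma M: "subfield M L" "K \<subseteq> M"
  using gal_M by (auto simp: galois_extension_def)

sublocale A: group A by (rule group_Gal[OF M])

sublocale \<Gamma>: group \<Gamma> by (rule group_\<Gamma>)

lemma A_emb: "a \<in> carrier A \<Longrightarrow> a \<in> embeddings M" by (rule Gal_embedding[OF M(1)])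

lemma \<rho>_mult: "a \<in> carrier A \<Longrightarrow> b \<in> carrier A \<Longrightarrow> \<rho> (a \<otimes>\<^bsub>A\<^esub> b) = \<rho> a \<otimes>\<^bsub>\<Gamma>\<^esub> \<rho> b"
  by (rule hom_mult[OF \<rho>_hom])
lemma \<rho>_closed: "a \<in> carrier A \<Longrightarrow> \<rho> a \<in> carrier \<Gamma>" by (rule hom_in_carrier[OF \<rho>_hom])

sublocale \<rho>: group_hom A \<Gamma> \<rho>
  using \<rho>_hom by (simp add: group_hom_def group_hom_axioms_def A.is_group \<Gamma>.is_group)

lemma apply_\<zeta>_pow: "a \<in> carrier A \<Longrightarrow> a (\<zeta> [^]\<^bsub>U\<^esub> (i::nat)) = \<zeta> [^]\<^bsub>U\<^esub> (w a * i)"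
  using embedding_pow[OF M(1) A_emb \<zeta>_M \<zeta>_U] \<zeta>_U by (simp add: w_\<zeta> U.nat_pow_pow)

lemma w_mult: "a \<in> carrier A \<Longrightarrow> b \<in> carrier A \<Longrightarrow> [w (a \<otimes>\<^bsub>A\<^esub> b) = w a * w b] (mod p)"
  using mult_Gal_apply[of a M K b \<zeta>] \<zeta>_M apply_\<zeta>_pow[of a "w b"] w_\<zeta>[of b] w_\<zeta>[of "a \<otimes>\<^bsub>A\<^esub> b"]
  by (simp add: \<zeta>_pow_eq_iff)

lemma w_eqI: "a \<in> carrier A \<Longrightarrow> b \<in> carrier A \<Longrightarrow> [w a = w b] (mod p) \<Longrightarrow> w a = w b"
  using w_range by (simp add: cong_def)

lemma w_one: "w \<one>\<^bsub>A\<^esub> = 1"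
proof -
  have "\<zeta> [^]\<^bsub>U\<^esub> w \<one>\<^bsub>A\<^esub> = \<zeta> [^]\<^bsub>U\<^esub> (1::nat)" using w_\<zeta>[OF A.one_closed] \<zeta>_M \<zeta>_U by (simp add: one_Gal)
  then have "[w \<one>\<^bsub>A\<^esub> = 1] (mod p)" by (simp only: \<zeta>_pow_eq_iff)
  then show ?thesis using w_range[OF A.one_closed] p_gt_1 by (simp add: cong_def)
qed

lemma w_pow: "a \<in> carrier A \<Longrightarrow> [w (a [^]\<^bsub>A\<^esub> (i::nat)) = w a ^ i] (mod p)"
proof (induction i)
  case (Suc i)
  have "[w (a [^]\<^bsub>A\<^esub> i \<otimes>\<^bsub>A\<^esub> a) = w (a [^]\<^bsub>A\<^esub> i) * w a] (mod p)" using Suc.prems by (intro w_mult) auto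
  also have "[w (a [^]\<^bsub>A\<^esub> i) * w a = w a ^ i * w a] (mod p)" using Suc by (intro cong_scalar_right) auto
  finally show ?case by (simp add: mult.commute)
qed (simp add: w_one)

text \<open>A power of \<open>a\<close> with exponent divisible by \<open>p - 1\<close> but congruent to \<open>1\<close> modulo the order of
  \<open>\<Gamma>\<close> fixes \<open>\<zeta>\<close> without changing \<open>\<rho> a\<close>.\<close>

lemma exists_lift: "\<gamma> \<in> carrier \<Gamma> \<Longrightarrow> \<exists>a\<in>carrier A. \<rho> a = \<gamma> \<and> w a = 1"
proof -
  assume \<gamma>: "\<gamma> \<in> carrier \<Gamma>"
  then obtain a where a: "a \<in> carrier A" "\<rho> a = \<gamma>" using \<rho>_onto by (metis imageE)
  define N where "N = order \<Gamma>"
  have N: "N = p ^ (q * k + n)" unfolding N_def order_def card_\<Gamma> by (simp add: q_eq power_add)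
  have "p ^ 1 \<le> N" unfolding N using n_pos p_gt_1 by (intro power_increasing) auto
  then have N2: "N \<ge> 2" using p_gt_1 by simp
  \<comment> \<open>\<open>N\<close> is a power of \<open>p\<close>, hence 1 mod
    \<open>p - 1\<close>, so \<open>p - 1\<close> divides \<open>N - 1\<close>; and
    \<open>(N - 1)^2\<close> is \<open>N (N - 2) + 1\<close>, hence 1 mod \<open>N\<close>.\<close>
  define e where "e = (N - 1) * (N - 1)"
  have "[p = 1] (mod (p - 1))" using p_gt_1 by (simp add: cong_altdef_nat)
  then have "[N = 1 ^ (q * k + n)] (mod (p - 1))" unfolding N by (rule cong_pow)
  then have "(p - 1) dvd (N - 1)" using N2 by (simp add: cong_altdef_nat)
  then have "(p - 1) dvd e" unfolding e_def by (rule dvd_mult)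
  then obtain u where u: "e = (p - 1) * u" by (rule dvdE)
  have e: "e = N * (N - 2) + 1"
  proof -
    obtain m where "N = m + 2" using N2 by (metis add.commute le_Suc_ex)
    then show ?thesis by (simp add: e_def algebra_simps)
  qed
  have "\<rho> (a [^]\<^bsub>A\<^esub> e) = \<gamma> [^]\<^bsub>\<Gamma>\<^esub> e" using a by (simp add: \<rho>.hom_nat_pow)
  also have "\<dots> = (\<gamma> [^]\<^bsub>\<Gamma>\<^esub> N) [^]\<^bsub>\<Gamma>\<^esub> (N - 2) \<otimes>\<^bsub>\<Gamma>\<^esub> \<gamma>"
    using \<gamma> by (simp add: e \<Gamma>.nat_pow_mult[symmetric] \<Gamma>.nat_pow_pow)
  also have "\<dots> = \<gamma>" using \<gamma> \<Gamma>.pow_order_eq_1[OF \<gamma>] by (simp add: N_def)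
  finally have "\<rho> (a [^]\<^bsub>A\<^esub> e) = \<gamma>" .
  moreover have "w (a [^]\<^bsub>A\<^esub> e) = 1"
  proof -
    have "\<not> p dvd w a" using w_range[OF a(1)] by (auto dest: dvd_imp_le)
    then have "[w a ^ (p - 1) = 1] (mod p)" by (rule fermat_theorem[OF prime_p])
    then have "[(w a ^ (p - 1)) ^ u = 1 ^ u] (mod p)" by (rule cong_pow)
    then have "[w (a [^]\<^bsub>A\<^esub> e) = 1] (mod p)" using w_pow[OF a(1), of e] by (simp add: u power_mult cong_trans)
    then show ?thesis using w_range[of "a [^]\<^bsub>A\<^esub> e"] a p_gt_1 by (simp add: cong_def)
  qed
  ultimately show ?thesis using a by blast
qed

text \<open>Unique, since \<open>\<rho>\<close> and \<open>w\<close> together are injective; by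
  \<open>lift_mult\<close> it is a homomorphic section of \<open>\<rho>\<close>. With
  \<open>D_commutes\<close> and \<open>decompose\<close>, \<open>A\<close> is the direct product of
  a copy of \<open>\<Gamma>\<close> and of \<open>D\<close>.\<close>

definition lift where "lift \<gamma> = (SOME a. a \<in> carrier A \<and> \<rho> a = \<gamma> \<and> w a = 1)"

lemma lift:
  assumes "\<gamma> \<in> carrier \<Gamma>"
  shows "lift \<gamma> \<in> carrier A" "\<rho> (lift \<gamma>) = \<gamma>" "w (lift \<gamma>) = 1"
  using someI_ex[of "\<lambda>a. a \<in> carrier A \<and> \<rho> a = \<gamma> \<and> w a = 1"] exists_lift[OF assms] by (auto simp: lift_def)

lemma lift_mult:
  assumes "\<gamma> \<in> carrier \<Gamma>" "\<delta> \<in> carrier \<Gamma>"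
  shows "lift (\<gamma> \<otimes>\<^bsub>\<Gamma>\<^esub> \<delta>) = lift \<gamma> \<otimes>\<^bsub>A\<^esub> lift \<delta>"
proof (rule \<rho>_w_inj)
  note l = lift[OF assms(1)] lift[OF assms(2)] lift[OF \<Gamma>.m_closed[OF assms]]
  show "\<rho> (lift (\<gamma> \<otimes>\<^bsub>\<Gamma>\<^esub> \<delta>)) = \<rho> (lift \<gamma> \<otimes>\<^bsub>A\<^esub> lift \<delta>)" using l by (simp add: \<rho>_mult)
  have "[w (lift \<gamma> \<otimes>\<^bsub>A\<^esub> lift \<delta>) = 1] (mod p)" using w_mult[OF l(1,4)] l by simp
  then have "w (lift \<gamma> \<otimes>\<^bsub>A\<^esub> lift \<delta>) = 1" using w_range[OF A.m_closed[OF l(1,4)]] p_gt_1 by (simp add: cong_def)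
  then show "w (lift (\<gamma> \<otimes>\<^bsub>\<Gamma>\<^esub> \<delta>)) = w (lift \<gamma> \<otimes>\<^bsub>A\<^esub> lift \<delta>)" using l by simp
qed (use assms lift in auto)

lemma lift_unique: "a \<in> carrier A \<Longrightarrow> w a = 1 \<Longrightarrow> lift (\<rho> a) = a"
  using lift[OF \<rho>_closed] by (intro \<rho>_w_inj) auto

lemma lift_apply:
  assumes "\<gamma> \<in> carrier \<Gamma>" "\<delta> \<in> carrier \<Gamma>" "x \<in> M"
  shows "lift (\<gamma> \<otimes>\<^bsub>\<Gamma>\<^esub> \<delta>) x = lift \<gamma> (lift \<delta> x)"
  using mult_Gal_apply[OF lift(1)[OF assms(1)] lift(1)[OF assms(2)] assms(3)] lift_mult[OF assms(1,2)] by simp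

lemma lift_one: "x \<in> M \<Longrightarrow> lift \<one>\<^bsub>\<Gamma>\<^esub> x = x"
  using lift_unique[OF A.one_closed w_one] unfolding \<rho>.hom_one by (simp add: one_Gal)

lemma lift_closed: "\<gamma> \<in> carrier \<Gamma> \<Longrightarrow> x \<in> M \<Longrightarrow> lift \<gamma> x \<in> M"
  using GalD(1)[OF lift(1)] .

text \<open>The actions of the module, of a generator of the cyclic quotient, and of the kernel of
  \<open>\<rho>\<close>; on this kernel \<open>w\<close> is injective.\<close>

definition \<alpha> where "\<alpha> v = lift (v, 0)"
definition s where "s = lift (\<one>\<^bsub>V\<^esub>, 1)"
definition D where "D = A\<lparr>carrier := kernel A \<Gamma> \<rho>\<rparr>"

lemma in_\<Gamma>: "v \<in> carrier V \<Longrightarrow> (v, 0) \<in> carrier \<Gamma>" "(\<one>\<^bsub>V\<^esub>, 1) \<in> carrier \<Gamma>"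
  using q_gt_1 by (auto simp: carrier_\<Gamma>)

lemma \<alpha>_A: "v \<in> carrier V \<Longrightarrow> \<alpha> v \<in> carrier A" unfolding \<alpha>_def using lift(1) in_\<Gamma> by blast
lemma s_A: "s \<in> carrier A" unfolding s_def using lift(1) in_\<Gamma> by blast

lemma \<alpha>_mult: "v \<in> carrier V \<Longrightarrow> u \<in> carrier V \<Longrightarrow> x \<in> M \<Longrightarrow> \<alpha> (v \<otimes>\<^bsub>V\<^esub> u) x = \<alpha> v (\<alpha> u x)"
  using lift_apply[OF in_\<Gamma>(1) in_\<Gamma>(1), of v u x] q_gt_1 by (simp add: \<alpha>_def mult_\<Gamma> shift_0)

lemma s_\<alpha>: "v \<in> carrier V \<Longrightarrow> x \<in> M \<Longrightarrow> s (\<alpha> v x) = \<alpha> (shift 1 v) (s x)"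
  using lift_apply[OF in_\<Gamma>(2) in_\<Gamma>(1), of v x] lift_apply[OF in_\<Gamma>(1) in_\<Gamma>(2), of "shift 1 v" x] q_gt_1
  by (simp add: \<alpha>_def s_def mult_\<Gamma> shift_closed shift_0)

lemma s_pow: "x \<in> M \<Longrightarrow> (s ^^ i) x = lift (\<one>\<^bsub>V\<^esub>, int i mod int q) x"
proof (induction i)
  case 0
  then show ?case using lift_one by (simp add: one_\<Gamma>)
next
  case (Suc i)
  have c: "(\<one>\<^bsub>V\<^esub>, int i mod int q) \<in> carrier \<Gamma>" using q_gt_1 by (simp add: carrier_\<Gamma>)
  have "(s ^^ Suc i) x = lift ((\<one>\<^bsub>V\<^esub>, 1) \<otimes>\<^bsub>\<Gamma>\<^esub> (\<one>\<^bsub>V\<^esub>, int i mod int q)) x"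
    using Suc lift_apply[OF in_\<Gamma>(2) c] by (simp add: s_def)
  also have "(\<one>\<^bsub>V\<^esub>, 1) \<otimes>\<^bsub>\<Gamma>\<^esub> (\<one>\<^bsub>V\<^esub>, int i mod int q) = (\<one>\<^bsub>V\<^esub>, int (Suc i) mod int q)"
    using q_gt_1 by (simp add: mult_\<Gamma> shift_one mod_simps)
  finally show ?case .
qed

lemma s_order: "x \<in> M \<Longrightarrow> (s ^^ q) x = x"
  using s_pow[of x q] lift_one by (simp add: one_\<Gamma>)

lemma D_carrier: "d \<in> carrier D \<longleftrightarrow> d \<in> carrier A \<and> \<rho> d = \<one>\<^bsub>\<Gamma>\<^esub>"
  by (auto simp: D_def kernel_def)

lemma D_group: "group D"
  unfolding D_def using A.subgroup_imp_group \<rho>.subgroup_kernel by blast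

text \<open>Both products have the same \<open>\<rho>\<close>, which is trivial on \<open>D\<close>,
  and the same \<open>w\<close>, whose values commute; \<open>\<rho>_w_inj\<close> does the
  rest.\<close>

lemma D_commutes:
  assumes d: "d \<in> carrier D" and \<gamma>: "\<gamma> \<in> carrier \<Gamma>" and x: "x \<in> M"
  shows "d (lift \<gamma> x) = lift \<gamma> (d x)"
proof -
  note l = lift[OF \<gamma>]
  have dA: "d \<in> carrier A" "\<rho> d = \<one>\<^bsub>\<Gamma>\<^esub>" using d by (auto simp: D_carrier)
  have "d \<otimes>\<^bsub>A\<^esub> lift \<gamma> = lift \<gamma> \<otimes>\<^bsub>A\<^esub> d"
  proof (rule \<rho>_w_inj)
    show "\<rho> (d \<otimes>\<^bsub>A\<^esub> lift \<gamma>) = \<rho> (lift \<gamma> \<otimes>\<^bsub>A\<^esub> d)" using dA l \<gamma> by (simp add: \<rho>_mult)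
    have "[w (d \<otimes>\<^bsub>A\<^esub> lift \<gamma>) = w (lift \<gamma> \<otimes>\<^bsub>A\<^esub> d)] (mod p)"
      using w_mult[OF dA(1) l(1)] w_mult[OF l(1) dA(1)] by (simp add: mult.commute cong_def)
    then show "w (d \<otimes>\<^bsub>A\<^esub> lift \<gamma>) = w (lift \<gamma> \<otimes>\<^bsub>A\<^esub> d)" using dA l by (intro w_eqI) auto
  qed (use dA l in auto)
  then show ?thesis using mult_Gal_apply[OF dA(1) l(1) x] mult_Gal_apply[OF l(1) dA(1) x] by simp
qed

lemma D_small: "finite (carrier D)" "card (carrier D) < p"
proof -
  show "finite (carrier D)" using fin_M by (auto simp: D_def kernel_def)
  have "inj_on w (carrier D)" by (rule inj_onI) (auto simp: D_carrier intro: \<rho>_w_inj)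
  moreover have "w ` carrier D \<subseteq> {0<..<p}" using w_range by (auto simp: D_carrier)
  ultimately have "card (carrier D) \<le> card {0<..<p}" by (intro card_inj_on_le) auto
  then show "card (carrier D) < p" using p_gt_1 by simp
qed

abbreviation UM where "UM \<equiv> U\<lparr>carrier := M \<inter> carrier U\<rparr>"

lemma comm_group_UM: "comm_group UM"
  using subgroup.subgroup_is_group[OF subgroup_U[OF M(1)] U.is_group] U.m_comm
  by (intro group.group_comm_groupI) auto

lemma A_hom: "a \<in> carrier A \<Longrightarrow> a \<in> hom UM UM"
  using embedding_U[OF M(1) A_emb] embedding_mult[OF M(1) A_emb] GalD(1)[of a M K] by (intro homI) auto

lemma nat_prod_UM: "monoid.nat_prod UM f m = U.nat_prod f m"
proof -
  interpret UM: comm_group UM by (rule comm_group_UM)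
  show ?thesis by (induction m) auto
qed

lemma norm_prod_UM: "comm_group.norm_prod UM t m x = U.norm_prod t m x"
  by (simp add: comm_group.norm_prod_def[OF comm_group_UM] U.norm_prod_def nat_prod_UM)

lemma subgroup_\<alpha>: "subgroup (\<alpha> ` carrier V) A"
proof -
  have "\<alpha> \<in> hom V A"
  proof (rule homI)
    fix v u assume v: "v \<in> carrier V" and u: "u \<in> carrier V"
    have "(v, 0) \<otimes>\<^bsub>\<Gamma>\<^esub> (u, 0) = (v \<otimes>\<^bsub>V\<^esub> u, 0)" using u q_gt_1 by (simp add: mult_\<Gamma> shift_0)
    then show "\<alpha> (v \<otimes>\<^bsub>V\<^esub> u) = \<alpha> v \<otimes>\<^bsub>A\<^esub> \<alpha> u"
      using lift_mult[OF in_\<Gamma>(1)[OF v] in_\<Gamma>(1)[OF u]] by (simp add: \<alpha>_def)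
  qed (rule \<alpha>_A)
  then interpret \<alpha>: group_hom V A \<alpha> by (simp add: group_hom_def group_hom_axioms_def V.is_group A.is_group)
  show ?thesis by (rule \<alpha>.img_is_subgroup)
qed

lemma finite_\<alpha>: "finite (\<alpha> ` carrier V)"
  by (rule finite_subset[OF _ fin_M]) (use \<alpha>_A in auto)

text \<open>The cyclic extension of degree \<open>q\<close> together with \<open>\<zeta>\<close>:
  the lifts of \<open>V\<close> fix \<open>\<zeta>\<close>.\<close>

definition E where "E = fixed M (\<alpha> ` carrier V)"

lemma E_sub: "subfield E L" unfolding E_def using \<alpha>_A by (intro subfield_fixed[OF M(1)]) auto

lemma E_M: "x \<in> E \<Longrightarrow> x \<in> M" unfolding E_def by (rule fixedD(1))

lemma E_iff: "x \<in> E \<longleftrightarrow> x \<in> M \<and> (\<forall>v\<in>carrier V. \<alpha> v x = x)" by (auto simp: E_def fixed_def)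

lemma K_E: "K \<subseteq> E" using M(2) GalD(5)[OF \<alpha>_A] by (auto simp: E_iff)

lemma lift_E:
  assumes \<gamma>: "\<gamma> \<in> carrier \<Gamma>" and x: "x \<in> E"
  shows "lift \<gamma> x \<in> E"
proof -
  obtain a g where ag: "\<gamma> = (a, g)" "a \<in> carrier V" "g \<in> {0..<int q}"
    using \<gamma> unfolding carrier_\<Gamma> by blast
  have xM: "x \<in> M" using x by (rule E_M)
  have "\<alpha> v (lift \<gamma> x) = lift \<gamma> x" if v: "v \<in> carrier V" for v
  proof -
    let ?u = "shift (- g) v"
    have u: "?u \<in> carrier V" using v by (rule shift_closed)
    have "(v, 0) \<otimes>\<^bsub>\<Gamma>\<^esub> \<gamma> = \<gamma> \<otimes>\<^bsub>\<Gamma>\<^esub> (?u, 0)"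
      using ag u v q_gt_1 by (simp add: mult_\<Gamma> shift_0 shift_shift V.m_comm)
    then have "\<alpha> v (lift \<gamma> x) = lift \<gamma> (\<alpha> ?u x)"
      using lift_apply[OF in_\<Gamma>(1)[OF v] \<gamma> xM] lift_apply[OF \<gamma> in_\<Gamma>(1)[OF u] xM] by (simp add: \<alpha>_def)
    then show ?thesis using x u by (simp add: E_iff)
  qed
  then show ?thesis using lift_closed[OF \<gamma> xM] by (simp add: E_iff)
qed

lemma decompose:
  assumes a: "a \<in> carrier A"
  shows "\<exists>d\<in>carrier D. w d = w a \<and> (\<forall>x\<in>M. a x = lift (\<rho> a) (d x))"
proof -
  let ?\<gamma> = "\<rho> a"
  have \<gamma>: "?\<gamma> \<in> carrier \<Gamma>" using a by (rule \<rho>_closed)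
  note l = lift[OF \<gamma>]
  let ?d = "inv\<^bsub>A\<^esub> (lift ?\<gamma>) \<otimes>\<^bsub>A\<^esub> a"
  have d: "?d \<in> carrier A" using a l by simp
  have eq: "a = lift ?\<gamma> \<otimes>\<^bsub>A\<^esub> ?d" using a l by (simp add: A.m_assoc[symmetric])
  have "\<rho> ?d = \<one>\<^bsub>\<Gamma>\<^esub>" using a l \<gamma> by (simp add: \<rho>_mult)
  moreover have "w ?d = w a"
  proof (rule w_eqI[OF d a])
    have "[w a = 1 * w ?d] (mod p)" using w_mult[OF l(1) d] eq l(3) by metis
    then show "[w ?d = w a] (mod p)" by (simp add: cong_sym)
  qed
  moreover have "a x = lift ?\<gamma> (?d x)" if "x \<in> M" for x
    using mult_Gal_apply[OF l(1) d that] eq by metis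
  ultimately show ?thesis using d by (intro bexI[of _ ?d]) (auto simp: D_carrier)
qed

end

section \<open>An invariant class over \<open>E\<close> and the twisted extensions\<close>

context kummer_extension begin

text \<open>\<open>kummer_data\<close> gives the transformation law only for \<open>s\<close> and
  for \<open>D\<close>. Since \<open>V\<close> fixes \<open>b\<close>, and \<open>A\<close> is
  generated by \<open>D\<close> and the lifts of \<open>\<Gamma>\<close>, the law extends to all of
  \<open>A\<close>.\<close>

lemma exists_E_generator:
  "\<exists>b\<in>E \<inter> carrier U. (\<forall>\<beta>\<in>M \<inter> carrier U. \<pi> \<beta> \<noteq> b) \<and>
     (\<forall>a\<in>carrier A. \<exists>c\<in>E \<inter> carrier U. a b = b [^]\<^bsub>U\<^esub> w a \<otimes>\<^bsub>U\<^esub> \<pi> c)"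
proof -
  \<comment> \<open>\<open>m\<close> is \<open>q / p\<close>, so \<open>s ^^ m\<close> generates the
    subgroup of order \<open>p\<close> of the cyclic group; its restriction to \<open>E\<close> is
    \<open>t\<close>.\<close>
  define m where "m = p ^ (n - 1)"
  obtain n' where n': "n = Suc n'" using n_pos by (cases n) auto
  have mq: "0 < m" "q = m * p" using p_gt_1 by (auto simp: m_def q_eq n')
  then have mq2: "m < q" using p_gt_1 by simp
  note mq = mq(1) mq2 mq(2)
  define \<gamma> where "\<gamma> = (\<one>\<^bsub>V\<^esub>, int m)"
  have \<gamma>: "\<gamma> \<in> carrier \<Gamma>" using mq(1,2) by (simp add: \<gamma>_def carrier_\<Gamma>)
  have sm: "(s ^^ m) x = lift \<gamma> x" if "x \<in> M" for x using s_pow[OF that, of m] mq(1,2) by (simp add: \<gamma>_def)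
  define t where "t = restrict (lift \<gamma>) E"
  have t: "t \<in> carrier (Gal L E K)"
    unfolding t_def
  proof (rule restrict_Gal[OF _ K_E E_sub lift(1)[OF \<gamma>]])
    show "lift \<gamma> ` E = E"
    proof
      show "E \<subseteq> lift \<gamma> ` E"
      proof
        fix x assume x: "x \<in> E"
        have i: "inv\<^bsub>\<Gamma>\<^esub> \<gamma> \<in> carrier \<Gamma>" using \<gamma> by simp
        have "lift \<gamma> (lift (inv\<^bsub>\<Gamma>\<^esub> \<gamma>) x) = x"
          using lift_apply[OF \<gamma> i E_M[OF x]] lift_one[OF E_M[OF x]] \<gamma> by simp
        then show "x \<in> lift \<gamma> ` E" using lift_E[OF i x] by (metis imageI)
      qed
    qed (use lift_E[OF \<gamma>] in auto)
  qed (use E_M in auto)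
  have t_sm: "(t ^^ i) x = ((s ^^ m) ^^ i) x \<and> (t ^^ i) x \<in> E" if "x \<in> E" for x i
    using that by (induction i) (auto simp: t_def sm[OF E_M] lift_E[OF \<gamma>])
  have t_order: "(t ^^ p) x = x" if "x \<in> E" for x
  proof -
    have "(s ^^ m) ^^ p = s ^^ q" by (simp add: funpow_mult mq(3)[symmetric])
    then show ?thesis using t_sm[OF that, of p] s_order[OF E_M[OF that]] by simp
  qed
  \<comment> \<open>If \<open>t\<close> were trivial, \<open>lift \<gamma>\<close> would by Artin's
    theorem be one of the \<open>\<alpha> v\<close>, but the cyclic component \<open>m\<close> of
    \<open>\<gamma>\<close> is nonzero.\<close>
  have t_nontriv: "\<exists>x\<in>E. t x \<noteq> x"
  proof (rule ccontr)
    assume "\<not> ?thesis"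
    then have "lift \<gamma> x = x" if "x \<in> E" for x using that by (auto simp: t_def)
    then have "lift \<gamma> \<in> \<alpha> ` carrier V"
      using fixed_group_complete[OF M subgroup_\<alpha> finite_\<alpha> lift(1)[OF \<gamma>]] by (simp add: E_def)
    then obtain v where "v \<in> carrier V" "lift \<gamma> = lift (v, 0)" by (auto simp: \<alpha>_def)
    then have "\<gamma> = (v, 0)" using lift(2)[OF \<gamma>] lift(2)[OF in_\<Gamma>(1)] by metis
    then show False using mq(1) by (simp add: \<gamma>_def)
  qed
  have t_norm: "U.norm_prod t p x = comm_group.norm_prod UM (s ^^ m) p x" if "x \<in> E" for x
    unfolding norm_prod_UM U.norm_prod_def using t_sm[OF that] by (intro U.nat_prod_cong) auto
  have E_U: "E \<inter> carrier U = {x \<in> carrier UM. \<forall>v\<in>carrier V. \<alpha> v x = x}" by (auto simp: E_iff)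
  have pow_UM: "x [^]\<^bsub>UM\<^esub> (i::nat) = x [^]\<^bsub>U\<^esub> i" for x i by (rule U.nat_pow_consistent[symmetric])
  have "kummer_data p q k UM n \<alpha> s D (\<lambda>d. d) w \<pi> \<zeta> (E \<inter> carrier U)"
  proof (intro kummer_data.intro kummer_data_axioms.intro gamma_params_axioms comm_group_UM)
    show "prime p" "q = p ^ n" "n \<ge> 1" by (rule prime_p q_eq n_pos)+
    show "\<alpha> v \<in> hom UM UM" if "v \<in> carrier V" for v using A_hom[OF \<alpha>_A[OF that]] .
    show "\<alpha> (v \<otimes>\<^bsub>V\<^esub> u) x = \<alpha> v (\<alpha> u x)" if "v \<in> carrier V" "u \<in> carrier V" "x \<in> carrier UM" for v u x
      using \<alpha>_mult that by simp
    show "s \<in> hom UM UM" by (rule A_hom[OF s_A])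
    show "(s ^^ q) x = x" if "x \<in> carrier UM" for x using s_order that by simp
    show "s (\<alpha> v x) = \<alpha> (shift 1 v) (s x)" if "v \<in> carrier V" "x \<in> carrier UM" for v x using s_\<alpha> that by simp
    show "group D" "finite (carrier D)" "card (carrier D) < p" by (rule D_group D_small)+
    show "d \<in> hom UM UM" if "d \<in> carrier D" for d using A_hom that by (simp add: D_carrier)
    show "(d \<otimes>\<^bsub>D\<^esub> e) x = d (e x)" if "d \<in> carrier D" "e \<in> carrier D" "x \<in> carrier UM" for d e x
    proof -
      have "d \<in> carrier A" "e \<in> carrier A" using that by (auto simp: D_carrier)
      then show ?thesis using mult_Gal_apply[of d M K e x] that by (simp add: D_def)
    qed
    show "d (\<alpha> v x) = \<alpha> v (d x)" if "d \<in> carrier D" "v \<in> carrier V" "x \<in> carrier UM" for d v x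
      using D_commutes[OF that(1) in_\<Gamma>(1)[OF that(2)], of x] that by (simp add: \<alpha>_def)
    show "d (s x) = s (d x)" if "d \<in> carrier D" "x \<in> carrier UM" for d x
      using D_commutes[OF that(1) in_\<Gamma>(2), of x] that by (simp add: s_def)
    show "0 < w d \<and> w d < p" if "d \<in> carrier D" for d using w_range that by (simp add: D_carrier)
    show "[w (d \<otimes>\<^bsub>D\<^esub> e) = w d * w e] (mod p)" if "d \<in> carrier D" "e \<in> carrier D" for d e
      using w_mult[of d e] that by (simp add: D_carrier) (simp add: D_def)
    show "\<pi> \<in> hom UM UM" using \<pi>_U \<pi>_sub[OF M(1)] hom_mult[OF \<pi>_hom] by (intro homI) auto
    show "\<pi> (\<alpha> v x) = \<alpha> v (\<pi> x)" if "v \<in> carrier V" "x \<in> carrier UM" for v x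
      using embedding_\<pi>[OF M(1) A_emb[OF \<alpha>_A[OF that(1)]], of x] that by simp
    show "\<pi> (s x) = s (\<pi> x)" if "x \<in> carrier UM" for x
      using embedding_\<pi>[OF M(1) A_emb[OF s_A], of x] that by simp
    show "\<pi> (d x) = d (\<pi> x)" if "d \<in> carrier D" "x \<in> carrier UM" for d x
      using embedding_\<pi>[OF M(1) A_emb, of d x] that by (simp add: D_carrier)
    show "\<zeta> \<in> carrier UM" "\<zeta> \<noteq> \<one>\<^bsub>UM\<^esub>" using \<zeta>_M \<zeta>_U \<zeta>_not_one by auto
    show "\<zeta> [^]\<^bsub>UM\<^esub> p = \<one>\<^bsub>UM\<^esub>" using \<zeta>_pow by (simp add: pow_UM)
    show "\<alpha> v \<zeta> = \<zeta>" if "v \<in> carrier V" for v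
      using w_\<zeta>[OF \<alpha>_A[OF that]] lift(3)[OF in_\<Gamma>(1)[OF that]] \<zeta>_U by (simp add: \<alpha>_def)
    show "s \<zeta> = \<zeta>" using w_\<zeta>[OF s_A] lift(3)[OF in_\<Gamma>(2)] \<zeta>_U by (simp add: s_def)
    show "d \<zeta> = \<zeta> [^]\<^bsub>UM\<^esub> w d" if "d \<in> carrier D" for d using w_\<zeta> that by (simp add: D_carrier pow_UM)
    show "\<pi> x = \<one>\<^bsub>UM\<^esub> \<longleftrightarrow> (\<exists>j::nat. x = \<zeta> [^]\<^bsub>UM\<^esub> j)" if "x \<in> carrier UM" for x
      using \<pi>_kernel[of x] that by (simp add: pow_UM)
    show "E \<inter> carrier U = {x \<in> carrier UM. \<forall>v\<in>carrier V. \<alpha> v x = x}" by (rule E_U)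
    show "\<exists>y\<in>E \<inter> carrier U. x [^]\<^bsub>UM\<^esub> p = \<pi> y" if "x \<in> E \<inter> carrier U" for x
      using pow_\<pi>[OF E_sub, of x] that by (simp add: pow_UM)
    show "\<exists>\<gamma>\<in>carrier UM. \<forall>v\<in>carrier V. \<alpha> v \<gamma> = ch v \<otimes>\<^bsub>UM\<^esub> \<gamma>"
      if ch: "ch \<in> hom V UM" "\<And>v. v \<in> carrier V \<Longrightarrow> \<pi> (ch v) = \<one>\<^bsub>UM\<^esub>" for ch
    proof -
      have chU: "ch v \<in> M \<inter> carrier U" if "v \<in> carrier V" for v using hom_in_carrier[OF ch(1) that] by simp
      have fst_\<rho>: "fst (\<rho> (\<alpha> v)) = v" if "v \<in> carrier V" for v
        using lift(2)[OF in_\<Gamma>(1)[OF that]] by (simp add: \<alpha>_def)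
      \<comment> \<open>A character of \<open>V\<close> becomes one of the Galois group of
        \<open>M\<close> over \<open>E\<close> by reading off \<open>v\<close> from
        \<open>\<rho> a\<close>.\<close>
      have "\<exists>\<gamma>\<in>M \<inter> carrier U. \<forall>a\<in>\<alpha> ` carrier V. a \<gamma> = ch (fst (\<rho> a)) \<otimes>\<^bsub>U\<^esub> \<gamma>"
      proof (rule hilbert90[OF M subgroup_\<alpha> finite_\<alpha>])
        fix a assume "a \<in> \<alpha> ` carrier V"
        then obtain v where v: "v \<in> carrier V" "a = \<alpha> v" by auto
        obtain j :: nat where j: "ch v = \<zeta> [^]\<^bsub>U\<^esub> j" using \<pi>_kernel[of "ch v"] chU[OF v(1)] ch(2)[OF v(1)] by auto
        have "\<alpha> u (ch v) = ch v" if "u \<in> carrier V" for u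
          using apply_\<zeta>_pow[OF \<alpha>_A[OF that], of j] lift(3)[OF in_\<Gamma>(1)[OF that]] by (simp add: j \<alpha>_def)
        then show "ch (fst (\<rho> a)) \<in> fixed M (\<alpha> ` carrier V) \<inter> carrier U"
          using chU[OF v(1)] fst_\<rho>[OF v(1)] v by (simp add: fixed_def)
      next
        fix a b assume "a \<in> \<alpha> ` carrier V" "b \<in> \<alpha> ` carrier V"
        then obtain v u where v: "v \<in> carrier V" "a = \<alpha> v" and u: "u \<in> carrier V" "b = \<alpha> u" by auto
        have "\<rho> (a \<otimes>\<^bsub>A\<^esub> b) = (v \<otimes>\<^bsub>V\<^esub> u, 0)"
          using v u \<alpha>_A lift(2)[OF in_\<Gamma>(1)] q_gt_1 by (simp add: \<rho>_mult \<alpha>_def[symmetric]) (simp add: \<alpha>_def mult_\<Gamma> shift_0)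
        then show "ch (fst (\<rho> (a \<otimes>\<^bsub>A\<^esub> b))) = ch (fst (\<rho> a)) \<otimes>\<^bsub>U\<^esub> ch (fst (\<rho> b))"
          using v u fst_\<rho> hom_mult[OF ch(1) v(1) u(1)] by simp
      qed
      then show ?thesis using fst_\<rho> by auto
    qed
    show "\<exists>b\<in>E \<inter> carrier U. (s ^^ (p ^ (n - 1))) b = x \<otimes>\<^bsub>UM\<^esub> b"
      if x: "x \<in> E \<inter> carrier U" "comm_group.norm_prod UM (s ^^ (p ^ (n - 1))) p x = \<one>\<^bsub>UM\<^esub>" for x
    proof -
      have "U.norm_prod t p x = \<one>\<^bsub>U\<^esub>" using t_norm[of x] x by (simp add: m_def)
      then obtain b where b: "b \<in> E \<inter> carrier U" "t b = x \<otimes>\<^bsub>U\<^esub> b"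
        using hilbert90_cyclic[OF E_sub t t_order t_nontriv] x by blast
      then have "(s ^^ m) b = x \<otimes>\<^bsub>U\<^esub> b" using t_sm[of b 1] by simp
      then show ?thesis using b by (auto simp: m_def)
    qed
    show "(\<exists>y\<in>E \<inter> carrier U. comm_group.norm_prod UM (s ^^ (p ^ (n - 1))) p y = \<zeta>) \<or>
      (\<forall>x\<in>carrier UM. \<pi> x = x [^]\<^bsub>UM\<^esub> p) \<and> (odd p \<or> n \<ge> 2)"
      using \<zeta>_norm
    proof
      assume "\<forall>E F t. subfield E L \<longrightarrow> t \<in> carrier (Gal L E F) \<longrightarrow>
          (\<forall>x\<in>E. (t ^^ p) x = x) \<longrightarrow> (\<exists>x\<in>E. t x \<noteq> x) \<longrightarrow>
          (\<exists>y\<in>E \<inter> carrier U. comm_group.norm_prod U t p y = \<zeta>)"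
      then have "\<exists>y\<in>E \<inter> carrier U. U.norm_prod t p y = \<zeta>" using E_sub t t_order t_nontriv by blast
      then show ?thesis using t_norm by (auto simp: m_def)
    next
      assume "\<forall>x\<in>carrier U. \<pi> x = x [^]\<^bsub>U\<^esub> p"
      moreover have "odd p \<or> n \<ge> 2" using p2 prime_p by (metis prime_odd_nat prime_ge_2_nat le_neq_implies_less)
      ultimately show ?thesis by (simp add: pow_UM)
    qed
  qed
  note data = this
  obtain b where b: "b \<in> E \<inter> carrier U" "b \<notin> \<pi> ` carrier UM"
    and sb: "\<exists>c\<in>E \<inter> carrier U. s b = b \<otimes>\<^bsub>U\<^esub> \<pi> c"
    and db: "\<And>d. d \<in> carrier D \<Longrightarrow> \<exists>c\<in>E \<inter> carrier U. d b = b [^]\<^bsub>U\<^esub> w d \<otimes>\<^bsub>U\<^esub> \<pi> c"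
    using kummer_data.exists_invariant_non_image[OF data] by (auto simp: pow_UM)
  have bE: "b \<in> E" "b \<in> M" "b \<in> carrier U" using b E_M by auto
  have s_E: "s x \<in> E" if "x \<in> E" for x using lift_E[OF in_\<Gamma>(2) that] by (simp add: s_def)
  have s_U: "s x \<in> carrier U" if "x \<in> E" "x \<in> carrier U" for x
    using embedding_U[OF M(1) A_emb[OF s_A] E_M[OF that(1)] that(2)] .
  obtain c0 where c0: "c0 \<in> E" "c0 \<in> carrier U" "s b = b \<otimes>\<^bsub>U\<^esub> \<pi> c0" using sb by auto
  \<comment> \<open>Invariance of the class of \<open>b\<close> under \<open>s\<close> passes to
    powers, because \<open>E\<close> is stable under \<open>s\<close> and \<open>s\<close> commutes
    with \<open>\<pi>\<close>.\<close>
  have sib: "\<exists>c\<in>E \<inter> carrier U. (s ^^ i) b = b \<otimes>\<^bsub>U\<^esub> \<pi> c" for i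
  proof (induction i)
    case 0
    have "\<pi> \<one>\<^bsub>U\<^esub> = \<one>\<^bsub>U\<^esub>" using hom_one[OF \<pi>_hom U.is_group U.is_group] .
    then show ?case using bE U_closed(2)[OF E_sub] by (intro bexI[of _ "\<one>\<^bsub>U\<^esub>"]) auto
  next
    case (Suc i)
    then obtain c where c: "c \<in> E" "c \<in> carrier U" "(s ^^ i) b = b \<otimes>\<^bsub>U\<^esub> \<pi> c" by auto
    have "(s ^^ Suc i) b = s b \<otimes>\<^bsub>U\<^esub> s (\<pi> c)"
      using c embedding_mult[OF M(1) A_emb[OF s_A] bE(2), of "\<pi> c"] \<pi>_sub[OF M(1) E_M[OF c(1)]] by simp
    also have "s (\<pi> c) = \<pi> (s c)" using embedding_\<pi>[OF M(1) A_emb[OF s_A] E_M[OF c(1)]] .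
    also have "s b \<otimes>\<^bsub>U\<^esub> \<pi> (s c) = b \<otimes>\<^bsub>U\<^esub> \<pi> (c0 \<otimes>\<^bsub>U\<^esub> s c)"
      using c0 c bE s_U \<pi>_U by (simp add: hom_mult[OF \<pi>_hom] U.m_assoc)
    finally show ?case
      using c0 c s_U s_E U_closed(1)[OF E_sub, of c0 "s c"] by (intro bexI[of _ "c0 \<otimes>\<^bsub>U\<^esub> s c"]) auto
  qed
  have lb: "\<exists>c\<in>E \<inter> carrier U. lift \<delta> b = b \<otimes>\<^bsub>U\<^esub> \<pi> c" if \<delta>: "\<delta> \<in> carrier \<Gamma>" for \<delta>
  proof -
    obtain v g where vg: "\<delta> = (v, g)" "v \<in> carrier V" "0 \<le> g" "g < int q"
      using \<delta> unfolding carrier_\<Gamma> by auto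
    obtain c where c: "c \<in> E" "c \<in> carrier U" "(s ^^ nat g) b = b \<otimes>\<^bsub>U\<^esub> \<pi> c" using sib by blast
    have g\<Gamma>: "(\<one>\<^bsub>V\<^esub>, g) \<in> carrier \<Gamma>" using vg by (simp add: carrier_\<Gamma>)
    have "\<delta> = (v, 0) \<otimes>\<^bsub>\<Gamma>\<^esub> (\<one>\<^bsub>V\<^esub>, g)" using vg by (simp add: mult_\<Gamma> shift_one)
    then have "lift \<delta> b = \<alpha> v (lift (\<one>\<^bsub>V\<^esub>, g) b)"
      using lift_apply[OF in_\<Gamma>(1)[OF vg(2)] g\<Gamma> bE(2)] by (simp add: \<alpha>_def)
    also have "lift (\<one>\<^bsub>V\<^esub>, g) b = b \<otimes>\<^bsub>U\<^esub> \<pi> c" using s_pow[OF bE(2), of "nat g"] vg c by simp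
    also have "\<alpha> v (b \<otimes>\<^bsub>U\<^esub> \<pi> c) = b \<otimes>\<^bsub>U\<^esub> \<pi> c"
      using U_closed(1)[OF E_sub bE(1) \<pi>_sub[OF E_sub c(1)] bE(3) \<pi>_U[OF c(2)]] vg(2) by (simp add: E_iff)
    finally show ?thesis using c by blast
  qed
  have "\<exists>c\<in>E \<inter> carrier U. a b = b [^]\<^bsub>U\<^esub> w a \<otimes>\<^bsub>U\<^esub> \<pi> c" if a: "a \<in> carrier A" for a
  proof -
    obtain d where d: "d \<in> carrier D" "w d = w a" "a b = lift (\<rho> a) (d b)"
      using decompose[OF a] bE(2) by blast
    have \<delta>: "\<rho> a \<in> carrier \<Gamma>" using a by (rule \<rho>_closed)
    note emb = A_emb[OF lift(1)[OF \<delta>]]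
    obtain c1 where c1: "c1 \<in> E" "c1 \<in> carrier U" "d b = b [^]\<^bsub>U\<^esub> w a \<otimes>\<^bsub>U\<^esub> \<pi> c1" using db[OF d(1)] d(2) by auto
    obtain c2 where c2: "c2 \<in> E" "c2 \<in> carrier U" "lift (\<rho> a) b = b \<otimes>\<^bsub>U\<^esub> \<pi> c2" using lb[OF \<delta>] by auto
    let ?l = "lift (\<rho> a) c1"
    have lc: "?l \<in> E" "?l \<in> carrier U"
      using lift_E[OF \<delta> c1(1)] embedding_U[OF M(1) emb E_M[OF c1(1)] c1(2)] by auto
    have "a b = lift (\<rho> a) (b [^]\<^bsub>U\<^esub> w a) \<otimes>\<^bsub>U\<^esub> lift (\<rho> a) (\<pi> c1)"
      using d(3) c1 embedding_mult[OF M(1) emb U_closed(4)[OF M(1) bE(2,3)] \<pi>_sub[OF M(1) E_M[OF c1(1)]]] by simp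
    also have "\<dots> = (b \<otimes>\<^bsub>U\<^esub> \<pi> c2) [^]\<^bsub>U\<^esub> w a \<otimes>\<^bsub>U\<^esub> \<pi> ?l"
      using embedding_pow[OF M(1) emb bE(2,3)] c2(3) embedding_\<pi>[OF M(1) emb E_M[OF c1(1)]] by simp
    also have "\<dots> = b [^]\<^bsub>U\<^esub> w a \<otimes>\<^bsub>U\<^esub> \<pi> (c2 [^]\<^bsub>U\<^esub> w a \<otimes>\<^bsub>U\<^esub> ?l)"
      using bE c2 lc \<pi>_U by (simp add: U.nat_pow_distrib hom_mult[OF \<pi>_hom] U.nat_pow_hom[OF \<pi>_hom] U.m_assoc)
    finally show ?thesis
      using U_closed(1,4)[OF E_sub] c2 lc by (intro bexI[of _ "c2 [^]\<^bsub>U\<^esub> w a \<otimes>\<^bsub>U\<^esub> ?l"]) auto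
  qed
  moreover have "\<pi> \<beta> \<noteq> b" if "\<beta> \<in> M \<inter> carrier U" for \<beta> using b(2) that by auto
  ultimately show ?thesis using b(1) by blast
qed

text \<open>The root \<open>\<beta>\<close> of \<open>b\<close> generates \<open>N\<close> over
  \<open>M\<close>, and \<open>\<psi>\<close> is its Kummer character \<open>j\<close> on the
  elements fixing \<open>E\<close>. The family \<open>f\<close> is indexed by the twisting vectors;
  its values are the fixed fields of the kernels of the twisted surjections.\<close>

theorem many_extensions:
  "\<exists>f. inj_on f ({..<k} \<rightarrow>\<^sub>E {0..<int p}) \<and> f ` ({..<k} \<rightarrow>\<^sub>E {0..<int p}) \<subseteq> group_extensions \<Gamma> L K"
proof -
  obtain b where b: "b \<in> E" "b \<in> carrier U" and bM: "\<And>\<beta>. \<beta> \<in> M \<inter> carrier U \<Longrightarrow> \<pi> \<beta> \<noteq> b"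
    and bA: "\<And>a. a \<in> carrier A \<Longrightarrow> \<exists>c\<in>E \<inter> carrier U. a b = b [^]\<^bsub>U\<^esub> w a \<otimes>\<^bsub>U\<^esub> \<pi> c"
    using exists_E_generator by auto
  obtain f where f: "f \<in> carrier (M[X])" "degree f = p"
    and f_root: "\<And>z. z \<in> carrier L \<Longrightarrow> eval f z = \<zero> \<longleftrightarrow> z \<in> carrier U \<and> \<pi> z = b"
    using \<pi>_poly[OF M(1) E_M[OF b(1)] b(2)] by blast
  have f_nz: "f \<noteq> []" using f(2) p_gt_1 by auto
  obtain \<beta> where \<beta>L: "\<beta> \<in> carrier L" and f\<beta>: "eval f \<beta> = \<zero>"
    using exists_root_closed[OF subfield_poly_carrier[OF M(1) f(1)]] f(2) p_gt_1 by auto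
  then have \<beta>: "\<beta> \<in> carrier U" "\<pi> \<beta> = b" using f_root by auto
  have \<beta>M: "\<beta> \<notin> M" using bM[of \<beta>] \<beta> by auto
  define N where "N = simple_extension M \<beta>"
  have N: "subfield N L"
    unfolding N_def using simple_extension_is_subfield[OF M(1) \<beta>L] algebraic_mono[OF M(2) algebraic_extension[OF \<beta>L]] by simp
  have MN: "M \<subseteq> N" unfolding N_def by (rule simple_extension_incl[OF subfieldD(1)[OF M(1)] \<beta>L])
  have \<beta>N: "\<beta> \<in> N" unfolding N_def by (rule simple_extension_mem[OF subfieldE(1)[OF M(1)] \<beta>L])
  have KN: "K \<subseteq> N" using M(2) MN by blast
  have \<zeta>E: "\<zeta> \<in> E"
    using \<zeta>_M w_\<zeta>[OF \<alpha>_A] lift(3)[OF in_\<Gamma>(1)] \<zeta>_U by (simp add: E_iff) (simp add: \<alpha>_def)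
  \<comment> \<open>The transformation law of \<open>b\<close>, carried over to its root up to a
    power of \<open>\<zeta>\<close>. It gives normality of \<open>N\<close> and, below, the
    invariance of \<open>\<psi>\<close>.\<close>
  have conj: "\<exists>c\<in>E \<inter> carrier U. g \<beta> = \<beta> [^]\<^bsub>U\<^esub> w (restrict g M) \<otimes>\<^bsub>U\<^esub> c"
    if g: "g \<in> embeddings N" "restrict g M \<in> carrier A" for g
  proof -
    let ?w = "w (restrict g M)"
    obtain c where c: "c \<in> E" "c \<in> carrier U" "restrict g M b = b [^]\<^bsub>U\<^esub> ?w \<otimes>\<^bsub>U\<^esub> \<pi> c" using bA[OF g(2)] by auto
    have g\<beta>: "g \<beta> \<in> carrier U" using embedding_U[OF N g(1) \<beta>N \<beta>(1)] .
    have "\<pi> (g \<beta>) = g b" using embedding_\<pi>[OF N g(1) \<beta>N] \<beta>(2) by simp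
    also have "\<dots> = b [^]\<^bsub>U\<^esub> ?w \<otimes>\<^bsub>U\<^esub> \<pi> c" using c(3) E_M[OF b(1)] by simp
    also have "\<dots> = \<pi> (\<beta> [^]\<^bsub>U\<^esub> ?w \<otimes>\<^bsub>U\<^esub> c)"
      using \<beta> c by (simp add: hom_mult[OF \<pi>_hom] U.nat_pow_hom[OF \<pi>_hom])
    finally obtain j :: nat where "g \<beta> = \<zeta> [^]\<^bsub>U\<^esub> j \<otimes>\<^bsub>U\<^esub> (\<beta> [^]\<^bsub>U\<^esub> ?w \<otimes>\<^bsub>U\<^esub> c)"
      using same_\<pi>[OF g\<beta>, of "\<beta> [^]\<^bsub>U\<^esub> ?w \<otimes>\<^bsub>U\<^esub> c"] \<beta> c by auto
    also have "\<dots> = \<beta> [^]\<^bsub>U\<^esub> ?w \<otimes>\<^bsub>U\<^esub> (\<zeta> [^]\<^bsub>U\<^esub> j \<otimes>\<^bsub>U\<^esub> c)" using \<beta> c \<zeta>_U by (simp add: U.m_lcomm)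
    finally show ?thesis
      using U_closed(1,4)[OF E_sub] c \<zeta>E \<zeta>_U by (intro bexI[of _ "\<zeta> [^]\<^bsub>U\<^esub> j \<otimes>\<^bsub>U\<^esub> c"]) auto
  qed
  have conjN: "\<forall>g\<in>embeddings N. restrict g M \<in> carrier A \<longrightarrow> g \<beta> \<in> N"
  proof (intro ballI impI)
    fix g assume g: "g \<in> embeddings N" "restrict g M \<in> carrier A"
    obtain c where c: "c \<in> E" "c \<in> carrier U" "g \<beta> = \<beta> [^]\<^bsub>U\<^esub> w (restrict g M) \<otimes>\<^bsub>U\<^esub> c" using conj[OF g] by auto
    then have "c \<in> N" using E_M MN by blast
    then show "g \<beta> \<in> N" using U_closed(1)[OF N U_closed(4)[OF N \<beta>N \<beta>(1)]] c \<beta>(1) by simp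
  qed
  let ?S = "(\<lambda>j. \<zeta> [^]\<^bsub>U\<^esub> j \<otimes>\<^bsub>U\<^esub> \<beta>) ` {..<p}"
  have \<pi>\<zeta>: "\<pi> (\<zeta> [^]\<^bsub>U\<^esub> (j::nat)) = \<one>\<^bsub>U\<^esub>" for j using \<pi>_kernel[of "\<zeta> [^]\<^bsub>U\<^esub> j"] \<zeta>_U by auto
  have S_root: "?S \<subseteq> {z \<in> carrier L. eval f z = \<zero>}"
    using f_root \<beta> \<zeta>_U \<pi>\<zeta> b(2) U_carrier by (auto simp: hom_mult[OF \<pi>_hom])
  have cancel: "[i = j] (mod p)" if "\<zeta> [^]\<^bsub>U\<^esub> (i::nat) \<otimes>\<^bsub>U\<^esub> \<beta> = \<zeta> [^]\<^bsub>U\<^esub> j \<otimes>\<^bsub>U\<^esub> \<beta>" for i j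
    using that \<beta> \<zeta>_U by (simp add: \<zeta>_pow_eq_iff)
  have "inj_on (\<lambda>j. \<zeta> [^]\<^bsub>U\<^esub> j \<otimes>\<^bsub>U\<^esub> \<beta>) {..<p}"
  proof (rule inj_onI)
    fix i j assume "i \<in> {..<p}" "j \<in> {..<p}" "\<zeta> [^]\<^bsub>U\<^esub> i \<otimes>\<^bsub>U\<^esub> \<beta> = \<zeta> [^]\<^bsub>U\<^esub> j \<otimes>\<^bsub>U\<^esub> \<beta>"
    then show "i = j" using cancel[of i j] by (simp add: cong_def)
  qed
  then have S_card: "degree f \<le> card ?S" using f(2) by (simp add: card_image)
  note adj = adjoin_galois[OF gal_M fin_M \<beta>L N_def f(1) f_nz f\<beta> S_root S_card conjN]
  let ?A = "Gal L N K"
  interpret N: group ?A by (rule group_Gal[OF N KN])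
  define r where "r a = restrict a M" for a :: "'a \<Rightarrow> 'a"
  have rA: "r a \<in> carrier A" if "a \<in> carrier ?A" for a using hom_in_carrier[OF adj(6) that] by (simp add: r_def)
  have r_mult: "r (a \<otimes>\<^bsub>?A\<^esub> c) = r a \<otimes>\<^bsub>A\<^esub> r c" if "a \<in> carrier ?A" "c \<in> carrier ?A" for a c
    using hom_mult[OF adj(6) that] by (simp add: r_def)
  have r_onto: "\<exists>a\<in>carrier ?A. r a = c" if "c \<in> carrier A" for c
    using adj(7) that by (metis (no_types, lifting) imageE r_def)
  have r_apply: "a x = r a x" if "x \<in> M" for a x using that by (simp add: r_def)
  have emb: "a \<in> embeddings N" if "a \<in> carrier ?A" for a using Gal_embedding[OF N that] .
  define B where "B = {a \<in> carrier ?A. snd (\<rho> (r a)) = 0 \<and> int (w (r a)) = 1}"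
  \<comment> \<open>Only the residue mod \<open>p\<close> matters; outside \<open>B\<close> such an
    exponent need not exist, and then the value is arbitrary.\<close>
  define j where "j a = (SOME i::nat. a \<beta> = \<zeta> [^]\<^bsub>U\<^esub> i \<otimes>\<^bsub>U\<^esub> \<beta>)" for a :: "'a \<Rightarrow> 'a"
  have j_eq: "[j a = i] (mod p)" if "a \<beta> = \<zeta> [^]\<^bsub>U\<^esub> (i::nat) \<otimes>\<^bsub>U\<^esub> \<beta>" for a i
  proof -
    have "a \<beta> = \<zeta> [^]\<^bsub>U\<^esub> j a \<otimes>\<^bsub>U\<^esub> \<beta>" unfolding j_def by (rule someI[of _ i]) (rule that)
    then show ?thesis using that cancel by simp
  qed
  have B_E: "a x = x" if a: "a \<in> B" and x: "x \<in> E" for a x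
  proof -
    have "r a \<in> carrier A" "w (r a) = 1" "snd (\<rho> (r a)) = 0" using a rA by (auto simp: B_def)
    moreover from this have "fst (\<rho> (r a)) \<in> carrier V" using \<rho>_closed[of "r a"] unfolding carrier_\<Gamma> by auto
    moreover from calculation have "r a = \<alpha> (fst (\<rho> (r a)))"
      using lift_unique[of "r a"] unfolding \<alpha>_def by (metis prod.collapse)
    ultimately show ?thesis using x r_apply[OF E_M[OF x], of a] E_iff by metis
  qed
  have j_B: "a \<beta> = \<zeta> [^]\<^bsub>U\<^esub> j a \<otimes>\<^bsub>U\<^esub> \<beta>" if a: "a \<in> B" for a
  proof -
    have aA: "a \<in> carrier ?A" using a by (simp add: B_def)
    have "\<pi> (a \<beta>) = \<pi> \<beta>" using embedding_\<pi>[OF N emb[OF aA] \<beta>N] B_E[OF a b(1)] \<beta>(2) by simp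
    then obtain i :: nat where i: "a \<beta> = \<zeta> [^]\<^bsub>U\<^esub> i \<otimes>\<^bsub>U\<^esub> \<beta>"
      using same_\<pi>[OF embedding_U[OF N emb[OF aA] \<beta>N \<beta>(1)] \<beta>(1)] by auto
    show ?thesis unfolding j_def by (rule someI[of _ i]) (rule i)
  qed
  have \<zeta>N: "\<zeta> \<in> N" using \<zeta>_M MN by blast
  have \<zeta>i: "\<zeta> [^]\<^bsub>U\<^esub> (i::nat) \<in> N" "\<zeta> [^]\<^bsub>U\<^esub> (i::nat) \<in> M" "\<zeta> [^]\<^bsub>U\<^esub> (i::nat) \<in> E" for i
    using U_closed(4)[OF N \<zeta>N \<zeta>_U] U_closed(4)[OF M(1) \<zeta>_M \<zeta>_U] U_closed(4)[OF E_sub \<zeta>E \<zeta>_U] by auto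
  have "\<exists>\<rho>'. (\<forall>c \<in> {..<k} \<rightarrow>\<^sub>E {0..<int p}.
             \<rho>' c \<in> hom ?A \<Gamma> \<and> \<rho>' c ` carrier ?A = carrier \<Gamma>) \<and>
           inj_on (\<lambda>c. kernel ?A \<Gamma> (\<rho>' c)) ({..<k} \<rightarrow>\<^sub>E {0..<int p})"
  proof (cases "\<exists>b0. b0 \<in> carrier ?A \<and> r b0 = \<one>\<^bsub>A\<^esub> \<and> b0 \<beta> \<noteq> \<beta>")
    \<comment> \<open>Impossible: \<open>\<beta>\<close> is not in \<open>M\<close>, so some
      automorphism over \<open>M\<close> moves it.\<close>
    case False
    then show ?thesis using adj(9)[OF \<beta>M] by (auto simp: r_def one_Gal)
  next
    case True
    then obtain b0 where b0: "b0 \<in> carrier ?A" "r b0 = \<one>\<^bsub>A\<^esub>" "b0 \<beta> \<noteq> \<beta>" by blast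
    show ?thesis
    proof (rule twisted_surjections[where \<rho> = "\<lambda>a. \<rho> (r a)" and w = "\<lambda>a. int (w (r a))" and B = B
          and \<psi> = "\<lambda>a. int (j a)" and ?b0.0 = b0])
      show "prime p" "group ?A" "finite (carrier ?A)" by (rule prime_p N.is_group adj(2))+
      show "(\<lambda>a. \<rho> (r a)) \<in> hom ?A \<Gamma>" using rA r_mult \<rho>_closed \<rho>_mult by (intro homI) auto
      show "(\<lambda>a. \<rho> (r a)) ` carrier ?A = carrier \<Gamma>"
      proof
        show "carrier \<Gamma> \<subseteq> (\<lambda>a. \<rho> (r a)) ` carrier ?A"
        proof
          fix y assume "y \<in> carrier \<Gamma>"
          then obtain c where c: "c \<in> carrier A" "\<rho> c = y" using \<rho>_onto by (metis imageE)
          then obtain a where "a \<in> carrier ?A" "r a = c" using r_onto by blast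
          then show "y \<in> (\<lambda>a. \<rho> (r a)) ` carrier ?A" using c by (metis imageI)
        qed
      qed (use rA \<rho>_closed in auto)
      show "0 < int (w (r a)) \<and> int (w (r a)) < int p" if "a \<in> carrier ?A" for a
        using w_range[OF rA[OF that]] by simp
      show "int (w (r (a \<otimes>\<^bsub>?A\<^esub> c))) = int (w (r a)) * int (w (r c)) mod int p"
        if ac: "a \<in> carrier ?A" "c \<in> carrier ?A" for a c
      proof -
        have "w (r (a \<otimes>\<^bsub>?A\<^esub> c)) mod p = w (r a) * w (r c) mod p"
          using w_mult[OF rA[OF ac(1)] rA[OF ac(2)]] r_mult[OF ac] by (simp add: cong_def)
        moreover have "w (r (a \<otimes>\<^bsub>?A\<^esub> c)) mod p = w (r (a \<otimes>\<^bsub>?A\<^esub> c))"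
          using w_range[OF rA[OF N.m_closed[OF ac]]] by simp
        ultimately show ?thesis by (metis of_nat_mult zmod_int)
      qed
      show "B = {a \<in> carrier ?A. snd (\<rho> (r a)) = 0 \<and> int (w (r a)) = 1}" by (rule B_def)
      show "[int (j (a \<otimes>\<^bsub>?A\<^esub> c)) = int (j a) + int (j c)] (mod int p)" if ac: "a \<in> B" "c \<in> B" for a c
      proof -
        have aA: "a \<in> carrier ?A" and cA: "c \<in> carrier ?A" using ac by (auto simp: B_def)
        have "(a \<otimes>\<^bsub>?A\<^esub> c) \<beta> = a (\<zeta> [^]\<^bsub>U\<^esub> j c \<otimes>\<^bsub>U\<^esub> \<beta>)" using mult_Gal_apply[OF aA cA \<beta>N] j_B[OF ac(2)] by simp
        also have "\<dots> = \<zeta> [^]\<^bsub>U\<^esub> j c \<otimes>\<^bsub>U\<^esub> (\<zeta> [^]\<^bsub>U\<^esub> j a \<otimes>\<^bsub>U\<^esub> \<beta>)"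
          using embedding_mult[OF N emb[OF aA] \<zeta>i(1) \<beta>N] B_E[OF ac(1) \<zeta>i(3)] j_B[OF ac(1)] by simp
        also have "\<dots> = \<zeta> [^]\<^bsub>U\<^esub> (j a + j c) \<otimes>\<^bsub>U\<^esub> \<beta>"
          using \<zeta>_U \<beta> by (simp add: U.nat_pow_mult[symmetric] U.m_ac)
        finally have "[j (a \<otimes>\<^bsub>?A\<^esub> c) = j a + j c] (mod p)" by (rule j_eq)
        then show ?thesis by (metis cong_int_iff of_nat_add)
      qed
      \<comment> \<open>On \<open>a \<beta> = \<beta>^(w a) e\<close> the element \<open>c\<close>
        acts through the factor \<open>\<zeta>^(w a j c)\<close>, and \<open>inv a\<close> takes
        this root of unity back to \<open>\<zeta>^(j c)\<close>. The two occurrences of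
        \<open>w a\<close> cancel, which is why \<open>b\<close> was taken from the
        eigenspace.\<close>
      show "[int (j (inv\<^bsub>?A\<^esub> a \<otimes>\<^bsub>?A\<^esub> c \<otimes>\<^bsub>?A\<^esub> a)) = int (j c)] (mod int p)"
        if a: "a \<in> carrier ?A" and cB: "c \<in> B" for a c
      proof -
        let ?w = "w (r a)"
        have c: "c \<in> carrier ?A" using cB by (simp add: B_def)
        obtain e where e: "e \<in> E" "e \<in> carrier U" "a \<beta> = \<beta> [^]\<^bsub>U\<^esub> ?w \<otimes>\<^bsub>U\<^esub> e"
          using conj[OF emb[OF a]] rA[OF a] by (auto simp: r_def)
        have eN: "e \<in> N" using e(1) E_M MN by blast
        have "c (a \<beta>) = c (\<beta> [^]\<^bsub>U\<^esub> ?w) \<otimes>\<^bsub>U\<^esub> c e"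
          unfolding e(3) using embedding_mult[OF N emb[OF c] U_closed(4)[OF N \<beta>N \<beta>(1)] eN] .
        also have "\<dots> = (\<zeta> [^]\<^bsub>U\<^esub> j c \<otimes>\<^bsub>U\<^esub> \<beta>) [^]\<^bsub>U\<^esub> ?w \<otimes>\<^bsub>U\<^esub> e"
          using embedding_pow[OF N emb[OF c] \<beta>N \<beta>(1)] j_B[OF cB] B_E[OF cB e(1)] by simp
        also have "\<dots> = \<zeta> [^]\<^bsub>U\<^esub> (?w * j c) \<otimes>\<^bsub>U\<^esub> a \<beta>"
          unfolding e(3) using \<zeta>_U \<beta> e by (simp add: U.nat_pow_distrib U.nat_pow_pow U.m_assoc mult.commute)
        also have "\<zeta> [^]\<^bsub>U\<^esub> (?w * j c) = a (\<zeta> [^]\<^bsub>U\<^esub> j c)"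
          using apply_\<zeta>_pow[OF rA[OF a], of "j c"] r_apply[OF \<zeta>i(2), of a "j c"] by simp
        also have "a (\<zeta> [^]\<^bsub>U\<^esub> j c) \<otimes>\<^bsub>U\<^esub> a \<beta> = a (\<zeta> [^]\<^bsub>U\<^esub> j c \<otimes>\<^bsub>U\<^esub> \<beta>)"
          using embedding_mult[OF N emb[OF a] \<zeta>i(1) \<beta>N] by simp
        finally have ca: "c (a \<beta>) = a (\<zeta> [^]\<^bsub>U\<^esub> j c \<otimes>\<^bsub>U\<^esub> \<beta>)" .
        have zN: "\<zeta> [^]\<^bsub>U\<^esub> j c \<otimes>\<^bsub>U\<^esub> \<beta> \<in> N" using U_closed(1)[OF N \<zeta>i(1) \<beta>N] \<zeta>_U \<beta> by simp
        have "(inv\<^bsub>?A\<^esub> a \<otimes>\<^bsub>?A\<^esub> c \<otimes>\<^bsub>?A\<^esub> a) \<beta> = (inv\<^bsub>?A\<^esub> a) (c (a \<beta>))"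
          using a c \<beta>N GalD(1)[OF a \<beta>N] by (simp add: mult_Gal_apply)
        also have "\<dots> = (inv\<^bsub>?A\<^esub> a \<otimes>\<^bsub>?A\<^esub> a) (\<zeta> [^]\<^bsub>U\<^esub> j c \<otimes>\<^bsub>U\<^esub> \<beta>)"
          unfolding ca using mult_Gal_apply[OF N.inv_closed[OF a] a zN] by simp
        also have "\<dots> = \<zeta> [^]\<^bsub>U\<^esub> j c \<otimes>\<^bsub>U\<^esub> \<beta>" using N.l_inv[OF a] zN by (simp add: one_Gal)
        finally have "[j (inv\<^bsub>?A\<^esub> a \<otimes>\<^bsub>?A\<^esub> c \<otimes>\<^bsub>?A\<^esub> a) = j c] (mod p)" by (rule j_eq)
        then show ?thesis by (simp add: cong_int_iff)
      qed
      show b0B: "b0 \<in> B" using b0 w_one by (simp add: B_def one_\<Gamma>)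
      show "\<rho> (r b0) = \<one>\<^bsub>\<Gamma>\<^esub>" using b0 by simp
      show "\<not> [int (j b0) = 0] (mod int p)"
      proof
        assume "[int (j b0) = 0] (mod int p)"
        then have "[j b0 = 0] (mod p)" by (metis cong_int_iff of_nat_0)
        then have "\<zeta> [^]\<^bsub>U\<^esub> j b0 = \<zeta> [^]\<^bsub>U\<^esub> (0::nat)" using \<zeta>_pow_eq_iff by blast
        then show False using j_B[OF b0B] b0(3) \<beta> by simp
      qed
      show "\<exists>a\<in>B. \<rho> (r a) = (v, 0)" if v: "v \<in> carrier V" for v
      proof -
        obtain a where "a \<in> carrier ?A" "r a = \<alpha> v" using r_onto[OF \<alpha>_A[OF v]] by blast
        then show ?thesis using lift(2,3)[OF in_\<Gamma>(1)[OF v]] by (intro bexI[of _ a]) (auto simp: B_def \<alpha>_def)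
      qed
    qed
  qed
  then obtain \<rho>' where \<rho>': "\<And>c. c \<in> {..<k} \<rightarrow>\<^sub>E {0..<int p} \<Longrightarrow> \<rho>' c \<in> hom ?A \<Gamma> \<and> \<rho>' c ` carrier ?A = carrier \<Gamma>"
    and inj: "inj_on (\<lambda>c. kernel ?A \<Gamma> (\<rho>' c)) ({..<k} \<rightarrow>\<^sub>E {0..<int p})" by blast
  show ?thesis
  proof (intro exI conjI)
    show "inj_on (\<lambda>c. fixed N (kernel ?A \<Gamma> (\<rho>' c))) ({..<k} \<rightarrow>\<^sub>E {0..<int p})"
    proof (rule inj_onI)
      fix c c' assume c: "c \<in> {..<k} \<rightarrow>\<^sub>E {0..<int p}" "c' \<in> {..<k} \<rightarrow>\<^sub>E {0..<int p}"
        and eq: "fixed N (kernel ?A \<Gamma> (\<rho>' c)) = fixed N (kernel ?A \<Gamma> (\<rho>' c'))"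
      have "kernel ?A \<Gamma> (\<rho>' c) = kernel ?A \<Gamma> (\<rho>' c')"
        using \<rho>'[OF c(1)] \<rho>'[OF c(2)] eq by (intro fixed_kernel_inj[OF N KN adj(2) group_\<Gamma>]) auto
      then show "c = c'" using inj_onD[OF inj _ c] by simp
    qed
    show "(\<lambda>c. fixed N (kernel ?A \<Gamma> (\<rho>' c))) ` ({..<k} \<rightarrow>\<^sub>E {0..<int p}) \<subseteq> group_extensions \<Gamma> L K"
      using \<rho>' galois_extension_of_surjection[OF adj(1,2) group_\<Gamma>] by auto
  qed
qed

end

section \<open>Multiplicative and additive Hilbert 90 for finite groups\<close>

context field begin

lemma field_inv:
  assumes "x \<in> carrier R" "x \<noteq> \<zero>"
  shows "inv x \<in> carrier R" "inv x \<noteq> \<zero>" "x \<otimes> inv x = \<one>"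
proof -
  have "x \<in> Units R" using assms by (simp add: field_Units)
  then have "inv x \<in> Units R" "x \<otimes> inv x = \<one>" by simp_all
  then show "inv x \<in> carrier R" "inv x \<noteq> \<zero>" "x \<otimes> inv x = \<one>" by (auto simp: field_Units)
qed

lemma finsum_lessThan_Suc:
  assumes "\<And>i. f i \<in> carrier R"
  shows "finsum R f {..<Suc m} = finsum R f {..<m} \<oplus> f m"
  using assms by (simp add: lessThan_Suc a_comm)

lemma finsum_cyclic_shift:
  assumes "\<And>i. f i \<in> carrier R" "f m = f 0"
  shows "(\<Oplus>i\<in>{..<m}. f (Suc i)) = finsum R f {..<m}"
proof -
  have "f 0 \<oplus> (\<Oplus>i\<in>{..<l}. f (Suc i)) = finsum R f {..<l} \<oplus> f l" for l
  proof (induction l)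
    case (Suc l)
    have "f 0 \<oplus> (\<Oplus>i\<in>{..<Suc l}. f (Suc i)) = (f 0 \<oplus> (\<Oplus>i\<in>{..<l}. f (Suc i))) \<oplus> f (Suc l)"
      using assms(1) by (simp add: finsum_lessThan_Suc a_assoc)
    then show ?case using Suc assms(1) by (simp add: finsum_lessThan_Suc)
  qed (use assms in simp)
  then have "f 0 \<oplus> (\<Oplus>i\<in>{..<m}. f (Suc i)) = f 0 \<oplus> finsum R f {..<m}"
    using assms by (simp add: a_comm)
  then show ?thesis using assms(1) by simp
qed

lemma nat_prod_add_monoid:
  assumes "\<And>i. f i \<in> carrier R"
  shows "monoid.nat_prod (add_monoid R) f m = finsum R f {..<m}"
proof (induction m)
  case (Suc m)
  then show ?case using assms by (simp add: monoid.nat_prod.simps[OF a_monoid] finsum_lessThan_Suc)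
qed (simp add: monoid.nat_prod.simps[OF a_monoid])

lemma Gal_sum_nonzero:
  assumes K: "subfield K R" and F: "F \<subseteq> K" and P: "subgroup P (Gal R K F)" "finite P"
    and c: "\<And>a. a \<in> P \<Longrightarrow> c a \<in> carrier R" "c \<one>\<^bsub>Gal R K F\<^esub> \<noteq> \<zero>"
  shows "\<exists>x\<in>K. (\<Oplus>a\<in>P. c a \<otimes> a x) \<noteq> \<zero>"
proof (rule ccontr)
  assume neg: "\<not> ?thesis"
  interpret P: subgroup P "Gal R K F" by fact
  have PG: "a \<in> carrier (Gal R K F)" if "a \<in> P" for a using P.subset that by blast
  note sK = subfieldD[OF K]
  have "c \<one>\<^bsub>Gal R K F\<^esub> = \<zero>"
  proof (rule characters_independent[where H = P and K = K and c = c])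
    fix h assume h: "h \<in> P"
    show "h \<one> = \<one>" by (rule GalD(4)[OF PG[OF h]])
    show "h x \<in> carrier R" if "x \<in> K" for x using GalD(1)[OF PG[OF h] that] sK(8) by blast
    show "h (x \<otimes> y) = h x \<otimes> h y" if "x \<in> K" "y \<in> K" for x y using GalD(3)[OF PG[OF h] that] .
    show "\<exists>x\<in>K. h x \<noteq> h' x" if "h' \<in> P" "h \<noteq> h'" for h'
      using Gal_eqI[OF PG[OF h] PG[OF that(1)]] that(2) by blast
  next
    fix x assume "x \<in> K"
    then show "(\<Oplus>h\<in>P. c h \<otimes> h x) = \<zero>" using neg by blast
  qed (use sK P c in auto)
  then show False using c(2) by simp
qed

text \<open>Reindexing by left translation; the coefficients are fixed by \<open>P\<close>, so
  \<open>b\<close> acts on \<open>a x\<close> alone. Both forms of Hilbert 90 apply this to a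
  resolvent.\<close>

lemma Gal_sum_translate:
  assumes K: "subfield K R" and F: "F \<subseteq> K" and P: "subgroup P (Gal R K F)" "finite P"
    and c: "\<And>a. a \<in> P \<Longrightarrow> c a \<in> fixed K P" and x: "x \<in> K" and b: "b \<in> P"
  shows "(\<Oplus>a\<in>P. c a \<otimes> a x) \<in> K"
    "b (\<Oplus>a\<in>P. c a \<otimes> a x) = (\<Oplus>a\<in>P. c (inv\<^bsub>Gal R K F\<^esub> b \<otimes>\<^bsub>Gal R K F\<^esub> a) \<otimes> a x)"
proof -
  interpret G: group "Gal R K F" by (rule group_Gal[OF K F])
  interpret P: subgroup P "Gal R K F" by fact
  note sK = subfieldD[OF K]
  have PG: "a \<in> carrier (Gal R K F)" if "a \<in> P" for a using P.subset that by blast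
  define e where "e a = a x" for a :: "'a \<Rightarrow> 'a"
  have eK: "e a \<in> K" if "a \<in> P" for a using GalD(1)[OF PG[OF that] x] by (simp add: e_def)
  have cK: "c a \<in> K" if "a \<in> P" for a using fixedD(1)[OF c[OF that]] .
  have ceK: "c a \<otimes> e a' \<in> K" if "a \<in> P" "a' \<in> P" for a a' using sK(6)[OF cK[OF that(1)] eK[OF that(2)]] .
  have "(\<Oplus>a\<in>P. c a \<otimes> e a) \<in> K" using ceK by (intro subfield_finsum[OF K _ P(2)]) auto
  then show "(\<Oplus>a\<in>P. c a \<otimes> a x) \<in> K" by (simp add: e_def)
  let ?i = "inv\<^bsub>Gal R K F\<^esub> b"
  have ib: "?i \<in> P" using b by simp
  have "b (\<Oplus>a\<in>P. c a \<otimes> e a) = (\<Oplus>a\<in>P. b (c a \<otimes> e a))"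
    using ceK by (intro Gal_finsum[OF K PG[OF b] P(2)]) auto
  also have "\<dots> = (\<Oplus>a\<in>P. c (?i \<otimes>\<^bsub>Gal R K F\<^esub> (b \<otimes>\<^bsub>Gal R K F\<^esub> a)) \<otimes> e (b \<otimes>\<^bsub>Gal R K F\<^esub> a))"
  proof (rule finsum_cong')
    show "(\<lambda>a. c (?i \<otimes>\<^bsub>Gal R K F\<^esub> (b \<otimes>\<^bsub>Gal R K F\<^esub> a)) \<otimes> e (b \<otimes>\<^bsub>Gal R K F\<^esub> a)) \<in> P \<rightarrow> carrier R"
      using ceK sK(8) ib b by blast
    show "b (c a \<otimes> e a) = c (?i \<otimes>\<^bsub>Gal R K F\<^esub> (b \<otimes>\<^bsub>Gal R K F\<^esub> a)) \<otimes> e (b \<otimes>\<^bsub>Gal R K F\<^esub> a)" if a: "a \<in> P" for a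
    proof -
      have "?i \<otimes>\<^bsub>Gal R K F\<^esub> (b \<otimes>\<^bsub>Gal R K F\<^esub> a) = a" using PG[OF a] PG[OF b] by (simp add: G.m_assoc[symmetric])
      moreover have "e (b \<otimes>\<^bsub>Gal R K F\<^esub> a) = b (e a)" using mult_Gal_apply[OF PG[OF b] PG[OF a] x] by (simp add: e_def)
      moreover have "b (c a) = c a" by (rule fixedD(2)[OF c[OF a] b])
      ultimately show ?thesis using GalD(3)[OF PG[OF b] cK[OF a] eK[OF a]] by simp
    qed
  qed simp
  also have "\<dots> = (\<Oplus>a\<in>(\<lambda>a. b \<otimes>\<^bsub>Gal R K F\<^esub> a) ` P. c (?i \<otimes>\<^bsub>Gal R K F\<^esub> a) \<otimes> e a)"
  proof (rule finsum_reindex[symmetric])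
    show "(\<lambda>a. c (?i \<otimes>\<^bsub>Gal R K F\<^esub> a) \<otimes> e a) \<in> (\<lambda>a. b \<otimes>\<^bsub>Gal R K F\<^esub> a) ` P \<rightarrow> carrier R"
      using ceK sK(8) ib b by blast
    show "inj_on (\<lambda>a. b \<otimes>\<^bsub>Gal R K F\<^esub> a) P" using PG b by (auto simp: inj_on_def)
  qed
  also have "(\<lambda>a. b \<otimes>\<^bsub>Gal R K F\<^esub> a) ` P = P"
  proof
    show "P \<subseteq> (\<lambda>a. b \<otimes>\<^bsub>Gal R K F\<^esub> a) ` P"
    proof
      fix a assume a: "a \<in> P"
      have "a = b \<otimes>\<^bsub>Gal R K F\<^esub> (?i \<otimes>\<^bsub>Gal R K F\<^esub> a)" using PG[OF a] PG[OF b] by (simp add: G.m_assoc[symmetric])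
      then show "a \<in> (\<lambda>a. b \<otimes>\<^bsub>Gal R K F\<^esub> a) ` P" using a ib by blast
    qed
  qed (use b in auto)
  finally show "b (\<Oplus>a\<in>P. c a \<otimes> a x) = (\<Oplus>a\<in>P. c (inv\<^bsub>Gal R K F\<^esub> b \<otimes>\<^bsub>Gal R K F\<^esub> a) \<otimes> a x)"
    by (simp add: e_def)
qed

text \<open>As the values of \<open>ch\<close> are fixed by \<open>P\<close>, the cocycle is a
  homomorphism. The solution is the resolvent with coefficients \<open>inv (ch a)\<close>, nonzero
  for some \<open>x\<close> by independence of characters.\<close>

lemma hilbert90_mult:
  assumes K: "subfield K R" and F: "F \<subseteq> K" and P: "subgroup P (Gal R K F)" "finite P"
    and ch: "\<And>a. a \<in> P \<Longrightarrow> ch a \<in> fixed K P" "\<And>a. a \<in> P \<Longrightarrow> ch a \<noteq> \<zero>"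
      "\<And>a b. a \<in> P \<Longrightarrow> b \<in> P \<Longrightarrow> ch (a \<otimes>\<^bsub>Gal R K F\<^esub> b) = ch a \<otimes> ch b"
  shows "\<exists>y\<in>K. y \<noteq> \<zero> \<and> (\<forall>a\<in>P. a y = ch a \<otimes> y)"
proof -
  interpret G: group "Gal R K F" by (rule group_Gal[OF K F])
  interpret P: subgroup P "Gal R K F" by fact
  have FP: "subfield (fixed K P) R" by (rule subfield_fixed[OF K P.subset])
  note sK = subfieldD[OF K] and sF = subfieldD[OF FP]
  have PG: "a \<in> carrier (Gal R K F)" if "a \<in> P" for a using P.subset that by blast
  have chc: "ch a \<in> carrier R" if "a \<in> P" for a using ch(1)[OF that] sF(8) by blast
  let ?c = "\<lambda>a. inv (ch a)"
  have c: "?c a \<in> fixed K P" "?c a \<in> carrier R" "?c a \<noteq> \<zero>" if "a \<in> P" for a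
    using sF(7)[OF ch(1)[OF that] ch(2)[OF that]] field_inv[OF chc[OF that] ch(2)[OF that]] by auto
  obtain x where x: "x \<in> K" "(\<Oplus>a\<in>P. ?c a \<otimes> a x) \<noteq> \<zero>"
    using Gal_sum_nonzero[OF K F P, of ?c] c by auto
  define e where "e a = a x" for a :: "'a \<Rightarrow> 'a"
  have eK: "e a \<in> carrier R" if "a \<in> P" for a using GalD(1)[OF PG[OF that] x(1)] sK(8) by (simp add: e_def)
  let ?y = "\<Oplus>a\<in>P. ?c a \<otimes> a x"
  have yK: "?y \<in> K" using Gal_sum_translate(1)[OF K F P, of ?c x "\<one>\<^bsub>Gal R K F\<^esub>"] c x by auto
  have "b ?y = ch b \<otimes> ?y" if b: "b \<in> P" for b
  proof -
    let ?i = "inv\<^bsub>Gal R K F\<^esub> b"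
    have "b ?y = (\<Oplus>a\<in>P. ?c (?i \<otimes>\<^bsub>Gal R K F\<^esub> a) \<otimes> e a)"
      using Gal_sum_translate(2)[OF K F P, of ?c x b] c x b by (simp add: e_def)
    also have "\<dots> = (\<Oplus>a\<in>P. ch b \<otimes> (?c a \<otimes> e a))"
    proof (rule finsum_cong')
      fix a assume a: "a \<in> P"
      have ia: "?i \<otimes>\<^bsub>Gal R K F\<^esub> a \<in> P" using a b by simp
      have "b \<otimes>\<^bsub>Gal R K F\<^esub> (?i \<otimes>\<^bsub>Gal R K F\<^esub> a) = a" using PG[OF a] PG[OF b] by (simp add: G.m_assoc[symmetric])
      then have "ch a = ch b \<otimes> ch (?i \<otimes>\<^bsub>Gal R K F\<^esub> a)" using ch(3)[OF b ia] by simp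
      then have "ch (?i \<otimes>\<^bsub>Gal R K F\<^esub> a) \<otimes> (ch b \<otimes> ?c a) = ch a \<otimes> ?c a"
        using chc[OF b] chc[OF ia] c(2)[OF a] by (simp add: m_assoc[symmetric] m_comm)
      also have "\<dots> = \<one>" by (rule field_inv(3)[OF chc[OF a] ch(2)[OF a]])
      finally have "?c (?i \<otimes>\<^bsub>Gal R K F\<^esub> a) = ch b \<otimes> ?c a"
        using chc[OF b] chc[OF ia] c(2)[OF a] by (intro comm_inv_char) auto
      then show "?c (?i \<otimes>\<^bsub>Gal R K F\<^esub> a) \<otimes> e a = ch b \<otimes> (?c a \<otimes> e a)"
        using chc[OF b] c(2)[OF a] eK[OF a] by (simp add: m_assoc[symmetric])
    qed (use c eK chc b in auto)
    also have "\<dots> = ch b \<otimes> (\<Oplus>a\<in>P. ?c a \<otimes> e a)"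
      using c eK chc b P(2) by (intro finsum_rdistr[symmetric]) auto
    finally show ?thesis by (simp add: e_def)
  qed
  then show ?thesis using yK x by blast
qed

text \<open>With \<open>T\<close> the trace of \<open>x\<close> and \<open>S\<close> the sum of the
  \<open>ch a \<otimes> a x\<close>, translation by \<open>b\<close> changes \<open>S\<close> by
  \<open>\<ominus> (ch b \<otimes> T)\<close>. So the negative of \<open>S / T\<close> is a solution
  once \<open>T\<close> is nonzero.\<close>

lemma hilbert90_add:
  assumes K: "subfield K R" and F: "F \<subseteq> K" and P: "subgroup P (Gal R K F)" "finite P"
    and ch: "\<And>a. a \<in> P \<Longrightarrow> ch a \<in> fixed K P"
      "\<And>a b. a \<in> P \<Longrightarrow> b \<in> P \<Longrightarrow> ch (a \<otimes>\<^bsub>Gal R K F\<^esub> b) = ch a \<oplus> ch b"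
  shows "\<exists>y\<in>K. \<forall>a\<in>P. a y = ch a \<oplus> y"
proof -
  interpret G: group "Gal R K F" by (rule group_Gal[OF K F])
  interpret P: subgroup P "Gal R K F" by fact
  have FP: "subfield (fixed K P) R" by (rule subfield_fixed[OF K P.subset])
  note sK = subfieldD[OF K] and sF = subfieldD[OF FP]
  have PG: "a \<in> carrier (Gal R K F)" if "a \<in> P" for a using P.subset that by blast
  have chc: "ch a \<in> carrier R" if "a \<in> P" for a using ch(1)[OF that] sF(8) by blast
  obtain x where x: "x \<in> K" "(\<Oplus>a\<in>P. \<one> \<otimes> a x) \<noteq> \<zero>"
    using Gal_sum_nonzero[OF K F P, of "\<lambda>_. \<one>"] by auto
  define e where "e a = a x" for a :: "'a \<Rightarrow> 'a"
  have eK: "e a \<in> carrier R" if "a \<in> P" for a using GalD(1)[OF PG[OF that] x(1)] sK(8) by (simp add: e_def)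
  define T where "T = (\<Oplus>a\<in>P. \<one> \<otimes> e a)"
  define S where "S = (\<Oplus>a\<in>P. ch a \<otimes> e a)"
  have T: "T \<in> K" "T \<noteq> \<zero>" "\<And>b. b \<in> P \<Longrightarrow> b T = T"
    using Gal_sum_translate[OF K F P, of "\<lambda>_. \<one>" x] sF(3) x by (auto simp: T_def e_def intro: P.one_closed)
  have S: "S \<in> K" using Gal_sum_translate(1)[OF K F P, of ch x "\<one>\<^bsub>Gal R K F\<^esub>"] ch x by (auto simp: S_def e_def)
  have TS: "T \<in> carrier R" "S \<in> carrier R" "inv T \<in> carrier R" "inv T \<in> K" using T S sK(7,8) by auto
  have bS: "b S = S \<oplus> \<ominus> (ch b \<otimes> T)" if b: "b \<in> P" for b
  proof -
    let ?i = "inv\<^bsub>Gal R K F\<^esub> b"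
    have "b S = (\<Oplus>a\<in>P. ch (?i \<otimes>\<^bsub>Gal R K F\<^esub> a) \<otimes> e a)"
      using Gal_sum_translate(2)[OF K F P, of ch x b] ch x b by (simp add: e_def S_def)
    also have "\<dots> = (\<Oplus>a\<in>P. ch a \<otimes> e a \<oplus> \<ominus> ch b \<otimes> (\<one> \<otimes> e a))"
    proof (rule finsum_cong')
      fix a assume a: "a \<in> P"
      have ia: "?i \<otimes>\<^bsub>Gal R K F\<^esub> a \<in> P" using a b by simp
      have "b \<otimes>\<^bsub>Gal R K F\<^esub> (?i \<otimes>\<^bsub>Gal R K F\<^esub> a) = a" using PG[OF a] PG[OF b] by (simp add: G.m_assoc[symmetric])
      then have "ch a = ch b \<oplus> ch (?i \<otimes>\<^bsub>Gal R K F\<^esub> a)" using ch(2)[OF b ia] by simp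
      then show "ch (?i \<otimes>\<^bsub>Gal R K F\<^esub> a) \<otimes> e a = ch a \<otimes> e a \<oplus> \<ominus> ch b \<otimes> (\<one> \<otimes> e a)"
        using chc[OF b] chc[OF ia] eK[OF a] by algebra
    qed (use eK chc b in auto)
    also have "\<dots> = S \<oplus> (\<Oplus>a\<in>P. \<ominus> ch b \<otimes> (\<one> \<otimes> e a))"
      unfolding S_def using eK chc b by (intro finsum_addf) auto
    also have "(\<Oplus>a\<in>P. \<ominus> ch b \<otimes> (\<one> \<otimes> e a)) = \<ominus> ch b \<otimes> T"
      unfolding T_def using eK chc b P(2) by (intro finsum_rdistr[symmetric]) auto
    finally show ?thesis using chc[OF b] TS by (simp add: l_minus)
  qed
  let ?y = "\<ominus> (S \<otimes> inv T)"
  have "b ?y = ch b \<oplus> ?y" if b: "b \<in> P" for b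
  proof -
    have "b ?y = \<ominus> (b S \<otimes> inv (b T))"
      using Gal_minus[OF K PG[OF b]] GalD(3)[OF PG[OF b] S TS(4)] Gal_inverse[OF K PG[OF b] T(1,2)] S TS(4) sK(6) by simp
    also have "\<dots> = \<ominus> ((S \<oplus> \<ominus> (ch b \<otimes> T)) \<otimes> inv T)" using bS[OF b] T(3)[OF b] by simp
    also have "\<dots> = ?y \<oplus> ch b \<otimes> (T \<otimes> inv T)" using chc[OF b] TS(1,2,3) by algebra
    also have "T \<otimes> inv T = \<one>" using T(2) TS(1) field_Units by simp
    finally show ?thesis using chc[OF b] TS by (simp add: a_comm)
  qed
  moreover have "?y \<in> K" using S TS sK(4,6) by blast
  ultimately show ?thesis by blast
qed

end

lemma (in group) prime_order_inj:
  assumes "prime p" "x \<in> carrier G" "x [^] p = \<one>" "x \<noteq> \<one>"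
  shows "inj_on (\<lambda>i::nat. x [^] i) {..<p}"
proof -
  have "ord x dvd p" using pow_eq_id[OF assms(2)] assms(3) by simp
  moreover have "ord x \<noteq> 1" using pow_ord_eq_1[OF assms(2)] assms(2,4) by (metis nat_pow_eone)
  ultimately have "ord x = p" using assms(1) by (metis prime_nat_iff)
  then show ?thesis using ord_inj[OF assms(2)] prime_gt_0_nat[OF assms(1)]
    by (auto simp: inj_on_def)
qed

section \<open>Hilbert 90 for an automorphism of prime order\<close>

context field begin

context
  fixes E F t p
  assumes E: "subfield E R" and t: "t \<in> carrier (Gal R E F)" and p: "prime p"
    and t_order: "\<And>x. x \<in> E \<Longrightarrow> (t ^^ p) x = x" and t_nontriv: "\<exists>x\<in>E. t x \<noteq> x"
begin

lemma funpow_E: "x \<in> E \<Longrightarrow> (t ^^ i) x \<in> E"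
  using GalD(1)[OF t] by (induction i) auto

lemma funpow_carrier: "x \<in> E \<Longrightarrow> (t ^^ i) x \<in> carrier R"
  using funpow_E subfieldD(8)[OF E] by blast

text \<open>A nontrivial \<open>t\<close> with \<open>t ^^ p\<close> trivial has exactly
  \<open>p\<close> distinct powers, which are independent characters.\<close>

lemma cyclic_sum_nonzero:
  assumes k: "\<And>i. c i \<in> carrier R" "c 0 \<noteq> \<zero>"
  shows "\<exists>x\<in>E. (\<Oplus>i\<in>{..<p}. c i \<otimes> (t ^^ i) x) \<noteq> \<zero>"
proof (rule ccontr)
  assume neg: "\<not> ?thesis"
  \<comment> \<open>The group of all automorphisms of \<open>E\<close>: \<open>group_Gal\<close>
    wants a base inside \<open>E\<close>, which is not assumed of \<open>F\<close>.\<close>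
  let ?G = "Gal R E {}"
  interpret G: group ?G by (rule group_Gal[OF E]) simp
  note sE = subfieldD[OF E]
  have tG: "t \<in> carrier ?G" using GalD[OF t] by (intro GalI) (auto simp: bij_betw_def)
  have pow: "(t [^]\<^bsub>?G\<^esub> i) x = (t ^^ i) x" if "x \<in> E" for i :: nat and x
    using that
  proof (induction i arbitrary: x)
    case (Suc i)
    then show ?case
      using mult_Gal_apply[OF G.nat_pow_closed[OF tG, of i] tG Suc.prems] GalD(1)[OF t Suc.prems]
      by (simp add: funpow_swap1)
  qed (simp add: one_Gal)
  have "t [^]\<^bsub>?G\<^esub> p = \<one>\<^bsub>?G\<^esub>"
    using t_order pow by (intro Gal_eqI[OF G.nat_pow_closed[OF tG] G.one_closed]) (simp add: one_Gal)
  moreover have "t \<noteq> \<one>\<^bsub>?G\<^esub>" using t_nontriv by (auto simp: one_Gal)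
  ultimately have inj: "inj_on (\<lambda>i::nat. t [^]\<^bsub>?G\<^esub> i) {..<p}" by (rule G.prime_order_inj[OF p tG])
  let ?P = "(\<lambda>i::nat. t [^]\<^bsub>?G\<^esub> i) ` {..<p}"
  define d where "d h = c (inv_into {..<p} (\<lambda>i::nat. t [^]\<^bsub>?G\<^esub> i) h)" for h
  have d: "d (t [^]\<^bsub>?G\<^esub> i) = c i" if "i < p" for i using inv_into_f_f[OF inj, of i] that by (simp add: d_def)
  have p0: "0 < p" using p prime_gt_0_nat by blast
  have "d (t [^]\<^bsub>?G\<^esub> (0::nat)) = \<zero>"
  proof (rule characters_independent[where H = ?P and K = E and c = d])
    fix h assume "h \<in> ?P"
    then have h: "h \<in> carrier ?G" using tG by auto
    show "h \<one> = \<one>" by (rule GalD(4)[OF h])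
    show "h x \<in> carrier R" if "x \<in> E" for x using GalD(1)[OF h that] sE(8) by blast
    show "h (x \<otimes> y) = h x \<otimes> h y" if "x \<in> E" "y \<in> E" for x y using GalD(3)[OF h that] .
    show "\<exists>x\<in>E. h x \<noteq> h' x" if "h' \<in> ?P" "h \<noteq> h'" for h'
    proof -
      have "h' \<in> carrier ?G" using that(1) tG by auto
      then show ?thesis using Gal_eqI[OF h] that(2) by blast
    qed
    show "d h \<in> carrier R" using k(1) by (simp add: d_def)
  next
    fix x assume x: "x \<in> E"
    define e where "e h = h x" for h :: "'a \<Rightarrow> 'a"
    have e: "e (t [^]\<^bsub>?G\<^esub> i) = (t ^^ i) x" for i :: nat using pow[OF x] by (simp add: e_def)
    have "(\<Oplus>h\<in>?P. d h \<otimes> e h) = (\<Oplus>i\<in>{..<p}. d (t [^]\<^bsub>?G\<^esub> i) \<otimes> e (t [^]\<^bsub>?G\<^esub> i))"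
      using k(1) funpow_carrier[OF x] by (intro finsum_reindex inj) (auto simp: e d_def)
    also have "\<dots> = (\<Oplus>i\<in>{..<p}. c i \<otimes> (t ^^ i) x)"
      using k(1) funpow_carrier[OF x] d by (intro finsum_cong') (auto simp: e)
    also have "\<dots> = \<zero>" using neg x by blast
    finally show "(\<Oplus>h\<in>?P. d h \<otimes> h x) = \<zero>" by (simp add: e_def)
  next
    show "t [^]\<^bsub>?G\<^esub> (0::nat) \<in> ?P" using p0 by (intro imageI) simp
  qed (use sE in auto)
  then show False using d[OF p0] k(2) by simp
qed

lemma Gal_finsum_funpow:
  assumes "\<And>i. f i \<in> E"
  shows "t (\<Oplus>i\<in>{..<m}. f i) = (\<Oplus>i\<in>{..<m}. t (f i))" "(\<Oplus>i\<in>{..<(m::nat)}. f i) \<in> E"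
  using Gal_finsum[OF E t, of "{..<m}" f] subfield_finsum[OF E, of "{..<m}" f] assms by auto

text \<open>The coefficients \<open>f i\<close> are the partial norms of \<open>x\<close>. They
  satisfy \<open>x \<otimes> t (f i) = f (Suc i)\<close>, so the resolvent \<open>z\<close>
  satisfies \<open>x \<otimes> t z = z\<close>; norm one closes the cycle at \<open>i = p\<close>,
  and \<open>b\<close> is the inverse of \<open>z\<close>.\<close>

lemma hilbert90_cyclic_mult:
  assumes x: "x \<in> E" "x \<noteq> \<zero>" and norm1: "nat_prod (\<lambda>i. (t ^^ i) x) p = \<one>"
  shows "\<exists>b\<in>E. b \<noteq> \<zero> \<and> t b = x \<otimes> b"
proof -
  note sE = subfieldD[OF E]
  define f where "f i = nat_prod (\<lambda>i. (t ^^ i) x) i" for i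
  have fE: "f i \<in> E" for i
    by (induction i) (auto simp: f_def sE(3) sE(6) funpow_E[OF x(1)])
  have fc: "f i \<in> carrier R" for i using fE sE(8) by blast
  have xc: "x \<in> carrier R" using x sE(8) by blast
  have fS: "x \<otimes> t (f i) = f (Suc i)" for i
  proof (induction i)
    case 0
    then show ?case using xc GalD(4)[OF t] by (simp add: f_def)
  next
    case (Suc i)
    have "x \<otimes> t (f (Suc i)) = x \<otimes> (t (f i) \<otimes> t ((t ^^ i) x))"
      using GalD(3)[OF t fE[of i] funpow_E[OF x(1), of i]] by (simp add: f_def)
    also have "\<dots> = (x \<otimes> t (f i)) \<otimes> (t ^^ Suc i) x"
      using xc fc[of "Suc i"] GalD(1)[OF t fE[of i]] funpow_carrier[OF x(1), of "Suc i"] sE(8) by (simp add: m_assoc)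
    finally show ?case using Suc by (simp add: f_def)
  qed
  obtain y where y: "y \<in> E" "(\<Oplus>i\<in>{..<p}. f i \<otimes> (t ^^ i) y) \<noteq> \<zero>"
    using cyclic_sum_nonzero[of f] fc by (auto simp: f_def)
  define g where "g i = f i \<otimes> (t ^^ i) y" for i
  have gE: "g i \<in> E" for i unfolding g_def using sE(6)[OF fE funpow_E[OF y(1)]] .
  then have gc: "g i \<in> carrier R" for i using sE(8) by blast
  let ?z = "\<Oplus>i\<in>{..<p}. g i"
  have zE: "?z \<in> E" by (rule Gal_finsum_funpow(2)[OF gE])
  have tg: "x \<otimes> t (g i) = g (Suc i)" for i
  proof -
    have "x \<otimes> t (g i) = x \<otimes> (t (f i) \<otimes> (t ^^ Suc i) y)"
      unfolding g_def using GalD(3)[OF t fE funpow_E[OF y(1)]] by simp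
    also have "\<dots> = g (Suc i)"
      using fS[of i] xc sE(8)[OF GalD(1)[OF t fE[of i]]] funpow_carrier[OF y(1), of "Suc i"]
      by (simp add: g_def m_assoc[symmetric])
    finally show ?thesis .
  qed
  have "x \<otimes> t ?z = (\<Oplus>i\<in>{..<p}. x \<otimes> t (g i))"
    unfolding Gal_finsum_funpow(1)[OF gE]
    using xc GalD(1)[OF t gE] sE(8) by (intro finsum_rdistr) auto
  also have "\<dots> = (\<Oplus>i\<in>{..<p}. g (Suc i))" by (simp add: tg)
  also have "\<dots> = ?z"
  proof (rule finsum_cyclic_shift[OF gc])
    have "f p = \<one>" using norm1 by (simp add: f_def)
    moreover have "f 0 = \<one>" by (simp add: f_def)
    ultimately show "g p = g 0" using t_order[OF y(1)] by (simp add: g_def)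
  qed
  finally have xz: "x \<otimes> t ?z = ?z" .
  have z: "?z \<noteq> \<zero>" using y(2) by (simp add: g_def)
  have zc: "?z \<in> carrier R" "t ?z \<in> carrier R" "t ?z \<noteq> \<zero>"
    using zE sE(8) GalD(1)[OF t zE] Gal_nonzero[OF E t zE z] by auto
  have "t ?z \<otimes> (x \<otimes> inv ?z) = ?z \<otimes> inv ?z"
    using xz xc zc field_inv(1)[OF zc(1) z] by (simp add: m_assoc[symmetric] m_comm)
  then have "inv (t ?z) = x \<otimes> inv ?z"
    using field_inv[OF zc(1) z] xc zc by (intro comm_inv_char) auto
  then have "t (inv ?z) = x \<otimes> inv ?z" using Gal_inverse[OF E t zE z] by simp
  then show ?thesis using sE(7)[OF zE z] field_inv(2)[OF zc(1) z] by blast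
qed

text \<open>A nonzero trace exists by independence of characters and is fixed by \<open>t\<close>,
  so one may divide by it.\<close>

lemma exists_trace_one: "\<exists>y\<in>E. (\<Oplus>i\<in>{..<p}. (t ^^ i) y) = \<one>"
proof -
  note sE = subfieldD[OF E]
  obtain y where y: "y \<in> E" "(\<Oplus>i\<in>{..<p}. \<one> \<otimes> (t ^^ i) y) \<noteq> \<zero>"
    using cyclic_sum_nonzero[of "\<lambda>_. \<one>"] by auto
  let ?T = "\<Oplus>i\<in>{..<p}. (t ^^ i) y"
  have T: "?T \<in> E" "?T \<noteq> \<zero>"
    using Gal_finsum_funpow(2)[of "\<lambda>i. (t ^^ i) y" p] funpow_E[OF y(1)] y(2) funpow_carrier[OF y(1)] by auto
  have "t ?T = (\<Oplus>i\<in>{..<p}. (t ^^ Suc i) y)"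
    using Gal_finsum_funpow(1)[of "\<lambda>i. (t ^^ i) y" p] funpow_E[OF y(1)] by simp
  also have "\<dots> = ?T"
    using finsum_cyclic_shift[of "\<lambda>i. (t ^^ i) y" p] funpow_carrier[OF y(1)] t_order[OF y(1)] by simp
  finally have tT: "t ?T = ?T" .
  have iT: "inv ?T \<in> E" "inv ?T \<in> carrier R" "?T \<in> carrier R" using sE(7)[OF T] sE(8) T by auto
  have tiT: "t (inv ?T) = inv ?T" using Gal_inverse[OF E t T] tT by simp
  have "(t ^^ i) (y \<otimes> inv ?T) = (t ^^ i) y \<otimes> inv ?T" for i
    using GalD(3)[OF t funpow_E[OF y(1)] iT(1)] tiT by (induction i) auto
  then have "(\<Oplus>i\<in>{..<p}. (t ^^ i) (y \<otimes> inv ?T)) = (\<Oplus>i\<in>{..<p}. (t ^^ i) y \<otimes> inv ?T)" by simp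
  also have "\<dots> = ?T \<otimes> inv ?T"
    using funpow_carrier[OF y(1)] iT by (intro finsum_ldistr[symmetric]) auto
  also have "\<dots> = \<one>" by (rule field_inv(3)[OF iT(3) T(2)])
  finally show ?thesis using sE(6)[OF y(1) iT(1)] by blast
qed

text \<open>The additive counterpart: the partial traces \<open>f i\<close> are the coefficients of
  a resolvent of an element \<open>y\<close> of trace one, and \<open>b\<close> is its
  negative.\<close>

lemma hilbert90_cyclic_add:
  assumes x: "x \<in> E" and tr0: "(\<Oplus>i\<in>{..<p}. (t ^^ i) x) = \<zero>"
  shows "\<exists>b\<in>E. t b = x \<oplus> b"
proof -
  note sE = subfieldD[OF E]
  define f where "f i = (\<Oplus>j\<in>{..<i}. (t ^^ j) x)" for i
  have fE: "f i \<in> E" for i unfolding f_def by (rule Gal_finsum_funpow(2)[OF funpow_E[OF x]])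
  have fc: "f i \<in> carrier R" for i using fE sE(8) by blast
  have xc: "x \<in> carrier R" using x sE(8) by blast
  have fSuc: "f (Suc i) = f i \<oplus> (t ^^ i) x" for i
    unfolding f_def by (rule finsum_lessThan_Suc[OF funpow_carrier[OF x]])
  have fS: "x \<oplus> t (f i) = f (Suc i)" for i
  proof (induction i)
    case 0
    then show ?case using xc Gal_zero[OF E t] fSuc[of 0] by (simp add: f_def)
  next
    case (Suc i)
    have "x \<oplus> t (f (Suc i)) = x \<oplus> (t (f i) \<oplus> t ((t ^^ i) x))"
      using GalD(2)[OF t fE[of i] funpow_E[OF x, of i]] by (simp add: fSuc)
    also have "\<dots> = (x \<oplus> t (f i)) \<oplus> (t ^^ Suc i) x"
      using xc sE(8)[OF GalD(1)[OF t fE[of i]]] funpow_carrier[OF x, of "Suc i"] by (simp add: a_assoc)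
    finally show ?case using Suc by (simp add: fSuc)
  qed
  obtain y where y: "y \<in> E" "(\<Oplus>i\<in>{..<p}. (t ^^ i) y) = \<one>" using exists_trace_one by blast
  have yc: "(t ^^ i) y \<in> carrier R" for i by (rule funpow_carrier[OF y(1)])
  define g where "g i = f i \<otimes> (t ^^ i) y" for i
  have gE: "g i \<in> E" for i unfolding g_def using sE(6)[OF fE funpow_E[OF y(1)]] .
  then have gc: "g i \<in> carrier R" for i using sE(8) by blast
  let ?z = "\<Oplus>i\<in>{..<p}. g i"
  have zE: "?z \<in> E" by (rule Gal_finsum_funpow(2)[OF gE])
  have zc: "?z \<in> carrier R" using zE sE(8) by blast
  have tg: "t (g i) = g (Suc i) \<oplus> \<ominus> x \<otimes> (t ^^ Suc i) y" for i
  proof -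
    have tf: "t (f i) \<in> carrier R" using sE(8)[OF GalD(1)[OF t fE]] .
    have "t (g i) = t (f i) \<otimes> (t ^^ Suc i) y"
      unfolding g_def using GalD(3)[OF t fE funpow_E[OF y(1)]] by simp
    moreover have "g (Suc i) = (x \<oplus> t (f i)) \<otimes> (t ^^ Suc i) y" unfolding g_def fS by simp
    ultimately show ?thesis using xc tf yc[of "Suc i"] by (simp del: funpow.simps(2)) algebra
  qed
  have "t ?z = (\<Oplus>i\<in>{..<p}. g (Suc i) \<oplus> \<ominus> x \<otimes> (t ^^ Suc i) y)"
    unfolding Gal_finsum_funpow(1)[OF gE] by (simp add: tg del: funpow.simps(2))
  also have "\<dots> = (\<Oplus>i\<in>{..<p}. g (Suc i)) \<oplus> (\<Oplus>i\<in>{..<p}. \<ominus> x \<otimes> (t ^^ Suc i) y)"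
    using gc xc yc by (intro finsum_addf) (auto simp del: funpow.simps(2))
  also have "(\<Oplus>i\<in>{..<p}. g (Suc i)) = ?z"
  proof (rule finsum_cyclic_shift[OF gc])
    have "f p = \<zero>" "f 0 = \<zero>" using tr0 by (simp_all add: f_def)
    then show "g p = g 0" using yc[of 0] yc[of p] by (simp add: g_def)
  qed
  also have "(\<Oplus>i\<in>{..<p}. \<ominus> x \<otimes> (t ^^ Suc i) y) = \<ominus> x \<otimes> (\<Oplus>i\<in>{..<p}. (t ^^ Suc i) y)"
    using xc yc by (intro finsum_rdistr[symmetric]) (auto simp del: funpow.simps(2))
  also have "(\<Oplus>i\<in>{..<p}. (t ^^ Suc i) y) = \<one>"
    using finsum_cyclic_shift[of "\<lambda>i. (t ^^ i) y" p] yc t_order[OF y(1)] y(2) by simp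
  finally have "t ?z = ?z \<oplus> \<ominus> x" using xc by simp
  then have "t (\<ominus> ?z) = x \<oplus> \<ominus> ?z" using Gal_minus[OF E t zE] xc zc by (simp add: minus_add a_comm)
  then show ?thesis using sE(4)[OF zE] by blast
qed

end

section \<open>Characteristic \<open>p\<close> and the polynomials of both theories\<close>

lemma add_pow_char:
  fixes p l :: nat
  assumes "[p] \<cdot> \<one> = \<zero>" "x \<in> carrier R"
  shows "[(p * l)] \<cdot> x = \<zero>"
proof -
  have "[p] \<cdot> x = [p] \<cdot> \<one> \<otimes> x" using add_pow_ldistr[of \<one> x p] assms(2) by simp
  then have "[p] \<cdot> x = \<zero>" using assms by simp
  then show ?thesis using add.nat_pow_pow[OF assms(2), of l p] by simp
qed

text \<open>The limit \<open>N\<close> may exceed \<open>m + 1\<close>, where the binomial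
  coefficients vanish; the induction uses the expansion of \<open>(x + 1)^m\<close> with two
  different limits.\<close>

lemma binomial_one:
  assumes x: "x \<in> carrier R" and N: "m < N"
  shows "(x \<oplus> \<one>) [^] m = (\<Oplus>i\<in>{..<N}. [(m choose i)] \<cdot> (x [^] i))"
  using N
proof (induction m arbitrary: N)
  case 0
  have "(\<Oplus>i\<in>{..<Suc l}. [(0 choose i)] \<cdot> (x [^] i)) = \<one>" for l
  proof (induction l)
    case (Suc l)
    then show ?case using x by (subst finsum_lessThan_Suc) auto
  qed (use x in \<open>simp add: finsum_lessThan_Suc\<close>)
  then show ?case using 0 by (cases N) auto
next
  case (Suc m)
  obtain l where l: "N = Suc l" using Suc.prems by (cases N) auto
  define S where "S a b = (\<Oplus>i\<in>{..<b}. [(a choose i)] \<cdot> (x [^] i))" for a b :: nat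
  have tc: "[(a::nat)] \<cdot> (x [^] (i::nat)) \<in> carrier R" for a i using x by simp
  have S_Suc: "S a (Suc b) = S a b \<oplus> [(a choose b)] \<cdot> (x [^] b)" for a b
    unfolding S_def by (rule finsum_lessThan_Suc[OF tc])
  have Sc: "S a b \<in> carrier R" for a b unfolding S_def using tc by (intro finsum_closed) auto
  have "S (Suc m) (Suc b) = S m b \<otimes> x \<oplus> S m (Suc b)" for b
  proof (induction b)
    case 0
    then show ?case using x by (simp add: S_def finsum_lessThan_Suc)
  next
    case (Suc b)
    let ?u = "x [^] Suc b"
    have "S (Suc m) (Suc (Suc b)) = S (Suc m) (Suc b) \<oplus> ([(m choose b)] \<cdot> ?u \<oplus> [(m choose Suc b)] \<cdot> ?u)"
      using x by (subst S_Suc) (simp add: add.nat_pow_mult)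
    also have "[(m choose b)] \<cdot> ?u = ([(m choose b)] \<cdot> (x [^] b)) \<otimes> x"
      using x add_pow_ldistr[of "x [^] b" x "m choose b"] by simp
    also have "S (Suc m) (Suc b) = S m b \<otimes> x \<oplus> S m (Suc b)" by (rule Suc)
    finally have "S (Suc m) (Suc (Suc b)) = (S m b \<otimes> x \<oplus> S m (Suc b)) \<oplus>
        (([(m choose b)] \<cdot> (x [^] b)) \<otimes> x \<oplus> [(m choose Suc b)] \<cdot> ?u)" .
    also have "\<dots> = (S m b \<oplus> [(m choose b)] \<cdot> (x [^] b)) \<otimes> x \<oplus> (S m (Suc b) \<oplus> [(m choose Suc b)] \<cdot> ?u)"
      using Sc[of m b] Sc[of m "Suc b"] tc[of "m choose b" b] tc[of "m choose Suc b" "Suc b"] x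
      by (simp add: l_distr a_ac)
    finally show ?case by (simp only: S_Suc)
  qed
  then have "S (Suc m) N = S m l \<otimes> x \<oplus> S m (Suc l)" by (simp add: l)
  also have "S m l = (x \<oplus> \<one>) [^] m" unfolding S_def using Suc.IH[of l] Suc.prems l by simp
  also have "S m (Suc l) = (x \<oplus> \<one>) [^] m" unfolding S_def using Suc.IH[of "Suc l"] Suc.prems l by simp
  also have "(x \<oplus> \<one>) [^] m \<otimes> x \<oplus> (x \<oplus> \<one>) [^] m = (x \<oplus> \<one>) [^] Suc m" using x by (simp add: r_distr)
  finally show ?case by (simp add: S_def)
qed

text \<open>Only \<open>(z + 1)^p\<close> is expanded; the general case reduces to it on dividing by
  \<open>y\<close>.\<close>

lemma frobenius_add:
  fixes p :: nat
  assumes p: "prime p" and ch: "[p] \<cdot> \<one> = \<zero>" and x: "x \<in> carrier R" and y: "y \<in> carrier R"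
  shows "(x \<oplus> y) [^] p = x [^] p \<oplus> y [^] p"
proof -
  have p0: "0 < p" using p prime_gt_0_nat by blast
  have one: "(z \<oplus> \<one>) [^] p = z [^] p \<oplus> \<one>" if z: "z \<in> carrier R" for z
  proof -
    let ?f = "\<lambda>i. [(p choose i)] \<cdot> (z [^] (i::nat))"
    have fc: "?f i \<in> carrier R" for i using z by simp
    have "finsum R ?f {..<Suc l} = \<one>" if "l < p" for l
      using that
    proof (induction l)
      case (Suc l)
      have "p dvd (p choose Suc l)" using dvd_choose_prime[of "Suc l" p] p Suc.prems by simp
      then obtain u where "p choose Suc l = p * u" by auto
      then have "?f (Suc l) = \<zero>" using add_pow_char[OF ch, of "z [^] Suc l" u] z by simp
      then show ?case using Suc by (subst finsum_lessThan_Suc[OF fc]) simp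
    next
      case 0
      have "?f 0 = \<one>" by simp
      then show ?case by (subst finsum_lessThan_Suc[OF fc]) simp
    qed
    then have "finsum R ?f {..<p} = \<one>" using p0 by (cases p) auto
    then have "finsum R ?f {..<Suc p} = z [^] p \<oplus> \<one>"
      using z by (subst finsum_lessThan_Suc[OF fc]) (simp add: a_comm)
    then show ?thesis using binomial_one[OF z, of p "Suc p"] by simp
  qed
  show ?thesis
  proof (cases "y = \<zero>")
    case True
    then show ?thesis using x p0 by (simp add: nat_pow_zero)
  next
    case False
    note iy = field_inv[OF y False]
    have "x \<oplus> y = (x \<otimes> inv y \<oplus> \<one>) \<otimes> y"
      using x y iy by (simp add: l_distr m_assoc m_comm[of "inv y" y])
    then have "(x \<oplus> y) [^] p = (x \<otimes> inv y \<oplus> \<one>) [^] p \<otimes> y [^] p"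
      using x y iy by (simp add: nat_pow_distrib)
    also have "(x \<otimes> inv y \<oplus> \<one>) [^] p = (x \<otimes> inv y) [^] p \<oplus> \<one>" using one x iy by simp
    also have "((x \<otimes> inv y) [^] p \<oplus> \<one>) \<otimes> y [^] p = (x \<otimes> inv y \<otimes> y) [^] p \<oplus> y [^] p"
      using x y iy by (simp add: l_distr nat_pow_distrib)
    also have "x \<otimes> inv y \<otimes> y = x" using x y iy by (simp add: m_assoc m_comm[of "inv y" y])
    finally show ?thesis .
  qed
qed

lemma roots_eqI:
  assumes f: "f \<in> carrier (poly_ring R)" "f \<noteq> []" and S: "S \<subseteq> {z \<in> carrier R. eval f z = \<zero>}" "degree f \<le> card S"
    and x: "x \<in> carrier R" "eval f x = \<zero>"
  shows "x \<in> S"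
proof (rule ccontr)
  assume "x \<notin> S"
  have "finite S" by (rule card_roots_le_degree(1)[OF f S(1)])
  moreover have "card (insert x S) \<le> degree f" using S x by (intro card_roots_le_degree(2)[OF f]) auto
  ultimately show False using \<open>x \<notin> S\<close> S(2) by simp
qed

text \<open>Coefficient lists begin with the leading coefficient:
  \<open>monom \<one> (p - 1)\<close> is the list of \<open>X^(p-1)\<close>, and appending an entry
  multiplies by \<open>X\<close> and adds a constant. The result is \<open>X^p - b\<close>.\<close>

lemma power_poly:
  assumes "subfield E R" "b \<in> E" "0 < p"
  shows "monom \<one> (p - 1) @ [\<ominus> b] \<in> carrier (E[X])" "degree (monom \<one> (p - 1) @ [\<ominus> b]) = p"
    "\<And>z. z \<in> carrier R \<Longrightarrow> eval (monom \<one> (p - 1) @ [\<ominus> b]) z = z [^] p \<ominus> b"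
proof -
  note sE = subfieldD[OF assms(1)]
  show "monom \<one> (p - 1) @ [\<ominus> b] \<in> carrier (E[X])"
    using sE(2,3) sE(4)[OF assms(2)] by (auto simp: univ_poly_carrier[symmetric] polynomial_def monom_def)
  show "degree (monom \<one> (p - 1) @ [\<ominus> b]) = p" using assms(3) by (simp add: monom_def)
  fix z assume z: "z \<in> carrier R"
  have "eval (monom \<one> (p - 1) @ [\<ominus> b]) z = eval (monom \<one> (p - 1)) z \<otimes> z \<oplus> \<ominus> b"
    using z sE(8)[OF assms(2)] by (intro eval_append_aux monom_in_carrier) auto
  also have "\<dots> = z [^] (p - 1) \<otimes> z \<oplus> \<ominus> b" using eval_monom[of \<one> z "p - 1"] z by simp
  also have "z [^] (p - 1) \<otimes> z = z [^] p" using assms(3) nat_pow_Suc[of z "p - 1"] by simp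
  finally show "eval (monom \<one> (p - 1) @ [\<ominus> b]) z = z [^] p \<ominus> b" by (simp add: minus_eq)
qed

text \<open>In the same way, \<open>X^(p-2)\<close> followed by two entries is
  \<open>X^p - X - b\<close>.\<close>

lemma artin_schreier_poly:
  assumes "subfield E R" "b \<in> E" "2 \<le> p"
  shows "monom \<one> (p - 2) @ [\<ominus> \<one>, \<ominus> b] \<in> carrier (E[X])" "degree (monom \<one> (p - 2) @ [\<ominus> \<one>, \<ominus> b]) = p"
    "\<And>z. z \<in> carrier R \<Longrightarrow> eval (monom \<one> (p - 2) @ [\<ominus> \<one>, \<ominus> b]) z = z [^] p \<ominus> z \<ominus> b"
proof -
  note sE = subfieldD[OF assms(1)]
  have bc: "b \<in> carrier R" using sE(8)[OF assms(2)] .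
  show "monom \<one> (p - 2) @ [\<ominus> \<one>, \<ominus> b] \<in> carrier (E[X])"
    using sE(2,3) sE(4)[OF sE(3)] sE(4)[OF assms(2)] by (auto simp: univ_poly_carrier[symmetric] polynomial_def monom_def)
  show "degree (monom \<one> (p - 2) @ [\<ominus> \<one>, \<ominus> b]) = p" using assms(3) by (simp add: monom_def)
  fix z assume z: "z \<in> carrier R"
  have m: "set (monom \<one> (p - 2)) \<subseteq> carrier R" by (rule monom_in_carrier) simp
  have "eval ((monom \<one> (p - 2) @ [\<ominus> \<one>]) @ [\<ominus> b]) z = eval (monom \<one> (p - 2) @ [\<ominus> \<one>]) z \<otimes> z \<oplus> \<ominus> b"
    using z bc m by (intro eval_append_aux) auto
  also have "eval (monom \<one> (p - 2) @ [\<ominus> \<one>]) z = eval (monom \<one> (p - 2)) z \<otimes> z \<oplus> \<ominus> \<one>"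
    using z m by (intro eval_append_aux) auto
  also have "eval (monom \<one> (p - 2)) z = z [^] (p - 2)" using eval_monom[of \<one> z "p - 2"] z by simp
  also have "(z [^] (p - 2) \<otimes> z \<oplus> \<ominus> \<one>) \<otimes> z \<oplus> \<ominus> b = z [^] (p - 2) \<otimes> z \<otimes> z \<oplus> \<ominus> z \<oplus> \<ominus> b"
    using z bc by (simp add: l_distr l_minus)
  also have "z [^] (p - 2) \<otimes> z \<otimes> z = z [^] p"
  proof -
    obtain l where "p = Suc (Suc l)" using assms(3) by (metis add_2_eq_Suc le_Suc_ex)
    then show ?thesis by simp
  qed
  finally show "eval (monom \<one> (p - 2) @ [\<ominus> \<one>, \<ominus> b]) z = z [^] p \<ominus> z \<ominus> b" by (simp add: minus_eq)
qed

end

section \<open>The Kummer and the Artin-Schreier instance\<close>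

context algebraic_closure begin

lemma embedding_nat_pow:
  assumes "subfield E L" "h \<in> embeddings E" "x \<in> E"
  shows "h (x [^] (i::nat)) = h x [^] i" "x [^] i \<in> E"
proof -
  have "x [^] i \<in> E \<and> h (x [^] i) = h x [^] i"
    using subfieldD(3,6)[OF assms(1)] embeddingsD(3,4)[OF assms(2)] assms(3) by (induction i) auto
  then show "h (x [^] (i::nat)) = h x [^] i" "x [^] i \<in> E" by auto
qed

lemma subfield_nat_pow: "subfield E L \<Longrightarrow> x \<in> E \<Longrightarrow> x [^] (i::nat) \<in> E"
  using subfieldD(3,6) by (induction i) auto

text \<open>The last axiom is met through its second alternative, as \<open>\<pi>\<close> is the
  \<open>p\<close>-th power map. The kernel of \<open>\<pi>\<close> is found by counting: the
  \<open>p\<close> powers of \<open>z\<close> exhaust the roots of \<open>X^p - 1\<close>.\<close>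

lemma kummer_group_mult_of:
  assumes p: "prime p" and z: "z \<in> carrier L" "z [^] p = \<one>" "z \<noteq> \<one>"
  shows "kummer_group L K (Multiplicative_Group.mult_of L) p (\<lambda>x. x [^] p) z" (is "kummer_group L K ?U p _ z")
proof -
  have p0: "0 < p" using p prime_gt_0_nat by blast
  interpret U: group ?U by (rule field_mult_group)
  have comm: "comm_group ?U" by (rule U.group_comm_groupI) (simp add: m_comm)
  have z0: "z \<noteq> \<zero>" using z p0 by (auto simp: nat_pow_zero)
  have pow0: "x [^] (i::nat) \<noteq> \<zero>" if "x \<in> carrier L" "x \<noteq> \<zero>" for x i
    using that by (induction i) (auto simp: integral_iff)
  have nat_prod_U: "monoid.nat_prod ?U f m = nat_prod f m" for f m
    by (induction m) (auto simp: monoid.nat_prod.simps[OF U.is_monoid])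
  have norm_U: "comm_group.norm_prod ?U t m x = nat_prod (\<lambda>i. (t ^^ i) x) m" for t m x
    by (simp add: comm_group.norm_prod_def[OF comm] nat_prod_U)
  have inj: "inj_on (\<lambda>i::nat. z [^] i) {..<p}"
    using U.prime_order_inj[OF p, of z] z z0 by (simp add: Multiplicative_Group.nat_pow_mult_of)
  have root1: "(z [^] (i::nat)) [^] p = \<one>" for i
    using z by (simp add: nat_pow_pow mult.commute[of i]) (simp add: nat_pow_pow[symmetric])
  show ?thesis
  proof (intro kummer_group.intro kummer_group_axioms.intro algebraic_closure_axioms)
    show "prime p" by (rule p)
    show "comm_group ?U" by (rule comm)
    show "carrier ?U \<subseteq> carrier L" by auto
    show "subgroup (E \<inter> carrier ?U) ?U" if E: "subfield E L" for E
      using subfieldD[OF E] field_inv(2) m_inv_mult_of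
      by (intro U.subgroupI) (auto simp: m_inv_mult_of integral_iff)
    show "h x \<in> carrier ?U" if "subfield E L" "h \<in> embeddings E" "x \<in> E" "x \<in> carrier ?U" for E h x
      using embeddingsD(1)[OF that(2,3)] embedding_inj[OF that(1,2)] embedding_zero_minus(1)[OF that(1,2)]
        that(3,4) subfieldD(2)[OF that(1)] inj_onD[of h E x \<zero>] by auto
    show "h (x \<otimes>\<^bsub>?U\<^esub> y) = h x \<otimes>\<^bsub>?U\<^esub> h y"
      if "subfield E L" "h \<in> embeddings E" "x \<in> E" "y \<in> E" for E h x y
      using embeddingsD(3)[OF that(2-4)] by simp
    show "h (x [^] p) = h x [^] p" if "subfield E L" "h \<in> embeddings E" "x \<in> E" for E h x
      using embedding_nat_pow(1)[OF that] .
    show "(\<lambda>x. x [^] p) \<in> hom ?U ?U"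
      using pow0 by (intro homI) (auto simp: nat_pow_distrib)
    show "x [^] p \<in> E" if "subfield E L" "x \<in> E" for E x using subfield_nat_pow[OF that] .
    show "z \<in> carrier ?U" "z \<noteq> \<one>\<^bsub>?U\<^esub>" "z [^]\<^bsub>?U\<^esub> p = \<one>\<^bsub>?U\<^esub>"
      using z z0 by (auto simp: Multiplicative_Group.nat_pow_mult_of)
    show "x [^] p = \<one>\<^bsub>?U\<^esub> \<longleftrightarrow> (\<exists>j::nat. x = z [^]\<^bsub>?U\<^esub> j)" if x: "x \<in> carrier ?U" for x
    proof
      assume "\<exists>j::nat. x = z [^]\<^bsub>?U\<^esub> j"
      then show "x [^] p = \<one>\<^bsub>?U\<^esub>" using root1 by (auto simp: Multiplicative_Group.nat_pow_mult_of)
    next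
      assume x1: "x [^] p = \<one>\<^bsub>?U\<^esub>"
      note f = power_poly[OF carrier_is_subfield subfieldD(3)[OF carrier_is_subfield] p0]
      have "x \<in> (\<lambda>i. z [^] i) ` {..<p}"
      proof (rule roots_eqI[OF f(1)])
        show "monom \<one> (p - 1) @ [\<ominus> \<one>] \<noteq> []" by simp
        show "(\<lambda>i. z [^] i) ` {..<p} \<subseteq> {y \<in> carrier L. eval (monom \<one> (p - 1) @ [\<ominus> \<one>]) y = \<zero>}"
          using f(3) z root1 by (auto simp: minus_eq r_neg)
        show "degree (monom \<one> (p - 1) @ [\<ominus> \<one>]) \<le> card ((\<lambda>i. z [^] i) ` {..<p})"
          unfolding f(2) using card_image[OF inj] by simp
        show "x \<in> carrier L" "eval (monom \<one> (p - 1) @ [\<ominus> \<one>]) x = \<zero>" using x x1 f(3)[of x] by (auto simp: minus_eq r_neg)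
      qed
      then show "\<exists>j::nat. x = z [^]\<^bsub>?U\<^esub> j" by (auto simp: Multiplicative_Group.nat_pow_mult_of)
    qed
    show "\<exists>f\<in>carrier (E[X]). degree f = p \<and> (\<forall>y\<in>carrier L. eval f y = \<zero> \<longleftrightarrow> y \<in> carrier ?U \<and> y [^] p = b)"
      if E: "subfield E L" and b: "b \<in> E" "b \<in> carrier ?U" for E b
    proof -
      note f = power_poly[OF E b(1) p0]
      have "eval (monom \<one> (p - 1) @ [\<ominus> b]) y = \<zero> \<longleftrightarrow> y \<in> carrier ?U \<and> y [^] p = b" if y: "y \<in> carrier L" for y
      proof -
        have "eval (monom \<one> (p - 1) @ [\<ominus> b]) y = \<zero> \<longleftrightarrow> y [^] p = b"
          using f(3)[OF y] y b(2) by (simp add: r_right_minus_eq)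
        moreover have "y \<noteq> \<zero>" if "y [^] p = b" using that b(2) p0 by (auto simp: nat_pow_zero)
        ultimately show ?thesis using y by auto
      qed
      then show ?thesis using f(1,2) by blast
    qed
    show "\<exists>y\<in>E \<inter> carrier ?U. x [^]\<^bsub>?U\<^esub> p = y [^] p"
      if "subfield E L" "x \<in> E" "x \<in> carrier ?U" for E x
      using that by (intro bexI[of _ x]) (auto simp: Multiplicative_Group.nat_pow_mult_of)
    show "\<exists>\<gamma>\<in>M \<inter> carrier ?U. \<forall>a\<in>P. a \<gamma> = ch a \<otimes>\<^bsub>?U\<^esub> \<gamma>"
      if M: "subfield M L" "F \<subseteq> M" "subgroup P (Gal L M F)" "finite P"
        and ch: "\<And>a. a \<in> P \<Longrightarrow> ch a \<in> fixed M P \<inter> carrier ?U"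
          "\<And>a b. a \<in> P \<Longrightarrow> b \<in> P \<Longrightarrow> ch (a \<otimes>\<^bsub>Gal L M F\<^esub> b) = ch a \<otimes>\<^bsub>?U\<^esub> ch b" for M F P ch
    proof -
      have "\<exists>y\<in>M. y \<noteq> \<zero> \<and> (\<forall>a\<in>P. a y = ch a \<otimes> y)"
        using ch by (intro hilbert90_mult[OF M]) auto
      then show ?thesis using subfieldD(8)[OF M(1)] by auto
    qed
    show "\<exists>b\<in>E \<inter> carrier ?U. t b = x \<otimes>\<^bsub>?U\<^esub> b"
      if "subfield E L" "t \<in> carrier (Gal L E F)" "\<And>x. x \<in> E \<Longrightarrow> (t ^^ p) x = x" "\<exists>x\<in>E. t x \<noteq> x"
        "x \<in> E" "x \<in> carrier ?U" "comm_group.norm_prod ?U t p x = \<one>\<^bsub>?U\<^esub>" for E F t x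
    proof -
      have "\<exists>b\<in>E. b \<noteq> \<zero> \<and> t b = x \<otimes> b"
        using that(6,7) by (intro hilbert90_cyclic_mult[OF that(1,2) p that(3,4,5)]) (auto simp: norm_U)
      then show ?thesis using subfieldD(8)[OF that(1)] by auto
    qed
    show "(\<forall>E F t. subfield E L \<longrightarrow> t \<in> carrier (Gal L E F) \<longrightarrow>
          (\<forall>x\<in>E. (t ^^ p) x = x) \<longrightarrow> (\<exists>x\<in>E. t x \<noteq> x) \<longrightarrow>
          (\<exists>y\<in>E \<inter> carrier ?U. comm_group.norm_prod ?U t p y = z)) \<or>
        (\<forall>x\<in>carrier ?U. x [^] p = x [^]\<^bsub>?U\<^esub> p)"
      by (simp add: Multiplicative_Group.nat_pow_mult_of)
  qed
qed

text \<open>The role of \<open>\<zeta>\<close> is played by 1, whose powers in the additive group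
  are the elements of the prime field, the roots of \<open>X^p - X\<close>. Norms are traces, so
  \<open>exists_trace_one\<close> makes \<open>\<zeta>\<close> a norm outright.\<close>

lemma kummer_group_add_monoid:
  fixes p :: nat
  assumes p: "prime p" and ch: "[p] \<cdot> \<one> = \<zero>"
  shows "kummer_group L K (add_monoid L) p (\<lambda>x. x [^] p \<ominus> x) \<one>"
proof -
  have p0: "0 < p" and p2: "2 \<le> p" using p prime_gt_0_nat prime_ge_2_nat by blast+
  have comm: "comm_group (add_monoid L)" by (rule a_comm_group)
  interpret U: comm_group "add_monoid L" by (rule comm)
  have pow: "x [^]\<^bsub>add_monoid L\<^esub> (i::nat) = [i] \<cdot> x" for x i by (simp add: add_pow_def)
  have norm_U: "comm_group.norm_prod (add_monoid L) t m x = (\<Oplus>i\<in>{..<m}. (t ^^ i) x)"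
    if "\<And>i. (t ^^ i) x \<in> carrier L" for t m x
    using nat_prod_add_monoid[of "\<lambda>i. (t ^^ i) x" m] that by (simp add: comm_group.norm_prod_def[OF comm])
  have as_add: "(x \<oplus> y) [^] p \<ominus> (x \<oplus> y) = (x [^] p \<ominus> x) \<oplus> (y [^] p \<ominus> y)"
    if "x \<in> carrier L" "y \<in> carrier L" for x y
  proof -
    have "x [^] p \<in> carrier L" "y [^] p \<in> carrier L" using that by simp_all
    then show ?thesis using frobenius_add[OF p ch that] that by (simp, algebra)
  qed
  have as_nat: "([i] \<cdot> \<one>) [^] p \<ominus> [i] \<cdot> \<one> = \<zero>" for i :: nat
  proof (induction i)
    case 0
    then show ?case using p0 by (simp add: nat_pow_zero minus_eq)
  next
    case (Suc i)
    have "[Suc i] \<cdot> \<one> = [i] \<cdot> \<one> \<oplus> \<one>" by simp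
    then show ?case using as_add[of "[i] \<cdot> \<one>" \<one>] Suc by (simp add: minus_eq r_neg)
  qed
  have inj: "inj_on (\<lambda>i::nat. [i] \<cdot> \<one>) {..<p}"
    using group.prime_order_inj[OF a_group p, of \<one>] ch by (simp add: pow)
  show ?thesis
  proof (intro kummer_group.intro kummer_group_axioms.intro algebraic_closure_axioms)
    show "prime p" by (rule p)
    show "comm_group (add_monoid L)" by (rule comm)
    show "carrier (add_monoid L) \<subseteq> carrier L" by simp
    show "subgroup (E \<inter> carrier (add_monoid L)) (add_monoid L)" if E: "subfield E L" for E
    proof -
      have "E \<inter> carrier L = E" using subfieldD(1)[OF E] by blast
      then show ?thesis using subring.axioms(1)[OF subfieldE(1)[OF E]] by simp
    qed
    show "h x \<in> carrier (add_monoid L)" if "subfield E L" "h \<in> embeddings E" "x \<in> E" "x \<in> carrier (add_monoid L)" for E h x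
      using embeddingsD(1)[OF that(2,3)] by simp
    show "h (x \<otimes>\<^bsub>add_monoid L\<^esub> y) = h x \<otimes>\<^bsub>add_monoid L\<^esub> h y"
      if "subfield E L" "h \<in> embeddings E" "x \<in> E" "y \<in> E" for E h x y
      using embeddingsD(2)[OF that(2-4)] by simp
    show "h (x [^] p \<ominus> x) = h x [^] p \<ominus> h x" if "subfield E L" "h \<in> embeddings E" "x \<in> E" for E h x
      using embeddingsD(2)[OF that(2) embedding_nat_pow(2)[OF that] subfieldD(4)[OF that(1,3)], of p]
        embedding_nat_pow(1)[OF that] embedding_zero_minus(2)[OF that] by (simp add: minus_eq)
    show "(\<lambda>x. x [^] p \<ominus> x) \<in> hom (add_monoid L) (add_monoid L)" using as_add by (intro homI) auto
    show "x [^] p \<ominus> x \<in> E" if "subfield E L" "x \<in> E" for E x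
      using subfieldD(4,5)[OF that(1)] subfield_nat_pow[OF that] that(2) by (simp add: minus_eq)
    show "\<one> \<in> carrier (add_monoid L)" "\<one> \<noteq> \<one>\<^bsub>add_monoid L\<^esub>" "\<one> [^]\<^bsub>add_monoid L\<^esub> p = \<one>\<^bsub>add_monoid L\<^esub>"
      using ch by (simp_all add: pow)
    show "x [^] p \<ominus> x = \<one>\<^bsub>add_monoid L\<^esub> \<longleftrightarrow> (\<exists>j::nat. x = \<one> [^]\<^bsub>add_monoid L\<^esub> j)" if x: "x \<in> carrier (add_monoid L)" for x
    proof
      assume "\<exists>j::nat. x = \<one> [^]\<^bsub>add_monoid L\<^esub> j"
      then show "x [^] p \<ominus> x = \<one>\<^bsub>add_monoid L\<^esub>" using as_nat by (auto simp: pow)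
    next
      assume x1: "x [^] p \<ominus> x = \<one>\<^bsub>add_monoid L\<^esub>"
      note f = artin_schreier_poly[OF carrier_is_subfield subfieldD(2)[OF carrier_is_subfield] p2]
      have "x \<in> (\<lambda>i::nat. [i] \<cdot> \<one>) ` {..<p}"
      proof (rule roots_eqI[OF f(1)])
        show "monom \<one> (p - 2) @ [\<ominus> \<one>, \<ominus> \<zero>] \<noteq> []" by simp
        show "(\<lambda>i::nat. [i] \<cdot> \<one>) ` {..<p} \<subseteq> {y \<in> carrier L. eval (monom \<one> (p - 2) @ [\<ominus> \<one>, \<ominus> \<zero>]) y = \<zero>}"
        proof
          fix y assume "y \<in> (\<lambda>i::nat. [i] \<cdot> \<one>) ` {..<p}"
          then obtain i :: nat where y: "y = [i] \<cdot> \<one>" by auto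
          then have yc: "y \<in> carrier L" by simp
          show "y \<in> {y \<in> carrier L. eval (monom \<one> (p - 2) @ [\<ominus> \<one>, \<ominus> \<zero>]) y = \<zero>}"
            unfolding mem_Collect_eq f(3)[OF yc] using yc as_nat[of i] y by (simp add: minus_eq)
        qed
        show "degree (monom \<one> (p - 2) @ [\<ominus> \<one>, \<ominus> \<zero>]) \<le> card ((\<lambda>i::nat. [i] \<cdot> \<one>) ` {..<p})"
          unfolding f(2) using card_image[OF inj] by simp
        show xc: "x \<in> carrier L" using x by simp
        show "eval (monom \<one> (p - 2) @ [\<ominus> \<one>, \<ominus> \<zero>]) x = \<zero>"
          unfolding f(3)[OF xc] using x1 by (simp add: minus_eq)
      qed
      then show "\<exists>j::nat. x = \<one> [^]\<^bsub>add_monoid L\<^esub> j" by (auto simp: pow)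
    qed
    show "\<exists>f\<in>carrier (E[X]). degree f = p \<and> (\<forall>y\<in>carrier L. eval f y = \<zero> \<longleftrightarrow> y \<in> carrier (add_monoid L) \<and> y [^] p \<ominus> y = b)"
      if E: "subfield E L" and b: "b \<in> E" "b \<in> carrier (add_monoid L)" for E b
    proof -
      note f = artin_schreier_poly[OF E b(1) p2]
      have "eval (monom \<one> (p - 2) @ [\<ominus> \<one>, \<ominus> b]) y = \<zero> \<longleftrightarrow> y [^] p \<ominus> y = b" if y: "y \<in> carrier L" for y
        unfolding f(3)[OF y] using y b(2) by (simp add: r_right_minus_eq)
      then show ?thesis using f(1,2) by (intro bexI[OF _ f(1)]) simp
    qed
    show "\<exists>y\<in>E \<inter> carrier (add_monoid L). x [^]\<^bsub>add_monoid L\<^esub> p = y [^] p \<ominus> y"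
      if "subfield E L" "x \<in> E" "x \<in> carrier (add_monoid L)" for E x
    proof (rule bexI)
      show "\<zero> \<in> E \<inter> carrier (add_monoid L)" using subfieldD(2)[OF that(1)] by simp
      show "x [^]\<^bsub>add_monoid L\<^esub> p = \<zero> [^] p \<ominus> \<zero>"
        using add_pow_char[OF ch, of x 1] that(3) p0 by (simp add: pow nat_pow_zero minus_eq)
    qed
    show "\<exists>\<gamma>\<in>M \<inter> carrier (add_monoid L). \<forall>a\<in>P. a \<gamma> = ch a \<otimes>\<^bsub>add_monoid L\<^esub> \<gamma>"
      if M: "subfield M L" "F \<subseteq> M" "subgroup P (Gal L M F)" "finite P"
        and ch: "\<And>a. a \<in> P \<Longrightarrow> ch a \<in> fixed M P \<inter> carrier (add_monoid L)"
          "\<And>a b. a \<in> P \<Longrightarrow> b \<in> P \<Longrightarrow> ch (a \<otimes>\<^bsub>Gal L M F\<^esub> b) = ch a \<otimes>\<^bsub>add_monoid L\<^esub> ch b" for M F P ch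
    proof -
      have "\<exists>y\<in>M. \<forall>a\<in>P. a y = ch a \<oplus> y"
        using ch by (intro hilbert90_add[OF M]) auto
      then show ?thesis using subfieldD(8)[OF M(1)] by auto
    qed
    show "\<exists>b\<in>E \<inter> carrier (add_monoid L). t b = x \<otimes>\<^bsub>add_monoid L\<^esub> b"
      if a: "subfield E L" "t \<in> carrier (Gal L E F)" "\<And>x. x \<in> E \<Longrightarrow> (t ^^ p) x = x" "\<exists>x\<in>E. t x \<noteq> x"
        "x \<in> E" "x \<in> carrier (add_monoid L)" "comm_group.norm_prod (add_monoid L) t p x = \<one>\<^bsub>add_monoid L\<^esub>" for E F t x
    proof -
      have "(\<Oplus>i\<in>{..<p}. (t ^^ i) x) = \<zero>"
        using a(7) norm_U[OF funpow_carrier[OF a(1,2) p a(3,4,5)], of p] by simp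
      then have "\<exists>b\<in>E. t b = x \<oplus> b" by (intro hilbert90_cyclic_add[OF a(1,2) p _ a(4,5)] a(3))
      then show ?thesis using subfieldD(8)[OF a(1)] by auto
    qed
    show "(\<forall>E F t. subfield E L \<longrightarrow> t \<in> carrier (Gal L E F) \<longrightarrow>
          (\<forall>x\<in>E. (t ^^ p) x = x) \<longrightarrow> (\<exists>x\<in>E. t x \<noteq> x) \<longrightarrow>
          (\<exists>y\<in>E \<inter> carrier (add_monoid L). comm_group.norm_prod (add_monoid L) t p y = \<one>)) \<or>
        (\<forall>x\<in>carrier (add_monoid L). x [^] p \<ominus> x = x [^]\<^bsub>add_monoid L\<^esub> p)"
    proof (rule disjI1, intro allI impI)
      fix E F t assume a: "subfield E L" "t \<in> carrier (Gal L E F)" "\<forall>x\<in>E. (t ^^ p) x = x" "\<exists>x\<in>E. t x \<noteq> x"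
      have a3: "\<And>x. x \<in> E \<Longrightarrow> (t ^^ p) x = x" using a(3) by blast
      obtain y where y: "y \<in> E" "(\<Oplus>i\<in>{..<p}. (t ^^ i) y) = \<one>"
        using exists_trace_one[OF a(1,2) p a3 a(4)] by blast
      then have "comm_group.norm_prod (add_monoid L) t p y = \<one>"
        using norm_U[OF funpow_carrier[OF a(1,2) p a3 a(4) y(1)], of p] by simp
      then show "\<exists>y\<in>E \<inter> carrier (add_monoid L). comm_group.norm_prod (add_monoid L) t p y = \<one>"
        using y subfieldD(8)[OF a(1)] by auto
    qed
  qed
qed

text \<open>Take a root of \<open>1 + X + ... + X^(p-1)\<close>; at 1 this polynomial has the value
  \<open>p\<close>, which is nonzero here.\<close>

lemma exists_root_of_unity:
  fixes p :: nat
  assumes p: "prime p" and ch: "[p] \<cdot> \<one> \<noteq> \<zero>"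
  shows "\<exists>z\<in>carrier L. z [^] p = \<one> \<and> z \<noteq> \<one>"
proof -
  have p2: "2 \<le> p" using p by (rule prime_ge_2_nat)
  let ?f = "replicate p \<one>"
  have "?f \<in> carrier (poly_ring L)"
    by (auto simp: univ_poly_carrier[symmetric] polynomial_def)
  then obtain z where z: "z \<in> carrier L" "eval ?f z = \<zero>" using exists_root_closed[of ?f] p2 by fastforce
  have ec: "eval (replicate m \<one>) z \<in> carrier L" for m using z(1) by (intro eval_in_carrier) auto
  have "eval (replicate m \<one>) z \<otimes> (z \<ominus> \<one>) = z [^] m \<ominus> \<one>" for m
  proof (induction m)
    case 0
    then show ?case using z by (simp add: minus_eq r_neg)
  next
    case (Suc m)
    have "eval (replicate (Suc m) \<one>) z \<otimes> (z \<ominus> \<one>) = z [^] m \<otimes> (z \<ominus> \<one>) \<oplus> (z [^] m \<ominus> \<one>)"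
      using Suc z ec[of m] by (simp add: l_distr)
    also have "\<dots> = z [^] Suc m \<ominus> \<one>"
    proof -
      have "z [^] m \<in> carrier L" using z by simp
      then show ?thesis using z by (simp, algebra)
    qed
    finally show ?case .
  qed
  from this[of p] have "z [^] p \<ominus> \<one> = \<zero>" using z by simp
  then have "z [^] p = \<one>" using z by (simp add: r_right_minus_eq)
  moreover have "z \<noteq> \<one>"
  proof
    assume "z = \<one>"
    moreover have "eval (replicate m \<one>) \<one> = [m] \<cdot> \<one>" for m by (induction m) (auto simp: a_comm)
    ultimately show False using z(2) ch by simp
  qed
  ultimately show ?thesis using z by blast
qed

end

section \<open>Adjoining the root of unity and counting\<close>

context kummer_group begin

text \<open>A \<open>\<Gamma>\<close>-extension need not contain \<open>\<zeta>\<close>. It is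
  adjoined as a root of the polynomial for \<open>\<pi> z = \<one>\<close>, whose \<open>p\<close>
  distinct roots are the powers of \<open>\<zeta>\<close>. An automorphism of the larger field is
  determined by its restriction to \<open>M\<close> and by \<open>w\<close>, which is the joint
  injectivity that \<open>kummer_extension\<close> demands. In the additive case nothing is added
  and \<open>w\<close> is 1.\<close>

lemma many_group_extensions:
  assumes n: "n \<ge> 1" "p = 2 \<Longrightarrow> n \<ge> 2"
    and M0: "M \<in> group_extensions (free_semidirect (residue_ring (int p)) (integer_mod_group (p ^ n)) k) L K"
  shows "\<exists>f. inj_on f ({..<k} \<rightarrow>\<^sub>E {0..<int p}) \<and> f ` ({..<k} \<rightarrow>\<^sub>E {0..<int p}) \<subseteq>
           group_extensions (free_semidirect (residue_ring (int p)) (integer_mod_group (p ^ n)) k) L K"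
proof -
  have p1: "1 < p" using prime_p prime_gt_1_nat by blast
  interpret G: gamma_params p "p ^ n" k using p1 n(1) one_less_power[of p n] by unfold_locales auto
  have gal: "galois_extension L M K" and "Gal L M K \<cong> G.\<Gamma>" using M0 by (auto simp: group_extensions_def)
  then obtain \<theta> where \<theta>: "\<theta> \<in> hom (Gal L M K) G.\<Gamma>" "bij_betw \<theta> (carrier (Gal L M K)) (carrier G.\<Gamma>)"
    by (auto simp: is_iso_def iso_def)
  have fin: "finite (carrier (Gal L M K))" using bij_betw_finite[OF \<theta>(2)] G.finite_\<Gamma> by simp
  have M: "subfield M L" "K \<subseteq> M" using gal by (auto simp: galois_extension_def)
  obtain f where f: "f \<in> carrier (M[X])" "degree f = p"
    and f_root: "\<And>z. z \<in> carrier L \<Longrightarrow> eval f z = \<zero> \<longleftrightarrow> z \<in> carrier U \<and> \<pi> z = \<one>\<^bsub>U\<^esub>"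
    using \<pi>_poly[OF M(1) U_closed(2)[OF M(1)] U.one_closed] by blast
  have f_nz: "f \<noteq> []" using f(2) p1 by auto
  have \<zeta>L: "\<zeta> \<in> carrier L" using \<zeta>_U U_carrier by blast
  have \<pi>\<zeta>: "\<pi> (\<zeta> [^]\<^bsub>U\<^esub> (j::nat)) = \<one>\<^bsub>U\<^esub>" for j using \<pi>_kernel[of "\<zeta> [^]\<^bsub>U\<^esub> j"] \<zeta>_U by auto
  have f\<zeta>: "eval f \<zeta> = \<zero>" using f_root[OF \<zeta>L] \<pi>\<zeta>[of 1] \<zeta>_U by simp
  define N where "N = simple_extension M \<zeta>"
  have N: "subfield N L"
    unfolding N_def using simple_extension_is_subfield[OF M(1) \<zeta>L] algebraic_mono[OF M(2) algebraic_extension[OF \<zeta>L]] by simp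
  have \<zeta>N: "\<zeta> \<in> N" unfolding N_def by (rule simple_extension_mem[OF subfieldE(1)[OF M(1)] \<zeta>L])
  have root: "\<exists>j::nat. g \<zeta> = \<zeta> [^]\<^bsub>U\<^esub> j" if g: "g \<in> embeddings N" for g
  proof -
    have "\<pi> (g \<zeta>) = \<one>\<^bsub>U\<^esub>" using embedding_\<pi>[OF N g \<zeta>N] \<pi>\<zeta>[of 1] \<zeta>_U embedding_one[OF N g] by simp
    then show ?thesis using \<pi>_kernel[OF embedding_U[OF N g \<zeta>N \<zeta>_U]] by simp
  qed
  have conj: "\<forall>g\<in>embeddings N. restrict g M \<in> carrier (Gal L M K) \<longrightarrow> g \<zeta> \<in> N"
    using root U_closed(4)[OF N \<zeta>N \<zeta>_U] by metis
  let ?S = "(\<lambda>j. \<zeta> [^]\<^bsub>U\<^esub> j) ` {..<p}"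
  have S_root: "?S \<subseteq> {z \<in> carrier L. eval f z = \<zero>}"
    using f_root \<pi>\<zeta> \<zeta>_U U_carrier by auto
  have "inj_on (\<lambda>j::nat. \<zeta> [^]\<^bsub>U\<^esub> j) {..<p}"
    by (rule inj_onI) (simp add: \<zeta>_pow_eq_iff cong_def)
  then have S_card: "degree f \<le> card ?S" using f(2) by (simp add: card_image)
  note adj = adjoin_galois[OF gal fin \<zeta>L N_def f(1) f_nz f\<zeta> S_root S_card conj]
  define w where "w a = (SOME j::nat. 0 < j \<and> j < p \<and> a \<zeta> = \<zeta> [^]\<^bsub>U\<^esub> j)" for a :: "'a \<Rightarrow> 'a"
  have w: "0 < w a \<and> w a < p \<and> a \<zeta> = \<zeta> [^]\<^bsub>U\<^esub> w a" if a: "a \<in> carrier (Gal L N K)" for a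
  proof -
    have emb: "a \<in> embeddings N" by (rule Gal_embedding[OF N a])
    obtain j :: nat where j: "a \<zeta> = \<zeta> [^]\<^bsub>U\<^esub> j" using root[OF emb] by blast
    have "a \<zeta> \<noteq> a \<one>\<^bsub>U\<^esub>" using GalD(7)[OF a] \<zeta>N U_closed(2)[OF N] \<zeta>_not_one by (auto dest: inj_onD)
    then have "\<zeta> [^]\<^bsub>U\<^esub> j \<noteq> \<zeta> [^]\<^bsub>U\<^esub> (0::nat)" using j embedding_one[OF N emb] by simp
    then have "j mod p \<noteq> 0" by (simp only: \<zeta>_pow_eq_iff) (simp add: cong_def)
    then have "0 < j mod p \<and> j mod p < p \<and> a \<zeta> = \<zeta> [^]\<^bsub>U\<^esub> (j mod p)"
      using j p1 \<zeta>_pow_eq_iff[of j "j mod p"] by (simp add: cong_def)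
    then show ?thesis unfolding w_def by (rule someI)
  qed
  have "kummer_extension L K U p \<pi> \<zeta> (p ^ n) k n N (\<lambda>a. \<theta> (restrict a M)) w"
  proof (intro kummer_extension.intro kummer_extension_axioms.intro kummer_group_axioms G.gamma_params_axioms)
    show "galois_extension L N K" "finite (carrier (Gal L N K))" by (rule adj)+
    show "(\<lambda>a. \<theta> (restrict a M)) \<in> hom (Gal L N K) G.\<Gamma>"
      using hom_compose[OF adj(6) \<theta>(1)] by (simp add: comp_def)
    have "(\<lambda>a. \<theta> (restrict a M)) ` carrier (Gal L N K) = \<theta> ` ((\<lambda>a. restrict a M) ` carrier (Gal L N K))"
      by (simp only: image_image)
    also have "\<dots> = carrier G.\<Gamma>" unfolding adj(7) using \<theta>(2) by (simp add: bij_betw_def)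
    finally show "(\<lambda>a. \<theta> (restrict a M)) ` carrier (Gal L N K) = carrier G.\<Gamma>" .
    show "a = b" if ab: "a \<in> carrier (Gal L N K)" "b \<in> carrier (Gal L N K)"
      "\<theta> (restrict a M) = \<theta> (restrict b M)" "w a = w b" for a b
    proof (rule adj(8)[OF ab(1,2)])
      show "restrict a M = restrict b M"
        using \<theta>(2) ab(3) hom_in_carrier[OF adj(6) ab(1)] hom_in_carrier[OF adj(6) ab(2)]
        by (auto simp: bij_betw_def dest: inj_onD)
      show "a \<zeta> = b \<zeta>" using w[OF ab(1)] w[OF ab(2)] ab(4) by simp
    qed
  qed (use n \<zeta>N w in auto)
  then show ?thesis by (rule kummer_extension.many_extensions)
qed

end

text \<open>Whether \<open>p\<close> is zero in the field decides between the additive and the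
  multiplicative instance.\<close>

lemma (in algebraic_closure) card_group_extensions_ge:
  assumes p: "prime p" and n: "n \<ge> 1" "p = 2 \<Longrightarrow> n \<ge> 2"
    and M: "M \<in> group_extensions (free_semidirect (residue_ring (int p)) (integer_mod_group (p ^ n)) k) L K"
  shows "ecard (group_extensions (free_semidirect (residue_ring (int p)) (integer_mod_group (p ^ n)) k) L K) \<ge> enat (p ^ k)"
    (is "ecard ?X \<ge> _")
proof -
  let ?C = "{..<k} \<rightarrow>\<^sub>E {0..<int p}"
  have "\<exists>f. inj_on f ?C \<and> f ` ?C \<subseteq> ?X"
  proof (cases "[p] \<cdot> \<one> = \<zero>")
    case True
    then show ?thesis using kummer_group.many_group_extensions[OF kummer_group_add_monoid[OF p] n M] by blast
  next
    case False
    then obtain z where "z \<in> carrier L" "z [^] p = \<one>" "z \<noteq> \<one>" using exists_root_of_unity[OF p] by blast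
    then show ?thesis using kummer_group.many_group_extensions[OF kummer_group_mult_of[OF p] n M] by blast
  qed
  then obtain f where f: "inj_on f ?C" "f ` ?C \<subseteq> ?X" by blast
  have "card ?C = p ^ k" by (simp add: card_PiE)
  then show ?thesis
    using card_inj_on_le[OF f] by (cases "finite ?X") (simp_all add: ecard_def)
qed

theorem theorem1p1:
  fixes p n k :: nat
  assumes "prime p" and "n \<ge> 1" and "p = 2 \<Longrightarrow> n \<ge> 2" and "k \<ge> 1"
  shows "realization_multiplicity TYPE('a)
           (free_semidirect (residue_ring (int p)) (integer_mod_group (p ^ n)) k) \<ge> enat (p ^ k)"
proof -
  let ?\<Gamma> = "free_semidirect (residue_ring (int p)) (integer_mod_group (p ^ n)) k"
  have "enat (p ^ k) \<le> realization_count ?\<Gamma> F" if F: "F \<in> realizing_fields ?\<Gamma>" for F :: "'a ring"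
  proof -
    have "field F" and count: "realization_count ?\<Gamma> F \<ge> 1" using F by (auto simp: realizing_fields_def)
    interpret F: field F by fact
    interpret algebraic_closure F.alg_closure "F.indexed_const ` carrier F" by (rule F.alg_closureE(1))
    from count obtain M where "M \<in> group_extensions ?\<Gamma> F.alg_closure (F.indexed_const ` carrier F)"
      by (force simp: realization_count_def ecard_def one_enat_def split: if_splits)
    then show ?thesis
      unfolding realization_count_def using card_group_extensions_ge[OF assms(1,2)] assms(3) by blast
  qed
  then show ?thesis unfolding realization_multiplicity_def by (rule INF_greatest)
qed

end
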